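(* Let $\Omega$, $\mathcal A$, $u_0$, $\tau=\mathcal A u_0$ be as in the context. Let $f:\Omega\times\mathbb R^N\to[0,\infty)$ be a continuous integrand such that $f(x,\cdot)$ is convex for all $x\in\Omega$ and, for some $M>0$, $\frac1M(|z|-1)\le|f(x,z)|\le M(1+|z|)$ for all $(x,z)\in\Omega\times\mathbb R^N$. Assume further that there exists a modulus of continuity $\omega$ such that $|f(x,z)-f(y,z)|\le\omega(|x-y|)(1+|z|)$ for all $x,y\in\Omega$, $z\in\mathbb R^N$. Let $\mu\in u_0+\ker_{\mathcal M}\mathcal A$ and $w^*\in D(\mathcal A^* )$. Then the following conditions are equivalent: (i) $\mu$ is a generalized solution of $(\mathcal P)$ (i.e. $\mu$ minimizes $\overline{\mathcal F}$ over $u_0+\ker_{\mathcal M}\mathcal A$) and $w^*$ is a solution of $(\mathcal P^* )$ (i.e. $w^*$ maximizes $\mathcal R$ over $D(\mathcal A^* )$); (ii) the generalized pairing $\llbracket\mu,\mathcal A^*w^*\rrbracket$ is the singleton $$\Big\{\Big(\frac{d\mu}{d\mathcal L^d}\cdot\mathcal A^*w^*\Big)\mathcal L^d\llcorner\Omega+f^\infty\Big(\cdot,\frac{d\mu}{d|\mu^s|}\Big)|\mu^s|\Big\}.$$ In particular, if $\lambda\in\llbracket\mu,\mathcal A^*w^*\rrbracket$, then $$\frac{d\lambda}{d\mathcal L^d}(x)=\frac{d\mu}{d\mathcal L^d}(x)\cdot\mathcal A^*w^*(x)=f\Big(x,\frac{d\mu}{d\mathcal L^d}(x)\Big)+f^*(x,\mathcal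 A^*w^*(x))\quad\text{for }\mathcal L^d\text{-a.e. }x\in\Omega,$$ and $$\frac{d\lambda}{d|\mu^s|}(x)=f^\infty\Big(x,\frac{d\mu}{d|\mu^s|}(x)\Big)\quad\text{for }|\mu^s|\text{-a.e. }x\in\Omega.$$
   Context: $\Omega\subset\mathbb R^d$ is an open set with $\mathcal L^d(\partial\Omega)=0$, where $\mathcal L^d$ is Lebesgue measure. A modulus of continuity is a function $\omega:[0,\infty)\to[0,\infty)$ with $\omega(s)\to0=\omega(0)$ as $s\downarrow0$. Measures: $\mathcal M(\Omega;\mathbb R^N)$ is the space of finite $\mathbb R^N$-valued Radon measures on $\Omega$, $\mathcal M(\Omega)=\mathcal M(\Omega;\mathbb R)$; $\mu_j\overset{*}{\rightharpoonup}\mu$ means $\int\varphi\cdot d\mu_j\to\int\varphi\cdot d\mu$ for all bounded continuous $\varphi$. $\mu=\frac{d\mu}{d\mathcal L^d}\mathcal L^d+\mu^s$ is the Radon-Nikodým decomposition with respect to $\mathcal L^d$; $\frac{d\mu}{d|\mu^s|}$ denotes the density with respect to $|\mu^s|$ in the sense of differentiation of measures, equal to $\frac{d\mu^s}{d|\mu^s|}$ at $|\mu^s|$-a.e. point (similarly for $\lambda$). The area functional is $\langle\mu\rangle(A)=\int_A\sqrt{1+|\frac{d\mu}{d\mathcal L^d}|^2}\,dx+|\mu^s|(A)$. $\mu_j\to\mu$ area-strictly means $\mu_j\overset{*}{\rightharpoonup}\mu$ and $\langle\mu_j\rangle(\Omega)\to\langle\mu\rangle(\Omega)$. A function $u\in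 L^1$ is identified with $u\mathcal L^d$. Operator: $\mathcal A$ is a linear partial differential operator of arbitrary order on $\Omega$, taking $\mathbb R^N$-valued fields to $\mathbb R^n$-valued ones, with coefficients such that $\mathcal A\mu$ is defined in the sense of distributions for $\mu\in\mathcal M(\Omega;\mathbb R^N)$. Put $W^{\mathcal A,1}(\Omega)=\{u\in L^1(\Omega;\mathbb R^N):\mathcal A u\in L^1(\Omega;\mathbb R^n)\}$, $\ker\mathcal A=\{u\in L^1(\Omega;\mathbb R^N):\mathcal A u=0\}$, $\ker_{\mathcal M}\mathcal A=\{\mu\in\mathcal M(\Omega;\mathbb R^N):\mathcal A\mu=0\text{ in the sense of distributions}\}$. Assumptions: (H1) $\operatorname{Im}\mathcal A=\{\mathcal A u:u\in W^{\mathcal A,1}(\Omega)\}$ is strongly closed in $L^1(\Omega;\mathbb R^n)$; (H2) for every $\mu\in\ker_{\mathcal M}\mathcal A$ there is a sequence $(u_j)\subset\ker\mathcal A$ with $u_j\to\mu$ area-strictly. Fix $u_0\in W^{\mathcal A,1}(\Omega)$ and $\tau=\mathcal A u_0$. Adjoint: $D(\mathcal A^* )=\{w^*\in L^\infty(\Omega;\mathbb R^n):\exists c>0,\ |\int_\Omega w^*\cdot\mathcal A u\,dx|\le c\|u\|_{L^1}\ \forall u\in W^{\mathcal A,1}(\Omega)\}$, and for $w^*\in D(\mathcal A^* )$, $\mathcal A^*w^*\in L^\infty(\Omega;\mathbb R^N)$ is determined by $\int\mathcal A^*w^*\cdot u\,dx=\int w^*\cdot\mathcal A u\,dx$ for all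 $u\in W^{\mathcal A,1}(\Omega)$. Problems: $f^*(x,z^* )=\sup_{z\in\mathbb R^N}\{z^*\cdot z-f(x,z)\}$ and $f^\infty(x,z)=\lim_{x'\to x,\,t\to\infty}f(x',tz)/t$. $(\mathcal P)$ is the problem of minimizing $\int_\Omega f(x,u(x))\,dx$ over $u\in u_0+\ker\mathcal A$. Its relaxed functional is $\overline{\mathcal F}[\mu]=\int_\Omega f(x,\frac{d\mu}{d\mathcal L^d}(x))\,dx+\int_\Omega f^\infty(x,\frac{d\mu^s}{d|\mu^s|}(x))\,d|\mu^s|(x)$ on $u_0+\ker_{\mathcal M}\mathcal A$. $(\mathcal P^* )$ is the problem of maximizing $\mathcal R[w^*]=\int_\Omega w^*\cdot\tau\,dx-\int_\Omega f^*(x,\mathcal A^*w^*(x))\,dx$ over $w^*\in D(\mathcal A^* )$. Generalized pairing: $\llbracket\mu,\mathcal A^*w^*\rrbracket$ is the set of all $\lambda\in\mathcal M(\Omega)$ for which there exists a sequence $(u_j)\subset u_0+\ker\mathcal A$ such that $u_j\mathcal L^d\to\mu$ area-strictly and $(u_j\cdot\mathcal A^*w^* )\mathcal L^d\overset{*}{\rightharpoonup}\lambda$ in $\mathcal M(\Omega)$.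
   Formalization: Condition (ii) is taken to include the displayed relations for λ, since the singleton alone does not imply (i) (A=0, f=√(1+|z|²)); area-strict convergence requires finite area, so Ω has finite measure; the coefficient of ∂^α is taken of class C^|α|. *)

theory Defs
  imports "HOL-Analysis.Analysis"
begin

section \<open>Vector-valued measures\<close>

text \<open>
  Throughout, \<open>\<Omega>\<close> is an open subset of \<open>'a :: euclidean_space\<close>, the \<open>d\<close>-dimensional space, and
  functions on \<open>\<Omega>\<close> are total functions whose values outside \<open>\<Omega>\<close> never matter.
\<close>

definition borel_on :: "'a::euclidean_space set \<Rightarrow> 'a set set"
  where "borel_on \<Omega> = sets (restrict_space borel \<Omega>)"

definition leb :: "'a::euclidean_space set \<Rightarrow> 'a measure"
  where "leb \<Omega> = restrict_space lborel \<Omega>"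

text \<open>
  A countably additive function on the Borel sets of \<open>\<Omega>\<close> with values in a Euclidean space has
  finite total variation and is automatically Radon.  The value \<open>0\<close> on all other sets
  makes equality of functions coincide with equality of measures.
\<close>

definition radon_measures :: "'a::euclidean_space set \<Rightarrow> ('a set \<Rightarrow> 'b::euclidean_space) set"
  where "radon_measures \<Omega> =
    {m. (\<forall>E. E \<notin> borel_on \<Omega> \<longrightarrow> m E = 0) \<and>
        (\<forall>A :: nat \<Rightarrow> 'a set. range A \<subseteq> borel_on \<Omega> \<and> disjoint_family A
            \<longrightarrow> (\<lambda>i. m (A i)) sums m (\<Union>i. A i))}"

definition total_variation :: "'a::euclidean_space set \<Rightarrow> ('a set \<Rightarrow> 'b::euclidean_space) \<Rightarrow> 'a measure"
  where "total_variation \<Omega> m =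
    measure_of \<Omega> (borel_on \<Omega>)
      (\<lambda>E. SUP P \<in> {P. finite P \<and> disjoint P \<and> P \<subseteq> borel_on \<Omega> \<and> \<Union>P \<subseteq> E}.
         \<Sum>A\<in>P. ennreal (norm (m A)))"

text \<open>
  The density \<open>dm/d\<nu>\<close> in the Lebesgue decomposition of \<open>m\<close> with respect to \<open>\<nu>\<close>: outside some
  \<open>\<nu>\<close>-null set \<open>Z\<close>, which carries the singular part, \<open>m\<close> is given by integrating \<open>dm/d\<nu>\<close>.
  It is determined \<open>\<nu>\<close>-almost everywhere, and \<open>\<nu>\<close>-almost everywhere it is the derivative of
  \<open>m\<close> with respect to \<open>\<nu>\<close> in the sense of differentiation of measures.
\<close>

definition dens :: "'a measure \<Rightarrow> ('a set \<Rightarrow> 'b::euclidean_space) \<Rightarrow> 'a \<Rightarrow> 'b"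
  where "dens \<nu> m =
    (SOME g. integrable \<nu> g \<and>
       (\<exists>Z\<in>null_sets \<nu>. \<forall>E\<in>sets \<nu>. m E = (LINT x:E|\<nu>. g x) + m (E \<inter> Z)))"

definition sing_part :: "'a::euclidean_space set \<Rightarrow> ('a set \<Rightarrow> 'b::euclidean_space) \<Rightarrow> 'a set \<Rightarrow> 'b"
  where "sing_part \<Omega> m E =
    (if E \<in> borel_on \<Omega> then m E - (LINT x:E|leb \<Omega>. dens (leb \<Omega>) m x) else 0)"

abbreviation sing_variation ::
    "'a::euclidean_space set \<Rightarrow> ('a set \<Rightarrow> 'b::euclidean_space) \<Rightarrow> 'a measure"
  where "sing_variation \<Omega> m \<equiv> total_variation \<Omega> (sing_part \<Omega> m)"

text \<open>\<open>\<integral> \<phi> \<cdot> dm\<close>, through the polar decomposition \<open>m = (dm/d|m|) |m|\<close>.\<close>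

definition vint ::
    "'a::euclidean_space set \<Rightarrow> ('a \<Rightarrow> 'b::euclidean_space) \<Rightarrow> ('a set \<Rightarrow> 'b) \<Rightarrow> real"
  where "vint \<Omega> \<phi> m =
    (LINT x|total_variation \<Omega> m. \<phi> x \<bullet> dens (total_variation \<Omega> m) m x)"

definition weak_star_conv ::
    "'a::euclidean_space set \<Rightarrow> (nat \<Rightarrow> 'a set \<Rightarrow> 'b::euclidean_space) \<Rightarrow> ('a set \<Rightarrow> 'b) \<Rightarrow> bool"
  where "weak_star_conv \<Omega> mj m \<longleftrightarrow>
    (\<forall>\<phi>. continuous_on \<Omega> \<phi> \<and> bounded (\<phi> ` \<Omega>) \<longrightarrow> (\<lambda>j. vint \<Omega> \<phi> (mj j)) \<longlonglongrightarrow> vint \<Omega> \<phi> m)"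

definition area ::
    "'a::euclidean_space set \<Rightarrow> ('a set \<Rightarrow> 'b::euclidean_space) \<Rightarrow> 'a set \<Rightarrow> ennreal"
  where "area \<Omega> m A =
    (\<integral>\<^sup>+x\<in>A. ennreal (sqrt (1 + (norm (dens (leb \<Omega>) m x))\<^sup>2)) \<partial>leb \<Omega>)
      + emeasure (sing_variation \<Omega> m) A"

text \<open>
  The convergence of the areas is convergence of finite numbers.  If \<open>\<Omega>\<close> has infinite Lebesgue
  measure all areas are infinite, their convergence would say nothing, and no sequence
  converges area-strictly.
\<close>

definition area_strict_conv ::
    "'a::euclidean_space set \<Rightarrow> (nat \<Rightarrow> 'a set \<Rightarrow> 'b::euclidean_space) \<Rightarrow> ('a set \<Rightarrow> 'b) \<Rightarrow> bool"
  where "area_strict_conv \<Omega> mj m \<longleftrightarrow>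
    weak_star_conv \<Omega> mj m \<and> area \<Omega> m \<Omega> < \<infinity> \<and> (\<lambda>j. area \<Omega> (mj j) \<Omega>) \<longlonglongrightarrow> area \<Omega> m \<Omega>"

section \<open>Function spaces\<close>

definition L1 :: "'a::euclidean_space set \<Rightarrow> ('a \<Rightarrow> 'b::euclidean_space) set"
  where "L1 \<Omega> = {u. integrable (leb \<Omega>) u}"

definition Linf :: "'a::euclidean_space set \<Rightarrow> ('a \<Rightarrow> 'b::euclidean_space) set"
  where "Linf \<Omega> = {w \<in> borel_measurable (leb \<Omega>). \<exists>C. AE x in leb \<Omega>. norm (w x) \<le> C}"

definition fun_measure ::
    "'a::euclidean_space set \<Rightarrow> ('a \<Rightarrow> 'b::euclidean_space) \<Rightarrow> 'a set \<Rightarrow> 'b"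
  where "fun_measure \<Omega> u E = (if E \<in> borel_on \<Omega> then (LINT x:E|leb \<Omega>. u x) else 0)"

definition partial :: "'a \<Rightarrow> ('a::euclidean_space \<Rightarrow> 'b::real_normed_vector) \<Rightarrow> 'a \<Rightarrow> 'b"
  where "partial b g x = frechet_derivative g (at x) b"

definition partials :: "'a list \<Rightarrow> ('a::euclidean_space \<Rightarrow> 'b::real_normed_vector) \<Rightarrow> 'a \<Rightarrow> 'b"
  where "partials bs g = foldr partial bs g"

primrec Ck_on :: "nat \<Rightarrow> 'a::euclidean_space set \<Rightarrow> ('a \<Rightarrow> 'b::real_normed_vector) \<Rightarrow> bool"
  where
    "Ck_on 0 S g \<longleftrightarrow> continuous_on S g"
  | "Ck_on (Suc k) S g \<longleftrightarrow>
       (\<forall>x\<in>S. g differentiable (at x)) \<and> (\<forall>b\<in>Basis. Ck_on k S (partial b g))"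

definition test_functions :: "'a::euclidean_space set \<Rightarrow> ('a \<Rightarrow> 'c::euclidean_space) set"
  where "test_functions \<Omega> =
    {\<phi>. (\<forall>k. Ck_on k UNIV \<phi>) \<and> compact (closure {x. \<phi> x \<noteq> 0}) \<and> closure {x. \<phi> x \<noteq> 0} \<subseteq> \<Omega>}"

section \<open>The differential operator\<close>

text \<open>
  The operator of order at most \<open>k\<close> is \<open>\<A>u = \<Sum> a\<^sub>b\<^sub>s(x) \<partial>\<^sub>b\<^sub>s u\<close>.  In place of multi-indices we sum
  over lists \<open>bs\<close> of at most \<open>k\<close> basis vectors, \<open>\<partial>\<^sub>b\<^sub>s\<close> being the iterated partial derivative; the
  coefficient of \<open>\<partial>\<^sup>\<alpha>\<close> is the sum of \<open>a\<^sub>b\<^sub>s\<close> over the lists \<open>bs\<close> that enumerate \<open>\<alpha>\<close>.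
  A coefficient of class \<open>C\<^sup>j\<close> in front of a derivative of order \<open>j\<close> is what makes
  \<open>\<A>m\<close> meaningful as a distribution for every measure \<open>m\<close>.
\<close>

definition deriv_lists :: "nat \<Rightarrow> 'a::euclidean_space list set"
  where "deriv_lists k = {bs. set bs \<subseteq> Basis \<and> length bs \<le> k}"

definition admissible_coeffs ::
    "'a::euclidean_space set \<Rightarrow> nat \<Rightarrow>
      ('a list \<Rightarrow> 'a \<Rightarrow> ('b::euclidean_space \<Rightarrow>\<^sub>L 'c::euclidean_space)) \<Rightarrow> bool"
  where "admissible_coeffs \<Omega> k a \<longleftrightarrow> (\<forall>bs\<in>deriv_lists k. Ck_on (length bs) \<Omega> (a bs))"

definition formal_adjoint ::
    "nat \<Rightarrow> ('a::euclidean_space list \<Rightarrow> 'a \<Rightarrow> ('b::euclidean_space \<Rightarrow>\<^sub>L 'c::euclidean_space))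
      \<Rightarrow> ('a \<Rightarrow> 'c) \<Rightarrow> 'a \<Rightarrow> 'b"
  where "formal_adjoint k a \<phi> x =
    (\<Sum>bs\<in>deriv_lists k.
       (-1) ^ length bs *\<^sub>R partials bs (\<lambda>y. adjoint (blinfun_apply (a bs y)) (\<phi> y)) x)"

definition op_distr ::
    "'a::euclidean_space set \<Rightarrow> nat \<Rightarrow>
      ('a list \<Rightarrow> 'a \<Rightarrow> ('b::euclidean_space \<Rightarrow>\<^sub>L 'c::euclidean_space))
      \<Rightarrow> ('a set \<Rightarrow> 'b) \<Rightarrow> ('a \<Rightarrow> 'c) \<Rightarrow> real"
  where "op_distr \<Omega> k a m \<phi> = vint \<Omega> (formal_adjoint k a \<phi>) m"

definition op_rel ::
    "'a::euclidean_space set \<Rightarrow> nat \<Rightarrow>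
      ('a list \<Rightarrow> 'a \<Rightarrow> ('b::euclidean_space \<Rightarrow>\<^sub>L 'c::euclidean_space))
      \<Rightarrow> ('a \<Rightarrow> 'b) \<Rightarrow> ('a \<Rightarrow> 'c) \<Rightarrow> bool"
  where "op_rel \<Omega> k a u v \<longleftrightarrow>
    u \<in> L1 \<Omega> \<and> v \<in> L1 \<Omega> \<and>
    (\<forall>\<phi>\<in>test_functions \<Omega>. op_distr \<Omega> k a (fun_measure \<Omega> u) \<phi> = (LINT x|leb \<Omega>. v x \<bullet> \<phi> x))"

definition W ::
    "'a::euclidean_space set \<Rightarrow> nat \<Rightarrow>
      ('a list \<Rightarrow> 'a \<Rightarrow> ('b::euclidean_space \<Rightarrow>\<^sub>L 'c::euclidean_space)) \<Rightarrow> ('a \<Rightarrow> 'b) set"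
  where "W \<Omega> k a = {u. \<exists>v. op_rel \<Omega> k a u v}"

text \<open>\<open>\<A>u\<close> for \<open>u\<close> in \<open>W\<close>; the choice is only between functions that agree almost everywhere.\<close>

definition op ::
    "'a::euclidean_space set \<Rightarrow> nat \<Rightarrow>
      ('a list \<Rightarrow> 'a \<Rightarrow> ('b::euclidean_space \<Rightarrow>\<^sub>L 'c::euclidean_space))
      \<Rightarrow> ('a \<Rightarrow> 'b) \<Rightarrow> 'a \<Rightarrow> 'c"
  where "op \<Omega> k a u = (SOME v. op_rel \<Omega> k a u v)"

definition op_image ::
    "'a::euclidean_space set \<Rightarrow> nat \<Rightarrow>
      ('a list \<Rightarrow> 'a \<Rightarrow> ('b::euclidean_space \<Rightarrow>\<^sub>L 'c::euclidean_space)) \<Rightarrow> ('a \<Rightarrow> 'c) set"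
  where "op_image \<Omega> k a = {v. \<exists>u\<in>W \<Omega> k a. op_rel \<Omega> k a u v}"

definition strongly_closed_L1 ::
    "'a::euclidean_space set \<Rightarrow> ('a \<Rightarrow> 'b::euclidean_space) set \<Rightarrow> bool"
  where "strongly_closed_L1 \<Omega> V \<longleftrightarrow>
    (\<forall>vj v. (\<forall>j::nat. vj j \<in> V) \<and> v \<in> L1 \<Omega> \<and> (\<lambda>j. LINT x|leb \<Omega>. norm (vj j x - v x)) \<longlonglongrightarrow> 0
       \<longrightarrow> v \<in> V)"

definition ker_fun ::
    "'a::euclidean_space set \<Rightarrow> nat \<Rightarrow>
      ('a list \<Rightarrow> 'a \<Rightarrow> ('b::euclidean_space \<Rightarrow>\<^sub>L 'c::euclidean_space)) \<Rightarrow> ('a \<Rightarrow> 'b) set"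
  where "ker_fun \<Omega> k a =
    {u \<in> L1 \<Omega>. \<forall>\<phi>\<in>test_functions \<Omega>. op_distr \<Omega> k a (fun_measure \<Omega> u) \<phi> = 0}"

definition ker_meas ::
    "'a::euclidean_space set \<Rightarrow> nat \<Rightarrow>
      ('a list \<Rightarrow> 'a \<Rightarrow> ('b::euclidean_space \<Rightarrow>\<^sub>L 'c::euclidean_space)) \<Rightarrow> ('a set \<Rightarrow> 'b) set"
  where "ker_meas \<Omega> k a =
    {m \<in> radon_measures \<Omega>. \<forall>\<phi>\<in>test_functions \<Omega>. op_distr \<Omega> k a m \<phi> = 0}"

definition affine_fun ::
    "'a::euclidean_space set \<Rightarrow> nat \<Rightarrow>
      ('a list \<Rightarrow> 'a \<Rightarrow> ('b::euclidean_space \<Rightarrow>\<^sub>L 'c::euclidean_space))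
      \<Rightarrow> ('a \<Rightarrow> 'b) \<Rightarrow> ('a \<Rightarrow> 'b) set"
  where "affine_fun \<Omega> k a u0 = {(\<lambda>x. u0 x + v x) | v. v \<in> ker_fun \<Omega> k a}"

definition affine_meas ::
    "'a::euclidean_space set \<Rightarrow> nat \<Rightarrow>
      ('a list \<Rightarrow> 'a \<Rightarrow> ('b::euclidean_space \<Rightarrow>\<^sub>L 'c::euclidean_space))
      \<Rightarrow> ('a \<Rightarrow> 'b) \<Rightarrow> ('a set \<Rightarrow> 'b) set"
  where "affine_meas \<Omega> k a u0 = {(\<lambda>E. fun_measure \<Omega> u0 E + m E) | m. m \<in> ker_meas \<Omega> k a}"

definition adj_domain ::
    "'a::euclidean_space set \<Rightarrow> nat \<Rightarrow>
      ('a list \<Rightarrow> 'a \<Rightarrow> ('b::euclidean_space \<Rightarrow>\<^sub>L 'c::euclidean_space)) \<Rightarrow> ('a \<Rightarrow> 'c) set"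
  where "adj_domain \<Omega> k a =
    {w \<in> Linf \<Omega>. \<exists>c>0. \<forall>u\<in>W \<Omega> k a.
       \<bar>LINT x|leb \<Omega>. w x \<bullet> op \<Omega> k a u x\<bar> \<le> c * (LINT x|leb \<Omega>. norm (u x))}"

definition adj_op ::
    "'a::euclidean_space set \<Rightarrow> nat \<Rightarrow>
      ('a list \<Rightarrow> 'a \<Rightarrow> ('b::euclidean_space \<Rightarrow>\<^sub>L 'c::euclidean_space))
      \<Rightarrow> ('a \<Rightarrow> 'c) \<Rightarrow> 'a \<Rightarrow> 'b"
  where "adj_op \<Omega> k a w =
    (SOME g. g \<in> Linf \<Omega> \<and>
       (\<forall>u\<in>W \<Omega> k a. (LINT x|leb \<Omega>. g x \<bullet> u x) = (LINT x|leb \<Omega>. w x \<bullet> op \<Omega> k a u x)))"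

section \<open>The variational problems\<close>

definition modulus_of_continuity :: "(real \<Rightarrow> real) \<Rightarrow> bool"
  where "modulus_of_continuity \<omega> \<longleftrightarrow>
    (\<forall>s\<ge>0. 0 \<le> \<omega> s) \<and> \<omega> 0 = 0 \<and> (\<omega> \<longlongrightarrow> 0) (at_right 0)"

definition conj_fun :: "('a \<Rightarrow> 'b::euclidean_space \<Rightarrow> real) \<Rightarrow> 'a \<Rightarrow> 'b \<Rightarrow> ereal"
  where "conj_fun f x zs = (SUP z. ereal (zs \<bullet> z - f x z))"

text \<open>For \<open>x\<close> in the open set \<open>\<Omega>\<close>, only values of \<open>f\<close> at points of \<open>\<Omega>\<close> enter this limit.\<close>

definition recession ::
    "('a::euclidean_space \<Rightarrow> 'b::euclidean_space \<Rightarrow> real) \<Rightarrow> 'a \<Rightarrow> 'b \<Rightarrow> real"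
  where "recession f x z = Lim (nhds x \<times>\<^sub>F at_top) (\<lambda>(x', t). f x' (t *\<^sub>R z) / t)"

definition relaxed ::
    "'a::euclidean_space set \<Rightarrow> ('a \<Rightarrow> 'b::euclidean_space \<Rightarrow> real) \<Rightarrow> ('a set \<Rightarrow> 'b) \<Rightarrow> ennreal"
  where "relaxed \<Omega> f m =
    (\<integral>\<^sup>+x. ennreal (f x (dens (leb \<Omega>) m x)) \<partial>leb \<Omega>)
    + (\<integral>\<^sup>+x. ennreal (recession f x (dens (sing_variation \<Omega> m) (sing_part \<Omega> m) x))
          \<partial>sing_variation \<Omega> m)"

text \<open>The integral of an extended-real function as the integral of its positive part minus the
  integral of its negative part (the coercion \<open>e2ennreal\<close> sends negative numbers to \<open>0\<close>).\<close>

definition ereal_integral :: "'a measure \<Rightarrow> ('a \<Rightarrow> ereal) \<Rightarrow> ereal"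
  where "ereal_integral M g =
    enn2ereal (\<integral>\<^sup>+x. e2ennreal (g x) \<partial>M) - enn2ereal (\<integral>\<^sup>+x. e2ennreal (- g x) \<partial>M)"

definition dual_functional ::
    "'a::euclidean_space set \<Rightarrow> nat \<Rightarrow>
      ('a list \<Rightarrow> 'a \<Rightarrow> ('b::euclidean_space \<Rightarrow>\<^sub>L 'c::euclidean_space))
      \<Rightarrow> ('a \<Rightarrow> 'b) \<Rightarrow> ('a \<Rightarrow> 'b \<Rightarrow> real) \<Rightarrow> ('a \<Rightarrow> 'c) \<Rightarrow> ereal"
  where "dual_functional \<Omega> k a u0 f w =
    ereal (LINT x|leb \<Omega>. w x \<bullet> op \<Omega> k a u0 x)
    - ereal_integral (leb \<Omega>) (\<lambda>x. conj_fun f x (adj_op \<Omega> k a w x))"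

definition generalized_solution ::
    "'a::euclidean_space set \<Rightarrow> nat \<Rightarrow>
      ('a list \<Rightarrow> 'a \<Rightarrow> ('b::euclidean_space \<Rightarrow>\<^sub>L 'c::euclidean_space))
      \<Rightarrow> ('a \<Rightarrow> 'b) \<Rightarrow> ('a \<Rightarrow> 'b \<Rightarrow> real) \<Rightarrow> ('a set \<Rightarrow> 'b) \<Rightarrow> bool"
  where "generalized_solution \<Omega> k a u0 f m \<longleftrightarrow>
    m \<in> affine_meas \<Omega> k a u0 \<and> (\<forall>m'\<in>affine_meas \<Omega> k a u0. relaxed \<Omega> f m \<le> relaxed \<Omega> f m')"

definition dual_solution ::
    "'a::euclidean_space set \<Rightarrow> nat \<Rightarrow>
      ('a list \<Rightarrow> 'a \<Rightarrow> ('b::euclidean_space \<Rightarrow>\<^sub>L 'c::euclidean_space))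
      \<Rightarrow> ('a \<Rightarrow> 'b) \<Rightarrow> ('a \<Rightarrow> 'b \<Rightarrow> real) \<Rightarrow> ('a \<Rightarrow> 'c) \<Rightarrow> bool"
  where "dual_solution \<Omega> k a u0 f w \<longleftrightarrow>
    w \<in> adj_domain \<Omega> k a \<and>
    (\<forall>w'\<in>adj_domain \<Omega> k a. dual_functional \<Omega> k a u0 f w' \<le> dual_functional \<Omega> k a u0 f w)"

definition pairing ::
    "'a::euclidean_space set \<Rightarrow> nat \<Rightarrow>
      ('a list \<Rightarrow> 'a \<Rightarrow> ('b::euclidean_space \<Rightarrow>\<^sub>L 'c::euclidean_space))
      \<Rightarrow> ('a \<Rightarrow> 'b) \<Rightarrow> ('a set \<Rightarrow> 'b) \<Rightarrow> ('a \<Rightarrow> 'c) \<Rightarrow> ('a set \<Rightarrow> real) set"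
  where "pairing \<Omega> k a u0 m w =
    {l \<in> radon_measures \<Omega>. \<exists>u. (\<forall>j::nat. u j \<in> affine_fun \<Omega> k a u0) \<and>
       area_strict_conv \<Omega> (\<lambda>j. fun_measure \<Omega> (u j)) m \<and>
       weak_star_conv \<Omega> (\<lambda>j. fun_measure \<Omega> (\<lambda>x. u j x \<bullet> adj_op \<Omega> k a w x)) l}"

definition extremal_measure ::
    "'a::euclidean_space set \<Rightarrow> nat \<Rightarrow>
      ('a list \<Rightarrow> 'a \<Rightarrow> ('b::euclidean_space \<Rightarrow>\<^sub>L 'c::euclidean_space))
      \<Rightarrow> ('a \<Rightarrow> 'b \<Rightarrow> real) \<Rightarrow> ('a set \<Rightarrow> 'b) \<Rightarrow> ('a \<Rightarrow> 'c) \<Rightarrow> 'a set \<Rightarrow> real"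
  where "extremal_measure \<Omega> k a f m w E =
    (if E \<in> borel_on \<Omega>
     then (LINT x:E|leb \<Omega>. dens (leb \<Omega>) m x \<bullet> adj_op \<Omega> k a w x)
        + (LINT x:E|sing_variation \<Omega> m. recession f x (dens (sing_variation \<Omega> m) m x))
     else 0)"

end

theory Submission
  imports Defs "HOL-Library.Function_Algebras"
begin

text \<open>
  The perspective \<open>|t| f(x, z / |t|)\<close>, completed by \<open>f\<^sup>\<infinity>(x, z)\<close> at \<open>t = 0\<close>, is continuous and
  positively homogeneous, so Reshetnyak's theorem applied to the pairs \<open>(u j, 1)\<close> shows that
  \<open>\<integral> \<phi> f(x, u j)\<close> converges along area-strict sequences. With the recovery sequences of (H2) this
  identifies the infimum of the relaxed problem with that of the original one. Hahn--Banach applied to the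
  directional derivative of the value function gives a multiplier, bounded on \<open>L\<^sup>1\<close>, that vanishes on the kernel;
  closed range and the open mapping theorem turn it into some \<open>\<A>\<^sup>* w\<^sup>*\<close>, so that there is no duality gap.

  For an optimal pair and \<open>u j \<rightarrow> \<mu>\<close> area-strictly, the integrals of the Fenchel gaps
  \<open>f(x, u j) + f\<^sup>*(x, \<A>\<^sup>* w\<^sup>*) - u j \<bullet> \<A>\<^sup>* w\<^sup>* \<ge> 0\<close> tend to \<open>0\<close>, which identifies the limit of the pairings.
  Away from the singular part of \<open>\<mu>\<close> the convergence is strong in \<open>L\<^sup>1\<close>; testing with continuous cutoffs
  makes the Fenchel gap of the absolutely continuous part vanish. Conversely, integrating the extremal
  measure against \<open>1\<close> gives equality in weak duality.
\<close>

section \<open>Vector measures and their densities\<close>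

text \<open>The obstacle is that \<open>adj_op \<Omega> k a w\<close> is only an essentially bounded
  function: its values on a Lebesgue null set mean nothing, so along a concentrating sequence the
  products \<open>u j x \<bullet> adj_op \<Omega> k a w x\<close> have no limit that weak
  convergence or Reshetnyak continuity could name. Near-equality in Fenchel's inequality, forced by
  optimality, trades these products for \<open>f x (u j x)\<close>, whose integrals do converge. The
  multiplier is essentially bounded because convexity and linear growth make \<open>f x\<close>
  Lipschitz with the growth constant \<open>M\<close>. The densities in the definitions are choices,
  determined only almost everywhere. Each measure is therefore written as \<open>s \<rho>\<close>
  over one scalar measure with \<open>leb \<Omega> = t \<rho>\<close>; singular part, area and
  relaxed energy then become integrals of pointwise expressions in \<open>(s, t)\<close>. That
  \<open>\<Omega>\<close> has finite Lebesgue measure is read off from (H2), applied to the zero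
  measure.\<close>

lemma sets_leb: "sets (leb \<Omega>) = borel_on \<Omega>"
  unfolding leb_def borel_on_def by (simp add: sets_restrict_space)

lemma space_leb [simp]: "space (leb \<Omega>) = \<Omega>"
  unfolding leb_def by (simp add: space_restrict_space)

lemma space_eq_borel_on:
  assumes "sets \<rho> = borel_on \<Omega>"
  shows "space \<rho> = \<Omega>"
  using sets_eq_imp_space_eq[of \<rho> "leb \<Omega>"] assms by (simp add: sets_leb)

lemma sigma_algebra_borel_on: "sigma_algebra \<Omega> (borel_on \<Omega>)"
  using sets.sigma_algebra_axioms[of "leb \<Omega>"] by (simp add: sets_leb)

text \<open>The vector measure \<open>s \<rho>\<close>. The value 0 off \<open>sets \<rho>\<close>
  matches the convention in \<open>radon_measures\<close>, so that equality of measures is equality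
  of functions.\<close>

definition dmeas :: "'a measure \<Rightarrow> ('a \<Rightarrow> 'b::euclidean_space) \<Rightarrow> 'a set \<Rightarrow> 'b"
  where "dmeas \<rho> s E = (if E \<in> sets \<rho> then LINT x:E|\<rho>. s x else 0)"

lemma fun_measure_eq_dmeas: "fun_measure \<Omega> u = dmeas (leb \<Omega>) u"
  by (auto simp: fun_measure_def dmeas_def sets_leb fun_eq_iff)

lemma integrable_set_integrable:
  "integrable M f \<Longrightarrow> A \<in> sets M \<Longrightarrow> set_integrable M A f"
  for f :: "'a \<Rightarrow> 'b::{banach,second_countable_topology}"
  unfolding set_integrable_def by (rule integrable_mult_indicator)

lemma norm_set_integral_le:
  fixes f :: "'a \<Rightarrow> 'b::{banach,second_countable_topology}"
  assumes "integrable M f" "A \<in> sets M"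
  shows "norm (LINT x:A|M. f x) \<le> (LINT x:A|M. norm (f x))"
  unfolding set_lebesgue_integral_def
  by (rule order_trans[OF integral_norm_bound]) (simp add: norm_scaleR)

lemma emeasure_density_norm:
  fixes f :: "'a \<Rightarrow> 'b::{banach,second_countable_topology}"
  assumes f: "integrable M f" and A: "A \<in> sets M"
  shows "emeasure (density M (\<lambda>x. ennreal (norm (f x)))) A = ennreal (LINT x:A|M. norm (f x))"
proof -
  have m: "f \<in> borel_measurable M" using f by simp
  have "emeasure (density M (\<lambda>x. ennreal (norm (f x)))) A = (\<integral>\<^sup>+x. ennreal (indicator A x * norm (f x)) \<partial>M)"
    using A m by (auto simp: emeasure_density intro!: nn_integral_cong split: split_indicator)
  also have "\<dots> = ennreal (\<integral>x. indicator A x * norm (f x) \<partial>M)"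
    using integrable_mult_indicator[OF A integrable_norm[OF f]]
    by (intro nn_integral_eq_integral) auto
  finally show ?thesis by (simp add: set_lebesgue_integral_def)
qed

lemma sums_set_integral:
  fixes f :: "'a \<Rightarrow> 'b::{banach,second_countable_topology}"
  assumes f: "integrable M f" and A: "range A \<subseteq> sets M" "disjoint_family A"
  shows "(\<lambda>i::nat. LINT x:A i|M. f x) sums (LINT x:(\<Union>i. A i)|M. f x)"
proof -
  let ?D = "density M (\<lambda>x. ennreal (norm (f x)))"
  have Am: "A i \<in> sets M" for i using A by auto
  have "(LINT x:(\<Union>i. A i)|M. f x) = (\<Sum>i. LINT x:A i|M. f x)"
    using A Am f by (intro lebesgue_integral_countable_add integrable_set_integrable)
      (auto simp: disjoint_family_on_def)
  \<comment> \<open>The equation with the infinite sum does not by itself give convergence; the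
    finite measure \<open>?D\<close> dominates the terms absolutely.\<close>
  moreover have "summable (\<lambda>i. LINT x:A i|M. f x)"
  proof (rule summable_norm_cancel, rule summable_comparison_test)
    show "\<exists>N. \<forall>n\<ge>N. norm (norm (LINT x:A n|M. f x)) \<le> (LINT x:A n|M. norm (f x))"
      using norm_set_integral_le[OF f Am] by auto
    have "(\<Sum>i. emeasure ?D (A i)) = emeasure ?D (\<Union>i. A i)"
      using A by (intro suminf_emeasure) auto
    also have "\<dots> < \<infinity>" using emeasure_density_norm[OF f, of "\<Union>i. A i"] Am by auto
    finally have "(\<Sum>i. ennreal (LINT x:A i|M. norm (f x))) \<noteq> top"
      using emeasure_density_norm[OF f Am] by auto
    moreover have "0 \<le> (LINT x:A i|M. norm (f x))" for i
      by (simp add: set_lebesgue_integral_def)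
    ultimately show "summable (\<lambda>i. LINT x:A i|M. norm (f x))"
      by (intro summable_suminf_not_top) auto
  qed
  ultimately show ?thesis by (simp add: summable_sums)
qed

lemma integrable_simple_approx:
  fixes f :: "'a \<Rightarrow> 'b::{banach,second_countable_topology}"
  assumes f: "integrable M f" and e: "e > 0"
  obtains s where "simple_function M s" "integrable M s" "(\<integral>x. norm (f x - s x) \<partial>M) < e"
proof -
  obtain s where s: "\<And>i. simple_function M (s i)" "\<And>i. emeasure M {y\<in>space M. s i y \<noteq> 0} \<noteq> \<infinity>"
     "\<And>x. x\<in>space M \<Longrightarrow> (\<lambda>i. s i x) \<longlonglongrightarrow> f x" "\<And>x i. x\<in>space M \<Longrightarrow> norm (s i x) \<le> 2 * norm (f x)"
    by (rule integrable_implies_simple_function_sequence[OF f], rule that)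
  have si: "integrable M (s i)" for i
    using s by (intro integrable_simple_function)
  have "(\<lambda>i. \<integral>x. norm (f x - s i x) \<partial>M) \<longlonglongrightarrow> (\<integral>x. 0 \<partial>M)"
  proof (rule integral_dominated_convergence[where w="\<lambda>x. 3 * norm (f x)"])
    show "AE x in M. (\<lambda>i. norm (f x - s i x)) \<longlonglongrightarrow> 0"
    proof (rule AE_I2)
      fix x assume "x \<in> space M"
      then have "(\<lambda>i. norm (f x - s i x)) \<longlonglongrightarrow> norm (f x - f x)"
        by (intro tendsto_intros s(3))
      then show "(\<lambda>i. norm (f x - s i x)) \<longlonglongrightarrow> 0" by simp
    qed
    show "AE x in M. norm (norm (f x - s i x)) \<le> 3 * norm (f x)" for i
    proof (rule AE_I2)
      fix x assume "x \<in> space M"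
      then show "norm (norm (f x - s i x)) \<le> 3 * norm (f x)"
        using s(4)[of x i] norm_triangle_ineq4[of "f x" "s i x"] by simp
    qed
  qed (use f si in auto)
  then have "\<forall>\<^sub>F i in sequentially. (\<integral>x. norm (f x - s i x) \<partial>M) < e"
    using e by (auto dest: order_tendstoD)
  then obtain i where "(\<integral>x. norm (f x - s i x) \<partial>M) < e" by (auto simp: eventually_sequentially)
  with s si that show ?thesis by blast
qed

text \<open>The upper bound is the triangle inequality. For the lower one, \<open>s\<close> is
  replaced by a simple function \<open>q\<close>: on a level set of \<open>q\<close> the norm of the
  integral is the integral of the norm, so the partition of \<open>E\<close> into level sets nearly
  attains the supremum.\<close>

lemma total_variation_sup:
  fixes s :: "'a::euclidean_space \<Rightarrow> 'b::euclidean_space"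
  assumes \<rho>: "sets \<rho> = borel_on \<Omega>" and s: "integrable \<rho> s" and E: "E \<in> borel_on \<Omega>"
  shows "(SUP P \<in> {P. finite P \<and> disjoint P \<and> P \<subseteq> borel_on \<Omega> \<and> \<Union>P \<subseteq> E}.
         \<Sum>A\<in>P. ennreal (norm (dmeas \<rho> s A))) = emeasure (density \<rho> (\<lambda>x. ennreal (norm (s x)))) E"
   (is "(SUP P \<in> ?C. ?v P) = emeasure ?D E")
proof (rule antisym)
  show "(SUP P \<in> ?C. ?v P) \<le> emeasure ?D E"
  proof (rule SUP_least)
    fix P assume P: "P \<in> ?C"
    have "?v P \<le> (\<Sum>A\<in>P. emeasure ?D A)"
    proof (rule sum_mono)
      fix A assume "A \<in> P"
      then have A: "A \<in> sets \<rho>" using P \<rho> by auto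
      show "ennreal (norm (dmeas \<rho> s A)) \<le> emeasure ?D A"
        using norm_set_integral_le[OF s A] A
        by (simp add: emeasure_density_norm[OF s A] dmeas_def ennreal_leI)
    qed
    also have "\<dots> = emeasure ?D (\<Union>A\<in>P. A)"
      using P \<rho> by (intro sum_emeasure) (auto simp: disjoint_family_on_def disjoint_def)
    also have "\<dots> \<le> emeasure ?D E"
      using P E \<rho> by (intro emeasure_mono) auto
    finally show "?v P \<le> emeasure ?D E" .
  qed
next
  have Em: "E \<in> sets \<rho>" using E \<rho> by simp
  show "emeasure ?D E \<le> (SUP P \<in> ?C. ?v P)"
  proof (rule ennreal_le_epsilon)
    fix e :: real assume e: "e > 0"
    \<comment> \<open>\<open>e/2\<close>, because the error \<open>s - q\<close> enters twice: once
      in passing from \<open>s\<close> to \<open>q\<close> under the norm and once in going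
      back.\<close>
    then obtain q where q: "simple_function \<rho> q" "integrable \<rho> q" "(\<integral>x. norm (s x - q x) \<partial>\<rho>) < e/2"
      using integrable_simple_approx[OF s, of "e/2"] by auto
    define A where "A c = E \<inter> (q -` {c} \<inter> space \<rho>)" for c
    have Am: "A c \<in> sets \<rho>" for c
      unfolding A_def using Em q(1) by (auto intro: simple_functionD)
    define V where "V = {c \<in> q ` space \<rho>. A c \<noteq> {}}"
    have fV: "finite V" unfolding V_def using simple_functionD(1)[OF q(1)] by auto
    have inj: "inj_on A V"
    proof (rule inj_onI)
      fix c d assume "c \<in> V" "d \<in> V" "A c = A d"
      then obtain x where "x \<in> A c" "x \<in> A d" unfolding V_def by auto
      then show "c = d" unfolding A_def by auto
    qed
    have disj: "disjoint_family_on A V" unfolding disjoint_family_on_def A_def by auto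
    have UA: "(\<Union>c\<in>V. A c) = E"
      using sets.sets_into_space[OF Em] unfolding V_def A_def by auto
    have inC: "A ` V \<in> ?C"
    proof -
      have "disjoint (A ` V)"
        using disj by (rule disjoint_family_on_disjoint_image)
      then show ?thesis using fV Am \<rho> UA by auto
    qed
    let ?d = "\<lambda>c. LINT x:A c|\<rho>. norm (s x - q x)"
    have key: "(LINT x:A c|\<rho>. norm (s x)) \<le> norm (dmeas \<rho> s (A c)) + 2 * ?d c" for c
    proof -
      have iq: "integrable \<rho> (\<lambda>x. s x - q x)" using s q by simp
      have sI: "set_integrable \<rho> (A c) s" "set_integrable \<rho> (A c) q"
        "set_integrable \<rho> (A c) (\<lambda>x. norm (s x))" "set_integrable \<rho> (A c) (\<lambda>x. norm (q x))"
        "set_integrable \<rho> (A c) (\<lambda>x. norm (s x - q x))"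
        using s q(2) iq by (auto intro!: integrable_set_integrable Am)
      \<comment> \<open>Here \<open>\<rho>\<close> may be infinite, and so may be the measure of the
        level set of the value 0; for every other value, integrability of \<open>q\<close> bounds
        it.\<close>
      have ind: "integrable \<rho> (indicat_real (A c))" if "c \<noteq> 0"
      proof -
        have "set_integrable \<rho> (A c) (\<lambda>x. norm c)"
          using sI(4) by (rule set_integrable_cong[THEN iffD1, rotated -1]) (auto simp: A_def)
        then show ?thesis using that by (simp add: set_integrable_def)
      qed
      have e1: "(LINT x:A c|\<rho>. q x) = measure \<rho> (A c) *\<^sub>R c"
      proof -
        have "(LINT x:A c|\<rho>. q x) = (LINT x:A c|\<rho>. c)"
          by (intro set_lebesgue_integral_cong Am) (auto simp: A_def)
        also have "\<dots> = measure \<rho> (A c) *\<^sub>R c"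
          using Am ind by (cases "c = 0") (simp_all add: set_lebesgue_integral_def)
        finally show ?thesis .
      qed
      have e2: "(LINT x:A c|\<rho>. norm (q x)) = measure \<rho> (A c) *\<^sub>R norm c"
      proof -
        have "(LINT x:A c|\<rho>. norm (q x)) = (LINT x:A c|\<rho>. norm c)"
          by (intro set_lebesgue_integral_cong Am) (auto simp: A_def)
        also have "\<dots> = measure \<rho> (A c) *\<^sub>R norm c"
          using Am ind by (cases "c = 0") (simp_all add: set_lebesgue_integral_def)
        finally show ?thesis .
      qed
      have "(LINT x:A c|\<rho>. norm (s x)) \<le> (LINT x:A c|\<rho>. norm (q x) + norm (s x - q x))"
        using sI by (intro set_integral_mono set_integral_add) (auto simp: norm_triangle_sub)
      also have "\<dots> = norm (LINT x:A c|\<rho>. q x) + ?d c"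
        using sI by (simp add: set_integral_add e1 e2)
      also have "(LINT x:A c|\<rho>. q x) = (LINT x:A c|\<rho>. s x) - (LINT x:A c|\<rho>. s x - q x)"
        using sI by (simp add: set_integral_diff)
      also have "norm \<dots> \<le> norm (LINT x:A c|\<rho>. s x) + ?d c"
        using norm_set_integral_le[OF iq Am[of c]] by (smt (verit) norm_triangle_ineq4)
      finally show ?thesis using Am by (simp add: dmeas_def)
    qed
    have iN: "integrable \<rho> (\<lambda>x. norm (s x - q x))" using s q by simp
    have "emeasure ?D E = ennreal (LINT x:E|\<rho>. norm (s x))"
      by (rule emeasure_density_norm[OF s Em])
    also have "(LINT x:E|\<rho>. norm (s x)) = (\<Sum>c\<in>V. LINT x:A c|\<rho>. norm (s x))"
      unfolding UA[symmetric] using s fV disj Am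
      by (intro set_integral_finite_Union integrable_set_integrable) auto
    also have "\<dots> \<le> (\<Sum>c\<in>V. norm (dmeas \<rho> s (A c))) + 2 * (\<Sum>c\<in>V. ?d c)"
      using key by (simp add: sum_distrib_left sum.distrib[symmetric] sum_mono)
    also have "(\<Sum>c\<in>V. ?d c) = (LINT x:E|\<rho>. norm (s x - q x))"
      unfolding UA[symmetric] using iN fV disj Am
      by (intro set_integral_finite_Union[symmetric] integrable_set_integrable) auto
    also have "\<dots> \<le> (\<integral>x. norm (s x - q x) \<partial>\<rho>)"
      unfolding set_lebesgue_integral_def using iN Em
      by (intro integral_mono integrable_mult_indicator) (auto split: split_indicator)
    finally have le: "emeasure ?D E \<le> ennreal ((\<Sum>c\<in>V. norm (dmeas \<rho> s (A c))) + 2 * (\<integral>x. norm (s x - q x) \<partial>\<rho>))"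
      by (simp add: ennreal_leI)
    have "emeasure ?D E \<le> ennreal ((\<Sum>c\<in>V. norm (dmeas \<rho> s (A c))) + e)"
      using q(3) by (intro order_trans[OF le] ennreal_leI) simp
    also have "\<dots> = (\<Sum>B\<in>A ` V. ennreal (norm (dmeas \<rho> s B))) + ennreal e"
      using e by (simp add: sum.reindex[OF inj] ennreal_plus sum_nonneg sum_ennreal)
    also have "\<dots> \<le> (SUP P \<in> ?C. ?v P) + ennreal e"
      using inC by (intro add_mono SUP_upper) auto
    finally show "emeasure ?D E \<le> (SUP P \<in> ?C. ?v P) + ennreal e" .
  qed
qed

text \<open>\<open>total_variation\<close> passes a set function to \<open>measure_of\<close>; once
  the supremum is known to agree on all Borel sets with a genuine measure, \<open>measure_of\<close>
  returns that measure.\<close>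

lemma total_variation_dmeas:
  fixes s :: "'a::euclidean_space \<Rightarrow> 'b::euclidean_space"
  assumes \<rho>: "sets \<rho> = borel_on \<Omega>" and s: "integrable \<rho> s"
  shows "total_variation \<Omega> (dmeas \<rho> s) = density \<rho> (\<lambda>x. ennreal (norm (s x)))"
proof -
  let ?D = "density \<rho> (\<lambda>x. ennreal (norm (s x)))"
  have D: "sets ?D = borel_on \<Omega>" "space ?D = \<Omega>" using \<rho> by (auto simp: space_eq_borel_on)
  interpret sigma_algebra \<Omega> "borel_on \<Omega>" by (rule sigma_algebra_borel_on)
  have "total_variation \<Omega> (dmeas \<rho> s) = measure_of \<Omega> (borel_on \<Omega>) (emeasure ?D)"
    unfolding total_variation_def
    by (intro measure_of_eq total_variation_sup[OF \<rho> s]) (use space_closed sigma_sets_eq in auto)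
  also have "\<dots> = ?D" using measure_of_of_measure[of ?D] D by simp
  finally show ?thesis .
qed

lemma radon_measures_sums:
  assumes "m \<in> radon_measures \<Omega>" "range A \<subseteq> borel_on \<Omega>" "disjoint_family A"
  shows "(\<lambda>i::nat. m (A i)) sums m (\<Union>i. A i)"
  using assms by (auto simp: radon_measures_def)

lemma radon_measures_empty:
  assumes "m \<in> radon_measures \<Omega>"
  shows "m {} = 0"
proof -
  interpret sigma_algebra \<Omega> "borel_on \<Omega>" by (rule sigma_algebra_borel_on)
  have "(\<lambda>i::nat. m {}) sums m (\<Union>i::nat. {})"
    by (rule radon_measures_sums[OF assms]) (auto simp: disjoint_family_on_def)
  then show ?thesis by (auto dest: sums_summable simp: summable_const_iff)
qed

lemma radon_measures_Un:
  assumes m: "m \<in> radon_measures \<Omega>" and AB: "A \<in> borel_on \<Omega>" "B \<in> borel_on \<Omega>" "A \<inter> B = {}"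
  shows "m (A \<union> B) = m A + m B"
proof -
  interpret sigma_algebra \<Omega> "borel_on \<Omega>" by (rule sigma_algebra_borel_on)
  have "(\<lambda>i. m (binaryset A B i)) sums m (\<Union>i. binaryset A B i)"
    using AB by (intro radon_measures_sums[OF m])
      (auto simp: disjoint_family_on_def binaryset_def split: if_splits)
  moreover have "(\<lambda>i. m (binaryset A B i)) sums (m A + m B)"
    using radon_measures_empty[OF m] by (intro binaryset_sums)
  ultimately show ?thesis by (simp add: UN_binaryset_eq sums_unique2)
qed

lemma radon_measures_Diff:
  assumes m: "m \<in> radon_measures \<Omega>" and AB: "A \<in> borel_on \<Omega>" "B \<in> borel_on \<Omega>" "B \<subseteq> A"
  shows "m (A - B) = m A - m B"
proof -
  interpret sigma_algebra \<Omega> "borel_on \<Omega>" by (rule sigma_algebra_borel_on)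
  have "m (B \<union> (A - B)) = m B + m (A - B)"
    using AB by (intro radon_measures_Un[OF m]) auto
  moreover have "B \<union> (A - B) = A" using AB by auto
  ultimately show ?thesis by simp
qed

lemma dmeas_radon:
  assumes "sets \<rho> = borel_on \<Omega>" "integrable \<rho> s"
  shows "dmeas \<rho> s \<in> radon_measures \<Omega>"
proof -
  have "(\<lambda>i. dmeas \<rho> s (A i)) sums dmeas \<rho> s (\<Union>i. A i)"
    if "range A \<subseteq> borel_on \<Omega>" "disjoint_family A" for A :: "nat \<Rightarrow> _"
  proof -
    have "range A \<subseteq> sets \<rho>" using that assms(1) by simp
    moreover from this have "(\<Union>i. A i) \<in> sets \<rho>" by auto
    ultimately show ?thesis
      using sums_set_integral[OF assms(2) _ that(2)] by (auto simp: dmeas_def subset_eq)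
  qed
  then show ?thesis using assms(1) by (auto simp: radon_measures_def dmeas_def)
qed

section \<open>Jordan decomposition and a common dominating measure\<close>

lemma nonneg_radon_measure:
  fixes \<tau> :: "'a::euclidean_space set \<Rightarrow> real"
  assumes \<tau>: "\<tau> \<in> radon_measures \<Omega>" and nn: "\<And>E. E \<in> borel_on \<Omega> \<Longrightarrow> 0 \<le> \<tau> E"
  shows "\<exists>M. finite_measure M \<and> sets M = borel_on \<Omega> \<and> (\<forall>E\<in>borel_on \<Omega>. emeasure M E = ennreal (\<tau> E))"
proof -
  interpret sigma_algebra \<Omega> "borel_on \<Omega>" by (rule sigma_algebra_borel_on)
  define M where "M = measure_of \<Omega> (borel_on \<Omega>) (\<lambda>E. ennreal (\<tau> E))"
  have sM: "sets M = borel_on \<Omega>" "space M = \<Omega>"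
    unfolding M_def by simp_all
  have em: "emeasure M E = ennreal (\<tau> E)" if "E \<in> borel_on \<Omega>" for E
  proof (rule emeasure_measure_of[OF M_def])
    show "borel_on \<Omega> \<subseteq> Pow \<Omega>" by (rule space_closed)
    show "positive (sets M) (\<lambda>E. ennreal (\<tau> E))"
      using radon_measures_empty[OF \<tau>] by (simp add: positive_def)
    show "countably_additive (sets M) (\<lambda>E. ennreal (\<tau> E))"
      unfolding countably_additive_def sM
    proof safe
      fix A :: "nat \<Rightarrow> 'a set" assume A: "range A \<subseteq> borel_on \<Omega>" "disjoint_family A"
      have "(\<lambda>i. \<tau> (A i)) sums \<tau> (\<Union>i. A i)" using A by (rule radon_measures_sums[OF \<tau>])
      then show "(\<Sum>i. ennreal (\<tau> (A i))) = ennreal (\<tau> (\<Union>i. A i))"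
        using nn A by (intro suminf_ennreal_eq) auto
    qed
    show "E \<in> sets M" using that sM by simp
  qed
  have "finite_measure M"
    by (rule finite_measureI) (use em[of \<Omega>] sM in auto)
  with sM em show ?thesis by blast
qed

lemma finite_measure_radon:
  assumes "finite_measure M" "sets M = borel_on \<Omega>"
  shows "measure M \<in> radon_measures \<Omega>"
proof -
  interpret finite_measure M by fact
  show ?thesis
    unfolding radon_measures_def using assms(2)
    by (auto intro!: finite_measure_UNION simp: measure_notin_sets)
qed

lemma radon_measures_add:
  "m \<in> radon_measures \<Omega> \<Longrightarrow> m' \<in> radon_measures \<Omega> \<Longrightarrow> (\<lambda>E. m E + m' E) \<in> radon_measures \<Omega>"
  by (auto simp: radon_measures_def intro!: sums_add)

lemma radon_measures_diff:
  "m \<in> radon_measures \<Omega> \<Longrightarrow> m' \<in> radon_measures \<Omega> \<Longrightarrow> (\<lambda>E. m E - m' E) \<in> radon_measures \<Omega>"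
  by (auto simp: radon_measures_def intro!: sums_diff)

lemma radon_measures_sum:
  "(\<And>i. i \<in> I \<Longrightarrow> m i \<in> radon_measures \<Omega>) \<Longrightarrow> (\<lambda>E. \<Sum>i\<in>I. m i E) \<in> radon_measures \<Omega>"
  by (auto simp: radon_measures_def intro!: sums_sum)

lemma radon_measures_inner:
  "m \<in> radon_measures \<Omega> \<Longrightarrow> (\<lambda>E. m E \<bullet> b) \<in> radon_measures \<Omega>"
  by (auto simp: radon_measures_def intro!: bounded_linear.sums[OF bounded_linear_inner_left])

text \<open>The positive part \<open>sup {\<tau> A | A \<subseteq> E}\<close> of a real measure is a measure; were it infinite,
  infinitely many disjoint sets of measure at least \<open>1\<close> in modulus could be split off.\<close>

lemma jordan_decomposition:
  fixes \<tau> :: "'a::euclidean_space set \<Rightarrow> real"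
  assumes \<tau>: "\<tau> \<in> radon_measures \<Omega>"
  shows "\<exists>P N. finite_measure P \<and> finite_measure N \<and> sets P = borel_on \<Omega> \<and> sets N = borel_on \<Omega> \<and>
    (\<forall>E\<in>borel_on \<Omega>. \<tau> E = measure P E - measure N E)"
proof -
  interpret sigma_algebra \<Omega> "borel_on \<Omega>" by (rule sigma_algebra_borel_on)
  define T where "T E = (SUP A\<in>{A\<in>borel_on \<Omega>. A \<subseteq> E}. ennreal (\<tau> A))" for E
  have le_T: "ennreal (\<tau> A) \<le> T E" if "A \<in> borel_on \<Omega>" "A \<subseteq> E" for A E
    unfolding T_def using that by (intro SUP_upper) auto
  \<comment> \<open>The three cases reflect that \<open>ennreal\<close> truncates at 0: a set with
    negative value contributes nothing and is dropped from the union.\<close>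
  have super: "T E + T F \<le> T (E \<union> F)" if EF: "E \<inter> F = {}" for E F
  proof -
    have ne: "{A\<in>borel_on \<Omega>. A \<subseteq> X} \<noteq> {}" for X by auto
    have *: "ennreal (\<tau> A) + ennreal (\<tau> B) \<le> T (E \<union> F)"
      if A: "A \<in> borel_on \<Omega>" "A \<subseteq> E" and B: "B \<in> borel_on \<Omega>" "B \<subseteq> F" for A B
    proof -
      consider "\<tau> A \<le> 0" | "\<tau> B \<le> 0" | "\<tau> A > 0" "\<tau> B > 0" by linarith
      then show ?thesis
      proof cases
        case 1 then show ?thesis using le_T[of B "E \<union> F"] B by (auto simp: ennreal_neg)
      next
        case 2 then show ?thesis using le_T[of A "E \<union> F"] A by (auto simp: ennreal_neg)
      next
        case 3
        then have "ennreal (\<tau> A) + ennreal (\<tau> B) = ennreal (\<tau> (A \<union> B))"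
          using A B EF by (subst radon_measures_Un[OF \<tau>]) (auto simp: ennreal_plus)
        also have "\<dots> \<le> T (E \<union> F)" using A B by (intro le_T) auto
        finally show ?thesis .
      qed
    qed
    have "T E + T F = (SUP A\<in>{A\<in>borel_on \<Omega>. A \<subseteq> E}. ennreal (\<tau> A) + T F)"
      unfolding T_def[of E] by (rule ennreal_SUP_add_left[symmetric, OF ne])
    also have "\<dots> \<le> T (E \<union> F)"
    proof (rule SUP_least)
      fix A assume A: "A \<in> {A\<in>borel_on \<Omega>. A \<subseteq> E}"
      have "ennreal (\<tau> A) + T F = (SUP B\<in>{A\<in>borel_on \<Omega>. A \<subseteq> F}. ennreal (\<tau> A) + ennreal (\<tau> B))"
        unfolding T_def[of F] by (rule ennreal_SUP_add_right[OF ne])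
      also have "\<dots> \<le> T (E \<union> F)" using A * by (intro SUP_least) auto
      finally show "ennreal (\<tau> A) + T F \<le> T (E \<union> F)" .
    qed
    finally show ?thesis .
  qed
  have mono: "T E \<le> T F" if "E \<subseteq> F" for E F
    unfolding T_def using that by (intro SUP_subset_mono) auto
  have T0: "T {} = 0"
    using radon_measures_empty[OF \<tau>] by (auto simp: T_def bot_ennreal intro!: antisym SUP_least)
  define M where "M = measure_of \<Omega> (borel_on \<Omega>) T"
  have sM: "sets M = borel_on \<Omega>" "space M = \<Omega>"
    unfolding M_def by simp_all
  have em: "emeasure M E = T E" if "E \<in> borel_on \<Omega>" for E
  proof (rule emeasure_measure_of[OF M_def])
    show "borel_on \<Omega> \<subseteq> Pow \<Omega>" by (rule space_closed)
    show "positive (sets M) T" using T0 by (simp add: positive_def)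
    show "countably_additive (sets M) T"
      unfolding countably_additive_def sM
    proof safe
      fix E :: "nat \<Rightarrow> 'a set" assume E: "range E \<subseteq> borel_on \<Omega>" "disjoint_family E"
      show "(\<Sum>i. T (E i)) = T (\<Union>i. E i)"
      proof (rule antisym)
        \<comment> \<open>Superadditivity gives this half of countable additivity; the other half
          cuts a competitor \<open>A\<close> along the sets \<open>E i\<close>.\<close>
        have fin: "(\<Sum>i<n. T (E i)) \<le> T (\<Union>i<n. E i)" for n
        proof (induction n)
          case (Suc n)
          have "(\<Union>i<n. E i) \<inter> E n = {}"
          proof -
            have "E i \<inter> E n = {}" if "i < n" for i
              using that by (intro disjoint_family_onD[OF E(2)]) auto
            then show ?thesis by blast
          qed
          then have "T (\<Union>i<n. E i) + T (E n) \<le> T (\<Union>i<Suc n. E i)"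
            using super[of "\<Union>i<n. E i" "E n"] by (simp add: lessThan_Suc Un_commute)
          then show ?case using order_trans[OF add_right_mono[OF Suc]] by simp
        qed (simp add: T0)
        show "(\<Sum>i. T (E i)) \<le> T (\<Union>i. E i)"
          by (rule suminf_le_const) (auto intro: order_trans[OF fin mono])
        show "T (\<Union>i. E i) \<le> (\<Sum>i. T (E i))"
          unfolding T_def[of "\<Union>i. E i"]
        proof (rule SUP_least)
          fix A assume A: "A \<in> {A\<in>borel_on \<Omega>. A \<subseteq> (\<Union>i. E i)}"
          have AE: "A \<inter> E i \<in> borel_on \<Omega>" for i using A E(1) by auto
          have "(\<lambda>i. \<tau> (A \<inter> E i)) sums \<tau> (\<Union>i. A \<inter> E i)"
            using A E by (intro radon_measures_sums[OF \<tau>]) (auto simp: disjoint_family_on_def)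
          moreover have "(\<Union>i. A \<inter> E i) = A" using A by auto
          ultimately have "(\<lambda>n. \<Sum>i<n. \<tau> (A \<inter> E i)) \<longlonglongrightarrow> \<tau> A" by (simp add: sums_def)
          then have "(\<lambda>n. ennreal (\<Sum>i<n. \<tau> (A \<inter> E i))) \<longlonglongrightarrow> ennreal (\<tau> A)"
            by (rule tendsto_ennrealI)
          moreover have "ennreal (\<Sum>i<n. \<tau> (A \<inter> E i)) \<le> (\<Sum>i. T (E i))" for n
          proof -
            have "ennreal (\<Sum>i<n. \<tau> (A \<inter> E i)) \<le> ennreal (\<Sum>i<n. max 0 (\<tau> (A \<inter> E i)))"
              by (intro ennreal_leI sum_mono) auto
            also have "\<dots> = (\<Sum>i<n. ennreal (max 0 (\<tau> (A \<inter> E i))))"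
              by (intro sum_ennreal[symmetric]) auto
            also have "\<dots> \<le> (\<Sum>i<n. T (E i))"
              using AE by (intro sum_mono) (auto simp: max_def intro!: le_T)
            also have "\<dots> \<le> (\<Sum>i. T (E i))" by (intro sum_le_suminf) auto
            finally show ?thesis .
          qed
          ultimately show "ennreal (\<tau> A) \<le> (\<Sum>i. T (E i))"
            by (intro LIMSEQ_le_const2) auto
        qed
      qed
    qed
    show "E \<in> sets M" using that sM by simp
  qed
  \<comment> \<open>If \<open>\<tau> B > 1 + \<bar>\<tau> E\<bar>\<close> then
    \<open>\<tau> (E - B) < -1\<close>, so each of the two pieces has value at least 1 in modulus.
    As \<open>T\<close> is additive, one piece still has infinite \<open>T\<close>; it is kept and
    the other is split off.\<close>
  have step: "\<exists>F. F \<in> borel_on \<Omega> \<and> T F = top \<and> F \<subseteq> E \<and> \<bar>\<tau> (E - F)\<bar> \<ge> 1"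
    if E: "E \<in> borel_on \<Omega>" "T E = top" for E
  proof -
    have "ennreal (1 + \<bar>\<tau> E\<bar>) < T E" using E(2) by (simp add: less_top[symmetric])
    then obtain B where B: "B \<in> borel_on \<Omega>" "B \<subseteq> E" "ennreal (1 + \<bar>\<tau> E\<bar>) < ennreal (\<tau> B)"
      unfolding T_def less_SUP_iff by auto
    then have gt: "1 + \<bar>\<tau> E\<bar> < \<tau> B"
      by (metis abs_ge_zero add_nonneg_nonneg ennreal_less_iff zero_le_one)
    have d: "\<tau> (E - B) = \<tau> E - \<tau> B" using B E by (intro radon_measures_Diff[OF \<tau>])
    have EB: "E - B \<in> borel_on \<Omega>" using B(1) E(1) by (rule Diff[rotated])
    have "emeasure M (B \<union> (E - B)) = emeasure M B + emeasure M (E - B)"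
      using B(1) EB by (intro plus_emeasure[symmetric]) (auto simp: sM(1))
    moreover have "B \<union> (E - B) = E" using B by auto
    ultimately have "T B + T (E - B) = top" using B(1) EB E by (simp add: em)
    then consider "T B = top" | "T (E - B) = top" by auto
    then show ?thesis
    proof cases
      case 1 then show ?thesis using B gt d by (intro exI[of _ B]) auto
    next
      case 2
      have "E - (E - B) = B" using B by auto
      then show ?thesis using 2 B E gt by (intro exI[of _ "E - B"]) auto
    qed
  qed
  have "T \<Omega> \<noteq> top"
  proof
    assume inf: "T \<Omega> = top"
    have "\<exists>F. \<forall>n. (F n \<in> borel_on \<Omega> \<and> T (F n) = top) \<and> F (Suc n) \<subseteq> F n \<and> \<bar>\<tau> (F n - F (Suc n))\<bar> \<ge> 1"
    proof (rule dependent_nat_choice[where P="\<lambda>n F. F \<in> borel_on \<Omega> \<and> T F = top" and Q="\<lambda>n E F. F \<subseteq> E \<and> \<bar>\<tau> (E - F)\<bar> \<ge> 1"])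
      show "\<exists>F. F \<in> borel_on \<Omega> \<and> T F = top" using inf by blast
      show "\<exists>F. (F \<in> borel_on \<Omega> \<and> T F = top) \<and> F \<subseteq> E \<and> \<bar>\<tau> (E - F)\<bar> \<ge> 1"
        if "E \<in> borel_on \<Omega> \<and> T E = top" for E using step that by blast
    qed
    then obtain F where F: "\<And>n. F n \<in> borel_on \<Omega>" "\<And>n. F (Suc n) \<subseteq> F n" "\<And>n. \<bar>\<tau> (F n - F (Suc n))\<bar> \<ge> 1"
      by auto
    have dec: "decseq F" using F(2) by (rule decseq_SucI)
    have "F n - F (Suc n) \<in> borel_on \<Omega>" for n using F(1) by auto
    moreover have "disjoint_family (\<lambda>n. F n - F (Suc n))"
    proof -
      have "(F i - F (Suc i)) \<inter> (F j - F (Suc j)) = {}" if "i < j" for i j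
        using decseqD[OF dec, of "Suc i" j] that by auto
      then show ?thesis
        unfolding disjoint_family_on_def by (metis Int_commute linorder_neqE_nat)
    qed
    \<comment> \<open>The disjoint differences have a convergent series of values, although each
      value is at least 1 in modulus.\<close>
    ultimately have "summable (\<lambda>n. \<tau> (F n - F (Suc n)))"
      by (intro sums_summable[OF radon_measures_sums[OF \<tau>]]) auto
    then have "(\<lambda>n. \<tau> (F n - F (Suc n))) \<longlonglongrightarrow> 0" by (rule summable_LIMSEQ_zero)
    then have "\<forall>\<^sub>F n in sequentially. \<bar>\<tau> (F n - F (Suc n))\<bar> < 1"
      using order_tendstoD(2)[OF tendsto_rabs_zero, of _ sequentially 1] by simp
    then obtain n where "\<bar>\<tau> (F n - F (Suc n))\<bar> < 1" by (auto simp: eventually_sequentially)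
    with F(3)[of n] show False by simp
  qed
  then have fM: "finite_measure M" by (intro finite_measureI) (simp add: sM em)
  interpret M: finite_measure M by fact
  have ge: "\<tau> E \<le> measure M E" if "E \<in> borel_on \<Omega>" for E
  proof -
    have "ennreal (\<tau> E) \<le> ennreal (measure M E)"
      using le_T[of E E] that by (simp add: em[symmetric] M.emeasure_eq_measure)
    then show ?thesis by (simp add: ennreal_le_iff)
  qed
  \<comment> \<open>The negative part is the positive part minus \<open>\<tau>\<close>; it is
    nonnegative because \<open>E\<close> itself competes in the supremum \<open>T E\<close>.\<close>
  have "(\<lambda>E. measure M E - \<tau> E) \<in> radon_measures \<Omega>"
    by (intro radon_measures_diff finite_measure_radon fM sM \<tau>)
  then obtain N where N: "finite_measure N" "sets N = borel_on \<Omega>"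
      "\<And>E. E \<in> borel_on \<Omega> \<Longrightarrow> emeasure N E = ennreal (measure M E - \<tau> E)"
    using nonneg_radon_measure[of "\<lambda>E. measure M E - \<tau> E" \<Omega>] ge by auto
  have "\<tau> E = measure M E - measure N E" if "E \<in> borel_on \<Omega>" for E
    using N(3)[OF that] ge[OF that] by (simp add: measure_def)
  with fM N(1,2) sM show ?thesis by blast
qed

text \<open>Domination gives absolute continuity and a finite density. The density is chosen real
  and nonnegative at every point, as the locale \<open>lebesgue_density\<close> demands of
  \<open>t\<close>.\<close>

lemma radon_nikodym_le:
  assumes fin: "finite_measure \<rho>" and Q: "finite_measure Q" "sets Q = sets \<rho>"
    and le: "\<And>E. E \<in> sets \<rho> \<Longrightarrow> emeasure Q E \<le> emeasure \<rho> E"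
  shows "\<exists>D :: 'a \<Rightarrow> real. integrable \<rho> D \<and> (\<forall>x. 0 \<le> D x) \<and> Q = density \<rho> (\<lambda>x. ennreal (D x)) \<and>
    (\<forall>E\<in>sets \<rho>. measure Q E = (LINT x:E|\<rho>. D x))"
proof -
  interpret finite_measure \<rho> by fact
  have ac: "absolutely_continuous \<rho> Q"
    unfolding absolutely_continuous_def using Q(2) by (auto dest: le simp: null_sets_def)
  obtain D where D: "D \<in> borel_measurable \<rho>" "AE x in \<rho>. RN_deriv \<rho> Q x = ennreal (D x)" "\<And>x. 0 \<le> D x"
    using real_RN_deriv[OF Q(1) ac Q(2)] by metis
  have Qd: "Q = density \<rho> (\<lambda>x. ennreal (D x))"
  proof -
    have "Q = density \<rho> (RN_deriv \<rho> Q)" using density_RN_deriv[OF ac Q(2)] by simp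
    also have "\<dots> = density \<rho> (\<lambda>x. ennreal (D x))"
      using D by (intro density_cong) auto
    finally show ?thesis .
  qed
  have "(\<integral>\<^sup>+x. ennreal (D x) \<partial>\<rho>) = emeasure Q (space \<rho>)"
    using D(1) by (subst Qd) (simp add: emeasure_density cong: nn_integral_cong)
  also have "\<dots> < \<infinity>"
    using finite_measure.emeasure_finite[OF Q(1), of "space \<rho>"] by (simp add: less_top)
  finally have int: "integrable \<rho> D"
    using D by (intro integrableI_nonneg) auto
  have "measure Q E = (LINT x:E|\<rho>. D x)" if "E \<in> sets \<rho>" for E
  proof -
    have "emeasure Q E = ennreal (LINT x:E|\<rho>. norm (D x))"
      using emeasure_density_norm[OF int that] D(3) by (simp add: Qd)
    then show ?thesis using D(3)
      by (simp add: measure_def set_lebesgue_integral_def)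
  qed
  with int D(3) Qd show ?thesis by blast
qed

text \<open>\<open>\<rho>\<close> is the sum of Lebesgue measure and of the positive and negative
  parts of all coordinates of \<open>m\<close>. It dominates each summand, so the scalar
  Radon-Nikodym theorem yields \<open>s\<close> coordinate by coordinate, and \<open>t\<close> from
  Lebesgue measure.\<close>

lemma radon_rep:
  fixes m :: "'a::euclidean_space set \<Rightarrow> 'b::euclidean_space"
  assumes m: "m \<in> radon_measures \<Omega>" and leb: "finite_measure (leb \<Omega>)"
  obtains \<rho> s t where "finite_measure \<rho>" "sets \<rho> = borel_on \<Omega>" "integrable \<rho> s" "integrable \<rho> t"
    "\<And>x. 0 \<le> t x" "m = dmeas \<rho> s" "leb \<Omega> = density \<rho> (\<lambda>x. ennreal (t x))"
proof -
  interpret sigma_algebra \<Omega> "borel_on \<Omega>" by (rule sigma_algebra_borel_on)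
  have "\<forall>b. \<exists>P N. finite_measure P \<and> finite_measure N \<and> sets P = borel_on \<Omega> \<and> sets N = borel_on \<Omega> \<and>
     (\<forall>E\<in>borel_on \<Omega>. m E \<bullet> b = measure P E - measure N E)"
    using jordan_decomposition[OF radon_measures_inner[OF m]] by metis
  then obtain P N where PN: "\<And>b. finite_measure (P b)" "\<And>b. finite_measure (N b)"
     "\<And>b. sets (P b) = borel_on \<Omega>" "\<And>b. sets (N b) = borel_on \<Omega>"
     "\<And>b E. E\<in>borel_on \<Omega> \<Longrightarrow> m E \<bullet> b = measure (P b) E - measure (N b) E" by metis
  define \<tau> where "\<tau> E = measure (leb \<Omega>) E + (\<Sum>b\<in>Basis. measure (P b) E + measure (N b) E)" for E
  have "\<tau> \<in> radon_measures \<Omega>"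
    unfolding \<tau>_def using PN leb
    by (intro radon_measures_add radon_measures_sum finite_measure_radon) (auto simp: sets_leb)
  then obtain \<rho> where \<rho>: "finite_measure \<rho>" "sets \<rho> = borel_on \<Omega>" "\<And>E. E \<in> borel_on \<Omega> \<Longrightarrow> emeasure \<rho> E = ennreal (\<tau> E)"
    using nonneg_radon_measure[of \<tau> \<Omega>] by (auto simp: \<tau>_def sum_nonneg)
  have PNle: "measure (P b) E + measure (N b) E \<le> (\<Sum>b\<in>Basis. measure (P b) E + measure (N b) E)" if "b \<in> Basis" for b E
    using that by (intro member_le_sum) auto
  have leP: "emeasure (P b) E \<le> emeasure \<rho> E" if "b \<in> Basis" "E \<in> sets \<rho>" for b E
    using PNle[OF that(1), of E] that \<rho> PN(1)[of b] by (simp add: finite_measure.emeasure_eq_measure \<tau>_def)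
      (smt (verit) ennreal_leI measure_nonneg)
  have leN: "emeasure (N b) E \<le> emeasure \<rho> E" if "b \<in> Basis" "E \<in> sets \<rho>" for b E
    using PNle[OF that(1), of E] that \<rho> PN(2)[of b] by (simp add: finite_measure.emeasure_eq_measure \<tau>_def)
      (smt (verit) ennreal_leI measure_nonneg)
  have leL: "emeasure (leb \<Omega>) E \<le> emeasure \<rho> E" if "E \<in> sets \<rho>" for E
    using that \<rho> leb by (simp add: finite_measure.emeasure_eq_measure \<tau>_def sum_nonneg ennreal_leI)
  have "\<exists>D. integrable \<rho> D \<and> (\<forall>E\<in>sets \<rho>. measure (P b) E = (LINT x:E|\<rho>. D x))" if "b \<in> Basis" for b
    using radon_nikodym_le[OF \<rho>(1) PN(1)[of b], unfolded PN \<rho>(2), OF refl] leP that \<rho>(2) by metis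
  then obtain DP where DP: "\<And>b. b \<in> Basis \<Longrightarrow> integrable \<rho> (DP b)"
     "\<And>b E. b \<in> Basis \<Longrightarrow> E \<in> sets \<rho> \<Longrightarrow> measure (P b) E = (LINT x:E|\<rho>. DP b x)" by metis
  have "\<exists>D. integrable \<rho> D \<and> (\<forall>E\<in>sets \<rho>. measure (N b) E = (LINT x:E|\<rho>. D x))" if "b \<in> Basis" for b
    using radon_nikodym_le[OF \<rho>(1) PN(2)[of b], unfolded PN \<rho>(2), OF refl] leN that \<rho>(2) by metis
  then obtain DN where DN: "\<And>b. b \<in> Basis \<Longrightarrow> integrable \<rho> (DN b)"
     "\<And>b E. b \<in> Basis \<Longrightarrow> E \<in> sets \<rho> \<Longrightarrow> measure (N b) E = (LINT x:E|\<rho>. DN b x)" by metis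
  obtain t where t: "integrable \<rho> t" "\<And>x. 0 \<le> t x" "leb \<Omega> = density \<rho> (\<lambda>x. ennreal (t x))"
    using radon_nikodym_le[OF \<rho>(1) leb, unfolded sets_leb \<rho>(2), OF refl] leL \<rho>(2) by metis
  define s where "s x = (\<Sum>b\<in>Basis. (DP b x - DN b x) *\<^sub>R b)" for x
  have si: "integrable \<rho> s" unfolding s_def using DP(1) DN(1) by auto
  have "m = dmeas \<rho> s"
  proof
    fix E
    show "m E = dmeas \<rho> s E"
    proof (cases "E \<in> borel_on \<Omega>")
      case True
      then have E: "E \<in> sets \<rho>" using \<rho> by simp
      have "m E = (\<Sum>b\<in>Basis. (m E \<bullet> b) *\<^sub>R b)" by (simp add: euclidean_representation)
      also have "\<dots> = (\<Sum>b\<in>Basis. (LINT x:E|\<rho>. DP b x - DN b x) *\<^sub>R b)"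
        using True E PN(5) DP DN by (auto intro!: sum.cong simp: set_integral_diff integrable_set_integrable)
      also have "\<dots> = (\<Sum>b\<in>Basis. LINT x:E|\<rho>. (DP b x - DN b x) *\<^sub>R b)"
      proof (rule sum.cong[OF refl])
        fix b :: 'b assume b: "b \<in> Basis"
        have "integrable \<rho> (\<lambda>x. indicator E x *\<^sub>R (DP b x - DN b x))"
          using DP(1) DN(1) b E by (intro integrable_mult_indicator) auto
        then show "(LINT x:E|\<rho>. DP b x - DN b x) *\<^sub>R b = (LINT x:E|\<rho>. (DP b x - DN b x) *\<^sub>R b)"
          unfolding set_lebesgue_integral_def
          by (subst integral_scaleR_left[symmetric]) auto
      qed
      also have "\<dots> = (LINT x:E|\<rho>. s x)"
        unfolding set_lebesgue_integral_def s_def scaleR_sum_right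
        using DP(1) DN(1) E by (intro Bochner_Integration.integral_sum[symmetric] integrable_mult_indicator) auto
      finally show ?thesis using E by (simp add: dmeas_def)
    next
      case False then show ?thesis using m \<rho> by (auto simp: dmeas_def radon_measures_def)
    qed
  qed
  with \<rho> si t that show ?thesis by blast
qed

text \<open>\<open>dens\<close> is a choice, and two admissible choices may come with different null
  sets. On a set that avoids both of them the residual terms are \<open>m {} = 0\<close>, hence the
  two densities have the same integrals.\<close>

lemma dens_unique:
  fixes m :: "'a::euclidean_space set \<Rightarrow> 'b::euclidean_space"
  assumes \<nu>: "finite_measure \<nu>" and m0: "m {} = 0"
    and g: "integrable \<nu> g" "Z \<in> null_sets \<nu>" "\<And>E. E \<in> sets \<nu> \<Longrightarrow> m E = (LINT x:E|\<nu>. g x) + m (E \<inter> Z)"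
  shows "integrable \<nu> (dens \<nu> m)" "AE x in \<nu>. dens \<nu> m x = g x"
proof -
  interpret finite_measure \<nu> by fact
  have "integrable \<nu> (dens \<nu> m) \<and> (\<exists>Z\<in>null_sets \<nu>. \<forall>E\<in>sets \<nu>. m E = (LINT x:E|\<nu>. dens \<nu> m x) + m (E \<inter> Z))"
    unfolding dens_def by (rule someI[of _ g]) (use g in auto)
  then obtain Y where h: "integrable \<nu> (dens \<nu> m)" and Y: "Y \<in> null_sets \<nu>"
    "\<And>E. E \<in> sets \<nu> \<Longrightarrow> m E = (LINT x:E|\<nu>. dens \<nu> m x) + m (E \<inter> Y)" by auto
  show "integrable \<nu> (dens \<nu> m)" by fact
  show "AE x in \<nu>. dens \<nu> m x = g x"
  proof (rule density_unique_banach[OF h g(1)])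
    fix E assume E: "E \<in> sets \<nu>"
    let ?E = "E - (Z \<union> Y)"
    have Em: "?E \<in> sets \<nu>" using E g(2) Y(1) by auto
    have null: "Z \<union> Y \<in> null_sets \<nu>" using g(2) Y(1) by auto
    have eq: "(LINT x:?E|\<nu>. k x) = (LINT x:E|\<nu>. k x)" if "integrable \<nu> k" for k :: "'a \<Rightarrow> 'b"
    proof (rule set_integral_cong_set)
      have k: "k \<in> borel_measurable \<nu>" using that by simp
      show "set_borel_measurable \<nu> ?E k" "set_borel_measurable \<nu> E k"
        unfolding set_borel_measurable_def using k E Em by measurable
      show "AE x in \<nu>. (x \<in> E) = (x \<in> ?E)" using AE_not_in[OF null] by eventually_elim auto
    qed
    have i: "?E \<inter> Z = {}" "?E \<inter> Y = {}" by auto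
    show "(LINT x:E|\<nu>. dens \<nu> m x) = (LINT x:E|\<nu>. g x)"
      using g(3)[OF Em] Y(2)[OF Em] unfolding i m0 by (simp add: eq[OF h] eq[OF g(1)])
  qed
qed

lemma integrable_density_iff_real:
  fixes g :: "'a \<Rightarrow> 'b::{banach,second_countable_topology}"
  assumes "g \<in> borel_measurable \<rho>" "r \<in> borel_measurable \<rho>" "\<And>x. 0 \<le> r x"
  shows "integrable (density \<rho> (\<lambda>x. ennreal (r x))) g \<longleftrightarrow> integrable \<rho> (\<lambda>x. r x *\<^sub>R g x)"
  using assms by (intro integrable_density) auto

lemma AE_density_real:
  assumes "r \<in> borel_measurable \<rho>"
  shows "(AE x in density \<rho> (\<lambda>x. ennreal (r x)). P x) \<longleftrightarrow> (AE x in \<rho>. 0 < r x \<longrightarrow> P x)"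
  using assms by (subst AE_density) auto

text \<open>For \<open>\<nu> = r \<rho>\<close> the exceptional set is \<open>{r = 0}\<close>: it is
  null for \<open>\<nu>\<close> and carries the part of \<open>s \<rho>\<close> that is singular to
  \<open>\<nu>\<close>. The last conclusion restates the density over \<open>\<rho>\<close>, where
  facts about different \<open>\<nu>\<close> can be combined.\<close>

lemma dens_dmeas:
  fixes s :: "'a::euclidean_space \<Rightarrow> 'b::euclidean_space"
  assumes \<rho>: "finite_measure \<rho>" "sets \<rho> = borel_on \<Omega>" and s: "integrable \<rho> s"
    and r: "integrable \<rho> r" "\<And>x. 0 \<le> r x"
  defines "\<nu> \<equiv> density \<rho> (\<lambda>x. ennreal (r x))"
  shows "integrable \<nu> (dens \<nu> (dmeas \<rho> s))"
    "AE x in \<nu>. dens \<nu> (dmeas \<rho> s) x = s x /\<^sub>R r x"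
    "AE x in \<rho>. 0 < r x \<longrightarrow> dens \<nu> (dmeas \<rho> s) x = s x /\<^sub>R r x"
proof -
  have [measurable]: "r \<in> borel_measurable \<rho>" "s \<in> borel_measurable \<rho>" using r s by auto
  interpret finite_measure \<rho> by fact
  have fin: "finite_measure \<nu>"
  proof (rule finite_measureI)
    have "emeasure \<nu> (space \<nu>) = (\<integral>\<^sup>+x. ennreal (norm (r x)) \<partial>\<rho>)"
      using r by (simp add: \<nu>_def emeasure_density cong: nn_integral_cong)
    then show "emeasure \<nu> (space \<nu>) \<noteq> \<infinity>" using r(1) by (simp add: integrable_iff_bounded)
  qed
  let ?Z = "{x\<in>space \<rho>. r x = 0}"
  have Zm: "?Z \<in> sets \<rho>" by measurable
  have Z: "?Z \<in> null_sets \<nu>"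
    unfolding \<nu>_def by (subst null_sets_density_iff) (use Zm in auto)
  have snu: "sets \<nu> = sets \<rho>" unfolding \<nu>_def by simp
  have i: "integrable \<nu> (\<lambda>x. s x /\<^sub>R r x)"
    unfolding \<nu>_def
  proof (subst integrable_density_iff_real)
    show "integrable \<rho> (\<lambda>x. r x *\<^sub>R (s x /\<^sub>R r x))"
    proof (rule Bochner_Integration.integrable_bound[OF s])
      have "norm (r x *\<^sub>R (s x /\<^sub>R r x)) \<le> norm (s x)" for x by (cases "r x = 0") auto
      then show "AE x in \<rho>. norm (r x *\<^sub>R (s x /\<^sub>R r x)) \<le> norm (s x)" by simp
    qed auto
  qed (use r in auto)
  have eq: "dmeas \<rho> s E = (LINT x:E|\<nu>. s x /\<^sub>R r x) + dmeas \<rho> s (E \<inter> ?Z)" if "E \<in> sets \<nu>" for E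
  proof -
    have E: "E \<in> sets \<rho>" "E \<inter> ?Z \<in> sets \<rho>" "E - ?Z \<in> sets \<rho>" using that snu Zm by auto
    have "(LINT x:E|\<nu>. s x /\<^sub>R r x) = (LINT x:E-?Z|\<rho>. s x)"
    proof -
      have "(LINT x:E|\<nu>. s x /\<^sub>R r x) = (LINT x|\<rho>. r x *\<^sub>R (indicator E x *\<^sub>R (s x /\<^sub>R r x)))"
        unfolding set_lebesgue_integral_def \<nu>_def using r E
        by (intro integral_density) auto
      also have "\<dots> = (LINT x:E-?Z|\<rho>. s x)"
        unfolding set_lebesgue_integral_def
        by (intro Bochner_Integration.integral_cong) (auto split: split_indicator)
      finally show ?thesis .
    qed
    moreover have "(LINT x:(E-?Z) \<union> (E \<inter> ?Z)|\<rho>. s x) = (LINT x:E-?Z|\<rho>. s x) + (LINT x:E\<inter>?Z|\<rho>. s x)"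
      using E s by (intro set_integral_Un integrable_set_integrable) auto
    moreover have "(E-?Z) \<union> (E \<inter> ?Z) = E" by auto
    ultimately show ?thesis using E by (simp add: dmeas_def)
  qed
  have d0: "dmeas \<rho> s {} = 0" by (simp add: dmeas_def set_lebesgue_integral_def)
  show "integrable \<nu> (dens \<nu> (dmeas \<rho> s))"
    by (rule dens_unique(1)[OF fin d0 i Z eq])
  show *: "AE x in \<nu>. dens \<nu> (dmeas \<rho> s) x = s x /\<^sub>R r x"
    by (rule dens_unique(2)[OF fin d0 i Z eq])
  show "AE x in \<rho>. 0 < r x \<longrightarrow> dens \<nu> (dmeas \<rho> s) x = s x /\<^sub>R r x"
    using * unfolding \<nu>_def by (subst (asm) AE_density_real) auto
qed

text \<open>Where \<open>s x = 0\<close> the density of the measure with respect to its own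
  variation is arbitrary, but there the weight \<open>norm (s x)\<close> vanishes.\<close>

lemma vint_dmeas:
  fixes s :: "'a::euclidean_space \<Rightarrow> 'b::euclidean_space"
  assumes \<rho>: "finite_measure \<rho>" "sets \<rho> = borel_on \<Omega>" and s: "integrable \<rho> s"
    and \<phi>[measurable]: "\<phi> \<in> borel_measurable \<rho>"
  shows "vint \<Omega> \<phi> (dmeas \<rho> s) = (LINT x|\<rho>. \<phi> x \<bullet> s x)"
proof -
  let ?\<nu> = "density \<rho> (\<lambda>x. ennreal (norm (s x)))"
  have [measurable]: "s \<in> borel_measurable \<rho>" using s by auto
  note d = dens_dmeas[OF \<rho> s, of "\<lambda>x. norm (s x)"]
  have [measurable]: "dens ?\<nu> (dmeas \<rho> s) \<in> borel_measurable \<rho>"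
    using d(1) s by auto
  have "vint \<Omega> \<phi> (dmeas \<rho> s) = (LINT x|?\<nu>. \<phi> x \<bullet> dens ?\<nu> (dmeas \<rho> s) x)"
    by (simp add: vint_def total_variation_dmeas[OF \<rho>(2) s])
  also have "\<dots> = (LINT x|\<rho>. norm (s x) *\<^sub>R (\<phi> x \<bullet> dens ?\<nu> (dmeas \<rho> s) x))"
    by (intro integral_density) auto
  also have "\<dots> = (LINT x|\<rho>. \<phi> x \<bullet> s x)"
  proof (intro integral_cong_AE)
    have "AE x in \<rho>. 0 < norm (s x) \<longrightarrow> dens ?\<nu> (dmeas \<rho> s) x = s x /\<^sub>R norm (s x)"
      using d(3) s by simp
    then show "AE x in \<rho>. norm (s x) *\<^sub>R (\<phi> x \<bullet> dens ?\<nu> (dmeas \<rho> s) x) = \<phi> x \<bullet> s x"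
    proof eventually_elim
      case (elim x)
      then show ?case by (cases "s x = 0") simp_all
    qed
  qed auto
  finally show ?thesis .
qed

text \<open>Every vector measure is \<open>s \<rho>\<close> for some \<open>\<rho>\<close> that also dominates Lebesgue measure, \<open>leb \<Omega> = t \<rho>\<close>.
  The singular part of \<open>s \<rho>\<close> then lives on \<open>{t = 0}\<close>, and area-strict convergence of
  \<open>u j\<close> to \<open>s \<rho>\<close> is strict convergence of \<open>(u j, 1)\<close> to \<open>(s, t) \<rho>\<close>.\<close>

locale lebesgue_density =
  fixes \<Omega> :: "'a::euclidean_space set" and \<rho> :: "'a measure" and t :: "'a \<Rightarrow> real"
  assumes fin: "finite_measure \<rho>" and sets_rho: "sets \<rho> = borel_on \<Omega>"
    and t: "integrable \<rho> t" "\<And>x. 0 \<le> t x" and leb: "leb \<Omega> = density \<rho> (\<lambda>x. ennreal (t x))"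
begin

lemma space_rho [simp]: "space \<rho> = \<Omega>"
  by (rule space_eq_borel_on[OF sets_rho])

lemma t_meas [measurable]: "t \<in> borel_measurable \<rho>"
  using t(1) by simp

lemma leb_meas: "borel_measurable (leb \<Omega>) = borel_measurable \<rho>"
  by (rule measurable_cong_sets) (auto simp: leb)

lemma AE_leb: "(AE x in leb \<Omega>. P x) \<longleftrightarrow> (AE x in \<rho>. 0 < t x \<longrightarrow> P x)"
  unfolding leb by (rule AE_density_real) simp

lemma integrable_leb_iff:
  fixes g :: "'a \<Rightarrow> 'b::{banach,second_countable_topology}"
  assumes "g \<in> borel_measurable \<rho>"
  shows "integrable (leb \<Omega>) g \<longleftrightarrow> integrable \<rho> (\<lambda>x. t x *\<^sub>R g x)"
  unfolding leb using assms t by (intro integrable_density_iff_real) auto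

lemma integral_leb:
  fixes g :: "'a \<Rightarrow> 'b::{banach,second_countable_topology}"
  assumes "g \<in> borel_measurable \<rho>"
  shows "integral\<^sup>L (leb \<Omega>) g = (LINT x|\<rho>. t x *\<^sub>R g x)"
  unfolding leb using assms t by (intro integral_density) auto

lemma nn_integral_leb:
  assumes "g \<in> borel_measurable \<rho>"
  shows "integral\<^sup>N (leb \<Omega>) g = (\<integral>\<^sup>+x. ennreal (t x) * g x \<partial>\<rho>)"
  unfolding leb using assms t by (intro nn_integral_density) auto

lemma dens_leb:
  fixes s :: "'a \<Rightarrow> 'b::euclidean_space"
  assumes s: "integrable \<rho> s"
  shows "integrable (leb \<Omega>) (dens (leb \<Omega>) (dmeas \<rho> s))"
    "AE x in \<rho>. 0 < t x \<longrightarrow> dens (leb \<Omega>) (dmeas \<rho> s) x = s x /\<^sub>R t x"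
  unfolding leb using dens_dmeas[OF fin sets_rho s t] by auto

text \<open>The Lebesgue density is \<open>s / t\<close> on \<open>{t > 0}\<close>, and integrating
  it against \<open>t \<rho>\<close> recovers \<open>s \<rho>\<close> there; what remains sits on
  \<open>{t = 0}\<close>.\<close>

lemma sing_part_dmeas:
  fixes s :: "'a \<Rightarrow> 'b::euclidean_space"
  assumes s: "integrable \<rho> s"
  shows "sing_part \<Omega> (dmeas \<rho> s) = dmeas \<rho> (\<lambda>x. if t x = 0 then s x else 0)"
proof
  fix E
  have [measurable]: "s \<in> borel_measurable \<rho>" using s by auto
  show "sing_part \<Omega> (dmeas \<rho> s) E = dmeas \<rho> (\<lambda>x. if t x = 0 then s x else 0) E"
  proof (cases "E \<in> sets \<rho>")
    case E: True
    let ?d = "dens (leb \<Omega>) (dmeas \<rho> s)"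
    have [measurable]: "?d \<in> borel_measurable \<rho>"
      using borel_measurable_integrable[OF dens_leb(1)[OF s]] unfolding leb_meas .
    have i: "integrable \<rho> (\<lambda>x. if t x = 0 then s x else 0)" "integrable \<rho> (\<lambda>x. if t x = 0 then 0 else s x)"
      by (rule Bochner_Integration.integrable_bound[OF s]; auto)+
    have "(LINT x:E|leb \<Omega>. ?d x) = (LINT x|\<rho>. t x *\<^sub>R (indicator E x *\<^sub>R ?d x))"
      unfolding set_lebesgue_integral_def using E by (intro integral_leb) auto
    also have "\<dots> = (LINT x:E|\<rho>. if t x = 0 then 0 else s x)"
      unfolding set_lebesgue_integral_def
    proof (intro integral_cong_AE)
      show "AE x in \<rho>. t x *\<^sub>R indicat_real E x *\<^sub>R ?d x = indicat_real E x *\<^sub>R (if t x = 0 then 0 else s x)"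
        using dens_leb(2)[OF s] by eventually_elim (use t(2) in \<open>auto simp: less_le split: split_indicator\<close>)
    qed (use E in auto)
    finally have *: "(LINT x:E|leb \<Omega>. ?d x) = (LINT x:E|\<rho>. if t x = 0 then 0 else s x)" .
    have "(LINT x:E|\<rho>. s x) = (LINT x:E|\<rho>. (if t x = 0 then s x else 0) + (if t x = 0 then 0 else s x))"
      using E by (intro set_lebesgue_integral_cong) auto
    also have "\<dots> = (LINT x:E|\<rho>. if t x = 0 then s x else 0) + (LINT x:E|\<rho>. if t x = 0 then 0 else s x)"
      by (intro set_integral_add integrable_set_integrable i E)
    finally show ?thesis using E sets_rho * by (simp add: sing_part_def dmeas_def)
  qed (use sets_rho in \<open>auto simp: sing_part_def dmeas_def\<close>)
qed

lemma integrable_sing: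
  fixes s :: "'a \<Rightarrow> 'b::euclidean_space"
  assumes s: "integrable \<rho> s"
  shows "integrable \<rho> (\<lambda>x. if t x = 0 then s x else 0)"
  using borel_measurable_integrable[OF s]
  by (intro Bochner_Integration.integrable_bound[OF s]) auto

lemma sing_variation_dmeas:
  fixes s :: "'a \<Rightarrow> 'b::euclidean_space"
  assumes s: "integrable \<rho> s"
  shows "sing_variation \<Omega> (dmeas \<rho> s) = density \<rho> (\<lambda>x. ennreal (if t x = 0 then norm (s x) else 0))"
  unfolding sing_part_dmeas[OF s] total_variation_dmeas[OF sets_rho integrable_sing[OF s]]
  by (rule arg_cong[where f="density \<rho>"]) auto

text \<open>On \<open>{t > 0}\<close> the product of \<open>t\<close> with the area integrand at
  \<open>s / t\<close> is the norm of \<open>(s, t)\<close>, and on \<open>{t = 0}\<close> the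
  singular variation contributes \<open>norm s\<close>. This is what links areas to total masses of
  pairs.\<close>

lemma area_dmeas:
  fixes s :: "'a \<Rightarrow> 'b::euclidean_space"
  assumes s: "integrable \<rho> s"
  shows "area \<Omega> (dmeas \<rho> s) \<Omega> = (\<integral>\<^sup>+x. ennreal (norm (s x, t x)) \<partial>\<rho>)"
proof -
  have [measurable]: "s \<in> borel_measurable \<rho>" using s by auto
  let ?d = "dens (leb \<Omega>) (dmeas \<rho> s)"
  have [measurable]: "?d \<in> borel_measurable \<rho>"
    using borel_measurable_integrable[OF dens_leb(1)[OF s]] unfolding leb_meas .
  have O: "\<Omega> \<in> sets \<rho>" using sets.top[of \<rho>] by simp
  have "(\<integral>\<^sup>+x\<in>\<Omega>. ennreal (sqrt (1 + (norm (?d x))\<^sup>2)) \<partial>leb \<Omega>) = (\<integral>\<^sup>+x. ennreal (sqrt (1 + (norm (?d x))\<^sup>2)) \<partial>leb \<Omega>)"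
    by (intro nn_integral_cong) auto
  also have "\<dots> = (\<integral>\<^sup>+x. ennreal (t x) * ennreal (sqrt (1 + (norm (?d x))\<^sup>2)) \<partial>\<rho>)"
    by (intro nn_integral_leb) auto
  also have "\<dots> = (\<integral>\<^sup>+x. ennreal (if t x = 0 then 0 else norm (s x, t x)) \<partial>\<rho>)"
  proof (rule nn_integral_cong_AE)
    show "AE x in \<rho>. ennreal (t x) * ennreal (sqrt (1 + (norm (?d x))\<^sup>2)) = ennreal (if t x = 0 then 0 else norm (s x, t x))"
      using dens_leb(2)[OF s]
    proof eventually_elim
      case (elim x)
      show ?case
      proof (cases "t x = 0")
        case False
        then have tx: "t x > 0" using t(2)[of x] by simp
        have "t x * sqrt (1 + (norm (?d x))\<^sup>2) = sqrt ((t x)\<^sup>2 * (1 + (norm (?d x))\<^sup>2))"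
          using tx by (simp add: real_sqrt_mult)
        also have "(t x)\<^sup>2 * (1 + (norm (?d x))\<^sup>2) = (t x)\<^sup>2 + (norm (s x))\<^sup>2"
          using elim tx by (simp add: field_simps power2_eq_square)
        finally have "t x * sqrt (1 + (norm (?d x))\<^sup>2) = norm (s x, t x)"
          by (simp add: norm_Pair add.commute)
        then show ?thesis using tx by (simp add: ennreal_mult'[symmetric])
      qed simp
    qed
  qed
  finally have 1: "(\<integral>\<^sup>+x\<in>\<Omega>. ennreal (sqrt (1 + (norm (?d x))\<^sup>2)) \<partial>leb \<Omega>) = (\<integral>\<^sup>+x. ennreal (if t x = 0 then 0 else norm (s x, t x)) \<partial>\<rho>)" .
  have 2: "emeasure (sing_variation \<Omega> (dmeas \<rho> s)) \<Omega> = (\<integral>\<^sup>+x. ennreal (if t x = 0 then norm (s x) else 0) \<partial>\<rho>)"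
    unfolding sing_variation_dmeas[OF s] using O
    by (subst emeasure_density) (auto intro!: nn_integral_cong split: split_indicator)
  have "area \<Omega> (dmeas \<rho> s) \<Omega> = (\<integral>\<^sup>+x. ennreal (if t x = 0 then 0 else norm (s x, t x)) + ennreal (if t x = 0 then norm (s x) else 0) \<partial>\<rho>)"
    unfolding area_def 1 2 by (intro nn_integral_add[symmetric]) auto
  also have "\<dots> = (\<integral>\<^sup>+x. ennreal (norm (s x, t x)) \<partial>\<rho>)"
    by (intro nn_integral_cong) (auto simp: norm_Pair)
  finally show ?thesis .
qed

end

text \<open>Functions are handled as the special case \<open>\<rho> = leb \<Omega>\<close>,
  \<open>t = 1\<close> of the representation.\<close>

lemma leb_lebesgue_density:
  assumes "finite_measure (leb \<Omega>)"
  shows "lebesgue_density \<Omega> (leb \<Omega>) (\<lambda>x. 1)"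
proof -
  interpret finite_measure "leb \<Omega>" by fact
  show ?thesis
    by unfold_locales (auto simp: sets_leb density_1 emeasure_finite)
qed

section \<open>Density of continuous functions\<close>

lemma measurable_continuous_on_borel_on:
  fixes \<phi> :: "'a::euclidean_space \<Rightarrow> 'b::topological_space"
  assumes "continuous_on \<Omega> \<phi>" "sets \<rho> = borel_on \<Omega>"
  shows "\<phi> \<in> borel_measurable \<rho>"
proof -
  have "\<phi> \<in> borel_measurable (restrict_space borel \<Omega>)"
    using assms(1) by (rule borel_measurable_continuous_on_restrict)
  moreover have "measurable (restrict_space borel \<Omega>) (borel :: 'b measure) = measurable \<rho> borel"
    using assms(2) by (intro measurable_cong_sets) (auto simp: borel_on_def)
  ultimately show ?thesis by simp
qed

text \<open>The composition goes through the Borel sets restricted to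
  \<open>\<Omega> \<times> UNIV\<close>, because \<open>F\<close> is controlled only there.\<close>

lemma measurable_Caratheodory:
  fixes F :: "'a::euclidean_space \<Rightarrow> 'e::euclidean_space \<Rightarrow> 'b::topological_space"
  assumes F: "continuous_on (\<Omega> \<times> UNIV) (\<lambda>(x, e). F x e)" and \<rho>: "sets \<rho> = borel_on \<Omega>"
    and y: "y \<in> borel_measurable \<rho>"
  shows "(\<lambda>x. F x (y x)) \<in> borel_measurable \<rho>"
proof -
  have "(\<lambda>x. (x, y x)) \<in> measurable \<rho> (restrict_space borel (\<Omega> \<times> UNIV))"
  proof (rule measurable_restrict_space2)
    have "(\<lambda>x. x) \<in> borel_measurable \<rho>"
      by (rule measurable_continuous_on_borel_on[OF _ \<rho>]) (rule continuous_on_id)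
    then show "(\<lambda>x. (x, y x)) \<in> borel_measurable \<rho>"
      using y by (rule borel_measurable_Pair)
  qed (use space_eq_borel_on[OF \<rho>] in auto)
  then have "(\<lambda>(x, e). F x e) \<circ> (\<lambda>x. (x, y x)) \<in> borel_measurable \<rho>"
    using borel_measurable_continuous_on_restrict[OF F] by (rule measurable_comp)
  then show ?thesis by (simp add: comp_def)
qed

text \<open>The measure is pushed to the Borel sets of the whole space, where regularity applies.
  The open set found there may leave \<open>\<Omega>\<close>, hence the intersection in the last
  estimate.\<close>

lemma borel_on_regular:
  fixes \<rho> :: "'a::euclidean_space measure"
  assumes \<rho>: "finite_measure \<rho>" "sets \<rho> = borel_on \<Omega>" and O: "open \<Omega>" and A: "A \<in> sets \<rho>" and e: "0 < e"
  obtains K U where "compact K" "open U" "K \<subseteq> A" "A \<subseteq> U" "measure \<rho> (U \<inter> \<Omega> - K) < e"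
proof -
  interpret finite_measure \<rho> by fact
  have idm: "(\<lambda>x. x) \<in> measurable \<rho> borel"
    by (rule measurable_continuous_on_borel_on[OF _ \<rho>(2)]) (rule continuous_on_id)
  define N where "N = distr \<rho> borel (\<lambda>x. x)"
  have sp: "space \<rho> = \<Omega>" by (rule space_eq_borel_on[OF \<rho>(2)])
  have N: "emeasure N B = emeasure \<rho> (B \<inter> \<Omega>)" if "B \<in> sets borel" for B
    unfolding N_def using emeasure_distr[OF idm that] sp by (simp add: vimage_def Int_def)
  have finN: "emeasure N (space N) \<noteq> \<infinity>" using emeasure_finite N[of UNIV] by (simp add: N_def)
  have sN: "sets N = sets borel" by (simp add: N_def)
  interpret N: finite_measure N using finN by (rule finite_measureI)
  have Ob: "\<Omega> \<in> sets borel" using O by simp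
  have Ab: "A \<in> sets borel" "A \<subseteq> \<Omega>"
    using A Ob unfolding \<rho>(2) borel_on_def by (auto simp: sets_restrict_space_iff)
  have "emeasure N A < emeasure N A + ennreal (e/2)"
    using e by (simp add: N.emeasure_eq_measure ennreal_plus[symmetric] ennreal_less_iff del: ennreal_plus)
  then have "(INF U \<in> {U. A \<subseteq> U \<and> open U}. emeasure N U) < emeasure N A + ennreal (e/2)"
    using outer_regular[OF sN finN Ab(1)] by simp
  then obtain U where U: "A \<subseteq> U" "open U" "emeasure N U < emeasure N A + ennreal (e/2)"
    unfolding INF_less_iff by auto
  have "\<exists>K. K \<subseteq> A \<and> compact K \<and> measure N A < measure N K + e/2"
  proof (rule ccontr)
    assume neg: "\<not> ?thesis"
    have "emeasure N A \<le> ennreal (measure N A - e/2)"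
      unfolding inner_regular[OF sN finN Ab(1)]
    proof (rule SUP_least)
      fix K assume "K \<in> {K. K \<subseteq> A \<and> compact K}"
      then have "measure N A \<ge> measure N K + e/2" using neg by (auto simp: not_less)
      then show "emeasure N K \<le> ennreal (measure N A - e/2)"
        by (simp add: N.emeasure_eq_measure ennreal_leI)
    qed
    \<comment> \<open>\<open>ennreal\<close> sends a negative difference to 0, which adds the second
      alternative; the competitor \<open>{}\<close> excludes it.\<close>
    then have "measure N A \<le> measure N A - e/2 \<or> measure N A = 0"
      using measure_nonneg[of N A] by (auto simp: N.emeasure_eq_measure ennreal_le_iff2)
    moreover have "measure N A \<ge> measure N {} + e/2" using neg by (auto simp: not_less)
    ultimately show False using e by auto
  qed
  then obtain K where K: "K \<subseteq> A" "compact K" "measure N A < measure N K + e/2" by auto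
  have Kb: "K \<in> sets N" "U \<in> sets N" using K U by (auto simp: sN borel_compact)
  have "measure N U < measure N A + e/2"
    using U(3) e by (simp add: N.emeasure_eq_measure ennreal_plus[symmetric] ennreal_less_iff del: ennreal_plus)
  then have "measure N (U - K) < e"
    using N.finite_measure_Diff[OF Kb(2,1)] K U by simp
  moreover have "measure N (U - K) = measure \<rho> (U \<inter> \<Omega> - K)"
  proof -
    have "(U - K) \<inter> \<Omega> = U \<inter> \<Omega> - K" by auto
    then show ?thesis using N[of "U - K"] Kb sN by (simp add: measure_def)
  qed
  ultimately show ?thesis using K U that by auto
qed

text \<open>Indicators are approximated by Urysohn functions between a compact and an open set; sums
  and dominated limits follow by the triangle inequality.\<close>

lemma continuous_dense_L1:
  fixes f :: "'a::euclidean_space \<Rightarrow> 'b::euclidean_space"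
  assumes \<rho>: "finite_measure \<rho>" "sets \<rho> = borel_on \<Omega>" and O: "open \<Omega>" and f: "integrable \<rho> f"
  shows "0 < e \<Longrightarrow> \<exists>h. continuous_on UNIV h \<and> bounded (range h) \<and> (LINT x|\<rho>. norm (h x - f x)) < e"
  using f
proof (induction f arbitrary: e rule: integrable_induct)
  interpret finite_measure \<rho> by fact
  have mc: "h \<in> borel_measurable \<rho>" if "continuous_on UNIV h" for h :: "'a \<Rightarrow> 'c::topological_space"
    by (rule measurable_continuous_on_borel_on[OF _ \<rho>(2)]) (rule continuous_on_subset[OF that], simp)
  have ic: "integrable \<rho> h" if c: "continuous_on UNIV h" and b: "bounded (range h)" for h :: "'a \<Rightarrow> 'b"
  proof -
    obtain B where "\<And>x. norm (h x) \<le> B" using b by (auto simp: bounded_iff)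
    then show ?thesis using mc[OF c] by (intro integrable_const_bound[where B=B]) auto
  qed
  {
    case (base A c)
    \<comment> \<open>The summand 1 covers \<open>c = 0\<close>.\<close>
    have "0 < e / (norm c + 1)" using base by (simp add: add_nonneg_pos)
    from borel_on_regular[OF \<rho> O base(1) this]
    obtain K U where KU: "compact K" "open U" "K \<subseteq> A" "A \<subseteq> U" "measure \<rho> (U \<inter> \<Omega> - K) < e / (norm c + 1)" .
    have "closed (- U)" "closed K" "K \<inter> - U = {}" using KU by (auto simp: compact_imp_closed)
    then obtain g :: "'a \<Rightarrow> real" where g: "continuous_on UNIV g" "\<And>x. g x \<in> closed_segment 1 0"
       "\<And>x. x \<in> K \<Longrightarrow> g x = 1" "\<And>x. x \<in> -U \<Longrightarrow> g x = 0"
      using Urysohn[of K "-U" 1 0] by metis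
    have g01: "0 \<le> g x" "g x \<le> 1" for x using g(2)[of x] by (auto simp: closed_segment_eq_real_ivl)
    define h where "h x = g x *\<^sub>R c" for x
    have h: "continuous_on UNIV h" unfolding h_def using g(1) by (intro continuous_intros)
    have hb: "bounded (range h)"
      unfolding bounded_iff h_def using g01 by (intro exI[of _ "norm c"]) (auto intro!: mult_left_le_one_le)
    have Sm: "U \<inter> \<Omega> - K \<in> sets \<rho>"
      using KU O unfolding \<rho>(2) borel_on_def by (auto simp: sets_restrict_space_iff borel_compact)
    have "(LINT x|\<rho>. norm (h x - indicator A x *\<^sub>R c)) \<le> (LINT x|\<rho>. indicator (U \<inter> \<Omega> - K) x * norm c)"
    proof (rule integral_mono)
      show "integrable \<rho> (\<lambda>x. norm (h x - indicator A x *\<^sub>R c))"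
        using ic[OF h hb] base(1,2)
        by (intro integrable_norm Bochner_Integration.integrable_diff integrable_scaleR_left integrable_real_indicator) auto
      show "integrable \<rho> (\<lambda>x. indicator (U \<inter> \<Omega> - K) x * norm c)"
        using Sm by (intro integrable_mult_left integrable_real_indicator) (auto simp: emeasure_finite less_top[symmetric])
      fix x assume "x \<in> space \<rho>"
      then have x: "x \<in> \<Omega>" using space_eq_borel_on[OF \<rho>(2)] by simp
      have eq: "norm (h x - indicator A x *\<^sub>R c) = \<bar>g x - indicator A x\<bar> * norm c"
        unfolding h_def by (simp add: scaleR_diff_left[symmetric] del: scaleR_diff_left)
      have "\<bar>g x - indicator A x\<bar> \<le> indicator (U \<inter> \<Omega> - K) x"
        using g01[of x] g(3,4)[of x] KU x by (auto split: split_indicator)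
      then show "norm (h x - indicator A x *\<^sub>R c) \<le> indicator (U \<inter> \<Omega> - K) x * norm c"
        unfolding eq by (intro mult_right_mono) auto
    qed
    also have "\<dots> = measure \<rho> (U \<inter> \<Omega> - K) * norm c"
      using Sm by (simp add: Int_absorb2 sets.sets_into_space)
    also have "\<dots> \<le> e / (norm c + 1) * norm c" using KU by (intro mult_right_mono) auto
    also have "\<dots> < e / (norm c + 1) * (norm c + 1)"
      using \<open>0 < e / (norm c + 1)\<close> by (intro mult_strict_left_mono) auto
    also have "\<dots> = e"
      using norm_ge_zero[of c] by (simp del: norm_ge_zero)
    finally show ?case using h hb by blast
  next
    case (add f g)
    obtain h k where h: "continuous_on UNIV h" "bounded (range h)" "(LINT x|\<rho>. norm (h x - f x)) < e/2"
      and k: "continuous_on UNIV k" "bounded (range k)" "(LINT x|\<rho>. norm (k x - g x)) < e/2"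
      using add.IH(1)[of "e/2"] add.IH(2)[of "e/2"] add.prems by auto
    have "(LINT x|\<rho>. norm ((h x + k x) - (f x + g x))) \<le> (LINT x|\<rho>. norm (h x - f x) + norm (k x - g x))"
      using ic[OF h(1,2)] ic[OF k(1,2)] add.hyps
      by (intro integral_mono) (auto simp: add_diff_add norm_triangle_ineq)
    also have "\<dots> = (LINT x|\<rho>. norm (h x - f x)) + (LINT x|\<rho>. norm (k x - g x))"
      using ic[OF h(1,2)] ic[OF k(1,2)] add.hyps by (intro Bochner_Integration.integral_add) auto
    also have "\<dots> < e" using h k by simp
    finally show ?case using h k
      by (intro exI[of _ "\<lambda>x. h x + k x"] conjI continuous_intros bounded_plus_comp) auto
  next
    case (lim f s)
    have "(\<lambda>i. LINT x|\<rho>. norm (s i x - f x)) \<longlonglongrightarrow> (LINT x|\<rho>. 0)"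
    proof (rule integral_dominated_convergence[where w="\<lambda>x. 3 * norm (f x)"])
      show "AE x in \<rho>. (\<lambda>i. norm (s i x - f x)) \<longlonglongrightarrow> 0"
      proof (rule AE_I2)
        fix x assume "x \<in> space \<rho>"
        then have "(\<lambda>i. norm (s i x - f x)) \<longlonglongrightarrow> norm (f x - f x)" by (intro tendsto_intros lim)
        then show "(\<lambda>i. norm (s i x - f x)) \<longlonglongrightarrow> 0" by simp
      qed
      show "AE x in \<rho>. norm (norm (s i x - f x)) \<le> 3 * norm (f x)" for i
      proof (rule AE_I2)
        fix x assume "x \<in> space \<rho>"
        then show "norm (norm (s i x - f x)) \<le> 3 * norm (f x)"
          using lim.hyps(3)[of x i] norm_triangle_ineq4[of "s i x" "f x"] by simp
      qed
    qed (use lim in auto)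
    then have "\<forall>\<^sub>F i in sequentially. (LINT x|\<rho>. norm (s i x - f x)) < e/2"
      using lim.prems by (intro order_tendstoD(2)[where a="e/2"]) auto
    then obtain i where i: "(LINT x|\<rho>. norm (s i x - f x)) < e/2" by (auto simp: eventually_sequentially)
    obtain h where h: "continuous_on UNIV h" "bounded (range h)" "(LINT x|\<rho>. norm (h x - s i x)) < e/2"
      using lim.IH[of "e/2"] lim.prems by auto
    have "(LINT x|\<rho>. norm (h x - f x)) \<le> (LINT x|\<rho>. norm (h x - s i x) + norm (s i x - f x))"
      using ic[OF h(1,2)] lim.hyps
    proof (intro integral_mono)
      show "norm (h x - f x) \<le> norm (h x - s i x) + norm (s i x - f x)" for x
        using norm_triangle_ineq[of "h x - s i x" "s i x - f x"] by simp
    qed auto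
    also have "\<dots> = (LINT x|\<rho>. norm (h x - s i x)) + (LINT x|\<rho>. norm (s i x - f x))"
      using ic[OF h(1,2)] lim.hyps by (intro Bochner_Integration.integral_add) auto
    also have "\<dots> < e" using h i by simp
    finally show ?case using h by blast
  }
qed

text \<open>Density of continuous functions in the weighted space gives no pointwise bound by 1.
  Projection to the closed unit ball restores it, and the error does not grow, because the
  projection is nonexpansive and fixes the values of \<open>\<sigma>\<close>.\<close>

lemma continuous_dense_weighted:
  fixes \<sigma> :: "'a::euclidean_space \<Rightarrow> 'b::euclidean_space"
  assumes \<rho>: "finite_measure \<rho>" "sets \<rho> = borel_on \<Omega>" and O: "open \<Omega>"
    and \<sigma>: "\<sigma> \<in> borel_measurable \<rho>" "\<And>x. norm (\<sigma> x) \<le> 1"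
    and \<kappa>: "integrable \<rho> \<kappa>" "\<And>x. 0 \<le> \<kappa> x" and e: "0 < e"
  obtains h where "continuous_on UNIV h" "\<And>x. norm (h x) \<le> 1" "(LINT x|\<rho>. \<kappa> x * norm (h x - \<sigma> x)) < e"
proof -
  define N where "N = density \<rho> (\<lambda>x. ennreal (\<kappa> x))"
  have [measurable]: "\<kappa> \<in> borel_measurable \<rho>" using \<kappa> by auto
  have fin: "finite_measure N"
  proof (rule finite_measureI)
    have "emeasure N (space N) = (\<integral>\<^sup>+x. ennreal (norm (\<kappa> x)) \<partial>\<rho>)"
      using \<kappa> by (simp add: N_def emeasure_density cong: nn_integral_cong)
    then show "emeasure N (space N) \<noteq> \<infinity>" using \<kappa>(1) by (simp add: integrable_iff_bounded)
  qed
  interpret N: finite_measure N by fact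
  have sN: "sets N = borel_on \<Omega>" using \<rho> by (simp add: N_def)
  have \<sigma>N: "\<sigma> \<in> borel_measurable N" using \<sigma>(1) by (simp add: N_def)
  have "integrable N \<sigma>"
    using \<sigma>(2) \<sigma>N by (intro N.integrable_const_bound[where B=1]) auto
  then obtain g where g: "continuous_on UNIV g" "bounded (range g)" "(LINT x|N. norm (g x - \<sigma> x)) < e"
    using continuous_dense_L1[OF fin sN O _ e] by blast
  define h where "h x = closest_point (cball 0 1) (g x)" for x
  have ne: "convex (cball (0::'b) 1)" "closed (cball (0::'b) 1)" "cball (0::'b) 1 \<noteq> {}" by auto
  have hc: "continuous_on UNIV h"
    unfolding h_def using continuous_on_compose[OF g(1) continuous_on_closest_point[OF ne]]
    by (simp add: comp_def)
  have h1: "norm (h x) \<le> 1" for x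
    using closest_point_in_set[OF ne(2,3), of "g x"] by (simp add: h_def)
  have hg: "norm (h x - \<sigma> x) \<le> norm (g x - \<sigma> x)" for x
    using closest_point_lipschitz[OF ne, of "g x" "\<sigma> x"] closest_point_self[where S="cball 0 1" and x="\<sigma> x"] \<sigma>(2)[of x]
    by (simp add: h_def dist_norm)
  have mh: "h \<in> borel_measurable \<rho>" "g \<in> borel_measurable \<rho>"
    by (rule measurable_continuous_on_borel_on[OF _ \<rho>(2)]; rule continuous_on_subset; (rule hc g(1))?; simp)+
  then have mhN: "h \<in> borel_measurable N" "g \<in> borel_measurable N" by (auto simp: N_def)
  obtain B where B: "\<And>x. norm (g x) \<le> B" using g(2) by (auto simp: bounded_iff)
  have "(LINT x|\<rho>. \<kappa> x * norm (h x - \<sigma> x)) = (LINT x|N. norm (h x - \<sigma> x))"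
    unfolding N_def using mh \<sigma> \<kappa> by (subst integral_density) auto
  also have "\<dots> \<le> (LINT x|N. norm (g x - \<sigma> x))"
  proof (rule integral_mono)
    show "integrable N (\<lambda>x. norm (g x - \<sigma> x))"
      using mhN \<sigma>N B \<open>integrable N \<sigma>\<close>
      by (intro integrable_norm Bochner_Integration.integrable_diff N.integrable_const_bound[where B=B and f=g]) auto
    show "integrable N (\<lambda>x. norm (h x - \<sigma> x))"
      using mhN \<sigma>N h1 \<open>integrable N \<sigma>\<close>
      by (intro integrable_norm Bochner_Integration.integrable_diff N.integrable_const_bound[where B=1 and f=h]) auto
  qed (rule hg)
  also have "\<dots> < e" by (rule g(3))
  finally show ?thesis using hc h1 that by blast
qed

section \<open>Reshetnyak continuity\<close>

lemma integrable_bounded_inner: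
  fixes y :: "'a \<Rightarrow> 'e::euclidean_space"
  assumes y: "integrable M y" and \<phi>: "\<phi> \<in> borel_measurable M" and B: "\<And>x. x \<in> space M \<Longrightarrow> norm (\<phi> x) \<le> B"
  shows "integrable M (\<lambda>x. \<phi> x \<bullet> y x)"
proof (rule Bochner_Integration.integrable_bound[where f="\<lambda>x. B * norm (y x)"])
  show "AE x in M. norm (\<phi> x \<bullet> y x) \<le> norm (B * norm (y x))"
  proof (rule AE_I2)
    fix x assume x: "x \<in> space M"
    have "norm (\<phi> x \<bullet> y x) \<le> norm (\<phi> x) * norm (y x)" using Cauchy_Schwarz_ineq2 by simp
    also have "\<dots> \<le> B * norm (y x)" using B[OF x] by (intro mult_right_mono) auto
    finally show "norm (\<phi> x \<bullet> y x) \<le> norm (B * norm (y x))" by simp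
  qed
qed (use y \<phi> in auto)

lemma integrable_bounded_mult:
  fixes y :: "'a \<Rightarrow> real"
  assumes y: "integrable M y" and \<phi>: "\<phi> \<in> borel_measurable M" and B: "\<And>x. x \<in> space M \<Longrightarrow> \<bar>\<phi> x\<bar> \<le> B"
  shows "integrable M (\<lambda>x. \<phi> x * y x)"
  using integrable_bounded_inner[OF y \<phi>, of B] B by simp

lemma boundedD_real:
  assumes "bounded (\<phi> ` \<Omega>)"
  shows "\<exists>B. 0 \<le> B \<and> (\<forall>x\<in>\<Omega>. norm (\<phi> x) \<le> B)"
proof -
  from assms obtain B where "\<And>x. x \<in> \<Omega> \<Longrightarrow> norm (\<phi> x) \<le> B" by (auto simp: bounded_iff)
  then have "\<And>x. x \<in> \<Omega> \<Longrightarrow> norm (\<phi> x) \<le> max 0 B" by (meson le_max_iff_disj)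
  then show ?thesis by (intro exI[of _ "max 0 B"]) simp
qed

lemma sgn_inner_self: "sgn y \<bullet> y = norm (y :: 'e::real_inner)"
  by (cases "y = 0") (simp_all add: sgn_div_norm dot_square_norm power2_eq_square)

text \<open>\<open>sgn (y x)\<close> is the polar direction of \<open>y \<rho>\<close>. Pairing with
  a continuous approximation of it replaces the norm of \<open>y\<close> by an expression linear in
  \<open>y\<close>, which weak convergence can handle.\<close>

lemma continuous_dense_sgn:
  fixes y :: "'a::euclidean_space \<Rightarrow> 'e::euclidean_space"
  assumes \<rho>: "finite_measure \<rho>" "sets \<rho> = borel_on \<Omega>" and O: "open \<Omega>" and y: "integrable \<rho> y" and e: "0 < e"
  shows "\<exists>h. continuous_on UNIV h \<and> (\<forall>x. norm (h x) \<le> 1) \<and>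
    (LINT x|\<rho>. norm (y x) * norm (h x - sgn (y x))) < e"
proof -
  have yb: "y \<in> borel_measurable \<rho>" using y by simp
  then have sm: "(\<lambda>x. sgn (y x)) \<in> borel_measurable \<rho>" unfolding sgn_div_norm by simp
  have s1: "norm (sgn (y x)) \<le> 1" for x by (simp add: norm_sgn)
  obtain h where "continuous_on UNIV h" "\<And>x. norm (h x) \<le> 1"
      "(LINT x|\<rho>. norm (y x) * norm (h x - sgn (y x))) < e"
    by (rule continuous_dense_weighted[OF \<rho> O sm s1 integrable_norm[OF y] norm_ge_zero e, rule_format])
      (rule that)
  then show ?thesis by blast
qed

text \<open>The sequence and its limit have different base measures, because the limit may charge
  sets that are null for \<open>lam\<close>. Assumption \<open>mass\<close> excludes a loss of norm
  through oscillation.\<close>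

locale strict_convergence =
  fixes \<Omega> :: "'a::euclidean_space set" and lam \<rho> :: "'a measure"
    and Y :: "nat \<Rightarrow> 'a \<Rightarrow> 'e::euclidean_space" and y :: "'a \<Rightarrow> 'e"
  assumes O: "open \<Omega>"
    and lam: "finite_measure lam" "sets lam = borel_on \<Omega>"
    and rho: "finite_measure \<rho>" "sets \<rho> = borel_on \<Omega>"
    and Y: "\<And>j. integrable lam (Y j)" and y: "integrable \<rho> y"
    and weak: "\<And>\<phi>. continuous_on \<Omega> \<phi> \<Longrightarrow> bounded (\<phi> ` \<Omega>) \<Longrightarrow>
      (\<lambda>j. LINT x|lam. \<phi> x \<bullet> Y j x) \<longlonglongrightarrow> (LINT x|\<rho>. \<phi> x \<bullet> y x)"
    and mass: "(\<lambda>j. LINT x|lam. norm (Y j x)) \<longlonglongrightarrow> (LINT x|\<rho>. norm (y x))"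
begin

lemma sp: "space lam = \<Omega>" "space \<rho> = \<Omega>"
  using space_eq_borel_on lam(2) rho(2) by auto

text \<open>Lower semicontinuity: for a continuous field \<open>h\<close> in the unit ball,
  \<open>\<phi> x * norm (Y j x)\<close> is at least
  \<open>\<phi> x * (h x \<bullet> Y j x)\<close>, whose integral converges by \<open>weak\<close>;
  with \<open>h\<close> close to the polar direction of \<open>y\<close> the loss is at most
  \<open>e\<close>.\<close>

lemma narrow_lower:
  assumes \<phi>: "continuous_on \<Omega> \<phi>" "\<And>x. x \<in> \<Omega> \<Longrightarrow> 0 \<le> \<phi> x" "\<And>x. x \<in> \<Omega> \<Longrightarrow> \<phi> x \<le> B" and e: "0 < e"
  shows "\<forall>\<^sub>F j in sequentially. (LINT x|lam. \<phi> x * norm (Y j x)) > (LINT x|\<rho>. \<phi> x * norm (y x)) - e"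
proof -
  define C where "C = max 0 B"
  have C: "0 \<le> C" "\<And>x. x \<in> \<Omega> \<Longrightarrow> \<phi> x \<le> C" using \<phi>(3) unfolding C_def by (auto simp: le_max_iff_disj)
  have yb [measurable]: "y \<in> borel_measurable \<rho>" using y by auto
  have Yb [measurable]: "Y j \<in> borel_measurable lam" for j using Y by auto
  have \<phi>m: "\<phi> \<in> borel_measurable lam" "\<phi> \<in> borel_measurable \<rho>"
    using \<phi>(1) lam rho by (auto intro: measurable_continuous_on_borel_on)
  \<comment> \<open>\<open>C + 1\<close> in place of \<open>C\<close> covers
    \<open>C = 0\<close>.\<close>
  have "0 < e / (2 * (C + 1))" using C e by simp
  then obtain h where h: "continuous_on UNIV h" "\<And>x. norm (h x) \<le> 1"
      "(LINT x|\<rho>. norm (y x) * norm (h x - sgn (y x))) < e / (2 * (C + 1))"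
    using continuous_dense_sgn[OF rho O y] by blast
  have hO: "continuous_on \<Omega> h" using h(1) continuous_on_subset by blast
  have hm: "h \<in> borel_measurable lam" "h \<in> borel_measurable \<rho>"
    using hO lam rho by (auto intro: measurable_continuous_on_borel_on)
  define \<psi> where "\<psi> x = \<phi> x *\<^sub>R h x" for x
  have \<psi>c: "continuous_on \<Omega> \<psi>" unfolding \<psi>_def by (intro continuous_intros \<phi> hO)
  have \<psi>C: "norm (\<psi> x) \<le> C" if "x \<in> \<Omega>" for x
  proof -
    have "\<phi> x * norm (h x) \<le> C * 1" using C \<phi>(2) h(2) that by (intro mult_mono) auto
    then show ?thesis using \<phi>(2)[OF that] by (simp add: \<psi>_def)
  qed
  have \<psi>b: "bounded (\<psi> ` \<Omega>)" using \<psi>C by (auto simp: bounded_iff)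
  have \<psi>m: "\<psi> \<in> borel_measurable lam" "\<psi> \<in> borel_measurable \<rho>"
    using \<psi>c lam rho by (auto intro: measurable_continuous_on_borel_on)
  have i\<phi>: "integrable \<rho> (\<lambda>x. \<phi> x * norm (y x))"
    using C \<phi>(2) sp \<phi>m y by (intro integrable_bounded_mult[where B=C]) auto
  have i\<phi>Y: "integrable lam (\<lambda>x. \<phi> x * norm (Y j x))" for j
    using C \<phi>(2) sp \<phi>m Y by (intro integrable_bounded_mult[where B=C]) auto
  have i\<psi>: "integrable \<rho> (\<lambda>x. \<psi> x \<bullet> y x)"
    using \<psi>C \<psi>m sp y by (intro integrable_bounded_inner[where B=C]) auto
  have i\<psi>Y: "integrable lam (\<lambda>x. \<psi> x \<bullet> Y j x)" for j
    using \<psi>C \<psi>m sp Y by (intro integrable_bounded_inner[where B=C]) auto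
  have ih: "integrable \<rho> (\<lambda>x. norm (h x - sgn (y x)) * norm (y x))"
  proof (rule integrable_bounded_mult[where B=2])
    show "\<bar>norm (h x - sgn (y x))\<bar> \<le> 2" for x
      using norm_triangle_ineq4[of "h x" "sgn (y x)"] h(2)[of x] by (auto simp: norm_sgn split: if_splits)
  qed (use hm y in auto)
  have "(LINT x|\<rho>. \<phi> x * norm (y x)) - (LINT x|\<rho>. \<psi> x \<bullet> y x) = (LINT x|\<rho>. \<phi> x * norm (y x) - \<psi> x \<bullet> y x)"
    using i\<phi> i\<psi> by simp
  also have "\<dots> \<le> (LINT x|\<rho>. C * (norm (h x - sgn (y x)) * norm (y x)))"
  proof (rule integral_mono)
    fix x assume "x \<in> space \<rho>"
    then have x: "x \<in> \<Omega>" using sp by simp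
    have "\<phi> x * norm (y x) - \<psi> x \<bullet> y x = \<phi> x * ((sgn (y x) - h x) \<bullet> y x)"
      by (simp add: \<psi>_def inner_diff_left sgn_inner_self algebra_simps)
    also have "\<dots> \<le> \<phi> x * (norm (sgn (y x) - h x) * norm (y x))"
      using \<phi>(2)[OF x] by (intro mult_left_mono norm_cauchy_schwarz) auto
    also have "\<dots> \<le> C * (norm (h x - sgn (y x)) * norm (y x))"
      using C(2)[OF x] by (subst norm_minus_commute, intro mult_right_mono) auto
    finally show "\<phi> x * norm (y x) - \<psi> x \<bullet> y x \<le> C * (norm (h x - sgn (y x)) * norm (y x))" .
  qed (use i\<phi> i\<psi> ih in auto)
  also have "\<dots> = C * (LINT x|\<rho>. norm (y x) * norm (h x - sgn (y x)))"
    by (simp add: mult.commute)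
  also have "\<dots> \<le> C * (e / (2 * (C + 1)))"
    using h(3) C by (intro mult_left_mono) auto
  also have "\<dots> \<le> (C + 1) * (e / (2 * (C + 1)))"
    using C e by (intro mult_right_mono) auto
  also have "\<dots> = e / 2" using C by (simp add: field_simps)
  finally have A: "(LINT x|\<rho>. \<phi> x * norm (y x)) - e/2 \<le> (LINT x|\<rho>. \<psi> x \<bullet> y x)" by simp
  have "\<forall>\<^sub>F j in sequentially. (LINT x|lam. \<psi> x \<bullet> Y j x) > (LINT x|\<rho>. \<psi> x \<bullet> y x) - e/2"
    using e by (intro order_tendstoD(1)[OF weak[OF \<psi>c \<psi>b]]) auto
  then show ?thesis
  proof eventually_elim
    case (elim j)
    have "(LINT x|lam. \<psi> x \<bullet> Y j x) \<le> (LINT x|lam. \<phi> x * norm (Y j x))"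
    proof (rule integral_mono[OF i\<psi>Y i\<phi>Y])
      fix x assume "x \<in> space lam"
      then have x: "x \<in> \<Omega>" using sp by simp
      have "h x \<bullet> Y j x \<le> 1 * norm (Y j x)"
        using h(2)[of x] by (intro order_trans[OF norm_cauchy_schwarz] mult_right_mono) auto
      then show "\<psi> x \<bullet> Y j x \<le> \<phi> x * norm (Y j x)"
        using \<phi>(2)[OF x] by (simp add: \<psi>_def mult_left_mono)
    qed
    with A elim show ?case by linarith
  qed
qed

text \<open>Lower semicontinuity for both \<open>B + \<phi>\<close> and \<open>B - \<phi>\<close>
  bounds the integrals from below and from above, because the constant parts converge by
  \<open>mass\<close>.\<close>

lemma narrow:
  assumes \<phi>: "continuous_on \<Omega> \<phi>" "bounded (\<phi> ` \<Omega>)"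
  shows "(\<lambda>j. LINT x|lam. \<phi> x * norm (Y j x)) \<longlonglongrightarrow> (LINT x|\<rho>. \<phi> x * norm (y x))"
proof -
  obtain B where B: "0 \<le> B" "\<And>x. x \<in> \<Omega> \<Longrightarrow> norm (\<phi> x) \<le> B" using boundedD_real[OF \<phi>(2)] by blast
  have \<phi>m: "\<phi> \<in> borel_measurable lam" "\<phi> \<in> borel_measurable \<rho>"
    using \<phi>(1) lam rho by (auto intro: measurable_continuous_on_borel_on)
  have i\<phi>: "integrable \<rho> (\<lambda>x. \<phi> x * norm (y x))" "integrable lam (\<lambda>x. \<phi> x * norm (Y j x))" for j
    using B sp \<phi>m y Y by (auto intro!: integrable_bounded_mult[where B=B])
  have 1: "(LINT x|\<rho>. (B + \<phi> x) * norm (y x)) = B * (LINT x|\<rho>. norm (y x)) + (LINT x|\<rho>. \<phi> x * norm (y x))"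
    "(LINT x|\<rho>. (B - \<phi> x) * norm (y x)) = B * (LINT x|\<rho>. norm (y x)) - (LINT x|\<rho>. \<phi> x * norm (y x))"
    using i\<phi> y by (simp_all add: algebra_simps)
  have 2: "(LINT x|lam. (B + \<phi> x) * norm (Y j x)) = B * (LINT x|lam. norm (Y j x)) + (LINT x|lam. \<phi> x * norm (Y j x))"
    "(LINT x|lam. (B - \<phi> x) * norm (Y j x)) = B * (LINT x|lam. norm (Y j x)) - (LINT x|lam. \<phi> x * norm (Y j x))" for j
    using i\<phi>(2)[of j] Y[of j] by (simp_all add: algebra_simps)
  have Bm: "(\<lambda>j. B * (LINT x|lam. norm (Y j x))) \<longlonglongrightarrow> B * (LINT x|\<rho>. norm (y x))"
    by (intro tendsto_intros mass)
  show ?thesis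
  proof (rule tendstoI)
    fix e :: real assume e: "0 < e"
    have "\<forall>\<^sub>F j in sequentially. (LINT x|lam. (B + \<phi> x) * norm (Y j x)) > (LINT x|\<rho>. (B + \<phi> x) * norm (y x)) - e/2"
      using e B by (intro narrow_lower[where B="2*B"] continuous_intros \<phi>(1)) (auto dest: B(2) simp: abs_le_iff)
    moreover have "\<forall>\<^sub>F j in sequentially. (LINT x|lam. (B - \<phi> x) * norm (Y j x)) > (LINT x|\<rho>. (B - \<phi> x) * norm (y x)) - e/2"
      using e B by (intro narrow_lower[where B="2*B"] continuous_intros \<phi>(1)) (auto dest: B(2) simp: abs_le_iff)
    moreover have "\<forall>\<^sub>F j in sequentially. dist (B * (LINT x|lam. norm (Y j x))) (B * (LINT x|\<rho>. norm (y x))) < e/2"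
      using e by (intro tendstoD[OF Bm]) auto
    ultimately show "\<forall>\<^sub>F j in sequentially. dist (LINT x|lam. \<phi> x * norm (Y j x)) (LINT x|\<rho>. \<phi> x * norm (y x)) < e"
    proof eventually_elim
      case (elim j)
      then show ?case unfolding 1 2 dist_real_def by linarith
    qed
  qed
qed

text \<open>On \<open>K \<times> cball 0 1\<close> the integrand \<open>F\<close> differs from \<open>F x (h x)\<close> by at most
  \<open>\<eta> + c \<bar>\<sigma> - h x\<bar>\<^sup>2\<close>, and \<open>\<integral> \<bar>\<sigma> - h\<bar>\<^sup>2 d\<bar>Y j\<bar> = \<integral> (1 + \<bar>h\<bar>\<^sup>2) \<bar>Y j\<bar> - 2 \<integral> h \<bullet> Y j\<close> passes to the limit.\<close>

theorem reshetnyak: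
  assumes F: "continuous_on (\<Omega> \<times> UNIV) (\<lambda>(x, e). F x e)"
    and hom: "\<And>x e c. x \<in> \<Omega> \<Longrightarrow> 0 \<le> c \<Longrightarrow> F x (c *\<^sub>R e) = c * F x e"
    and bd: "\<And>x e. x \<in> \<Omega> \<Longrightarrow> \<bar>F x e\<bar> \<le> C * norm e"
  shows "(\<lambda>j. LINT x|lam. F x (Y j x)) \<longlonglongrightarrow> (LINT x|\<rho>. F x (y x))"
proof (rule tendstoI)
  fix e0 :: real assume e0: "0 < e0"
  define m where "m = (LINT x|\<rho>. norm (y x))"
  have m0: "0 \<le> m" unfolding m_def by simp
  define C' where "C' = max 1 C"
  have C': "1 \<le> C'" "\<And>x e. x \<in> \<Omega> \<Longrightarrow> \<bar>F x e\<bar> \<le> C' * norm e"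
  proof -
    show "1 \<le> C'" by (simp add: C'_def)
    fix x :: 'a and e :: 'e assume "x \<in> \<Omega>"
    then show "\<bar>F x e\<bar> \<le> C' * norm e"
      using bd[of x e] mult_right_mono[of C C' "norm e"] by (simp add: C'_def)
  qed
  have Fu: "\<bar>F x u\<bar> \<le> C'" if "x \<in> \<Omega>" "norm u \<le> 1" for x u
  proof -
    have "\<bar>F x u\<bar> \<le> C' * norm u" using C'(2) that by blast
    also have "\<dots> \<le> C' * 1" using that C'(1) by (intro mult_left_mono) auto
    finally show ?thesis by simp
  qed
  have yb [measurable]: "y \<in> borel_measurable \<rho>" using y by auto
  have Yb [measurable]: "Y j \<in> borel_measurable lam" for j using Y by auto
  \<comment> \<open>The final estimate adds \<open>q j \<le> q' + e \<le> 4 * e\<close>, one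
    \<open>e\<close> from \<open>lim1\<close>, and \<open>q' \<le> 3 * e\<close>; the total is below
    \<open>8 * e\<close>.\<close>
  define e where "e = e0 / 12"
  have e: "0 < e" using e0 by (simp add: e_def)
  define N where "N = density \<rho> (\<lambda>x. ennreal (norm (y x)))"
  have sN: "sets N = borel_on \<Omega>" using rho by (simp add: N_def)
  have fN: "finite_measure N"
  proof (rule finite_measureI)
    have "emeasure N (space N) = (\<integral>\<^sup>+x. ennreal (norm (y x)) \<partial>\<rho>)"
      by (simp add: N_def emeasure_density cong: nn_integral_cong)
    then show "emeasure N (space N) \<noteq> \<infinity>" using y by (simp add: integrable_iff_bounded)
  qed
  have OS: "\<Omega> \<in> sets N" using sets.top[of N] space_eq_borel_on[OF sN] by simp
  have "0 < e / C'" using e C' by simp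
  then obtain K U where KU: "compact K" "K \<subseteq> \<Omega>" "\<Omega> \<subseteq> U" "measure N (U \<inter> \<Omega> - K) < e / C'"
    using borel_on_regular[OF fN sN O OS] by metis
  have UO: "U \<inter> \<Omega> - K = \<Omega> - K" using KU by auto
  \<comment> \<open>\<open>F\<close> is continuous only over \<open>\<Omega>\<close>, so uniform
    continuity is available only over compact subsets. The cutoff confines the comparison to
    \<open>K'\<close>, and outside \<open>K\<close> the mass of \<open>y \<rho>\<close> is small by
    regularity.\<close>
  have "\<exists>\<kappa> K'. compact K' \<and> K' \<subseteq> \<Omega> \<and> continuous_on UNIV \<kappa> \<and> (\<forall>x. 0 \<le> \<kappa> x \<and> \<kappa> x \<le> (1::real)) \<and> (\<forall>x\<in>K. \<kappa> x = 1) \<and> (\<forall>x. x \<notin> K' \<longrightarrow> \<kappa> x = 0)"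
  proof (cases "K = {}")
    case True
    then show ?thesis by (intro exI[of _ "\<lambda>x. 0"] exI[of _ "{}"]) auto
  next
    case False
    from compact_in_open_separated[OF False KU(1) O KU(2)]
    obtain r where r: "0 < r" "{x. infdist x K \<le> r} \<subseteq> \<Omega>" .
    have K': "compact {x. infdist x K \<le> r}" using False KU(1) r by (intro compact_infdist_le) auto
    have c: "continuous_on UNIV (\<lambda>x. max 0 (1 - infdist x K / r))"
      by (intro continuous_intros) (use r in auto)
    show ?thesis
    proof (intro exI[of _ "\<lambda>x. max 0 (1 - infdist x K / r)"] exI[of _ "{x. infdist x K \<le> r}"] conjI)
      show "\<forall>x. 0 \<le> max 0 (1 - infdist x K / r) \<and> max 0 (1 - infdist x K / r) \<le> 1"
        using r by (auto simp: infdist_nonneg)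
      show "\<forall>x. x \<notin> {x. infdist x K \<le> r} \<longrightarrow> max 0 (1 - infdist x K / r) = 0"
        using r by (auto simp: field_simps)
    qed (use K' r c in auto)
  qed
  then obtain \<kappa> K' where K': "compact K'" "K' \<subseteq> \<Omega>" and \<kappa>c: "continuous_on UNIV \<kappa>"
    and \<kappa>01: "\<And>x. 0 \<le> \<kappa> x" "\<And>x. \<kappa> x \<le> (1::real)" and \<kappa>1: "\<And>x. x \<in> K \<Longrightarrow> \<kappa> x = 1" and \<kappa>0: "\<And>x. x \<notin> K' \<Longrightarrow> \<kappa> x = 0"
    by metis
  have \<kappa>O: "continuous_on \<Omega> \<kappa>" using \<kappa>c continuous_on_subset by blast
  define \<eta> where "\<eta> = e / (m + 1)"
  have \<eta>: "0 < \<eta>" "\<eta> * m \<le> e" using e m0 by (auto simp: \<eta>_def field_simps)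
  have "uniformly_continuous_on (K' \<times> cball 0 1) (\<lambda>(x, e). F x e)"
    using K' by (intro compact_uniformly_continuous continuous_on_subset[OF F] compact_Times) auto
  then obtain d where d: "0 < d"
    "\<And>p q. p \<in> K' \<times> cball 0 1 \<Longrightarrow> q \<in> K' \<times> cball 0 1 \<Longrightarrow> dist p q < d \<Longrightarrow> dist ((\<lambda>(x, e). F x e) p) ((\<lambda>(x, e). F x e) q) < \<eta>"
    using \<eta>(1) unfolding uniformly_continuous_on_def by metis
  \<comment> \<open>Chosen so that \<open>c * d\<^sup>2 = 2 * C'\<close>: directions at distance at
    least \<open>d\<close> are covered by the trivial bound \<open>2 * C'\<close>, closer ones by
    \<open>\<eta>\<close>.\<close>
  define c where "c = 2 * C' / d\<^sup>2"
  have c: "0 < c" using C' d by (simp add: c_def)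
  have Fosc: "\<bar>F x a - F x b\<bar> \<le> \<eta> + c * (norm (a - b))\<^sup>2"
    if x: "x \<in> K'" and a: "norm a \<le> 1" and b: "norm b \<le> 1" for x a b
  proof (cases "norm (a - b) < d")
    case True
    then have "\<bar>F x a - F x b\<bar> < \<eta>"
      using d(2)[of "(x,a)" "(x,b)"] x a b by (auto simp: dist_Pair_Pair dist_norm)
    then show ?thesis using c by (smt (verit) mult_nonneg_nonneg zero_le_power2)
  next
    case False
    then have "d\<^sup>2 \<le> (norm (a - b))\<^sup>2" using d(1) by (intro power_mono) auto
    then have "c * d\<^sup>2 \<le> c * (norm (a - b))\<^sup>2" using c by (intro mult_left_mono) auto
    moreover have "c * d\<^sup>2 = 2 * C'" using d(1) by (simp add: c_def)
    moreover have "\<bar>F x a\<bar> \<le> C'" "\<bar>F x b\<bar> \<le> C'"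
      using Fu x K'(2) a b by auto
    ultimately show ?thesis using \<eta> by linarith
  qed
  have "0 < e / (2 * c)" using e c by simp
  then obtain h where h: "continuous_on UNIV h" "\<And>x. norm (h x) \<le> 1"
      "(LINT x|\<rho>. norm (y x) * norm (h x - sgn (y x))) < e / (2 * c)"
    using continuous_dense_sgn[OF rho O y] by blast
  have hO: "continuous_on \<Omega> h" using h(1) continuous_on_subset by blast
  have hm: "h \<in> borel_measurable lam" "h \<in> borel_measurable \<rho>"
    using hO lam rho by (auto intro: measurable_continuous_on_borel_on)
  define A where "A x = \<kappa> x * F x (h x)" for x
  define P where "P x = \<eta> + c * (1 + (norm (h x))\<^sup>2) + C' * (1 - \<kappa> x)" for x
  have Fh: "continuous_on \<Omega> (\<lambda>x. F x (h x))"
  proof -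
    have "continuous_on \<Omega> (\<lambda>x. (x, h x))" by (intro continuous_intros hO)
    from continuous_on_compose2[OF F this] show ?thesis by auto
  qed
  have Ac: "continuous_on \<Omega> A" unfolding A_def by (intro continuous_intros \<kappa>O Fh)
  have Pc: "continuous_on \<Omega> P" unfolding P_def by (intro continuous_intros \<kappa>O hO)
  have Ab: "bounded (A ` \<Omega>)"
  proof -
    have "norm (A x) \<le> C'" if "x \<in> \<Omega>" for x
    proof -
      have "\<bar>F x (h x)\<bar> \<le> C' * 1"
        by (rule order_trans[OF C'(2)[OF that]]) (use h(2) C'(1) in \<open>intro mult_left_mono, auto\<close>)
      then have "\<kappa> x * \<bar>F x (h x)\<bar> \<le> 1 * C'" using \<kappa>01 by (intro mult_mono) auto
      then show ?thesis using \<kappa>01(1)[of x] by (simp add: A_def abs_mult)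
    qed
    then show ?thesis by (auto simp: bounded_iff)
  qed
  have Pb: "bounded (P ` \<Omega>)"
  proof -
    have "norm (P x) \<le> \<eta> + c * 2 + C'" for x
    proof -
      have "(norm (h x))\<^sup>2 \<le> 1" using h(2)[of x] by (simp add: power_le_one)
      then have "c * (1 + (norm (h x))\<^sup>2) \<le> c * 2" using c by (intro mult_left_mono) auto
      moreover have "C' * (1 - \<kappa> x) \<le> C' * 1" using \<kappa>01 C' by (intro mult_left_mono) auto
      moreover have "0 \<le> c * (1 + (norm (h x))\<^sup>2)" "0 \<le> C' * (1 - \<kappa> x)" using c \<kappa>01 C' by auto
      ultimately show ?thesis using \<eta> by (simp add: P_def)
    qed
    then show ?thesis by (auto simp: bounded_iff)
  qed
  have hb: "bounded (h ` \<Omega>)" using h(2) by (auto simp: bounded_iff)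
  have key: "\<bar>F x v - A x * norm v\<bar> \<le> P x * norm v - 2 * c * (h x \<bullet> v)" if x: "x \<in> \<Omega>" for x and v :: 'e
  proof -
    \<comment> \<open>Homogeneity reduces the comparison to directions in the closed unit ball,
      where \<open>Fosc\<close> applies.\<close>
    have Fv: "F x v = norm v * F x (sgn v)"
      using hom[OF x norm_ge_zero, of v "sgn v"] by (cases "v = 0") (auto simp: sgn_div_norm)
    have s1: "norm (sgn v) \<le> 1" by (simp add: norm_sgn)
    have sq: "(norm (sgn v - h x))\<^sup>2 * norm v = (1 + (norm (h x))\<^sup>2) * norm v - 2 * (h x \<bullet> v)"
    proof (cases "v = 0")
      case False
      have "(norm (sgn v - h x))\<^sup>2 = 1 + (norm (h x))\<^sup>2 - 2 * (h x \<bullet> sgn v)"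
      proof -
        have "sgn v \<bullet> sgn v = 1" using False by (simp add: dot_square_norm norm_sgn)
        then show ?thesis
          unfolding power2_norm_eq_inner inner_diff_left inner_diff_right by (simp add: inner_commute)
      qed
      moreover have "(h x \<bullet> sgn v) * norm v = h x \<bullet> v" using False by (simp add: sgn_div_norm)
      ultimately show ?thesis by (simp only: left_diff_distrib mult.assoc)
    qed simp
    have 1: "\<kappa> x * \<bar>F x (sgn v) - F x (h x)\<bar> \<le> \<eta> + c * (norm (sgn v - h x))\<^sup>2"
    proof (cases "x \<in> K'")
      case True
      have "\<kappa> x * \<bar>F x (sgn v) - F x (h x)\<bar> \<le> 1 * \<bar>F x (sgn v) - F x (h x)\<bar>"
        using \<kappa>01 by (intro mult_right_mono) auto
      also have "1 * \<bar>F x (sgn v) - F x (h x)\<bar> \<le> \<eta> + c * (norm (sgn v - h x))\<^sup>2"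
        using Fosc[OF True s1 h(2)[of x]] by simp
      finally show ?thesis . 
    next
      case False then show ?thesis using \<kappa>0 \<eta> c by simp
    qed
    have 2: "(1 - \<kappa> x) * \<bar>F x (sgn v)\<bar> \<le> (1 - \<kappa> x) * C'"
    proof (rule mult_left_mono)
      show "\<bar>F x (sgn v)\<bar> \<le> C'"
        by (rule Fu[OF x s1])
    qed (use \<kappa>01 in auto)
    have "F x v - A x * norm v = (\<kappa> x * (F x (sgn v) - F x (h x)) + (1 - \<kappa> x) * F x (sgn v)) * norm v"
      unfolding Fv A_def by (simp add: algebra_simps)
    also have "\<bar>\<dots>\<bar> \<le> (\<kappa> x * \<bar>F x (sgn v) - F x (h x)\<bar> + (1 - \<kappa> x) * \<bar>F x (sgn v)\<bar>) * norm v"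
      using \<kappa>01[of x] by (simp add: abs_mult mult_right_mono order_trans[OF abs_triangle_ineq])
    also have "\<dots> \<le> (\<eta> + c * (norm (sgn v - h x))\<^sup>2 + (1 - \<kappa> x) * C') * norm v"
      using 1 2 by (intro mult_right_mono) auto
    also have "\<dots> = \<eta> * norm v + c * ((norm (sgn v - h x))\<^sup>2 * norm v) + (1 - \<kappa> x) * C' * norm v"
      by (simp add: algebra_simps)
    also have "\<dots> = P x * norm v - 2 * c * (h x \<bullet> v)"
      unfolding sq P_def by (simp add: algebra_simps)
    finally show ?thesis .
  qed
  define I where "I j = (LINT x|lam. F x (Y j x))" for j
  define L where "L = (LINT x|\<rho>. F x (y x))"
  define q where "q j = (LINT x|lam. P x * norm (Y j x)) - 2 * c * (LINT x|lam. h x \<bullet> Y j x)" for j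
  define q' where "q' = (LINT x|\<rho>. P x * norm (y x)) - 2 * c * (LINT x|\<rho>. h x \<bullet> y x)"
  obtain BA where BA: "\<And>x. x \<in> \<Omega> \<Longrightarrow> norm (A x) \<le> BA" using boundedD_real[OF Ab] by blast
  obtain BP where BP: "\<And>x. x \<in> \<Omega> \<Longrightarrow> norm (P x) \<le> BP" using boundedD_real[OF Pb] by blast
  \<comment> \<open>Stated for an arbitrary base measure because it is applied on both sides: to
    \<open>Y j\<close> over \<open>lam\<close> and to \<open>y\<close> over
    \<open>\<rho>\<close>.\<close>
  have est: "\<bar>(LINT x|M. F x (v x)) - (LINT x|M. A x * norm (v x))\<bar> \<le> (LINT x|M. P x * norm (v x)) - 2 * c * (LINT x|M. h x \<bullet> v x)"
    if M: "sets M = borel_on \<Omega>" and v: "integrable M v" for M v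
  proof -
    have spM: "space M = \<Omega>" by (rule space_eq_borel_on[OF M])
    have vm: "v \<in> borel_measurable M" using v by auto
    have iF: "integrable M (\<lambda>x. F x (v x))"
    proof (rule Bochner_Integration.integrable_bound[where f="\<lambda>x. C' * norm (v x)"])
      show "(\<lambda>x. F x (v x)) \<in> borel_measurable M" by (rule measurable_Caratheodory[OF F M vm])
      show "AE x in M. norm (F x (v x)) \<le> norm (C' * norm (v x))"
        using C' spM by (intro AE_I2) auto
    qed (use v in auto)
    have iA: "integrable M (\<lambda>x. A x * norm (v x))"
      using v Ac M BA spM by (intro integrable_bounded_mult[where B=BA] integrable_norm measurable_continuous_on_borel_on[OF Ac]) auto
    have iP: "integrable M (\<lambda>x. P x * norm (v x))"
      using v Pc M BP spM by (intro integrable_bounded_mult[where B=BP] integrable_norm measurable_continuous_on_borel_on[OF Pc]) auto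
    have ihv: "integrable M (\<lambda>x. h x \<bullet> v x)"
      using v M h(2) by (intro integrable_bounded_inner[where B=1] measurable_continuous_on_borel_on[OF hO]) auto
    have "\<bar>(LINT x|M. F x (v x)) - (LINT x|M. A x * norm (v x))\<bar> = \<bar>LINT x|M. F x (v x) - A x * norm (v x)\<bar>"
      using iF iA by simp
    also have "\<dots> \<le> (LINT x|M. \<bar>F x (v x) - A x * norm (v x)\<bar>)" by (rule integral_abs_bound)
    also have "\<dots> \<le> (LINT x|M. P x * norm (v x) - 2 * c * (h x \<bullet> v x))"
      using key spM iF iA iP ihv by (intro integral_mono) auto
    also have "\<dots> = (LINT x|M. P x * norm (v x)) - 2 * c * (LINT x|M. h x \<bullet> v x)"
      using iP ihv by simp
    finally show ?thesis .
  qed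
  have lim1: "(\<lambda>j. LINT x|lam. A x * norm (Y j x)) \<longlonglongrightarrow> (LINT x|\<rho>. A x * norm (y x))"
    by (rule narrow[OF Ac Ab])
  have lim2: "q \<longlonglongrightarrow> q'"
    unfolding q_def q'_def by (intro tendsto_intros narrow[OF Pc Pb] weak[OF hO hb])
  have q'e: "q' \<le> 3 * e"
  proof -
    have iP: "integrable \<rho> (\<lambda>x. P x * norm (y x))"
      using y BP sp by (intro integrable_bounded_mult[where B=BP] integrable_norm measurable_continuous_on_borel_on[OF Pc] rho) auto
    have ihv: "integrable \<rho> (\<lambda>x. h x \<bullet> y x)"
      using y h(2) by (intro integrable_bounded_inner[where B=1] measurable_continuous_on_borel_on[OF hO] rho) auto
    have i1: "integrable \<rho> (\<lambda>x. norm (h x - sgn (y x)) * norm (y x))"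
    proof (rule integrable_bounded_mult[where B=2])
      show "\<bar>norm (h x - sgn (y x))\<bar> \<le> 2" for x
        using norm_triangle_ineq4[of "h x" "sgn (y x)"] h(2)[of x] by (auto simp: norm_sgn split: if_splits)
    qed (use hm y in auto)
    have Km: "\<Omega> - K \<in> sets \<rho>"
      using OS KU(1) O unfolding sN rho(2) borel_on_def by (auto simp: sets_restrict_space_iff borel_compact)
    have i2: "integrable \<rho> (\<lambda>x. indicator (\<Omega> - K) x * norm (y x))"
      using y Km by (intro integrable_bounded_mult[where B=1]) (auto split: split_indicator)
    have "q' = (LINT x|\<rho>. P x * norm (y x) - 2 * c * (h x \<bullet> y x))"
      unfolding q'_def using iP ihv by simp
    also have "\<dots> \<le> (LINT x|\<rho>. \<eta> * norm (y x) + 2 * c * (norm (h x - sgn (y x)) * norm (y x)) + C' * (indicator (\<Omega> - K) x * norm (y x)))"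
    proof (rule integral_mono)
      fix x assume "x \<in> space \<rho>"
      then have x: "x \<in> \<Omega>" using sp by simp
      \<comment> \<open>For the limit measure, \<open>norm (h x) \<le> 1\<close> turns the quadratic
        expression into the first-order distance of \<open>h x\<close> to \<open>sgn (y x)\<close>,
        which \<open>h\<close> was chosen to make small.\<close>
      have sq: "(1 + (norm (h x))\<^sup>2) * norm (y x) - 2 * (h x \<bullet> y x) \<le> 2 * (norm (h x - sgn (y x)) * norm (y x))"
      proof -
        have hsq: "(norm (h x))\<^sup>2 \<le> 1" using h(2)[of x] by (simp add: power_le_one)
        have "(1 + (norm (h x))\<^sup>2) * norm (y x) - 2 * (h x \<bullet> y x) \<le> 2 * norm (y x) - 2 * (h x \<bullet> y x)"
          using hsq by (intro diff_right_mono mult_right_mono) auto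
        also have "\<dots> = 2 * ((sgn (y x) - h x) \<bullet> y x)"
          by (simp add: inner_diff_left sgn_inner_self)
        also have "\<dots> \<le> 2 * (norm (sgn (y x) - h x) * norm (y x))"
          by (intro mult_left_mono norm_cauchy_schwarz) auto
        finally show ?thesis by (simp add: norm_minus_commute)
      qed
      have ch: "1 - \<kappa> x \<le> indicator (\<Omega> - K) x"
        using \<kappa>1[of x] \<kappa>01[of x] x by (auto split: split_indicator)
      have "P x * norm (y x) - 2 * c * (h x \<bullet> y x) =
         \<eta> * norm (y x) + c * ((1 + (norm (h x))\<^sup>2) * norm (y x) - 2 * (h x \<bullet> y x)) + C' * ((1 - \<kappa> x) * norm (y x))"
        by (simp add: P_def algebra_simps)
      also have "\<dots> \<le> \<eta> * norm (y x) + c * (2 * (norm (h x - sgn (y x)) * norm (y x))) + C' * (indicator (\<Omega> - K) x * norm (y x))"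
        using sq ch c C' by (intro add_mono mult_left_mono mult_right_mono) auto
      finally show "P x * norm (y x) - 2 * c * (h x \<bullet> y x) \<le> \<eta> * norm (y x) + 2 * c * (norm (h x - sgn (y x)) * norm (y x)) + C' * (indicator (\<Omega> - K) x * norm (y x))"
        by simp
    qed (use iP ihv i1 i2 y in auto)
    also have "\<dots> = \<eta> * m + 2 * c * (LINT x|\<rho>. norm (h x - sgn (y x)) * norm (y x)) + C' * (LINT x|\<rho>. indicator (\<Omega> - K) x * norm (y x))"
      unfolding m_def using i1 i2 y by simp
    also have "2 * c * (LINT x|\<rho>. norm (h x - sgn (y x)) * norm (y x)) \<le> 2 * c * (e / (2 * c))"
      using h(3) c by (intro mult_left_mono) (auto simp: mult.commute)
    also have "2 * c * (e / (2 * c)) = e" using c by simp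
    also have "(LINT x|\<rho>. indicator (\<Omega> - K) x * norm (y x)) = measure N (\<Omega> - K)"
      using emeasure_density_norm[OF y Km] unfolding N_def by (simp add: measure_def set_lebesgue_integral_def)
    also have "C' * measure N (\<Omega> - K) \<le> C' * (e / C')"
      using KU(4) C'(1) unfolding UO by (intro mult_left_mono) auto
    also have "C' * (e / C') = e" using C'(1) by simp
    finally show ?thesis using \<eta>(2) by simp
  qed
  have E1: "\<forall>\<^sub>F j in sequentially. dist (LINT x|lam. A x * norm (Y j x)) (LINT x|\<rho>. A x * norm (y x)) < e"
    using e by (intro tendstoD[OF lim1]) auto
  have E2: "\<forall>\<^sub>F j in sequentially. dist (q j) q' < e"
    using e by (intro tendstoD[OF lim2]) auto
  show "\<forall>\<^sub>F j in sequentially. dist (LINT x|lam. F x (Y j x)) (LINT x|\<rho>. F x (y x)) < e0"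
    using E1 E2
  proof eventually_elim
    case (elim j)
    then show ?case
      using est[OF lam(2) Y[of j]] est[OF rho(2) y] q'e e0
      unfolding q_def[symmetric] q'_def[symmetric] dist_real_def e_def by linarith
  qed
qed

end

section \<open>Linear growth integrands and area-strict convergence\<close>

text \<open>Even in the last variable, so that it is a function on the whole space as
  \<open>reshetnyak\<close> requires; the pairs integrated later have
  \<open>snd p \<ge> 0\<close>.\<close>

definition persp :: "('a::euclidean_space \<Rightarrow> 'b::euclidean_space \<Rightarrow> real) \<Rightarrow> 'a \<Rightarrow> 'b \<times> real \<Rightarrow> real"
  where "persp f x p = (if snd p = 0 then recession f x (fst p)
    else \<bar>snd p\<bar> * f x (fst p /\<^sub>R \<bar>snd p\<bar>))"

lemma persp_1 [simp]: "persp f x (z, 1) = f x z"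
  by (simp add: persp_def)

lemma persp_0 [simp]: "persp f x (z, 0) = recession f x z"
  by (simp add: persp_def)

text \<open>Since \<open>\<omega> 0 = 0\<close>, the limit holds along the full filter
  \<open>nhds x\<close>, the one that occurs in \<open>recession\<close>.\<close>

lemma tendsto_modulus_of_continuity:
  fixes x :: "'a::real_normed_vector"
  assumes "modulus_of_continuity \<omega>"
  shows "((\<lambda>x'. \<omega> (norm (x' - x))) \<longlongrightarrow> 0) (nhds x)"
proof (rule tendstoI)
  fix e :: real assume e: "0 < e"
  have "(\<omega> \<longlongrightarrow> 0) (at_right 0)" using assms by (simp add: modulus_of_continuity_def)
  from tendstoD[OF this e] obtain d where d: "0 < d" "\<And>s. 0 < s \<Longrightarrow> s < d \<Longrightarrow> dist (\<omega> s) 0 < e"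
    unfolding eventually_at_right_field by auto
  have "\<forall>\<^sub>F x' in nhds x. dist x' x < d" using d(1) by (auto simp: eventually_nhds_metric)
  then show "\<forall>\<^sub>F x' in nhds x. dist (\<omega> (norm (x' - x))) 0 < e"
  proof eventually_elim
    case (elim x')
    then show ?case
      using d(2)[of "norm (x' - x)"] e assms by (cases "x' = x") (auto simp: dist_norm modulus_of_continuity_def)
  qed
qed

locale integrand =
  fixes \<Omega> :: "'a::euclidean_space set" and f :: "'a \<Rightarrow> 'b::euclidean_space \<Rightarrow> real"
    and M :: real and \<omega> :: "real \<Rightarrow> real"
  assumes O: "open \<Omega>"
    and cont: "continuous_on (\<Omega> \<times> UNIV) (\<lambda>(x, z). f x z)"
    and nn: "\<And>x z. x \<in> \<Omega> \<Longrightarrow> 0 \<le> f x z"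
    and cvx: "\<And>x. x \<in> \<Omega> \<Longrightarrow> convex_on UNIV (f x)"
    and M: "0 < M"
    and growth: "\<And>x z. x \<in> \<Omega> \<Longrightarrow> f x z \<le> M * (1 + norm z)"
    and \<omega>: "modulus_of_continuity \<omega>"
    and mod: "\<And>x y z. x \<in> \<Omega> \<Longrightarrow> y \<in> \<Omega> \<Longrightarrow> \<bar>f x z - f y z\<bar> \<le> \<omega> (norm (x - y)) * (1 + norm z)"
begin

text \<open>The point \<open>z'\<close> lies on the segment from \<open>z\<close> to the remote
  point \<open>?w\<close>. Convexity bounds the slope by the one towards \<open>?w\<close>, and
  linear growth makes the latter asymptotically at most \<open>M\<close> times the distance of
  \<open>z'\<close> and \<open>z\<close>; nonnegativity discards the term
  \<open>- f x z / s\<close>.\<close>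

lemma lipschitz_aux:
  assumes x: "x \<in> \<Omega>"
  shows "f x z' - f x z \<le> M * norm (z' - z)"
proof -
  have le: "f x z' - f x z \<le> M * norm (z' - z) + M * (1 + norm z) / real (Suc n)" for n
  proof -
    define s where "s = real (Suc n)"
    have s: "1 \<le> s" by (simp add: s_def)
    let ?w = "z + s *\<^sub>R (z' - z)"
    have eq: "z' = (1 - 1/s) *\<^sub>R z + (1/s) *\<^sub>R ?w"
      using s by (simp add: algebra_simps)
    have "f x ((1 - 1/s) *\<^sub>R z + (1/s) *\<^sub>R ?w) \<le> (1 - 1/s) * f x z + (1/s) * f x ?w"
      using s by (intro convex_onD[OF cvx[OF x]]) auto
    then have "f x z' \<le> (1 - 1/s) * f x z + (1/s) * f x ?w" using eq by simp
    also have "(1 - 1/s) * f x z \<le> 1 * f x z" using nn[OF x] s by (intro mult_right_mono) auto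
    also have "(1/s) * f x ?w \<le> (1/s) * (M * (1 + (norm z + s * norm (z' - z))))"
    proof (intro mult_left_mono order_trans[OF growth[OF x]])
      show "1 + norm ?w \<le> 1 + (norm z + s * norm (z' - z))"
        using norm_triangle_ineq[of z "s *\<^sub>R (z' - z)"] s by simp
    qed (use M s in auto)
    also have "(1/s) * (M * (1 + (norm z + s * norm (z' - z)))) = M * norm (z' - z) + M * (1 + norm z) / s"
      using s by (simp add: field_simps)
    finally show ?thesis by (simp add: s_def)
  qed
  have "(\<lambda>n. M * norm (z' - z) + M * (1 + norm z) / real (Suc n)) \<longlonglongrightarrow> M * norm (z' - z) + 0"
    by (intro tendsto_add tendsto_const LIMSEQ_Suc[OF lim_const_over_n])
  then show ?thesis using le by (intro LIMSEQ_le_const[where X="\<lambda>n. M * norm (z' - z) + M * (1 + norm z) / real (Suc n)"]) auto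
qed

lemma lipschitz:
  assumes x: "x \<in> \<Omega>"
  shows "\<bar>f x z' - f x z\<bar> \<le> M * norm (z' - z)"
  using lipschitz_aux[OF x, of z' z] lipschitz_aux[OF x, of z z'] by (simp add: norm_minus_commute abs_le_iff)

text \<open>Convexity makes the difference quotients from 0 increasing in \<open>t\<close>, and the
  Lipschitz estimate bounds them.\<close>

lemma recession_exists:
  assumes x: "x \<in> \<Omega>"
  shows "\<exists>L. ((\<lambda>t. f x (t *\<^sub>R z) / t) \<longlongrightarrow> L) at_top"
proof -
  define g where "g t = (f x (t *\<^sub>R z) - f x 0) / t" for t
  have mono: "g s \<le> g t" if "0 < s" "s \<le> t" for s t
  proof -
    have "f x ((1 - s/t) *\<^sub>R 0 + (s/t) *\<^sub>R (t *\<^sub>R z)) \<le> (1 - s/t) * f x 0 + (s/t) * f x (t *\<^sub>R z)"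
      using that by (intro convex_onD[OF cvx[OF x]]) auto
    then have "f x (s *\<^sub>R z) - f x 0 \<le> (s/t) * (f x (t *\<^sub>R z) - f x 0)"
      using that by (simp add: algebra_simps)
    then have "(f x (s *\<^sub>R z) - f x 0) / s \<le> ((s/t) * (f x (t *\<^sub>R z) - f x 0)) / s"
      using that by (intro divide_right_mono) auto
    then show ?thesis using that by (simp add: g_def)
  qed
  have bdd: "g t \<le> M * norm z" if "0 < t" for t
    using lipschitz_aux[OF x, of "t *\<^sub>R z" 0] that by (simp add: g_def field_simps)
  define L where "L = (SUP t\<in>{0<..}. g t)"
  have ba: "bdd_above (g ` {0<..})" using bdd by (auto simp: bdd_above_def)
  have "(g \<longlongrightarrow> L) at_top"
  proof (rule order_tendstoI)
    fix a assume "a < L"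
    then obtain t0 where "0 < t0" "a < g t0"
      unfolding L_def using less_cSUP_iff[OF _ ba] by auto
    then show "\<forall>\<^sub>F t in at_top. a < g t"
      using mono by (auto intro!: exI[of _ t0] simp: eventually_at_top_linorder intro: less_le_trans)
  next
    fix a assume a: "L < a"
    have "g t \<le> L" if "0 < t" for t
      unfolding L_def using that by (intro cSUP_upper ba) auto
    then show "\<forall>\<^sub>F t in at_top. g t < a"
      using a by (intro eventually_mono[OF eventually_gt_at_top[of 0]]) (auto intro: le_less_trans)
  qed
  moreover have "((\<lambda>t. f x 0 / t) \<longlongrightarrow> 0) at_top"
    by (intro tendsto_divide_0[OF tendsto_const] filterlim_at_top_imp_at_infinity filterlim_ident)
  ultimately have "((\<lambda>t. g t + f x 0 / t) \<longlongrightarrow> L + 0) at_top" by (rule tendsto_add)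
  moreover have "(\<lambda>t. g t + f x 0 / t) = (\<lambda>t. f x (t *\<^sub>R z) / t)"
    by (simp add: g_def diff_divide_distrib fun_eq_iff)
  ultimately have "((\<lambda>t. f x (t *\<^sub>R z) / t) \<longlongrightarrow> L) at_top" by simp
  then show ?thesis by blast
qed

text \<open>\<open>recession\<close> is a joint limit in \<open>x'\<close> and \<open>t\<close>.
  Moving the point costs at most \<open>\<omega> (norm (x' - x)) * (1 / t + norm z)\<close>, so the
  joint limit exists and equals the one at fixed \<open>x\<close>.\<close>

lemma recession_tendsto:
  assumes x: "x \<in> \<Omega>"
  shows "((\<lambda>t. f x (t *\<^sub>R z) / t) \<longlongrightarrow> recession f x z) at_top"
proof -
  obtain L where L: "((\<lambda>t. f x (t *\<^sub>R z) / t) \<longlongrightarrow> L) at_top"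
    using recession_exists[OF x] by blast
  let ?F = "nhds x \<times>\<^sub>F (at_top :: real filter)"
  have sL: "((\<lambda>p. f x (snd p *\<^sub>R z) / snd p) \<longlongrightarrow> L) ?F"
    by (rule filterlim_compose[OF L filterlim_snd])
  have "((\<lambda>p. \<omega> (norm (fst p - x))) \<longlongrightarrow> 0) ?F"
    by (rule filterlim_compose[OF tendsto_modulus_of_continuity[OF \<omega>] filterlim_fst])
  moreover have "((\<lambda>p. 1 / snd p) \<longlongrightarrow> 0) ?F"
    by (intro tendsto_divide_0[OF tendsto_const] filterlim_at_top_imp_at_infinity filterlim_snd)
  ultimately have lim0: "((\<lambda>p. \<omega> (norm (fst p - x)) * (1 / snd p + norm z)) \<longlongrightarrow> 0 * (0 + norm z)) ?F"
    by (intro tendsto_intros)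
  have ev: "\<forall>\<^sub>F p in ?F. fst p \<in> \<Omega> \<and> 0 < snd p"
    unfolding eventually_prod_filter
    using eventually_nhds_in_open[OF O x] eventually_gt_at_top[of "0::real"] by fastforce
  have "((\<lambda>p. f (fst p) (snd p *\<^sub>R z) / snd p - f x (snd p *\<^sub>R z) / snd p) \<longlongrightarrow> 0) ?F"
  proof (rule Lim_null_comparison)
    show "((\<lambda>p. \<omega> (norm (fst p - x)) * (1 / snd p + norm z)) \<longlongrightarrow> 0) ?F" using lim0 by simp
    show "\<forall>\<^sub>F p in ?F. norm (f (fst p) (snd p *\<^sub>R z) / snd p - f x (snd p *\<^sub>R z) / snd p)
        \<le> \<omega> (norm (fst p - x)) * (1 / snd p + norm z)"
      using ev
    proof eventually_elim
      case (elim p)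
      have "norm (f (fst p) (snd p *\<^sub>R z) / snd p - f x (snd p *\<^sub>R z) / snd p)
         = \<bar>f (fst p) (snd p *\<^sub>R z) - f x (snd p *\<^sub>R z)\<bar> / snd p"
        using elim by (simp add: diff_divide_distrib[symmetric])
      also have "\<dots> \<le> \<omega> (norm (fst p - x)) * (1 + norm (snd p *\<^sub>R z)) / snd p"
        using elim x by (intro divide_right_mono mod) auto
      also have "\<dots> = \<omega> (norm (fst p - x)) * (1 / snd p + norm z)"
        using elim by (simp add: field_simps)
      finally show ?case .
    qed
  qed
  from tendsto_add[OF this sL] have "((\<lambda>p. f (fst p) (snd p *\<^sub>R z) / snd p) \<longlongrightarrow> L) ?F" by simp
  then have "((\<lambda>(x', t). f x' (t *\<^sub>R z) / t) \<longlongrightarrow> L) ?F" by (simp add: case_prod_unfold)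
  then have "recession f x z = L"
    unfolding recession_def by (intro tendsto_Lim) (auto simp: prod_filter_eq_bot)
  with L show ?thesis by simp
qed

text \<open>The factor \<open>\<bar>t\<bar>\<close> turns \<open>1 + norm (z / t)\<close> into
  \<open>\<bar>t\<bar> + norm z\<close>, so the estimate does not degenerate near
  \<open>t = 0\<close>; the case \<open>t = 0\<close> itself is the limit of the scaled
  estimates.\<close>

lemma persp_diff:
  assumes x: "x \<in> \<Omega>" "x' \<in> \<Omega>"
  shows "\<bar>persp f x (z, t) - persp f x' (z', t)\<bar> \<le> \<omega> (norm (x - x')) * (\<bar>t\<bar> + norm z) + M * norm (z - z')"
proof -
  have base: "\<bar>f x w - f x' w'\<bar> \<le> \<omega> (norm (x - x')) * (1 + norm w) + M * norm (w - w')" for w w'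
    using mod[OF x, of w] lipschitz[OF x(2), of w w'] by linarith
  show ?thesis
  proof (cases "t = 0")
    case False
    define s where "s = \<bar>t\<bar>"
    have s: "0 < s" using False by (simp add: s_def)
    have "\<bar>persp f x (z, t) - persp f x' (z', t)\<bar> = s * \<bar>f x (z /\<^sub>R s) - f x' (z' /\<^sub>R s)\<bar>"
      using False s by (simp add: persp_def s_def[symmetric] right_diff_distrib[symmetric] abs_mult)
    also have "\<dots> \<le> s * (\<omega> (norm (x - x')) * (1 + norm (z /\<^sub>R s)) + M * norm (z /\<^sub>R s - z' /\<^sub>R s))"
      by (intro mult_left_mono base) (use s in auto)
    also have "norm (z /\<^sub>R s - z' /\<^sub>R s) = norm (z - z') / s"
      using s by (simp add: scaleR_diff_right[symmetric] divide_inverse mult.commute)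
    also have "s * (\<omega> (norm (x - x')) * (1 + norm (z /\<^sub>R s)) + M * (norm (z - z') / s)) =
        \<omega> (norm (x - x')) * (s + norm z) + M * norm (z - z')"
      using s by (simp add: field_simps)
    finally show ?thesis by (simp add: s_def)
  next
    case True
    have "((\<lambda>s. \<bar>f x (s *\<^sub>R z) / s - f x' (s *\<^sub>R z') / s\<bar>) \<longlongrightarrow> \<bar>recession f x z - recession f x' z'\<bar>) at_top"
      by (intro tendsto_intros recession_tendsto x)
    moreover have "((\<lambda>s. \<omega> (norm (x - x')) * (1 / s + norm z) + M * norm (z - z')) \<longlongrightarrow>
         \<omega> (norm (x - x')) * (0 + norm z) + M * norm (z - z')) at_top"
      by (intro tendsto_intros tendsto_divide_0[OF tendsto_const] filterlim_at_top_imp_at_infinity filterlim_ident)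
    moreover have "\<forall>\<^sub>F s in at_top. \<bar>f x (s *\<^sub>R z) / s - f x' (s *\<^sub>R z') / s\<bar> \<le> \<omega> (norm (x - x')) * (1 / s + norm z) + M * norm (z - z')"
      using eventually_gt_at_top[of 0]
    proof eventually_elim
      case (elim s)
      have "\<bar>f x (s *\<^sub>R z) / s - f x' (s *\<^sub>R z') / s\<bar> = \<bar>f x (s *\<^sub>R z) - f x' (s *\<^sub>R z')\<bar> / s"
        using elim by (simp add: diff_divide_distrib[symmetric])
      also have "\<dots> \<le> (\<omega> (norm (x - x')) * (1 + norm (s *\<^sub>R z)) + M * norm (s *\<^sub>R z - s *\<^sub>R z')) / s"
        using elim by (intro divide_right_mono base) auto
      also have "norm (s *\<^sub>R z - s *\<^sub>R z') = s * norm (z - z')"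
        using elim by (simp add: scaleR_diff_right[symmetric] del: scaleR_diff_right)
      also have "(\<omega> (norm (x - x')) * (1 + norm (s *\<^sub>R z)) + M * (s * norm (z - z'))) / s =
          \<omega> (norm (x - x')) * (1 / s + norm z) + M * norm (z - z')"
        using elim by (simp add: field_simps)
      finally show ?case .
    qed
    ultimately have "\<bar>recession f x z - recession f x' z'\<bar> \<le> \<omega> (norm (x - x')) * (0 + norm z) + M * norm (z - z')"
      by (intro tendsto_le[OF trivial_limit_at_top_linorder]) auto
    then show ?thesis using True by simp
  qed
qed

text \<open>At \<open>t0 = 0\<close> the substitution \<open>s = 1 / t\<close> turns the right limit
  into that of the recession function; the left limit follows by evenness.\<close>

lemma persp_tendsto_t:
  assumes x: "x \<in> \<Omega>"
  shows "((\<lambda>t. persp f x (z, t)) \<longlongrightarrow> persp f x (z, t0)) (nhds t0)"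
proof (cases "t0 = 0")
  case True
  have fx: "((\<lambda>s. f x (s *\<^sub>R z) / s) \<longlongrightarrow> recession f x z) at_top" by (rule recession_tendsto[OF x])
  have R: "((\<lambda>t. persp f x (z, t)) \<longlongrightarrow> recession f x z) (at_right 0)"
    unfolding at_right_to_top filterlim_filtermap
  proof (rule Lim_transform_eventually[OF fx])
    show "\<forall>\<^sub>F s in at_top. f x (s *\<^sub>R z) / s = persp f x (z, inverse s)"
      using eventually_gt_at_top[of 0] by eventually_elim (simp add: persp_def divide_inverse mult.commute)
  qed
  have L: "((\<lambda>t. persp f x (z, t)) \<longlongrightarrow> recession f x z) (at_left 0)"
  proof -
    have "((\<lambda>t. persp f x (z, - t)) \<longlongrightarrow> recession f x z) (at_right 0)"
    proof -
      have "persp f x (z, - t) = persp f x (z, t)" for t by (simp add: persp_def)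
      then show ?thesis using R by simp
    qed
    then show ?thesis unfolding at_left_minus[of 0] filterlim_filtermap by simp
  qed
  have "((\<lambda>t. persp f x (z, t)) \<longlongrightarrow> recession f x z) (at 0)"
    using L R by (rule filterlim_split_at)
  then show ?thesis unfolding True by (intro tendsto_nhds_iff[THEN iffD2]) simp
next
  case False
  have "continuous_on UNIV (f x)"
  proof -
    have "continuous_on UNIV (\<lambda>z::'b. (x, z))" by (intro continuous_intros)
    then have "continuous_on UNIV (\<lambda>z. case (x, z) of (x, z) \<Rightarrow> f x z)"
      by (rule continuous_on_compose2[OF cont]) (use x in auto)
    then show ?thesis by simp
  qed
  then have c: "isCont (f x) w" for w by (simp add: continuous_on_eq_continuous_at)
  have "((\<lambda>t. \<bar>t\<bar> * f x (z /\<^sub>R \<bar>t\<bar>)) \<longlongrightarrow> \<bar>t0\<bar> * f x (z /\<^sub>R \<bar>t0\<bar>)) (at t0)"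
    using False by (intro tendsto_intros isCont_tendsto_compose[OF c]) auto
  then have "((\<lambda>t. \<bar>t\<bar> * f x (z /\<^sub>R \<bar>t\<bar>)) \<longlongrightarrow> \<bar>t0\<bar> * f x (z /\<^sub>R \<bar>t0\<bar>)) (nhds t0)"
    by (intro tendsto_nhds_iff[THEN iffD2]) simp
  moreover have "\<forall>\<^sub>F t in nhds t0. \<bar>t\<bar> * f x (z /\<^sub>R \<bar>t\<bar>) = persp f x (z, t)"
  proof -
    have "\<forall>\<^sub>F t in nhds t0. t \<in> - {0}"
      using False by (intro eventually_nhds_in_open) auto
    then show ?thesis by eventually_elim (simp add: persp_def)
  qed
  ultimately have "((\<lambda>t. persp f x (z, t)) \<longlongrightarrow> \<bar>t0\<bar> * f x (z /\<^sub>R \<bar>t0\<bar>)) (nhds t0)"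
    by (rule Lim_transform_eventually)
  then show ?thesis using False by (simp add: persp_def)
qed

text \<open>By \<open>persp_diff\<close> the variables \<open>x\<close> and \<open>z\<close> may be
  frozen at an error that tends to 0, which leaves continuity in \<open>t\<close>.\<close>

lemma persp_continuous: "continuous_on (\<Omega> \<times> UNIV) (\<lambda>(x, p). persp f x p)"
  unfolding continuous_on_def
proof
  fix q assume q: "q \<in> \<Omega> \<times> (UNIV :: ('b \<times> real) set)"
  obtain x z t where qe: "q = (x, (z, t))" and x: "x \<in> \<Omega>" using q by (cases q) auto
  let ?F = "at q within \<Omega> \<times> (UNIV :: ('b \<times> real) set)"
  have id: "((\<lambda>p. p) \<longlongrightarrow> q) ?F" by (rule tendsto_ident_at)
  have l1: "((\<lambda>p. fst p) \<longlongrightarrow> x) ?F" "((\<lambda>p. fst (snd p)) \<longlongrightarrow> z) ?F" "((\<lambda>p. snd (snd p)) \<longlongrightarrow> t) ?F"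
    using tendsto_fst[OF id] tendsto_fst[OF tendsto_snd[OF id]] tendsto_snd[OF tendsto_snd[OF id]] qe by auto
  have l2: "((\<lambda>p. \<omega> (norm (fst p - x))) \<longlongrightarrow> 0) ?F"
    by (rule filterlim_compose[OF tendsto_modulus_of_continuity[OF \<omega>] l1(1)])
  have l3: "((\<lambda>p. persp f x (z, snd (snd p))) \<longlongrightarrow> persp f x (z, t)) ?F"
    by (rule filterlim_compose[OF persp_tendsto_t[OF x] l1(3)])
  have "((\<lambda>p. \<omega> (norm (fst p - x)) * (\<bar>snd (snd p)\<bar> + norm (fst (snd p))) + M * norm (fst (snd p) - z)) \<longlongrightarrow>
      0 * (\<bar>t\<bar> + norm z) + M * norm (z - z)) ?F"
    by (intro tendsto_intros l1 l2)
  then have l4: "((\<lambda>p. \<omega> (norm (fst p - x)) * (\<bar>snd (snd p)\<bar> + norm (fst (snd p))) + M * norm (fst (snd p) - z)) \<longlongrightarrow> 0) ?F"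
    by simp
  have "((\<lambda>p. persp f (fst p) (snd p) - persp f x (z, snd (snd p))) \<longlongrightarrow> 0) ?F"
  proof (rule Lim_null_comparison[OF _ l4])
    have "\<forall>\<^sub>F p in ?F. p \<in> \<Omega> \<times> UNIV" by (simp add: eventually_at_filter)
    then show "\<forall>\<^sub>F p in ?F. norm (persp f (fst p) (snd p) - persp f x (z, snd (snd p)))
        \<le> \<omega> (norm (fst p - x)) * (\<bar>snd (snd p)\<bar> + norm (fst (snd p))) + M * norm (fst (snd p) - z)"
    proof eventually_elim
      case (elim p)
      then show ?case
        using persp_diff[of "fst p" x "fst (snd p)" "snd (snd p)" z] x by auto
    qed
  qed
  from tendsto_add[OF this l3] show "((\<lambda>(x, p). persp f x p) \<longlongrightarrow> (case q of (x, p) \<Rightarrow> persp f x p)) ?F"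
    by (simp add: case_prod_unfold qe)
qed

lemma recession_bounds:
  assumes x: "x \<in> \<Omega>"
  shows "0 \<le> recession f x z" "recession f x z \<le> M * norm z"
proof -
  note l = recession_tendsto[OF x, of z]
  have "\<forall>\<^sub>F t in at_top. 0 \<le> f x (t *\<^sub>R z) / t"
    using eventually_gt_at_top[of 0] by eventually_elim (use nn[OF x] in auto)
  then show "0 \<le> recession f x z"
    by (intro tendsto_lowerbound[OF l]) auto
  have "((\<lambda>t. M * (1 / t + norm z)) \<longlongrightarrow> M * (0 + norm z)) at_top"
    by (intro tendsto_intros tendsto_divide_0[OF tendsto_const] filterlim_at_top_imp_at_infinity filterlim_ident)
  moreover have "\<forall>\<^sub>F t in at_top. f x (t *\<^sub>R z) / t \<le> M * (1 / t + norm z)"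
    using eventually_gt_at_top[of 0]
  proof eventually_elim
    case (elim t)
    have "f x (t *\<^sub>R z) / t \<le> M * (1 + norm (t *\<^sub>R z)) / t"
      using elim by (intro divide_right_mono growth x) auto
    then show ?case using elim by (simp add: field_simps)
  qed
  ultimately show "recession f x z \<le> M * norm z"
    using tendsto_le[OF trivial_limit_at_top_linorder _ l] by fastforce
qed

lemma recession_scale:
  assumes x: "x \<in> \<Omega>" and c: "0 \<le> c"
  shows "recession f x (c *\<^sub>R z) = c * recession f x z"
proof (cases "c = 0")
  case True
  then show ?thesis using recession_bounds[OF x, of 0] by simp
next
  case False
  with c have c: "0 < c" by simp
  have "filterlim (\<lambda>t. c * t) at_top at_top"
    using c by (intro filterlim_tendsto_pos_mult_at_top[OF tendsto_const _ filterlim_ident])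
  from filterlim_compose[OF recession_tendsto[OF x, of z] this]
  have "((\<lambda>t. c * (f x ((c * t) *\<^sub>R z) / (c * t))) \<longlongrightarrow> c * recession f x z) at_top"
    by (intro tendsto_intros)
  moreover have "c * (f x ((c * t) *\<^sub>R z) / (c * t)) = f x (t *\<^sub>R (c *\<^sub>R z)) / t" for t
    using c by (simp add: mult.commute)
  ultimately have "((\<lambda>t. f x (t *\<^sub>R (c *\<^sub>R z)) / t) \<longlongrightarrow> c * recession f x z) at_top" by simp
  with recession_tendsto[OF x, of "c *\<^sub>R z"] show ?thesis
    by (rule tendsto_unique[OF trivial_limit_at_top_linorder])
qed

lemma persp_scale:
  assumes x: "x \<in> \<Omega>" and c: "0 \<le> c"
  shows "persp f x (c *\<^sub>R p) = c * persp f x p"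
proof (cases "c = 0 \<or> snd p = 0")
  case True
  then show ?thesis using recession_scale[OF x c, of "fst p"] recession_scale[OF x, of 0 0]
    by (auto simp: persp_def)
next
  case False
  with c have c: "0 < c" by simp
  then have "inverse \<bar>c * snd p\<bar> * c = inverse \<bar>snd p\<bar>" by (simp add: abs_mult)
  then have "(c *\<^sub>R fst p) /\<^sub>R \<bar>c * snd p\<bar> = fst p /\<^sub>R \<bar>snd p\<bar>" by (simp only: scaleR_scaleR)
  then have "f x ((c *\<^sub>R fst p) /\<^sub>R \<bar>c * snd p\<bar>) = f x (fst p /\<^sub>R \<bar>snd p\<bar>)" by (rule arg_cong)
  then show ?thesis using False c by (simp add: persp_def abs_mult del: scaleR_scaleR)
qed

lemma persp_bounds:
  assumes x: "x \<in> \<Omega>"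
  shows "0 \<le> persp f x p" "\<bar>persp f x p\<bar> \<le> 2 * M * norm p"
proof -
  show 0: "0 \<le> persp f x p" using recession_bounds[OF x] nn[OF x] by (simp add: persp_def)
  have "persp f x p \<le> M * (\<bar>snd p\<bar> + norm (fst p))"
  proof (cases "snd p = 0")
    case True then show ?thesis using recession_bounds[OF x] by (simp add: persp_def)
  next
    case False
    have "\<bar>snd p\<bar> * f x (fst p /\<^sub>R \<bar>snd p\<bar>) \<le> \<bar>snd p\<bar> * (M * (1 + norm (fst p /\<^sub>R \<bar>snd p\<bar>)))"
      by (intro mult_left_mono growth x) auto
    also have "\<dots> = M * (\<bar>snd p\<bar> + norm (fst p))" using False by (simp add: field_simps)
    finally show ?thesis using False by (simp add: persp_def)
  qed
  also have "\<dots> \<le> M * (norm p + norm p)"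
    using M norm_fst_le[of "fst p" "snd p"] norm_snd_le[of "snd p" "fst p"]
    by (intro mult_left_mono add_mono) auto
  finally show "\<bar>persp f x p\<bar> \<le> 2 * M * norm p" using 0 by simp
qed

lemma recession_continuous: "continuous_on (\<Omega> \<times> UNIV) (\<lambda>(x, z). recession f x z)"
proof -
  have "continuous_on (\<Omega> \<times> UNIV) (\<lambda>q::'a \<times> 'b. (fst q, (snd q, 0::real)))"
    by (intro continuous_intros)
  then have "continuous_on (\<Omega> \<times> UNIV) (\<lambda>q::'a \<times> 'b. case (fst q, (snd q, 0)) of (x, p) \<Rightarrow> persp f x p)"
    by (rule continuous_on_compose2[OF persp_continuous]) auto
  then show ?thesis by (simp add: case_prod_unfold)
qed

end

section \<open>Pairs of densities and uniqueness of weak limits\<close>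

lemma integrable_Pair:
  fixes f :: "'a \<Rightarrow> 'b::euclidean_space" and g :: "'a \<Rightarrow> 'c::euclidean_space"
  assumes "integrable M f" "integrable M g"
  shows "integrable M (\<lambda>x. (f x, g x))"
proof -
  have "integrable M (\<lambda>x. (f x, 0) + (0, g x))"
    by (intro Bochner_Integration.integrable_add
        integrable_bounded_linear[OF bounded_linear_Pair[OF bounded_linear_ident bounded_linear_zero]]
        integrable_bounded_linear[OF bounded_linear_Pair[OF bounded_linear_zero bounded_linear_ident]] assms)
  then show ?thesis by simp
qed

lemma sums_Pair:
  fixes f :: "nat \<Rightarrow> 'b::real_normed_vector" and g :: "nat \<Rightarrow> 'c::real_normed_vector"
  assumes "f sums a" "g sums b"
  shows "(\<lambda>i. (f i, g i)) sums (a, b)"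
proof -
  have "(\<lambda>i. (f i, 0) + (0, g i)) sums ((a, 0) + (0, b))"
    by (intro sums_add
        bounded_linear.sums[OF bounded_linear_Pair[OF bounded_linear_ident bounded_linear_zero]]
        bounded_linear.sums[OF bounded_linear_Pair[OF bounded_linear_zero bounded_linear_ident]] assms)
  then show ?thesis by simp
qed

text \<open>Testing with a continuous approximation of \<open>sgn (d x)\<close>, taken in the norm
  weighted by \<open>norm (d x)\<close>, shows that the integral of \<open>norm (d x)\<close> is
  arbitrarily small.\<close>

lemma AE_zero_if_test_zero:
  fixes d :: "'a::euclidean_space \<Rightarrow> 'e::euclidean_space"
  assumes \<rho>: "finite_measure \<rho>" "sets \<rho> = borel_on \<Omega>" and O: "open \<Omega>" and d: "integrable \<rho> d"
    and 0: "\<And>\<phi>. continuous_on UNIV \<phi> \<Longrightarrow> (\<And>x. norm (\<phi> x) \<le> 1) \<Longrightarrow> (LINT x|\<rho>. \<phi> x \<bullet> d x) = 0"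
  shows "AE x in \<rho>. d x = 0"
proof -
  have "(LINT x|\<rho>. norm (d x)) \<le> e" if e: "0 < e" for e
  proof -
    obtain h where h: "continuous_on UNIV h" "\<And>x. norm (h x) \<le> 1"
      "(LINT x|\<rho>. norm (d x) * norm (h x - sgn (d x))) < e"
      using continuous_dense_sgn[OF \<rho> O d e] by blast
    have hm: "h \<in> borel_measurable \<rho>"
      using h(1) by (intro measurable_continuous_on_borel_on[OF _ \<rho>(2)]) (rule continuous_on_subset, auto)
    have dm: "d \<in> borel_measurable \<rho>" using d by simp
    have ih: "integrable \<rho> (\<lambda>x. h x \<bullet> d x)"
      using hm h(2) d by (intro integrable_bounded_inner[where B=1]) auto
    have i1: "integrable \<rho> (\<lambda>x. norm (h x - sgn (d x)) * norm (d x))"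
    proof (rule integrable_bounded_mult[where B=2])
      show "\<bar>norm (h x - sgn (d x))\<bar> \<le> 2" for x
        using norm_triangle_ineq4[of "h x" "sgn (d x)"] h(2)[of x] by (auto simp: norm_sgn split: if_splits)
    qed (use hm dm d in \<open>auto simp: sgn_div_norm\<close>)
    have "(LINT x|\<rho>. norm (d x)) = (LINT x|\<rho>. norm (d x) - h x \<bullet> d x)"
      using d ih 0[OF h(1,2)] by simp
    also have "\<dots> \<le> (LINT x|\<rho>. norm (h x - sgn (d x)) * norm (d x))"
    proof (rule integral_mono)
      fix x
      have "norm (d x) - h x \<bullet> d x = (sgn (d x) - h x) \<bullet> d x"
        by (simp add: inner_diff_left sgn_inner_self)
      also have "\<dots> \<le> norm (h x - sgn (d x)) * norm (d x)"
        by (metis norm_cauchy_schwarz norm_minus_commute)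
      finally show "norm (d x) - h x \<bullet> d x \<le> norm (h x - sgn (d x)) * norm (d x)" .
    qed (use d ih i1 in auto)
    also have "\<dots> \<le> e" using h(3) by (simp add: mult.commute)
    finally show ?thesis .
  qed
  then have "(LINT x|\<rho>. norm (d x)) \<le> 0" by (rule field_le_epsilon) (simp add: field_le_epsilon)
  moreover have "0 \<le> (LINT x|\<rho>. norm (d x))" by simp
  ultimately have "(LINT x|\<rho>. norm (d x)) = 0" by linarith
  then show ?thesis using d by (subst (asm) integral_nonneg_eq_0_iff_AE) auto
qed

text \<open>Regarding \<open>(l, l')\<close> as one vector measure yields a common base measure over
  which the two densities can be subtracted.\<close>

lemma vint_eq_imp_eq:
  fixes l l' :: "'a::euclidean_space set \<Rightarrow> real"
  assumes fin: "finite_measure (leb \<Omega>)" and O: "open \<Omega>"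
    and l: "l \<in> radon_measures \<Omega>" "l' \<in> radon_measures \<Omega>"
    and eq: "\<And>\<phi>. continuous_on \<Omega> \<phi> \<Longrightarrow> bounded (\<phi> ` \<Omega>) \<Longrightarrow> vint \<Omega> \<phi> l = vint \<Omega> \<phi> l'"
  shows "l = l'"
proof -
  have "(\<lambda>E. (l E, l' E)) \<in> radon_measures \<Omega>"
    using l by (auto simp: radon_measures_def zero_prod_def intro!: sums_Pair)
  then obtain \<rho> s t where \<rho>: "finite_measure \<rho>" "sets \<rho> = borel_on \<Omega>" and s: "integrable \<rho> s"
    and ls: "(\<lambda>E. (l E, l' E)) = dmeas \<rho> s"
    by (rule radon_rep[OF _ fin])
  have i: "integrable \<rho> (\<lambda>x. fst (s x))" "integrable \<rho> (\<lambda>x. snd (s x))"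
    using s by (auto intro: integrable_bounded_linear[OF bounded_linear_fst] integrable_bounded_linear[OF bounded_linear_snd])
  have l1: "l = dmeas \<rho> (\<lambda>x. fst (s x))"
  proof
    fix E
    have "l E = fst (dmeas \<rho> s E)" using fun_cong[OF ls, of E] by (metis fst_conv)
    also have "\<dots> = dmeas \<rho> (\<lambda>x. fst (s x)) E"
      unfolding dmeas_def set_lebesgue_integral_def
      using integral_bounded_linear[OF bounded_linear_fst integrable_mult_indicator[OF _ s], symmetric] by simp
    finally show "l E = dmeas \<rho> (\<lambda>x. fst (s x)) E" .
  qed
  have l2: "l' = dmeas \<rho> (\<lambda>x. snd (s x))"
  proof
    fix E
    have "l' E = snd (dmeas \<rho> s E)" using fun_cong[OF ls, of E] by (metis snd_conv)
    also have "\<dots> = dmeas \<rho> (\<lambda>x. snd (s x)) E"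
      unfolding dmeas_def set_lebesgue_integral_def
      using integral_bounded_linear[OF bounded_linear_snd integrable_mult_indicator[OF _ s], symmetric] by simp
    finally show "l' E = dmeas \<rho> (\<lambda>x. snd (s x)) E" .
  qed
  have "AE x in \<rho>. fst (s x) - snd (s x) = 0"
  proof (rule AE_zero_if_test_zero[OF \<rho> O])
    fix \<phi> :: "'a \<Rightarrow> real" assume \<phi>: "continuous_on UNIV \<phi>" "\<And>x. norm (\<phi> x) \<le> 1"
    have \<phi>O: "continuous_on \<Omega> \<phi>" "bounded (\<phi> ` \<Omega>)"
      using \<phi>(2) by (auto simp: bounded_iff intro: continuous_on_subset[OF \<phi>(1)])
    have \<phi>m: "\<phi> \<in> borel_measurable \<rho>" by (rule measurable_continuous_on_borel_on[OF \<phi>O(1) \<rho>(2)])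
    have ii: "integrable \<rho> (\<lambda>x. \<phi> x \<bullet> fst (s x))" "integrable \<rho> (\<lambda>x. \<phi> x \<bullet> snd (s x))"
      using \<phi>m \<phi>(2) i by (auto intro!: integrable_bounded_inner[where B=1] simp del: inner_real_def)
    show "(LINT x|\<rho>. \<phi> x \<bullet> (fst (s x) - snd (s x))) = 0"
      using eq[OF \<phi>O] ii unfolding l1 l2 vint_dmeas[OF \<rho> i(1) \<phi>m] vint_dmeas[OF \<rho> i(2) \<phi>m]
      by (simp add: inner_diff_right del: inner_real_def)
  qed (use i in auto)
  then have "AE x in \<rho>. fst (s x) = snd (s x)" by simp
  then show ?thesis
    unfolding l1 l2 dmeas_def set_lebesgue_integral_def using i
    by (intro ext if_cong refl integral_cong_AE) auto
qed

section \<open>Area-strict convergence as strict convergence of pairs\<close>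

context lebesgue_density begin

lemma finite_leb: "finite_measure (leb \<Omega>)"
proof (rule finite_measureI)
  have "emeasure (leb \<Omega>) (space (leb \<Omega>)) = (\<integral>\<^sup>+x. ennreal (norm (t x)) \<partial>\<rho>)"
    using sets.top[of \<rho>] t(2) by (subst leb) (auto simp: emeasure_density intro!: nn_integral_cong)
  then show "emeasure (leb \<Omega>) (space (leb \<Omega>)) \<noteq> \<infinity>" using t(1) by (simp add: integrable_iff_bounded)
qed

lemma lebesgue_density_leb: "lebesgue_density \<Omega> (leb \<Omega>) (\<lambda>x. 1)"
  by (rule leb_lebesgue_density[OF finite_leb])

lemma borel_measurable_continuous:
  fixes \<phi> :: "'a \<Rightarrow> 'e::topological_space"
  assumes "continuous_on \<Omega> \<phi>"
  shows "\<phi> \<in> borel_measurable \<rho>" "\<phi> \<in> borel_measurable (leb \<Omega>)"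
  using assms by (auto intro: measurable_continuous_on_borel_on simp: sets_rho sets_leb)

lemma weak_star_conv_fun_measure_iff:
  fixes s :: "'a \<Rightarrow> 'b::euclidean_space"
  assumes u: "\<And>j. integrable (leb \<Omega>) (u j)" and s: "integrable \<rho> s"
  shows "weak_star_conv \<Omega> (\<lambda>j. fun_measure \<Omega> (u j)) (dmeas \<rho> s) \<longleftrightarrow>
    (\<forall>\<phi>. continuous_on \<Omega> \<phi> \<and> bounded (\<phi> ` \<Omega>) \<longrightarrow>
      (\<lambda>j. LINT x|leb \<Omega>. \<phi> x \<bullet> u j x) \<longlonglongrightarrow> (LINT x|\<rho>. \<phi> x \<bullet> s x))"
proof -
  have "vint \<Omega> \<phi> (fun_measure \<Omega> (u j)) = (LINT x|leb \<Omega>. \<phi> x \<bullet> u j x)"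
    and "vint \<Omega> \<phi> (dmeas \<rho> s) = (LINT x|\<rho>. \<phi> x \<bullet> s x)" if "continuous_on \<Omega> \<phi>" for \<phi> j
    using borel_measurable_continuous[OF that] u s
    by (simp_all add: fun_measure_eq_dmeas vint_dmeas finite_leb sets_leb fin sets_rho)
  then show ?thesis unfolding weak_star_conv_def by (auto cong: imp_cong)
qed

lemma integral_leb_real:
  assumes "continuous_on \<Omega> \<phi>"
  shows "(LINT x|leb \<Omega>. \<phi> x) = (LINT x|\<rho>. \<phi> x * t x)"
  using integral_leb[OF borel_measurable_continuous(1)[OF assms]] by (simp add: mult.commute)

lemma area_dmeas_real:
  fixes s :: "'a \<Rightarrow> 'b::euclidean_space"
  assumes s: "integrable \<rho> s"
  shows "area \<Omega> (dmeas \<rho> s) \<Omega> = ennreal (LINT x|\<rho>. norm (s x, t x))"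
  unfolding area_dmeas[OF s] by (intro nn_integral_eq_integral integrable_norm integrable_Pair s t) auto

text \<open>The extra component has density 1 along the sequence and \<open>t\<close> in the limit.
  As \<open>leb \<Omega> = t \<rho>\<close>, its integrals agree for every \<open>j\<close>, so weak
  convergence of the pairs is that of the first components, while the norms of the pairs integrate
  to the areas.\<close>

lemma area_strict_conv_iff:
  fixes s :: "'a \<Rightarrow> 'b::euclidean_space"
  assumes O: "open \<Omega>" and u: "\<And>j. integrable (leb \<Omega>) (u j)" and s: "integrable \<rho> s"
  shows "area_strict_conv \<Omega> (\<lambda>j. fun_measure \<Omega> (u j)) (dmeas \<rho> s) \<longleftrightarrow>
    strict_convergence \<Omega> (leb \<Omega>) \<rho> (\<lambda>j x. (u j x, 1::real)) (\<lambda>x. (s x, t x))"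
proof -
  interpret leb: lebesgue_density \<Omega> "leb \<Omega>" "\<lambda>x. 1" by (rule lebesgue_density_leb)
  interpret L: finite_measure "leb \<Omega>" by (rule finite_leb)
  have au: "area \<Omega> (fun_measure \<Omega> (u j)) \<Omega> = ennreal (LINT x|leb \<Omega>. norm (u j x, 1::real))" for j
    unfolding fun_measure_eq_dmeas by (rule leb.area_dmeas_real[OF u])
  have mass: "(\<lambda>j. area \<Omega> (fun_measure \<Omega> (u j)) \<Omega>) \<longlonglongrightarrow> area \<Omega> (dmeas \<rho> s) \<Omega> \<longleftrightarrow>
      (\<lambda>j. LINT x|leb \<Omega>. norm (u j x, 1::real)) \<longlonglongrightarrow> (LINT x|\<rho>. norm (s x, t x))"
    unfolding au area_dmeas_real[OF s] by (intro tendsto_ennreal_iff) auto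
  have fin': "area \<Omega> (dmeas \<rho> s) \<Omega> < \<infinity>" unfolding area_dmeas_real[OF s] by simp
  have weak: "(\<forall>\<phi>. continuous_on \<Omega> \<phi> \<and> bounded (\<phi> ` \<Omega>) \<longrightarrow> (\<lambda>j. LINT x|leb \<Omega>. \<phi> x \<bullet> u j x) \<longlonglongrightarrow> (LINT x|\<rho>. \<phi> x \<bullet> s x)) \<longleftrightarrow>
     (\<forall>\<psi>. continuous_on \<Omega> \<psi> \<and> bounded (\<psi> ` \<Omega>) \<longrightarrow>
       (\<lambda>j. LINT x|leb \<Omega>. \<psi> x \<bullet> (u j x, 1::real)) \<longlonglongrightarrow> (LINT x|\<rho>. \<psi> x \<bullet> (s x, t x)))"
    (is "?A \<longleftrightarrow> ?B")
  proof
    assume A: ?A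
    show ?B
    proof safe
      fix \<psi> :: "'a \<Rightarrow> 'b \<times> real" assume \<psi>: "continuous_on \<Omega> \<psi>" "bounded (\<psi> ` \<Omega>)"
      obtain B where B: "\<And>x. x \<in> \<Omega> \<Longrightarrow> norm (\<psi> x) \<le> B" using boundedD_real[OF \<psi>(2)] by blast
      have c: "continuous_on \<Omega> (\<lambda>x. fst (\<psi> x))" "continuous_on \<Omega> (\<lambda>x. snd (\<psi> x))"
        by (intro continuous_intros \<psi>)+
      have b: "norm (fst (\<psi> x)) \<le> B" "norm (snd (\<psi> x)) \<le> B" if "x \<in> \<Omega>" for x
        using B[OF that] norm_fst_le[of "fst (\<psi> x)" "snd (\<psi> x)"] norm_snd_le[of "snd (\<psi> x)" "fst (\<psi> x)"] by auto
      have bb: "bounded ((\<lambda>x. fst (\<psi> x)) ` \<Omega>)" using b by (auto simp: bounded_iff)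
      have i1: "integrable (leb \<Omega>) (\<lambda>x. fst (\<psi> x) \<bullet> u j x)" for j
        using b u c by (intro integrable_bounded_inner[where B=B] borel_measurable_continuous) auto
      have i2: "integrable (leb \<Omega>) (\<lambda>x. snd (\<psi> x))"
        using b by (intro L.integrable_const_bound[where B=B] borel_measurable_continuous c) auto
      have j1: "integrable \<rho> (\<lambda>x. fst (\<psi> x) \<bullet> s x)"
        using b s c by (intro integrable_bounded_inner[where B=B] borel_measurable_continuous) auto
      have j2: "integrable \<rho> (\<lambda>x. snd (\<psi> x) * t x)"
        using b t c by (intro integrable_bounded_mult[where B=B] borel_measurable_continuous) auto
      have "(\<lambda>j. (LINT x|leb \<Omega>. fst (\<psi> x) \<bullet> u j x) + (LINT x|leb \<Omega>. snd (\<psi> x))) \<longlonglongrightarrow>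
          (LINT x|\<rho>. fst (\<psi> x) \<bullet> s x) + (LINT x|leb \<Omega>. snd (\<psi> x))"
        using A c bb by (intro tendsto_intros) auto
      then show "(\<lambda>j. LINT x|leb \<Omega>. \<psi> x \<bullet> (u j x, 1::real)) \<longlonglongrightarrow> (LINT x|\<rho>. \<psi> x \<bullet> (s x, t x))"
        unfolding integral_leb_real[OF c(2)] using i1 i2 j1 j2
        by (simp add: inner_prod_def integral_leb_real[OF c(2), symmetric])
    qed
  next
    assume B: ?B
    show ?A
    proof safe
      fix \<phi> :: "'a \<Rightarrow> 'b" assume \<phi>: "continuous_on \<Omega> \<phi>" "bounded (\<phi> ` \<Omega>)"
      have "continuous_on \<Omega> (\<lambda>x. (\<phi> x, 0::real))" by (intro continuous_intros \<phi>)
      moreover have "bounded ((\<lambda>x. (\<phi> x, 0::real)) ` \<Omega>)" using \<phi>(2) by (auto simp: bounded_iff norm_Pair)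
      ultimately show "(\<lambda>j. LINT x|leb \<Omega>. \<phi> x \<bullet> u j x) \<longlonglongrightarrow> (LINT x|\<rho>. \<phi> x \<bullet> s x)"
        using B[rule_format, of "\<lambda>x. (\<phi> x, 0::real)"] by (simp add: inner_prod_def)
    qed
  qed
  have iu: "integrable (leb \<Omega>) (\<lambda>x. (u j x, 1::real))" for j
    using u[of j] by (intro integrable_Pair) auto
  have ist: "integrable \<rho> (\<lambda>x. (s x, t x))" using s t by (intro integrable_Pair) auto
  show ?thesis
    unfolding area_strict_conv_def weak_star_conv_fun_measure_iff[OF u s] mass weak strict_convergence_def
    using fin' O finite_leb sets_leb fin sets_rho iu ist by blast
qed

end

context lebesgue_density begin

lemma area_strict_reshetnyak:
  fixes s :: "'a \<Rightarrow> 'b::euclidean_space"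
  assumes O: "open \<Omega>" and u: "\<And>j. integrable (leb \<Omega>) (u j)" and s: "integrable \<rho> s"
    and conv: "area_strict_conv \<Omega> (\<lambda>j. fun_measure \<Omega> (u j)) (dmeas \<rho> s)"
    and F: "continuous_on (\<Omega> \<times> UNIV) (\<lambda>(x, p). F x p)"
    and hom: "\<And>x p c. x \<in> \<Omega> \<Longrightarrow> 0 \<le> c \<Longrightarrow> F x (c *\<^sub>R p) = c * F x p"
    and bd: "\<And>x p. x \<in> \<Omega> \<Longrightarrow> \<bar>F x p\<bar> \<le> C * norm p"
  shows "(\<lambda>j. LINT x|leb \<Omega>. F x (u j x, 1)) \<longlonglongrightarrow> (LINT x|\<rho>. F x (s x, t x))"
proof -
  interpret strict_convergence \<Omega> "leb \<Omega>" \<rho> "\<lambda>j x. (u j x, 1::real)" "\<lambda>x. (s x, t x)"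
    using conv by (subst (asm) area_strict_conv_iff[where u=u, OF O u s])
  show ?thesis by (rule reshetnyak[OF F hom bd])
qed

lemma integrable_scaleR_t:
  fixes v :: "'a \<Rightarrow> 'b::euclidean_space"
  assumes "integrable (leb \<Omega>) v"
  shows "integrable \<rho> (\<lambda>x. t x *\<^sub>R v x)"
  using assms integrable_leb_iff[of v] borel_measurable_integrable[OF assms] unfolding leb_meas by blast

lemma ex_continuous_approx:
  fixes v :: "'a \<Rightarrow> 'b::euclidean_space"
  assumes O: "open \<Omega>" and v: "integrable (leb \<Omega>) v" and e: "0 < e"
  shows "\<exists>h B. continuous_on \<Omega> h \<and> (\<forall>x\<in>\<Omega>. norm (h x) \<le> B) \<and> 0 \<le> B \<and> integrable (leb \<Omega>) h \<and>
    (LINT x|leb \<Omega>. norm (v x - h x)) < e"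
proof -
  interpret L: finite_measure "leb \<Omega>" by (rule finite_leb)
  obtain h where h: "continuous_on UNIV h" "bounded (range h)" "(LINT x|leb \<Omega>. norm (h x - v x)) < e"
    using continuous_dense_L1[OF finite_leb sets_leb O v e] by blast
  then obtain B where B: "0 \<le> B" "\<And>x. norm (h x) \<le> B" using boundedD_real[of h UNIV] by auto
  have hO: "continuous_on \<Omega> h" using h(1) continuous_on_subset by blast
  have "integrable (leb \<Omega>) h"
    using B borel_measurable_continuous(2)[OF hO] by (intro L.integrable_const_bound[where B=B]) auto
  then show ?thesis using hO B h(3) by (intro exI[of _ h] exI[of _ B]) (auto simp: norm_minus_commute)
qed

lemma integral_norm_diff_le:
  fixes a b :: "'x \<Rightarrow> 'e::euclidean_space"
  assumes "integrable N a" "integrable N b" "integrable N c"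
    and "\<And>x. x \<in> space N \<Longrightarrow> norm (a x - b x) \<le> c x"
  shows "\<bar>(LINT x|N. norm (a x)) - (LINT x|N. norm (b x))\<bar> \<le> (LINT x|N. c x)"
proof -
  have "\<bar>(LINT x|N. norm (a x)) - (LINT x|N. norm (b x))\<bar> = \<bar>LINT x|N. norm (a x) - norm (b x)\<bar>"
    using assms by simp
  also have "\<dots> \<le> (LINT x|N. \<bar>norm (a x) - norm (b x)\<bar>)" by (rule integral_abs_bound)
  also have "\<dots> \<le> (LINT x|N. c x)"
    using assms by (intro integral_mono) (auto intro: order_trans[OF norm_triangle_ineq3])
  finally show ?thesis .
qed

text \<open>The area of the shifted sequence is the integral of the homogeneous integrand
  \<open>norm (z + t v(x), t)\<close>. It is continuous only for continuous \<open>v\<close>, hence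
  the approximation \<open>h\<close>; the norm being 1-Lipschitz, both sides change by at most the
  distance of \<open>v\<close> and \<open>h\<close>. This carries recovery sequences from the kernel
  to the affine class.\<close>

lemma area_strict_shift:
  fixes s :: "'a \<Rightarrow> 'b::euclidean_space"
  assumes O: "open \<Omega>" and u: "\<And>j. integrable (leb \<Omega>) (u j)" and s: "integrable \<rho> s"
    and conv: "area_strict_conv \<Omega> (\<lambda>j. fun_measure \<Omega> (u j)) (dmeas \<rho> s)"
    and v: "integrable (leb \<Omega>) v"
  shows "area_strict_conv \<Omega> (\<lambda>j. fun_measure \<Omega> (\<lambda>x. v x + u j x)) (dmeas \<rho> (\<lambda>x. t x *\<^sub>R v x + s x))"
proof -
  interpret L: finite_measure "leb \<Omega>" by (rule finite_leb)
  have vm: "v \<in> borel_measurable \<rho>" using borel_measurable_integrable[OF v] unfolding leb_meas .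
  have vu: "integrable (leb \<Omega>) (\<lambda>x. v x + u j x)" for j using v u by simp
  have tv: "integrable \<rho> (\<lambda>x. t x *\<^sub>R v x)" by (rule integrable_scaleR_t[OF v])
  have vs: "integrable \<rho> (\<lambda>x. t x *\<^sub>R v x + s x)" using tv s by simp
  have weak: "(\<lambda>j. LINT x|leb \<Omega>. \<phi> x \<bullet> u j x) \<longlonglongrightarrow> (LINT x|\<rho>. \<phi> x \<bullet> s x)"
    if "continuous_on \<Omega> \<phi>" "bounded (\<phi> ` \<Omega>)" for \<phi>
    using conv that weak_star_conv_fun_measure_iff[where u=u, OF u s] by (simp add: area_strict_conv_def)
  have "weak_star_conv \<Omega> (\<lambda>j. fun_measure \<Omega> (\<lambda>x. v x + u j x)) (dmeas \<rho> (\<lambda>x. t x *\<^sub>R v x + s x))"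
    unfolding weak_star_conv_fun_measure_iff[OF vu vs]
  proof safe
    fix \<phi> :: "'a \<Rightarrow> 'b" assume \<phi>: "continuous_on \<Omega> \<phi>" "bounded (\<phi> ` \<Omega>)"
    obtain B where B: "\<And>x. x \<in> \<Omega> \<Longrightarrow> norm (\<phi> x) \<le> B" using boundedD_real[OF \<phi>(2)] by blast
    note m = borel_measurable_continuous[OF \<phi>(1)]
    have i: "integrable (leb \<Omega>) (\<lambda>x. \<phi> x \<bullet> v x)" "integrable (leb \<Omega>) (\<lambda>x. \<phi> x \<bullet> u j x)"
      "integrable \<rho> (\<lambda>x. \<phi> x \<bullet> s x)" for j
      using B m u s v by (auto intro!: integrable_bounded_inner[where B=B])
    have i': "integrable \<rho> (\<lambda>x. \<phi> x \<bullet> t x *\<^sub>R v x)"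
      using B m by (intro integrable_bounded_inner[OF tv, where B=B]) auto
    have eq: "(LINT x|leb \<Omega>. \<phi> x \<bullet> v x) = (LINT x|\<rho>. \<phi> x \<bullet> t x *\<^sub>R v x)"
      using integral_leb[of "\<lambda>x. \<phi> x \<bullet> v x"] m vm by simp
    have "(\<lambda>j. (LINT x|leb \<Omega>. \<phi> x \<bullet> v x) + (LINT x|leb \<Omega>. \<phi> x \<bullet> u j x)) \<longlonglongrightarrow> (LINT x|leb \<Omega>. \<phi> x \<bullet> v x) + (LINT x|\<rho>. \<phi> x \<bullet> s x)"
      by (intro tendsto_intros weak \<phi>)
    then show "(\<lambda>j. LINT x|leb \<Omega>. \<phi> x \<bullet> (v x + u j x)) \<longlonglongrightarrow> (LINT x|\<rho>. \<phi> x \<bullet> (t x *\<^sub>R v x + s x))"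
      unfolding inner_add_right using i i' unfolding eq[symmetric]
      by (simp add: eq Bochner_Integration.integral_add)
  qed
  moreover have "(\<lambda>j. area \<Omega> (fun_measure \<Omega> (\<lambda>x. v x + u j x)) \<Omega>) \<longlonglongrightarrow> area \<Omega> (dmeas \<rho> (\<lambda>x. t x *\<^sub>R v x + s x)) \<Omega>"
  proof -
    interpret leb: lebesgue_density \<Omega> "leb \<Omega>" "\<lambda>x. 1" by (rule lebesgue_density_leb)
    have au: "area \<Omega> (fun_measure \<Omega> (\<lambda>x. v x + u j x)) \<Omega> = ennreal (LINT x|leb \<Omega>. norm (v x + u j x, 1::real))" for j
      unfolding fun_measure_eq_dmeas by (rule leb.area_dmeas_real[OF vu])
    have "(\<lambda>j. LINT x|leb \<Omega>. norm (v x + u j x, 1::real)) \<longlonglongrightarrow> (LINT x|\<rho>. norm (t x *\<^sub>R v x + s x, t x))"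
    proof (rule tendstoI)
      fix e :: real assume "0 < e"
      then have e3: "0 < e/3" by simp
      obtain h B where h: "continuous_on \<Omega> h" "\<And>x. x \<in> \<Omega> \<Longrightarrow> norm (h x) \<le> B" "0 \<le> B" "integrable (leb \<Omega>) h"
          "(LINT x|leb \<Omega>. norm (v x - h x)) < e/3"
        using ex_continuous_approx[OF O v e3] by blast
      define F where "F x p = norm (fst p + snd p *\<^sub>R h x, snd p)" for x and p :: "'b \<times> real"
      have "(\<lambda>j. LINT x|leb \<Omega>. F x (u j x, 1)) \<longlonglongrightarrow> (LINT x|\<rho>. F x (s x, t x))"
      proof (rule area_strict_reshetnyak[OF O u s conv, where C="2 + B"])
        have "continuous_on (\<Omega> \<times> (UNIV :: ('b \<times> real) set)) (\<lambda>q. h (fst q))"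
          by (rule continuous_on_compose2[OF h(1)]) (auto intro: continuous_intros)
        then show "continuous_on (\<Omega> \<times> UNIV) (\<lambda>(x, p). F x p)"
          unfolding F_def case_prod_unfold by (intro continuous_intros)
        show "F x (c *\<^sub>R p) = c * F x p" if "0 \<le> c" for x c and p :: "'b \<times> real"
        proof -
          have "(fst (c *\<^sub>R p) + snd (c *\<^sub>R p) *\<^sub>R h x, snd (c *\<^sub>R p)) = c *\<^sub>R (fst p + snd p *\<^sub>R h x, snd p)"
            by (simp add: scaleR_add_right)
          then show ?thesis using that by (simp add: F_def del: scaleR_Pair)
        qed
        show "\<bar>F x p\<bar> \<le> (2 + B) * norm p" if "x \<in> \<Omega>" for x and p :: "'b \<times> real"
        proof -
          have "F x p \<le> norm (fst p + snd p *\<^sub>R h x) + \<bar>snd p\<bar>"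
            unfolding F_def using norm_Pair_le[of "fst p + snd p *\<^sub>R h x" "snd p"] by simp
          also have "\<dots> \<le> norm (fst p) + \<bar>snd p\<bar> * norm (h x) + \<bar>snd p\<bar>"
            using norm_triangle_ineq[of "fst p" "snd p *\<^sub>R h x"] by simp
          also have "\<dots> \<le> norm p + norm p * B + norm p"
            using norm_fst_le[of "fst p" "snd p"] norm_snd_le[of "snd p" "fst p"] h(2)[OF that]
            by (intro add_mono mult_mono) auto
          finally show ?thesis by (simp add: F_def algebra_simps)
        qed
      qed
      then have E1: "\<forall>\<^sub>F j in sequentially. dist (LINT x|leb \<Omega>. F x (u j x, 1)) (LINT x|\<rho>. F x (s x, t x)) < e/3"
        using e3 by (rule tendstoD)
      have c2: "\<bar>(LINT x|leb \<Omega>. norm (v x + u j x, 1::real)) - (LINT x|leb \<Omega>. F x (u j x, 1))\<bar> < e/3" for j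
      proof -
        have "\<bar>(LINT x|leb \<Omega>. norm (v x + u j x, 1::real)) - (LINT x|leb \<Omega>. norm (u j x + h x, 1::real))\<bar> \<le> (LINT x|leb \<Omega>. norm (v x - h x))"
          using v u h(4) by (intro integral_norm_diff_le integrable_Pair) (auto simp: norm_Pair)
        then show ?thesis using h(5) by (simp add: F_def)
      qed
      have c3: "\<bar>(LINT x|\<rho>. norm (t x *\<^sub>R v x + s x, t x)) - (LINT x|\<rho>. F x (s x, t x))\<bar> < e/3"
      proof -
        have ih: "integrable \<rho> (\<lambda>x. t x *\<^sub>R h x)" by (rule integrable_scaleR_t[OF h(4)])
        have hm: "h \<in> borel_measurable \<rho>" by (rule borel_measurable_continuous[OF h(1)])
        have "\<bar>(LINT x|\<rho>. norm (t x *\<^sub>R v x + s x, t x)) - (LINT x|\<rho>. norm (s x + t x *\<^sub>R h x, t x))\<bar> \<le> (LINT x|\<rho>. norm (t x *\<^sub>R v x - t x *\<^sub>R h x))"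
          using tv s ih t by (intro integral_norm_diff_le integrable_Pair) (auto simp: norm_Pair)
        also have "\<dots> = (LINT x|leb \<Omega>. norm (v x - h x))"
          using integral_leb[of "\<lambda>x. norm (v x - h x)"] vm hm t(2)
          by (simp add: scaleR_diff_right[symmetric] del: scaleR_diff_right)
        finally show ?thesis using h(5) by (simp add: F_def)
      qed
      show "\<forall>\<^sub>F j in sequentially. dist (LINT x|leb \<Omega>. norm (v x + u j x, 1::real)) (LINT x|\<rho>. norm (t x *\<^sub>R v x + s x, t x)) < e"
        using E1
      proof eventually_elim
        case (elim j)
        then show ?case using c2[of j] c3 unfolding dist_real_def by linarith
      qed
    qed
    then show ?thesis unfolding au area_dmeas_real[OF vs] by (rule tendsto_ennrealI)
  qed
  ultimately show ?thesis
    unfolding area_strict_conv_def by (simp add: area_dmeas_real[OF vs])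
qed

text \<open>Away from the singular part of the limit, area-strict convergence is strong convergence
  to the density.\<close>

lemma area_strict_L1_bound:
  fixes s :: "'a \<Rightarrow> 'b::euclidean_space"
  assumes O: "open \<Omega>" and u: "\<And>j. integrable (leb \<Omega>) (u j)" and s: "integrable \<rho> s"
    and conv: "area_strict_conv \<Omega> (\<lambda>j. fun_measure \<Omega> (u j)) (dmeas \<rho> s)"
    and v: "integrable (leb \<Omega>) v" "AE x in \<rho>. 0 < t x \<longrightarrow> s x = t x *\<^sub>R v x"
    and \<phi>: "continuous_on \<Omega> \<phi>" "\<And>x. x \<in> \<Omega> \<Longrightarrow> 0 \<le> \<phi> x" "\<And>x. x \<in> \<Omega> \<Longrightarrow> \<phi> x \<le> 1" and e: "0 < e"
  shows "\<forall>\<^sub>F j in sequentially. (LINT x|leb \<Omega>. \<phi> x * norm (u j x - v x)) <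
    (LINT x|\<rho>. \<phi> x * norm (if t x = 0 then s x else 0)) + e"
proof -
  have vm: "v \<in> borel_measurable \<rho>" using borel_measurable_integrable[OF v(1)] unfolding leb_meas .
  have e3: "0 < e/3" using e by simp
  obtain h B where h: "continuous_on \<Omega> h" "\<And>x. x \<in> \<Omega> \<Longrightarrow> norm (h x) \<le> B" "0 \<le> B" "integrable (leb \<Omega>) h"
      "(LINT x|leb \<Omega>. norm (v x - h x)) < e/3"
    using ex_continuous_approx[OF O v(1) e3] by blast
  have hm: "h \<in> borel_measurable \<rho>" by (rule borel_measurable_continuous[OF h(1)])
  note \<phi>m = borel_measurable_continuous[OF \<phi>(1)]
  have \<phi>i: "integrable N (\<lambda>x. \<phi> x * k x)" if "integrable N k" "\<phi> \<in> borel_measurable N" "space N = \<Omega>" for N k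
    using \<phi> that by (intro integrable_bounded_mult[where B=1]) auto
  \<comment> \<open>At \<open>(u j x, 1)\<close> this measures the distance to \<open>h x\<close>.
    At \<open>(s x, t x)\<close> it is \<open>\<phi> x * norm (s x)\<close> on the singular set and,
    where \<open>t x > 0\<close>, \<open>\<phi> x * t x\<close> times the distance of
    \<open>v x\<close> and \<open>h x\<close>.\<close>
  define F where "F x p = \<phi> x * norm (fst p - snd p *\<^sub>R h x)" for x and p :: "'b \<times> real"
  have lim: "(\<lambda>j. LINT x|leb \<Omega>. F x (u j x, 1)) \<longlonglongrightarrow> (LINT x|\<rho>. F x (s x, t x))"
  proof (rule area_strict_reshetnyak[OF O u s conv, where C="1 + B"])
    have "continuous_on (\<Omega> \<times> (UNIV :: ('b \<times> real) set)) (\<lambda>q. h (fst q))"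
      "continuous_on (\<Omega> \<times> (UNIV :: ('b \<times> real) set)) (\<lambda>q. \<phi> (fst q))"
      by (rule continuous_on_compose2[OF h(1)] continuous_on_compose2[OF \<phi>(1)]; auto intro: continuous_intros)+
    then show "continuous_on (\<Omega> \<times> UNIV) (\<lambda>(x, p). F x p)"
      unfolding F_def case_prod_unfold by (intro continuous_intros)
    show "F x (c *\<^sub>R p) = c * F x p" if "0 \<le> c" for x c and p :: "'b \<times> real"
    proof -
      have "fst (c *\<^sub>R p) - snd (c *\<^sub>R p) *\<^sub>R h x = c *\<^sub>R (fst p - snd p *\<^sub>R h x)"
        by (simp add: scaleR_diff_right)
      then show ?thesis using that by (simp add: F_def)
    qed
    show "\<bar>F x p\<bar> \<le> (1 + B) * norm p" if "x \<in> \<Omega>" for x and p :: "'b \<times> real"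
    proof -
      have "F x p \<le> 1 * norm (fst p - snd p *\<^sub>R h x)"
        unfolding F_def using \<phi> that by (intro mult_right_mono) auto
      also have "\<dots> \<le> norm (fst p) + \<bar>snd p\<bar> * norm (h x)"
        using norm_triangle_ineq4[of "fst p" "snd p *\<^sub>R h x"] by simp
      also have "\<dots> \<le> norm p + norm p * B"
        using norm_fst_le[of "fst p" "snd p"] norm_snd_le[of "snd p" "fst p"] h(2)[OF that]
        by (intro add_mono mult_mono) auto
      finally show ?thesis using \<phi>(2)[OF that] by (simp add: F_def algebra_simps)
    qed
  qed
  have ih: "integrable \<rho> (\<lambda>x. t x *\<^sub>R h x)" by (rule integrable_scaleR_t[OF h(4)])
  have tv: "integrable \<rho> (\<lambda>x. t x *\<^sub>R v x)" by (rule integrable_scaleR_t[OF v(1)])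
  have sI: "integrable \<rho> (\<lambda>x. if t x = 0 then s x else 0)" by (rule integrable_sing[OF s])
  have "(LINT x|\<rho>. F x (s x, t x)) \<le> (LINT x|\<rho>. \<phi> x * norm (if t x = 0 then s x else 0) + t x * norm (v x - h x))"
  proof (rule integral_mono_AE)
    show "integrable \<rho> (\<lambda>x. F x (s x, t x))"
      unfolding F_def using s ih \<phi>m by (auto intro!: \<phi>i)
    show "integrable \<rho> (\<lambda>x. \<phi> x * norm (if t x = 0 then s x else 0) + t x * norm (v x - h x))"
      using sI \<phi>m integrable_scaleR_t[of "\<lambda>x. norm (v x - h x)"] v h(4)
      by (intro Bochner_Integration.integrable_add \<phi>i integrable_norm) auto
    show "AE x in \<rho>. F x (s x, t x) \<le> \<phi> x * norm (if t x = 0 then s x else 0) + t x * norm (v x - h x)"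
      using v(2) AE_space
    proof eventually_elim
      case (elim x)
      show ?case
      proof (cases "t x = 0")
        case False
        then have tx: "0 < t x" using t(2)[of x] by simp
        have "F x (s x, t x) = \<phi> x * (t x * norm (v x - h x))"
          using elim tx by (simp add: F_def scaleR_diff_right[symmetric] del: scaleR_diff_right)
        also have "\<dots> \<le> 1 * (t x * norm (v x - h x))"
          using \<phi> elim tx by (intro mult_right_mono) auto
        finally show ?thesis using False by simp
      qed (simp add: F_def)
    qed
  qed
  also have "\<dots> = (LINT x|\<rho>. \<phi> x * norm (if t x = 0 then s x else 0)) + (LINT x|\<rho>. t x * norm (v x - h x))"
    using sI \<phi>m integrable_scaleR_t[of "\<lambda>x. norm (v x - h x)"] v h(4)
    by (intro Bochner_Integration.integral_add \<phi>i integrable_norm) auto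
  also have "(LINT x|\<rho>. t x * norm (v x - h x)) = (LINT x|leb \<Omega>. norm (v x - h x))"
    using integral_leb[of "\<lambda>x. norm (v x - h x)"] vm hm by simp
  finally have A: "(LINT x|\<rho>. F x (s x, t x)) < (LINT x|\<rho>. \<phi> x * norm (if t x = 0 then s x else 0)) + e/3"
    using h(5) by simp
  have "\<forall>\<^sub>F j in sequentially. dist (LINT x|leb \<Omega>. F x (u j x, 1)) (LINT x|\<rho>. F x (s x, t x)) < e/3"
    by (rule tendstoD[OF lim e3])
  then show ?thesis
  proof eventually_elim
    case (elim j)
    have "(LINT x|leb \<Omega>. \<phi> x * norm (u j x - v x)) \<le> (LINT x|leb \<Omega>. F x (u j x, 1) + norm (v x - h x))"
    proof (rule integral_mono)
      show "integrable (leb \<Omega>) (\<lambda>x. \<phi> x * norm (u j x - v x))"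
        using u v \<phi>m by (auto intro!: \<phi>i)
      show "integrable (leb \<Omega>) (\<lambda>x. F x (u j x, 1) + norm (v x - h x))"
        unfolding F_def using u v h(4) \<phi>m by (auto intro!: \<phi>i)
      fix x assume "x \<in> space (leb \<Omega>)"
      then have x: "x \<in> \<Omega>" by simp
      have "norm (u j x - v x) \<le> norm (u j x - h x) + norm (v x - h x)"
        using norm_triangle_ineq[of "u j x - h x" "h x - v x"] by (simp add: norm_minus_commute)
      then have "\<phi> x * norm (u j x - v x) \<le> \<phi> x * (norm (u j x - h x) + norm (v x - h x))"
        using \<phi>(2)[OF x] by (rule mult_left_mono)
      also have "\<dots> \<le> \<phi> x * norm (u j x - h x) + 1 * norm (v x - h x)"
        unfolding distrib_left using \<phi>(3)[OF x] by (intro add_left_mono mult_right_mono) auto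
      finally show "\<phi> x * norm (u j x - v x) \<le> F x (u j x, 1) + norm (v x - h x)" by (simp add: F_def)
    qed
    also have "\<dots> = (LINT x|leb \<Omega>. F x (u j x, 1)) + (LINT x|leb \<Omega>. norm (v x - h x))"
      unfolding F_def using u v h(4) \<phi>m by (intro Bochner_Integration.integral_add) (auto intro!: \<phi>i)
    finally show ?case using elim A h(5) unfolding dist_real_def by linarith
  qed
qed

end

section \<open>The relaxed functional as an integral of the perspective\<close>

locale relaxation = lebesgue_density \<Omega> \<rho> t + integrand \<Omega> f M \<omega>
  for \<Omega> :: "'a::euclidean_space set" and \<rho> t and f :: "'a \<Rightarrow> 'b::euclidean_space \<Rightarrow> real" and M \<omega>
begin

lemma persp_integrable:
  assumes s: "integrable \<rho> s"
  shows "integrable \<rho> (\<lambda>x. persp f x (s x, t x))"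
proof (rule Bochner_Integration.integrable_bound[where f="\<lambda>x. 2 * M * norm (s x, t x)"])
  show "integrable \<rho> (\<lambda>x. 2 * M * norm (s x, t x))"
    by (intro integrable_mult_right integrable_norm integrable_Pair s t)
  show "(\<lambda>x. persp f x (s x, t x)) \<in> borel_measurable \<rho>"
    using borel_measurable_integrable[OF integrable_Pair[OF s t(1)]]
    by (rule measurable_Caratheodory[OF persp_continuous sets_rho])
  show "AE x in \<rho>. norm (persp f x (s x, t x)) \<le> norm (2 * M * norm (s x, t x))"
    using persp_bounds M by (intro AE_I2) auto
qed

text \<open>A factor depending on \<open>x\<close> alone does not disturb homogeneity. The localised
  form is what identifies limit measures and not merely their total mass.\<close>

lemma energy_tendsto:
  assumes u: "\<And>j. integrable (leb \<Omega>) (u j)" and s: "integrable \<rho> s"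
    and conv: "area_strict_conv \<Omega> (\<lambda>j. fun_measure \<Omega> (u j)) (dmeas \<rho> s)"
    and \<phi>: "continuous_on \<Omega> \<phi>" "bounded (\<phi> ` \<Omega>)"
  shows "(\<lambda>j. LINT x|leb \<Omega>. \<phi> x * f x (u j x)) \<longlonglongrightarrow> (LINT x|\<rho>. \<phi> x * persp f x (s x, t x))"
proof -
  obtain B where B: "0 \<le> B" "\<And>x. x \<in> \<Omega> \<Longrightarrow> norm (\<phi> x) \<le> B" using boundedD_real[OF \<phi>(2)] by blast
  have "(\<lambda>j. LINT x|leb \<Omega>. \<phi> x * persp f x (u j x, 1)) \<longlonglongrightarrow> (LINT x|\<rho>. \<phi> x * persp f x (s x, t x))"
  proof (rule area_strict_reshetnyak[OF O u s conv, where C="B * (2 * M)"])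
    have "continuous_on (\<Omega> \<times> (UNIV :: ('b \<times> real) set)) (\<lambda>q. \<phi> (fst q))"
      by (rule continuous_on_compose2[OF \<phi>(1)]) (auto intro: continuous_intros)
    then show "continuous_on (\<Omega> \<times> UNIV) (\<lambda>(x, p). \<phi> x * persp f x p)"
      using persp_continuous unfolding case_prod_unfold by (intro continuous_intros)
    show "\<phi> x * persp f x (c *\<^sub>R p) = c * (\<phi> x * persp f x p)" if "x \<in> \<Omega>" "0 \<le> c" for x c p
      using persp_scale[OF that] by simp
    show "\<bar>\<phi> x * persp f x p\<bar> \<le> B * (2 * M) * norm p" if "x \<in> \<Omega>" for x p
      using mult_mono[OF B(2)[OF that] persp_bounds(2)[OF that, of p]] B(1) by (simp add: abs_mult)
  qed
  then show ?thesis by simp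
qed

text \<open>Homogeneity absorbs the weights: \<open>t * f x (s / t)\<close> on
  \<open>{t > 0}\<close> and \<open>norm s\<close> times the recession function at
  \<open>s / norm s\<close> on \<open>{t = 0}\<close> are the two branches of the perspective at
  \<open>(s, t)\<close>.\<close>

lemma relaxed_dmeas:
  assumes s: "integrable \<rho> s"
  shows "relaxed \<Omega> f (dmeas \<rho> s) = ennreal (LINT x|\<rho>. persp f x (s x, t x))"
proof -
  let ?d = "dens (leb \<Omega>) (dmeas \<rho> s)"
  let ?s = "\<lambda>x. if t x = 0 then s x else 0"
  have [measurable]: "s \<in> borel_measurable \<rho>" using s by auto
  have dm: "?d \<in> borel_measurable \<rho>"
    using borel_measurable_integrable[OF dens_leb(1)[OF s]] unfolding leb_meas .
  have fdm: "(\<lambda>x. f x (?d x)) \<in> borel_measurable \<rho>"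
    by (rule measurable_Caratheodory[OF cont sets_rho dm])
  have pm: "(\<lambda>x. persp f x (s x, t x)) \<in> borel_measurable \<rho>"
    using persp_integrable[OF s] by simp
  have "(\<integral>\<^sup>+x. ennreal (f x (?d x)) \<partial>leb \<Omega>) = (\<integral>\<^sup>+x. ennreal (t x) * ennreal (f x (?d x)) \<partial>\<rho>)"
    using fdm by (intro nn_integral_leb) auto
  also have "\<dots> = (\<integral>\<^sup>+x. ennreal (if t x = 0 then 0 else persp f x (s x, t x)) \<partial>\<rho>)"
  proof (rule nn_integral_cong_AE)
    show "AE x in \<rho>. ennreal (t x) * ennreal (f x (?d x)) = ennreal (if t x = 0 then 0 else persp f x (s x, t x))"
      using dens_leb(2)[OF s] AE_space
    proof eventually_elim
      case (elim x)
      then show ?case using t(2)[of x] nn[of x] by (auto simp: persp_def ennreal_mult less_le)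
    qed
  qed
  finally have 1: "(\<integral>\<^sup>+x. ennreal (f x (?d x)) \<partial>leb \<Omega>) = (\<integral>\<^sup>+x. ennreal (if t x = 0 then 0 else persp f x (s x, t x)) \<partial>\<rho>)" .
  let ?N = "density \<rho> (\<lambda>x. ennreal (norm (?s x)))"
  have sv: "sing_variation \<Omega> (dmeas \<rho> s) = ?N"
    unfolding sing_part_dmeas[OF s] total_variation_dmeas[OF sets_rho integrable_sing[OF s]] ..
  let ?e = "dens ?N (dmeas \<rho> ?s)"
  note e = dens_dmeas[OF fin sets_rho integrable_sing[OF s] integrable_norm[OF integrable_sing[OF s]] norm_ge_zero]
  have em: "?e \<in> borel_measurable \<rho>"
    using borel_measurable_integrable[OF e(1)] by simp
  have rm: "(\<lambda>x. recession f x (?e x)) \<in> borel_measurable \<rho>"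
    by (rule measurable_Caratheodory[OF recession_continuous sets_rho em])
  have "(\<integral>\<^sup>+x. ennreal (recession f x (?e x)) \<partial>?N) = (\<integral>\<^sup>+x. ennreal (norm (?s x)) * ennreal (recession f x (?e x)) \<partial>\<rho>)"
    using rm by (intro nn_integral_density) auto
  also have "\<dots> = (\<integral>\<^sup>+x. ennreal (if t x = 0 then persp f x (s x, t x) else 0) \<partial>\<rho>)"
  proof (rule nn_integral_cong_AE)
    show "AE x in \<rho>. ennreal (norm (?s x)) * ennreal (recession f x (?e x)) = ennreal (if t x = 0 then persp f x (s x, t x) else 0)"
      using e(3) AE_space
    proof eventually_elim
      case (elim x)
      then have x: "x \<in> \<Omega>" by simp
      show ?case
      proof (cases "?s x = 0")
        case True
        then show ?thesis using recession_scale[OF x, of 0 0] by (auto split: if_splits)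
      next
        case False
        then have tx: "t x = 0" "s x \<noteq> 0" by (auto split: if_splits)
        then have "recession f x (?e x) = inverse (norm (s x)) * recession f x (s x)"
          using elim recession_scale[OF x, of "inverse (norm (s x))" "s x"] by simp
        then show ?thesis using tx recession_bounds(1)[OF x, of "s x"] by (simp add: ennreal_mult[symmetric])
      qed
    qed
  qed
  finally have 2: "(\<integral>\<^sup>+x. ennreal (recession f x (dens (sing_variation \<Omega> (dmeas \<rho> s)) (sing_part \<Omega> (dmeas \<rho> s)) x)) \<partial>sing_variation \<Omega> (dmeas \<rho> s))
     = (\<integral>\<^sup>+x. ennreal (if t x = 0 then persp f x (s x, t x) else 0) \<partial>\<rho>)"
    unfolding sv unfolding sing_part_dmeas[OF s] .
  have "relaxed \<Omega> f (dmeas \<rho> s) = (\<integral>\<^sup>+x. ennreal (if t x = 0 then 0 else persp f x (s x, t x)) + ennreal (if t x = 0 then persp f x (s x, t x) else 0) \<partial>\<rho>)"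
    unfolding relaxed_def 1 2 using pm by (intro nn_integral_add[symmetric]) auto
  also have "\<dots> = (\<integral>\<^sup>+x. ennreal (persp f x (s x, t x)) \<partial>\<rho>)"
    by (intro nn_integral_cong) auto
  also have "\<dots> = ennreal (LINT x|\<rho>. persp f x (s x, t x))"
    using persp_integrable[OF s] persp_bounds(1) by (intro nn_integral_eq_integral) auto
  finally show ?thesis .
qed

end

lemma (in integrand) relaxation_leb:
  assumes "finite_measure (leb \<Omega>)"
  shows "relaxation \<Omega> (leb \<Omega>) (\<lambda>x. 1) f M \<omega>"
  by (intro relaxation.intro leb_lebesgue_density[OF assms] integrand_axioms)

section \<open>Hahn--Banach extension on integrable functions\<close>

text \<open>Integrable functions are kept as functions rather than as classes. The pointwise vector
  space structure makes \<open>subspace\<close> and the Hahn-Banach theorem applicable to them; the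
  integral of the norm is then only a seminorm.\<close>

instantiation "fun" :: (type, real_vector) real_vector
begin

definition scaleR_fun :: "real \<Rightarrow> ('a \<Rightarrow> 'b) \<Rightarrow> 'a \<Rightarrow> 'b"
  where "scaleR_fun c f = (\<lambda>x. c *\<^sub>R f x)"

instance
  by standard (auto simp: scaleR_fun_def fun_eq_iff algebra_simps)

end

lemma scaleR_fun_apply [simp]: "(c *\<^sub>R f) x = c *\<^sub>R f x"
  by (simp add: scaleR_fun_def)

lemma le_cINF_add:
  fixes a :: "'i \<Rightarrow> real" and b :: "'j \<Rightarrow> real"
  assumes "A \<noteq> {}" "B \<noteq> {}" and le: "\<And>i j. i \<in> A \<Longrightarrow> j \<in> B \<Longrightarrow> x \<le> a i + b j"
  shows "x \<le> (INF i\<in>A. a i) + (INF j\<in>B. b j)"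
proof -
  have "x - (INF i\<in>A. a i) \<le> b j" if "j \<in> B" for j
  proof -
    have "x - b j \<le> (INF i\<in>A. a i)"
      using le that by (intro cINF_greatest assms) (auto simp: algebra_simps)
    then show ?thesis by simp
  qed
  then have "x - (INF i\<in>A. a i) \<le> (INF j\<in>B. b j)" by (intro cINF_greatest assms)
  then show ?thesis by simp
qed

text \<open>For positive factors an inequality is enough as a requirement: applied with the inverse
  factor it gives equality.\<close>

definition sublinear_on :: "'v::real_vector set \<Rightarrow> ('v \<Rightarrow> real) \<Rightarrow> bool"
  where "sublinear_on L q \<longleftrightarrow> (\<forall>f\<in>L. \<forall>g\<in>L. q (f + g) \<le> q f + q g) \<and> (\<forall>f\<in>L. \<forall>c>0. q (c *\<^sub>R f) \<le> c * q f)"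

lemma sublinear_onD:
  assumes "sublinear_on L q" "subspace L"
  shows "\<And>f g. f \<in> L \<Longrightarrow> g \<in> L \<Longrightarrow> q (f + g) \<le> q f + q g"
    and "\<And>f c. f \<in> L \<Longrightarrow> 0 \<le> c \<Longrightarrow> q (c *\<^sub>R f) = c * q f"
    and "q 0 = 0"
    and "\<And>f. f \<in> L \<Longrightarrow> - q (- f) \<le> q f"
proof -
  show add: "q (f + g) \<le> q f + q g" if "f \<in> L" "g \<in> L" for f g
    using assms that by (auto simp: sublinear_on_def)
  have le: "q (c *\<^sub>R f) \<le> c * q f" if "f \<in> L" "0 < c" for f c
    using assms that by (auto simp: sublinear_on_def)
  have pos: "q (c *\<^sub>R f) = c * q f" if f: "f \<in> L" "0 < c" for f c
  proof -
    have "q (inverse c *\<^sub>R (c *\<^sub>R f)) \<le> inverse c * q (c *\<^sub>R f)"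
      using f assms(2) by (intro le) (auto simp: subspace_scale)
    then have "q f \<le> inverse c * q (c *\<^sub>R f)" using f by simp
    then have "c * q f \<le> q (c *\<^sub>R f)" using f by (simp add: field_simps)
    with le[OF f] show ?thesis by simp
  qed
  show 0: "q 0 = 0" using pos[of 0 2] assms(2) by (simp add: subspace_0)
  show "q (c *\<^sub>R f) = c * q f" if "f \<in> L" "0 \<le> c" for f c
    using pos[of f c] 0 that by (cases "c = 0") auto
  show "- q (- f) \<le> q f" if "f \<in> L" for f
    using add[of f "- f"] 0 that assms(2) by (simp add: subspace_neg)
qed

text \<open>By Zorn's lemma there is a minimal sublinear functional below \<open>p\<close>; minimality against
  \<open>h \<mapsto> inf {q (h + t k) - t q k | t \<ge> 0}\<close> makes it additive.\<close>

theorem hahn_banach_sublinear: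
  fixes p :: "'v::real_vector \<Rightarrow> real"
  assumes L: "subspace L" and p: "sublinear_on L p"
  shows "\<exists>q. (\<forall>f\<in>L. \<forall>g\<in>L. q (f + g) = q f + q g) \<and> (\<forall>f\<in>L. \<forall>c. q (c *\<^sub>R f) = c * q f) \<and> (\<forall>f\<in>L. q f \<le> p f)"
proof -
  \<comment> \<open>Without the normalisation off \<open>L\<close>, values there could be lowered
    indefinitely and chains in the pointwise order would have no lower bound.\<close>
  define S where "S = {q. sublinear_on L q \<and> (\<forall>f\<in>L. q f \<le> p f) \<and> (\<forall>f. f \<notin> L \<longrightarrow> q f = (0::real))}"
  define P where "P q r \<longleftrightarrow> (\<forall>f. r f \<le> q f)" for q r :: "'v \<Rightarrow> real"
  have Lneg: "- f \<in> L" if "f \<in> L" for f using L that by (rule subspace_neg)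
  \<comment> \<open>A lower bound common to all members of \<open>S\<close> makes infima over chains
    finite.\<close>
  have low: "- p (- f) \<le> q f" if "q \<in> S" "f \<in> L" for q f
  proof -
    have "- q (- f) \<le> q f" using sublinear_onD(4)[OF _ L, of q f] that by (auto simp: S_def)
    moreover have "q (- f) \<le> p (- f)" using that Lneg by (auto simp: S_def)
    ultimately show ?thesis by simp
  qed
  have "\<exists>m\<in>S. \<forall>a\<in>S. P m a \<longrightarrow> a = m"
  proof (rule predicate_Zorn)
    show "partial_order_on S (relation_of P S)"
      unfolding P_def
      by (intro partial_order_on_relation_ofI) (auto intro: order_trans intro!: ext antisym)
    fix C assume C: "C \<in> Chains (relation_of P S)"
    then have CS: "C \<subseteq> S" by (auto simp: Chains_def relation_of_def)
    have Cc: "(\<forall>f. q f \<le> r f) \<or> (\<forall>f. r f \<le> q f)" if "q \<in> C" "r \<in> C" for q r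
      using C that by (auto simp: Chains_def relation_of_def P_def)
    show "\<exists>u\<in>S. \<forall>a\<in>C. P a u"
    proof (cases "C = {}")
      case True
      have "(\<lambda>f. if f \<in> L then p f else 0) \<in> S"
        using p L by (auto simp: S_def sublinear_on_def subspace_add subspace_scale)
      then show ?thesis using True by auto
    next
      case False
      define r where "r f = (if f \<in> L then INF q\<in>C. q f else 0)" for f
      have bdd: "bdd_below ((\<lambda>q. q f) ` C)" if "f \<in> L" for f
        using low CS that by (intro bdd_belowI2[where m="- p (- f)"]) auto
      have rq: "r f \<le> q f" if "q \<in> C" for q f
        using that CS bdd by (auto simp: r_def S_def intro!: cINF_lower)
      have "r \<in> S"
      proof -
        have "r (f + g) \<le> r f + r g" if fg: "f \<in> L" "g \<in> L" for f g
        proof -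
          have "r (f + g) \<le> (INF q\<in>C. q f) + (INF q\<in>C. q g)"
          proof (rule le_cINF_add[OF False False])
            fix q q' assume q: "q \<in> C" "q' \<in> C"
            have sub: "q'' (f + g) \<le> q'' f + q'' g" if "q'' \<in> C" for q''
              using that CS fg by (auto simp: S_def sublinear_on_def)
            \<comment> \<open>Two members of a chain are comparable, so the smaller one serves in
              both summands.\<close>
            from Cc[OF q] show "r (f + g) \<le> q f + q' g"
            proof
              assume "\<forall>f. q f \<le> q' f"
              then show ?thesis using rq[OF q(1), of "f + g"] sub[OF q(1)] by (smt (verit))
            next
              assume "\<forall>f. q' f \<le> q f"
              then show ?thesis using rq[OF q(2), of "f + g"] sub[OF q(2)] by (smt (verit))
            qed
          qed
          then show ?thesis using fg by (simp add: r_def)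
        qed
        moreover have "r (c *\<^sub>R f) \<le> c * r f" if f: "f \<in> L" "0 < c" for f c
        proof -
          have "inverse c * r (c *\<^sub>R f) \<le> (INF q\<in>C. q f)"
          proof (rule cINF_greatest[OF False])
            fix q assume q: "q \<in> C"
            have "r (c *\<^sub>R f) \<le> c * q f"
              using rq[OF q, of "c *\<^sub>R f"] q CS f by (force simp: S_def sublinear_on_def)
            then show "inverse c * r (c *\<^sub>R f) \<le> q f" using f by (simp add: field_simps)
          qed
          then show ?thesis using f by (simp add: r_def field_simps)
        qed
        moreover have "r f \<le> p f" if "f \<in> L" for f
        proof -
          obtain q where "q \<in> C" using False by auto
          then show ?thesis using rq[of q f] CS that by (force simp: S_def)
        qed
        ultimately show ?thesis by (auto simp: S_def sublinear_on_def r_def)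
      qed
      then show ?thesis using rq by (auto simp: P_def)
    qed
  qed
  then obtain q where q: "q \<in> S" and min: "\<And>a. a \<in> S \<Longrightarrow> (\<And>f. a f \<le> q f) \<Longrightarrow> a = q"
    by (auto simp: P_def)
  have qs: "sublinear_on L q" using q by (simp add: S_def)
  note qD = sublinear_onD[OF qs L]
  have add: "q (f + k) = q f + q k" if f: "f \<in> L" and k: "k \<in> L" for f k
  proof -
    define a where "a h = (if h \<in> L then INF t\<in>{0..}. q (h + t *\<^sub>R k) - t * q k else 0)" for h
    have ne: "{0::real..} \<noteq> {}" by auto
    have Lk: "h + t *\<^sub>R k \<in> L" if "h \<in> L" for h t using that k L by (simp add: subspace_add subspace_scale)
    have lb: "- q (- h) \<le> q (h + t *\<^sub>R k) - t * q k" if "h \<in> L" "0 \<le> t" for h t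
      using qD(1)[OF Lk[OF that(1), of t] Lneg[OF that(1)]] qD(2)[OF k that(2)] by simp
    have bdd: "bdd_below ((\<lambda>t. q (h + t *\<^sub>R k) - t * q k) ` {0..})" if "h \<in> L" for h
      using lb that by (intro bdd_belowI2[where m="- q (- h)"]) auto
    have ale: "a h \<le> q (h + t *\<^sub>R k) - t * q k" if "h \<in> L" "0 \<le> t" for h t
      using that bdd by (auto simp: a_def intro!: cINF_lower)
    have aq: "a h \<le> q h" for h
      using ale[of h 0] q by (cases "h \<in> L") (auto simp: a_def S_def)
    have "a \<in> S"
    proof -
      have "a (g + h) \<le> a g + a h" if gh: "g \<in> L" "h \<in> L" for g h
      proof -
        have "a (g + h) \<le> (INF t\<in>{0..}. q (g + t *\<^sub>R k) - t * q k) + (INF t\<in>{0..}. q (h + t *\<^sub>R k) - t * q k)"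
        proof (rule le_cINF_add[OF ne ne])
          fix s t :: real assume st: "s \<in> {0..}" "t \<in> {0..}"
          have "a (g + h) \<le> q ((g + h) + (s + t) *\<^sub>R k) - (s + t) * q k"
            using gh st L by (intro ale) (auto simp: subspace_add)
          also have "(g + h) + (s + t) *\<^sub>R k = (g + s *\<^sub>R k) + (h + t *\<^sub>R k)" by (simp add: algebra_simps)
          also have "q \<dots> \<le> q (g + s *\<^sub>R k) + q (h + t *\<^sub>R k)" by (intro qD Lk gh)
          finally show "a (g + h) \<le> (q (g + s *\<^sub>R k) - s * q k) + (q (h + t *\<^sub>R k) - t * q k)"
            by (simp add: algebra_simps)
        qed
        then show ?thesis using gh by (simp add: a_def)
      qed
      moreover have "a (c *\<^sub>R h) \<le> c * a h" if h: "h \<in> L" "0 < c" for h c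
      proof -
        have "inverse c * a (c *\<^sub>R h) \<le> (INF t\<in>{0..}. q (h + t *\<^sub>R k) - t * q k)"
        proof (rule cINF_greatest[OF ne])
          fix t :: real assume t: "t \<in> {0..}"
          have "a (c *\<^sub>R h) \<le> q (c *\<^sub>R h + (c * t) *\<^sub>R k) - (c * t) * q k"
            using h t L by (intro ale) (auto simp: subspace_scale)
          also have "c *\<^sub>R h + (c * t) *\<^sub>R k = c *\<^sub>R (h + t *\<^sub>R k)" by (simp add: algebra_simps)
          also have "q \<dots> = c * q (h + t *\<^sub>R k)" using h by (intro qD Lk) auto
          finally have "a (c *\<^sub>R h) \<le> c * (q (h + t *\<^sub>R k) - t * q k)" by (simp add: algebra_simps)
          then show "inverse c * a (c *\<^sub>R h) \<le> q (h + t *\<^sub>R k) - t * q k"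
            using h by (simp add: field_simps)
        qed
        then show ?thesis using h by (simp add: a_def field_simps)
      qed
      moreover have "a h \<le> p h" if "h \<in> L" for h
        using aq[of h] q that by (force simp: S_def)
      ultimately show ?thesis by (auto simp: S_def sublinear_on_def a_def)
    qed
    then have "a = q" using aq by (intro min)
    \<comment> \<open>The competitor \<open>t = 1\<close> in the infimum that defines
      \<open>a f = q f\<close>.\<close>
    then have "q f + q k \<le> q (f + k)" using ale[OF f, of 1] by simp
    with qD(1)[OF f k] show ?thesis by simp
  qed
  have neg: "q (- f) = - q f" if "f \<in> L" for f
    using add[OF that Lneg[OF that]] qD(3) by simp
  have "q (c *\<^sub>R f) = c * q f" if f: "f \<in> L" for f c
  proof (cases "0 \<le> c")
    case False
    then have "q ((- c) *\<^sub>R (- f)) = (- c) * q (- f)" by (intro qD(2) Lneg f) auto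
    then show ?thesis using neg[OF f] by simp
  qed (use qD(2)[OF f] in auto)
  with add q show ?thesis by (intro exI[of _ q]) (auto simp: S_def)
qed

section \<open>The dual of the space of integrable functions\<close>

lemma subspace_L1: "subspace (L1 \<Omega> :: ('a::euclidean_space \<Rightarrow> 'b::euclidean_space) set)"
  unfolding subspace_def L1_def by (auto simp: plus_fun_def zero_fun_def scaleR_fun_def)

lemma linear_on_sum:
  assumes L: "subspace L" and ell: "\<And>f g. f \<in> L \<Longrightarrow> g \<in> L \<Longrightarrow> ell (f + g) = ell f + (ell g :: real)"
    and B: "finite B" "\<And>b. b \<in> B \<Longrightarrow> f b \<in> L"
  shows "ell (\<Sum>b\<in>B. f b) = (\<Sum>b\<in>B. ell (f b))"
  using B
proof (induction B)
  case empty
  have "ell (0 + 0) = ell 0 + ell 0" using L by (intro ell) (auto simp: subspace_0)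
  then show ?case by simp
next
  case (insert b B)
  then show ?case using L by (simp add: ell subspace_sum)
qed

lemma sum_fun_apply: "(\<Sum>b\<in>B. f b) x = (\<Sum>b\<in>B. f b x)"
  by (induction B rule: infinite_finite_induct) auto

text \<open>The values of \<open>ell\<close> on indicators times a basis vector form a set function
  that is dominated by a multiple of Lebesgue measure, hence countably additive. Radon-Nikodym gives
  bounded densities, and approximation by simple functions extends the formula.\<close>

theorem L1_dual:
  fixes ell :: "('a::euclidean_space \<Rightarrow> 'b::euclidean_space) \<Rightarrow> real"
  assumes fin: "finite_measure (leb \<Omega>)"
    and add: "\<And>f g. f \<in> L1 \<Omega> \<Longrightarrow> g \<in> L1 \<Omega> \<Longrightarrow> ell (f + g) = ell f + ell g"
    and scale: "\<And>f c. f \<in> L1 \<Omega> \<Longrightarrow> ell (c *\<^sub>R f) = c * ell f"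
    and bd: "\<And>f. f \<in> L1 \<Omega> \<Longrightarrow> ell f \<le> C * (LINT x|leb \<Omega>. norm (f x))"
  shows "\<exists>g\<in>Linf \<Omega>. \<forall>f\<in>L1 \<Omega>. ell f = (LINT x|leb \<Omega>. g x \<bullet> f x)"
proof -
  interpret finite_measure "leb \<Omega>" by fact
  let ?N = "\<lambda>f::'a \<Rightarrow> 'b. LINT x|leb \<Omega>. norm (f x)"
  define K where "K = max 1 C"
  have K: "1 \<le> K" by (simp add: K_def)
  have abs_bd: "\<bar>ell f\<bar> \<le> K * ?N f" if f: "f \<in> L1 \<Omega>" for f
  proof -
    have "- f \<in> L1 \<Omega>" using subspace_neg[OF subspace_L1 f] .
    then have "ell (- f) \<le> C * ?N f" using bd[of "- f"] by simp
    moreover have "ell (- f) = - ell f" using scale[OF f, of "-1"] by simp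
    moreover have "C * ?N f \<le> K * ?N f" by (intro mult_right_mono) (auto simp: K_def)
    ultimately show ?thesis using bd[OF f] by linarith
  qed
  define I :: "'a set \<Rightarrow> 'b \<Rightarrow> 'a \<Rightarrow> 'b" where "I E b = (\<lambda>x. indicator E x *\<^sub>R b)" for E b
  have IL: "I E b \<in> L1 \<Omega>" if "E \<in> borel_on \<Omega>" for E b
    using that unfolding I_def L1_def mem_Collect_eq
    by (intro integrable_scaleR_left integrable_real_indicator)
      (simp_all add: sets_leb emeasure_finite less_top[symmetric])
  have IN: "?N (I E b) = measure (leb \<Omega>) E" if "E \<in> borel_on \<Omega>" "b \<in> Basis" for E b
  proof -
    have "E \<in> sets (leb \<Omega>)" using that by (simp add: sets_leb)
    then have "E \<inter> space (leb \<Omega>) = E" by (rule sets.Int_space_eq2)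
    then show ?thesis using that(2) unfolding I_def by simp
  qed
  define \<tau> where "\<tau> b E = (if E \<in> borel_on \<Omega> then ell (I E b) else 0)" for b E
  interpret sa: sigma_algebra \<Omega> "borel_on \<Omega>" by (rule sigma_algebra_borel_on)
  have rad: "\<tau> b \<in> radon_measures \<Omega>" if b: "b \<in> Basis" for b
    unfolding radon_measures_def
  proof safe
    fix E assume "E \<notin> borel_on \<Omega>" then show "\<tau> b E = 0" by (simp add: \<tau>_def)
  next
    fix A :: "nat \<Rightarrow> 'a set" assume A: "range A \<subseteq> borel_on \<Omega>" "disjoint_family A"
    have Ai: "A i \<in> borel_on \<Omega>" for i using A by auto
    have U: "(\<Union>i. A i) \<in> borel_on \<Omega>" using A by auto
    have Un: "(\<Union>i<n. A i) \<in> borel_on \<Omega>" for n using A by auto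
    have fs: "(\<Sum>i<n. ell (I (A i) b)) = ell (I (\<Union>i<n. A i) b)" for n
    proof -
      have "I (\<Union>i<n. A i) b = (\<Sum>i<n. I (A i) b)"
        using A(2) by (auto simp: fun_eq_iff I_def sum_fun_apply scaleR_sum_left[symmetric]
           indicator_UN_disjoint disjoint_family_on_def)
      moreover have "ell (\<Sum>i<n. I (A i) b) = (\<Sum>i<n. ell (I (A i) b))"
        by (rule linear_on_sum[where L="L1 \<Omega>"]) (rule subspace_L1 add IL Ai finite_lessThan | assumption)+
      ultimately show ?thesis by simp
    qed
    have lim: "(\<lambda>n. K * (measure (leb \<Omega>) (\<Union>i. A i) - (\<Sum>i<n. measure (leb \<Omega>) (A i)))) \<longlonglongrightarrow> K * (measure (leb \<Omega>) (\<Union>i. A i) - measure (leb \<Omega>) (\<Union>i. A i))"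
      using finite_measure_UNION[of A] A unfolding sums_def sets_leb by (intro tendsto_intros) auto
    \<comment> \<open>The difference is the value on the tail of the union, and the Lebesgue measure
      of the tail tends to 0.\<close>
    have "(\<lambda>n. \<tau> b (\<Union>i. A i) - (\<Sum>i<n. \<tau> b (A i))) \<longlonglongrightarrow> 0"
    proof (rule Lim_null_comparison)
      show "(\<lambda>n. K * (measure (leb \<Omega>) (\<Union>i. A i) - (\<Sum>i<n. measure (leb \<Omega>) (A i)))) \<longlonglongrightarrow> 0" using lim by simp
      show "\<forall>\<^sub>F n in sequentially. norm (\<tau> b (\<Union>i. A i) - (\<Sum>i<n. \<tau> b (A i))) \<le> K * (measure (leb \<Omega>) (\<Union>i. A i) - (\<Sum>i<n. measure (leb \<Omega>) (A i)))"
      proof (rule always_eventually, rule allI)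
        fix n
        let ?D = "(\<Union>i. A i) - (\<Union>i<n. A i)"
        have D: "?D \<in> borel_on \<Omega>" using U Un by auto
        have "I (\<Union>i. A i) b = I ?D b + I (\<Union>i<n. A i) b"
          by (auto simp: fun_eq_iff I_def split: split_indicator)
        then have "ell (I (\<Union>i. A i) b) = ell (I ?D b) + ell (I (\<Union>i<n. A i) b)"
          using add[OF IL[OF D] IL[OF Un]] by simp
        then have "norm (\<tau> b (\<Union>i. A i) - (\<Sum>i<n. \<tau> b (A i))) = \<bar>ell (I ?D b)\<bar>"
          using U Ai by (simp add: \<tau>_def fs)
        also have "\<dots> \<le> K * measure (leb \<Omega>) ?D" using abs_bd[OF IL[OF D, of b]] IN[OF D b] by simp
        also have "measure (leb \<Omega>) ?D = measure (leb \<Omega>) (\<Union>i. A i) - measure (leb \<Omega>) (\<Union>i<n. A i)"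
          using U Un by (intro finite_measure_Diff) (auto simp: sets_leb)
        also have "measure (leb \<Omega>) (\<Union>i<n. A i) = (\<Sum>i<n. measure (leb \<Omega>) (A i))"
          using A by (intro finite_measure_finite_Union) (auto simp: sets_leb disjoint_family_on_def)
        finally show "norm (\<tau> b (\<Union>i. A i) - (\<Sum>i<n. \<tau> b (A i))) \<le> K * (measure (leb \<Omega>) (\<Union>i. A i) - (\<Sum>i<n. measure (leb \<Omega>) (A i)))" .
      qed
    qed
    from tendsto_diff[OF tendsto_const[of "\<tau> b (\<Union>i. A i)"] this]
    show "(\<lambda>i. \<tau> b (A i)) sums \<tau> b (\<Union>i. A i)" by (simp add: sums_def)
  qed
  have "\<exists>d. integrable (leb \<Omega>) d \<and> (AE x in leb \<Omega>. \<bar>d x\<bar> \<le> K) \<and> (\<forall>E\<in>borel_on \<Omega>. \<tau> b E = (LINT x:E|leb \<Omega>. d x))"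
    if b: "b \<in> Basis" for b
  proof -
    \<comment> \<open>The affine change moves a set function between \<open>- K\<close> and
      \<open>K\<close> times Lebesgue measure to one between 0 and Lebesgue measure, where
      \<open>radon_nikodym_le\<close> applies; it is undone by
      \<open>2 * K * D x - K\<close>.\<close>
    define \<nu> where "\<nu> E = (\<tau> b E + K * measure (leb \<Omega>) E) / (2 * K)" for E
    have tb: "\<bar>\<tau> b E\<bar> \<le> K * measure (leb \<Omega>) E" if "E \<in> borel_on \<Omega>" for E
      using abs_bd[OF IL[OF that, of b]] IN[OF that b] that by (simp add: \<tau>_def)
    have \<nu>r: "\<nu> \<in> radon_measures \<Omega>"
      using rad[OF b] finite_measure_radon[OF fin sets_leb] unfolding radon_measures_def \<nu>_def
      by (auto intro!: sums_divide sums_add sums_mult)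
    have \<nu>0: "0 \<le> \<nu> E" "\<nu> E \<le> measure (leb \<Omega>) E" if "E \<in> borel_on \<Omega>" for E
      using tb[OF that] K by (auto simp: \<nu>_def field_simps abs_le_iff)
    obtain Q where Q: "finite_measure Q" "sets Q = borel_on \<Omega>" "\<And>E. E \<in> borel_on \<Omega> \<Longrightarrow> emeasure Q E = ennreal (\<nu> E)"
      using nonneg_radon_measure[OF \<nu>r] \<nu>0 by blast
    have "\<exists>D. integrable (leb \<Omega>) D \<and> (\<forall>x. 0 \<le> D x) \<and> Q = density (leb \<Omega>) (\<lambda>x. ennreal (D x)) \<and>
        (\<forall>E\<in>sets (leb \<Omega>). measure Q E = (LINT x:E|leb \<Omega>. D x))"
      using Q \<nu>0 by (intro radon_nikodym_le fin) (auto simp: sets_leb emeasure_eq_measure ennreal_leI)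
    then obtain D where D: "integrable (leb \<Omega>) D" "\<And>x. 0 \<le> D x"
      "\<And>E. E \<in> borel_on \<Omega> \<Longrightarrow> measure Q E = (LINT x:E|leb \<Omega>. D x)" by (auto simp: sets_leb)
    have D\<nu>: "(LINT x:E|leb \<Omega>. D x) = \<nu> E" if "E \<in> borel_on \<Omega>" for E
      using D(3)[OF that] Q(3)[OF that] \<nu>0[OF that] by (simp add: measure_def)
    have c: "(LINT x:E|leb \<Omega>. (c::real)) = c * measure (leb \<Omega>) E" if "E \<in> borel_on \<Omega>" for E c
    proof -
      have "E \<in> sets (leb \<Omega>)" using that by (simp add: sets_leb)
      then have "E \<inter> space (leb \<Omega>) = E" by (rule sets.Int_space_eq2)
      then show ?thesis by (simp add: set_lebesgue_integral_def)
    qed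
    have si: "set_integrable (leb \<Omega>) E D" "set_integrable (leb \<Omega>) E (\<lambda>x. c::real)" if "E \<in> borel_on \<Omega>" for E c
      using that D(1) by (auto intro!: integrable_set_integrable simp: sets_leb)
    have "AE x in leb \<Omega>. 0 \<le> 1 - D x"
    proof (rule density_nonneg)
      show "0 \<le> (LINT x:E|leb \<Omega>. 1 - D x)" if "E \<in> sets (leb \<Omega>)" for E
        using that si[of E] \<nu>0[of E] by (simp add: sets_leb set_integral_diff D\<nu> c)
    qed (use D(1) in auto)
    then have "AE x in leb \<Omega>. \<bar>2 * K * D x - K\<bar> \<le> K"
    proof eventually_elim
      case (elim x)
      have "0 \<le> K * D x" "K * D x \<le> K * 1" using elim D(2)[of x] K by (auto intro!: mult_left_mono)
      then show ?case by (simp add: abs_le_iff)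
    qed
    moreover have "\<tau> b E = (LINT x:E|leb \<Omega>. 2 * K * D x - K)" if "E \<in> borel_on \<Omega>" for E
    proof -
      have "(LINT x:E|leb \<Omega>. 2 * K * D x - K) = 2 * K * (LINT x:E|leb \<Omega>. D x) - (LINT x:E|leb \<Omega>. K)"
        using si[OF that] by (subst set_integral_diff) auto
      then show ?thesis using K that by (simp add: D\<nu> c \<nu>_def)
    qed
    ultimately show ?thesis using D(1) by (intro exI[of _ "\<lambda>x. 2 * K * D x - K"]) auto
  qed
  then obtain d where d: "\<And>b. b \<in> Basis \<Longrightarrow> integrable (leb \<Omega>) (d b)" "\<And>b. b \<in> Basis \<Longrightarrow> AE x in leb \<Omega>. \<bar>d b x\<bar> \<le> K"
    "\<And>b E. b \<in> Basis \<Longrightarrow> E \<in> borel_on \<Omega> \<Longrightarrow> \<tau> b E = (LINT x:E|leb \<Omega>. d b x)" by metis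
  define g where "g x = (\<Sum>b\<in>Basis. d b x *\<^sub>R b)" for x :: 'a
  have gm: "g \<in> borel_measurable (leb \<Omega>)" unfolding g_def using d(1) by auto
  have gb: "g x \<bullet> b = d b x" if "b \<in> Basis" for x b
    unfolding g_def using that by (simp add: inner_sum_left inner_Basis if_distrib cong: if_cong)
  have "AE x in leb \<Omega>. \<forall>b\<in>Basis. \<bar>d b x\<bar> \<le> K" using d(2) by (intro AE_finite_allI) auto
  then have gB: "AE x in leb \<Omega>. norm (g x) \<le> K * DIM('b)"
  proof eventually_elim
    case (elim x)
    have "norm (g x) \<le> (\<Sum>b\<in>Basis. \<bar>g x \<bullet> b\<bar>)" by (rule norm_le_l1)
    also have "\<dots> \<le> (\<Sum>b\<in>(Basis::'b set). K)" using elim by (intro sum_mono) (simp add: gb)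
    finally show ?case by (simp add: mult.commute)
  qed
  have gL: "g \<in> Linf \<Omega>" using gm gB by (auto simp: Linf_def)
  have igf: "integrable (leb \<Omega>) (\<lambda>x. g x \<bullet> f x)" if "integrable (leb \<Omega>) f" for f
  proof (rule Bochner_Integration.integrable_bound[where f="\<lambda>x. (K * DIM('b)) * norm (f x)"])
    show "AE x in leb \<Omega>. norm (g x \<bullet> f x) \<le> norm (K * DIM('b) * norm (f x))"
      using gB
    proof eventually_elim
      case (elim x)
      have "\<bar>g x \<bullet> f x\<bar> \<le> norm (g x) * norm (f x)" by (rule Cauchy_Schwarz_ineq2)
      also have "\<dots> \<le> (K * DIM('b)) * norm (f x)" using elim by (intro mult_right_mono) auto
      finally show ?case using K by simp
    qed
  qed (use that gm in auto)
  have "ell f = (LINT x|leb \<Omega>. g x \<bullet> f x)" if "integrable (leb \<Omega>) f" for f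
    using that
  proof (induction f rule: integrable_induct)
    case (base A c)
    then have A: "A \<in> borel_on \<Omega>" by (simp add: sets_leb)
    note add = assms(2)
    have e1: "(\<lambda>x. indicator A x *\<^sub>R c) = (\<Sum>b\<in>Basis. (c \<bullet> b) *\<^sub>R I A b)"
    proof
      fix x
      have "(\<Sum>b\<in>Basis. (c \<bullet> b) *\<^sub>R I A b) x = indicator A x *\<^sub>R (\<Sum>b\<in>Basis. (c \<bullet> b) *\<^sub>R b)"
        by (simp add: sum_fun_apply I_def scaleR_sum_right mult.commute)
      then show "indicator A x *\<^sub>R c = (\<Sum>b\<in>Basis. (c \<bullet> b) *\<^sub>R I A b) x" by (simp add: euclidean_representation)
    qed
    have "ell (\<lambda>x. indicator A x *\<^sub>R c) = (\<Sum>b\<in>Basis. ell ((c \<bullet> b) *\<^sub>R I A b))"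
      unfolding e1
      by (rule linear_on_sum[where L="L1 \<Omega>"])
        (rule subspace_L1 add IL[OF A] finite_Basis subspace_scale[OF subspace_L1] | assumption)+
    also have "\<dots> = (\<Sum>b\<in>Basis. (c \<bullet> b) * (LINT x:A|leb \<Omega>. d b x))"
      using IL[OF A] A d(3) by (intro sum.cong) (auto simp: scale \<tau>_def)
    also have "\<dots> = (\<Sum>b\<in>Basis. LINT x|leb \<Omega>. indicator A x * (d b x * (c \<bullet> b)))"
      unfolding set_lebesgue_integral_def integral_mult_right_zero[symmetric]
      by (intro sum.cong Bochner_Integration.integral_cong) (auto simp: mult_ac)
    also have "\<dots> = (LINT x|leb \<Omega>. (\<Sum>b\<in>Basis. indicator A x * (d b x * (c \<bullet> b))))"
    proof (rule Bochner_Integration.integral_sum[symmetric])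
      fix b :: 'b assume "b \<in> Basis"
      then show "integrable (leb \<Omega>) (\<lambda>x. indicator A x * (d b x * (c \<bullet> b)))"
        using integrable_mult_indicator[OF base(1), of "\<lambda>x. d b x * (c \<bullet> b)"] d(1) by simp
    qed
    also have "\<dots> = (LINT x|leb \<Omega>. g x \<bullet> (indicator A x *\<^sub>R c))"
    proof (rule Bochner_Integration.integral_cong[OF refl])
      fix x
      have "g x \<bullet> c = (\<Sum>b\<in>Basis. d b x * (c \<bullet> b))"
        unfolding g_def inner_sum_left by (simp add: inner_commute[of _ c])
      then show "(\<Sum>b\<in>Basis. indicator A x * (d b x * (c \<bullet> b))) = g x \<bullet> (indicator A x *\<^sub>R c)"
        by (simp add: sum_distrib_left)
    qed
    finally show ?case .
  next
    case (add f h)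
    then have "ell (f + h) = ell f + ell h" by (intro assms(2)) (auto simp: L1_def)
    then show ?case using add igf by (simp add: plus_fun_def inner_add_right)
  next
    case (lim f s)
    have sL: "s i \<in> L1 \<Omega>" "f \<in> L1 \<Omega>" for i using lim.hyps by (auto simp: L1_def)
    have l1: "(\<lambda>i. LINT x|leb \<Omega>. norm (s i x - f x)) \<longlonglongrightarrow> (LINT x|leb \<Omega>. 0)"
    proof (rule integral_dominated_convergence[where w="\<lambda>x. 3 * norm (f x)"])
      show "AE x in leb \<Omega>. (\<lambda>i. norm (s i x - f x)) \<longlonglongrightarrow> 0"
      proof (rule AE_I2)
        fix x assume "x \<in> space (leb \<Omega>)"
        then have "(\<lambda>i. norm (s i x - f x)) \<longlonglongrightarrow> norm (f x - f x)" by (intro tendsto_intros lim.hyps)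
        then show "(\<lambda>i. norm (s i x - f x)) \<longlonglongrightarrow> 0" by simp
      qed
      show "AE x in leb \<Omega>. norm (norm (s i x - f x)) \<le> 3 * norm (f x)" for i
      proof (rule AE_I2)
        fix x assume "x \<in> space (leb \<Omega>)"
        then show "norm (norm (s i x - f x)) \<le> 3 * norm (f x)"
          using lim.hyps(3)[of x i] norm_triangle_ineq4[of "s i x" "f x"] by simp
      qed
    qed (use lim.hyps in auto)
    let ?T = "\<lambda>h. ell h - (LINT x|leb \<Omega>. g x \<bullet> h x)"
    have "\<bar>ell f - (LINT x|leb \<Omega>. g x \<bullet> f x)\<bar> \<le> (K + K * DIM('b)) * (LINT x|leb \<Omega>. norm (s i x - f x))" for i
    proof -
      have "s i = f + (s i + (-1) *\<^sub>R f)" by (simp add: fun_eq_iff)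
      then have "ell (s i) = ell f + ell (s i + (-1) *\<^sub>R f)"
        using assms(2)[of f "s i + (-1) *\<^sub>R f"] sL subspace_L1 by (metis subspace_add subspace_scale)
      moreover have "\<bar>ell (s i + (-1) *\<^sub>R f)\<bar> \<le> K * (LINT x|leb \<Omega>. norm (s i x - f x))"
        using abs_bd[of "s i - f"] subspace_diff[OF subspace_L1 sL] by simp
      moreover have "\<bar>(LINT x|leb \<Omega>. g x \<bullet> s i x) - (LINT x|leb \<Omega>. g x \<bullet> f x)\<bar> \<le> (K * DIM('b)) * (LINT x|leb \<Omega>. norm (s i x - f x))"
      proof -
        have "(LINT x|leb \<Omega>. g x \<bullet> s i x) - (LINT x|leb \<Omega>. g x \<bullet> f x) = (LINT x|leb \<Omega>. g x \<bullet> (s i x - f x))"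
          using igf lim.hyps by (simp add: inner_diff_right)
        also have "\<bar>\<dots>\<bar> \<le> (LINT x|leb \<Omega>. \<bar>g x \<bullet> (s i x - f x)\<bar>)" by (rule integral_abs_bound)
        also have "\<dots> \<le> (LINT x|leb \<Omega>. (K * DIM('b)) * norm (s i x - f x))"
        proof (rule integral_mono_AE)
          show "AE x in leb \<Omega>. \<bar>g x \<bullet> (s i x - f x)\<bar> \<le> K * real DIM('b) * norm (s i x - f x)"
            using gB
          proof eventually_elim
            case (elim x)
            have "\<bar>g x \<bullet> (s i x - f x)\<bar> \<le> norm (g x) * norm (s i x - f x)" by (rule Cauchy_Schwarz_ineq2)
            also have "\<dots> \<le> (K * DIM('b)) * norm (s i x - f x)" using elim by (intro mult_right_mono) auto
            finally show ?case .
          qed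
        qed (use igf lim.hyps in auto)
        finally show ?thesis by simp
      qed
      ultimately show ?thesis using lim.IH[of i] by (simp add: distrib_right abs_le_iff)
    qed
    moreover have "(\<lambda>i. (K + K * DIM('b)) * (LINT x|leb \<Omega>. norm (s i x - f x))) \<longlonglongrightarrow> (K + K * DIM('b)) * 0"
      using l1 by (intro tendsto_intros) simp
    ultimately have "\<bar>ell f - (LINT x|leb \<Omega>. g x \<bullet> f x)\<bar> \<le> 0"
      by (intro LIMSEQ_le_const[where X="\<lambda>i. (K + K * DIM('b)) * (LINT x|leb \<Omega>. norm (s i x - f x))"]) auto
    then show ?case by simp
  qed
  then show ?thesis using gL by (intro bexI[of _ g]) (auto simp: L1_def)
qed

corollary L1_hahn_banach:
  fixes p :: "('a::euclidean_space \<Rightarrow> 'b::euclidean_space) \<Rightarrow> real"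
  assumes fin: "finite_measure (leb \<Omega>)" and p: "sublinear_on (L1 \<Omega>) p"
    and bd: "\<And>f. f \<in> L1 \<Omega> \<Longrightarrow> p f \<le> C * (LINT x|leb \<Omega>. norm (f x))"
  shows "\<exists>g\<in>Linf \<Omega>. \<forall>f\<in>L1 \<Omega>. (LINT x|leb \<Omega>. g x \<bullet> f x) \<le> p f"
proof -
  obtain q where q: "\<And>f g. f\<in>L1 \<Omega> \<Longrightarrow> g\<in>L1 \<Omega> \<Longrightarrow> q (f + g) = q f + q g"
      "\<And>f c. f\<in>L1 \<Omega> \<Longrightarrow> q (c *\<^sub>R f) = c * q f" "\<And>f. f\<in>L1 \<Omega> \<Longrightarrow> q f \<le> p f"
    using hahn_banach_sublinear[OF subspace_L1 p] by blast
  then have "\<exists>g\<in>Linf \<Omega>. \<forall>f\<in>L1 \<Omega>. q f = (LINT x|leb \<Omega>. g x \<bullet> f x)"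
    using q(3) bd by (intro L1_dual[OF fin, where C=C]) (auto intro: order_trans[OF q(3)])
  then obtain g where "g \<in> Linf \<Omega>" "\<forall>f\<in>L1 \<Omega>. q f = (LINT x|leb \<Omega>. g x \<bullet> f x)" by blast
  then show ?thesis using q(3) by (intro bexI[of _ g]) auto
qed

text \<open>\<open>p\<close> is the infimal convolution of \<open>T\<close> on \<open>V\<close> with
  \<open>C\<close> times the seminorm. A linear functional below \<open>p\<close> is below
  \<open>T\<close> on \<open>V\<close>, and as \<open>V\<close> contains \<open>- f\<close> along
  with \<open>f\<close>, it equals \<open>T\<close> there.\<close>

corollary L1_extension:
  fixes T :: "('a::euclidean_space \<Rightarrow> 'b::euclidean_space) \<Rightarrow> real"
  assumes fin: "finite_measure (leb \<Omega>)" and V: "subspace V" "V \<subseteq> L1 \<Omega>"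
    and add: "\<And>f g. f \<in> V \<Longrightarrow> g \<in> V \<Longrightarrow> T (f + g) = T f + T g"
    and scale: "\<And>f c. f \<in> V \<Longrightarrow> T (c *\<^sub>R f) = c * T f"
    and bd: "\<And>f. f \<in> V \<Longrightarrow> T f \<le> C * (LINT x|leb \<Omega>. norm (f x))" and C: "0 \<le> C"
  shows "\<exists>g\<in>Linf \<Omega>. \<forall>f\<in>V. T f = (LINT x|leb \<Omega>. g x \<bullet> f x)"
proof -
  let ?N = "\<lambda>f::'a \<Rightarrow> 'b. LINT x|leb \<Omega>. norm (f x)"
  have Nadd: "?N (f + g) \<le> ?N f + ?N g" if "f \<in> L1 \<Omega>" "g \<in> L1 \<Omega>" for f g
  proof -
    have "?N (f + g) \<le> (LINT x|leb \<Omega>. norm (f x) + norm (g x))"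
      using that by (intro integral_mono) (auto simp: L1_def norm_triangle_ineq)
    then show ?thesis using that by (simp add: L1_def)
  qed
  have Nscale: "?N (c *\<^sub>R f) = \<bar>c\<bar> * ?N f" for c f by simp
  define p where "p h = (INF v\<in>V. T v + C * ?N (h - v))" for h
  have ne: "V \<noteq> {}" using subspace_0[OF V(1)] by auto
  have Vm: "h - v \<in> L1 \<Omega>" if "h \<in> L1 \<Omega>" "v \<in> V" for h v
    using that V subspace_diff[OF subspace_L1] by blast
  have T0: "T 0 = 0" using scale[of 0 0] subspace_0[OF V(1)] by simp
  have lb: "- C * ?N h \<le> T v + C * ?N (h - v)" if h: "h \<in> L1 \<Omega>" "v \<in> V" for h v
  proof -
    have "- T v \<le> C * ?N v"
      using bd[of "(-1) *\<^sub>R v"] scale[OF h(2), of "-1"] subspace_neg[OF V(1) h(2)] by simp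
    moreover have "?N v \<le> ?N h + ?N (h - v)"
    proof -
      have "?N (h + (- 1) *\<^sub>R (h - v)) \<le> ?N h + ?N ((- 1) *\<^sub>R (h - v))"
        by (intro Nadd h subspace_scale[OF subspace_L1] Vm)
      then show ?thesis unfolding Nscale[of "-1" "h - v"] by simp
    qed
    then have "C * ?N v \<le> C * (?N h + ?N (h - v))" using C by (rule mult_left_mono)
    ultimately show ?thesis by (simp add: algebra_simps)
  qed
  have bdd: "bdd_below ((\<lambda>v. T v + C * ?N (h - v)) ` V)" if "h \<in> L1 \<Omega>" for h
    using lb[OF that] by (intro bdd_belowI2[where m="- C * ?N h"]) auto
  have ple: "p h \<le> T v + C * ?N (h - v)" if "h \<in> L1 \<Omega>" "v \<in> V" for h v
    unfolding p_def using bdd[OF that(1)] that(2) by (rule cINF_lower)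
  have "sublinear_on (L1 \<Omega>) p"
    unfolding sublinear_on_def
  proof safe
    fix f g :: "'a \<Rightarrow> 'b" assume fg: "f \<in> L1 \<Omega>" "g \<in> L1 \<Omega>"
    show "p (f + g) \<le> p f + p g"
      unfolding p_def[of f] p_def[of g]
    proof (rule le_cINF_add[OF ne ne])
      fix v v' assume v: "v \<in> V" "v' \<in> V"
      have e: "(f + g) - (v + v') = (f - v) + (g - v')" by simp
      have "p (f + g) \<le> T (v + v') + C * ?N ((f + g) - (v + v'))"
        using fg v V(1) by (intro ple subspace_add subspace_L1)
      moreover have "C * ?N ((f - v) + (g - v')) \<le> C * (?N (f - v) + ?N (g - v'))"
        using C Nadd[OF Vm[OF fg(1) v(1)] Vm[OF fg(2) v(2)]] by (rule mult_left_mono[rotated])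
      ultimately show "p (f + g) \<le> (T v + C * ?N (f - v)) + (T v' + C * ?N (g - v'))"
        unfolding e add[OF v] distrib_left by linarith
    qed
  next
    fix f :: "'a \<Rightarrow> 'b" and c :: real assume f: "f \<in> L1 \<Omega>" and c: "0 < c"
    have "inverse c * p (c *\<^sub>R f) \<le> p f"
      unfolding p_def[of f]
    proof (rule cINF_greatest[OF ne])
      fix v assume v: "v \<in> V"
      have e: "c *\<^sub>R f - c *\<^sub>R v = c *\<^sub>R (f - v)" by (simp only: scaleR_diff_right)
      have "p (c *\<^sub>R f) \<le> T (c *\<^sub>R v) + C * ?N (c *\<^sub>R f - c *\<^sub>R v)"
        using f v V(1) by (intro ple subspace_scale subspace_L1)
      then have "p (c *\<^sub>R f) \<le> c * (T v + C * ?N (f - v))"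
        unfolding e scale[OF v] Nscale using c by (simp only: abs_of_pos distrib_left mult.left_commute)
      then show "inverse c * p (c *\<^sub>R f) \<le> T v + C * ?N (f - v)"
        unfolding inverse_eq_divide using c by (simp only: divide_le_eq times_divide_eq_left mult_1 if_True mult.commute)
    qed
    then show "p (c *\<^sub>R f) \<le> c * p f" using c by (simp add: field_simps)
  qed
  moreover have "p h \<le> C * ?N h" if "h \<in> L1 \<Omega>" for h
    using ple[OF that subspace_0[OF V(1)]] T0 by simp
  ultimately obtain g where g: "g \<in> Linf \<Omega>" "\<And>f. f \<in> L1 \<Omega> \<Longrightarrow> (LINT x|leb \<Omega>. g x \<bullet> f x) \<le> p f"
    using L1_hahn_banach[OF fin] by blast
  have le: "(LINT x|leb \<Omega>. g x \<bullet> f x) \<le> T f" if "f \<in> V" for f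
    using g(2)[of f] ple[of f f] that V(2) by force
  have "T f = (LINT x|leb \<Omega>. g x \<bullet> f x)" if f: "f \<in> V" for f
    using le[OF f] le[of "(-1) *\<^sub>R f"] scale[OF f, of "-1"] subspace_neg[OF V(1) f] by simp
  then show ?thesis using g(1) by blast
qed

section \<open>Differential operators and their weak formulation\<close>

lemma partial_eq:
  assumes "(g has_derivative g') (at x)"
  shows "partial b g x = g' b"
  using frechet_derivative_at[OF assms] by (simp add: partial_def)

lemma has_derivative_cong_open:
  assumes "open S" "x \<in> S" "\<And>x. x \<in> S \<Longrightarrow> f x = g x"
  shows "(f has_derivative f') (at x) \<longleftrightarrow> (g has_derivative f') (at x)"
  using assms by (metis has_derivative_transform_within_open)

lemma partial_cong:
  assumes "open S" "x \<in> S" "\<And>x. x \<in> S \<Longrightarrow> f x = g x"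
  shows "partial b f x = partial b g x"
  using has_derivative_cong_open[OF assms] by (simp add: partial_def frechet_derivative_def)

text \<open>As \<open>S\<close> is open, derivatives at its points depend on the values in
  \<open>S\<close> only; coefficients meaningful on \<open>\<Omega>\<close> alone can thus be
  combined freely.\<close>

lemma Ck_on_cong:
  assumes S: "open S" and eq: "\<And>x. x \<in> S \<Longrightarrow> f x = g x"
  shows "Ck_on k S f \<longleftrightarrow> Ck_on k S g"
  using eq
proof (induction k arbitrary: f g)
  case 0
  then show ?case by (auto intro: continuous_on_cong)
next
  case (Suc k)
  have "f differentiable at x \<longleftrightarrow> g differentiable at x" if "x \<in> S" for x
    using has_derivative_cong_open[OF S that Suc.prems] by (simp add: differentiable_def)
  moreover have "Ck_on k S (partial b f) \<longleftrightarrow> Ck_on k S (partial b g)" for b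
    using partial_cong[OF S _ Suc.prems] by (intro Suc.IH) auto
  ultimately show ?case by auto
qed

lemma Ck_on_continuous_on: "Ck_on k S g \<Longrightarrow> continuous_on S g"
  by (cases k) (auto intro!: continuous_at_imp_continuous_on differentiable_imp_continuous_within)

lemma Ck_on_Suc_imp: "Ck_on (Suc k) S g \<Longrightarrow> Ck_on k S g"
proof (induction k arbitrary: g)
  case 0
  then show ?case by (metis Ck_on.simps(1) Ck_on_continuous_on)
next
  case (Suc k)
  then show ?case by (metis Ck_on.simps(2))
qed

lemma Ck_on_subset: "Ck_on k S g \<Longrightarrow> T \<subseteq> S \<Longrightarrow> Ck_on k T g"
  by (induction k arbitrary: g) (auto intro: continuous_on_subset)

lemma Ck_on_Un: "open S \<Longrightarrow> open T \<Longrightarrow> Ck_on k S g \<Longrightarrow> Ck_on k T g \<Longrightarrow> Ck_on k (S \<union> T) g"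
  by (induction k arbitrary: g) (auto intro: continuous_on_open_Un)

lemma Ck_on_const: "Ck_on k S (\<lambda>x. c)"
proof (induction k arbitrary: c)
  case (Suc k)
  have "partial b (\<lambda>x. c) = (\<lambda>x. 0)" for b :: 'a
    using partial_eq[OF has_derivative_const] by auto
  then show ?case using Suc by simp
qed simp

lemma Ck_on_bounded_linear:
  assumes S: "open S" and L: "bounded_linear L"
  shows "Ck_on k S g \<Longrightarrow> Ck_on k S (\<lambda>x. L (g x))"
proof (induction k arbitrary: g)
  case 0
  then show ?case using bounded_linear.continuous_on[OF L] by auto
next
  case (Suc k)
  have d: "((\<lambda>x. L (g x)) has_derivative (\<lambda>h. L (frechet_derivative g (at x) h))) (at x)" if "x \<in> S" for x
    using Suc.prems that by (intro bounded_linear.has_derivative[OF L]) (auto simp: frechet_derivative_works)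
  have "Ck_on k S (partial b (\<lambda>x. L (g x)))" if "b \<in> Basis" for b
  proof -
    have "Ck_on k S (\<lambda>x. L (partial b g x))" using Suc that by auto
    then show ?thesis
      by (rule Ck_on_cong[OF S, THEN iffD1, rotated]) (simp add: partial_eq[OF d], simp add: partial_def)
  qed
  then show ?case using d by (auto simp: differentiable_def)
qed

lemma Ck_on_add:
  assumes S: "open S"
  shows "Ck_on k S f \<Longrightarrow> Ck_on k S g \<Longrightarrow> Ck_on k S (\<lambda>x. f x + g x)"
proof (induction k arbitrary: f g)
  case 0
  then show ?case by (auto intro: continuous_intros)
next
  case (Suc k)
  have d: "((\<lambda>x. f x + g x) has_derivative (\<lambda>h. frechet_derivative f (at x) h + frechet_derivative g (at x) h)) (at x)"
    if "x \<in> S" for x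
    using Suc.prems that by (intro has_derivative_add) (auto simp: frechet_derivative_works)
  have "Ck_on k S (partial b (\<lambda>x. f x + g x))" if "b \<in> Basis" for b
  proof -
    have "Ck_on k S (\<lambda>x. partial b f x + partial b g x)" using Suc that by auto
    then show ?thesis
      by (rule Ck_on_cong[OF S, THEN iffD1, rotated]) (simp add: partial_eq[OF d], simp add: partial_def)
  qed
  then show ?case using d by (auto simp: differentiable_def)
qed

lemma Ck_on_sum:
  assumes "open S" "\<And>i. i \<in> I \<Longrightarrow> Ck_on k S (f i)"
  shows "Ck_on k S (\<lambda>x. \<Sum>i\<in>I. f i x)"
  using assms(2)
  by (induction I rule: infinite_finite_induct) (auto intro: Ck_on_const Ck_on_add[OF assms(1)])

lemma Ck_on_bilinear:
  assumes S: "open S" and B: "bounded_bilinear B"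
  shows "Ck_on k S f \<Longrightarrow> Ck_on k S g \<Longrightarrow> Ck_on k S (\<lambda>x. B (f x) (g x))"
proof (induction k arbitrary: f g)
  case 0
  then show ?case using bounded_bilinear.continuous_on[OF B] by auto
next
  case (Suc k)
  have d: "((\<lambda>x. B (f x) (g x)) has_derivative
      (\<lambda>h. B (f x) (frechet_derivative g (at x) h) + B (frechet_derivative f (at x) h) (g x))) (at x)"
    if "x \<in> S" for x
    using Suc.prems that by (intro bounded_bilinear.FDERIV[OF B]) (auto simp: frechet_derivative_works)
  have "Ck_on k S (partial b (\<lambda>x. B (f x) (g x)))" if "b \<in> Basis" for b
  proof -
    have "Ck_on k S (\<lambda>x. B (f x) (partial b g x) + B (partial b f x) (g x))"
      using Suc.prems that Ck_on_Suc_imp[OF Suc.prems(1)] Ck_on_Suc_imp[OF Suc.prems(2)]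
      by (intro Ck_on_add[OF S] Suc.IH) auto
    then show ?thesis
      by (rule Ck_on_cong[OF S, THEN iffD1, rotated]) (simp add: partial_eq[OF d], simp add: partial_def)
  qed
  then show ?case using d by (auto simp: differentiable_def)
qed

lemma Ck_on_prod:
  fixes f :: "'i \<Rightarrow> 'a::euclidean_space \<Rightarrow> real"
  assumes "open S" "\<And>i. i \<in> I \<Longrightarrow> Ck_on k S (f i)"
  shows "Ck_on k S (\<lambda>x. \<Prod>i\<in>I. f i x)"
  using assms(2)
  by (induction I rule: infinite_finite_induct)
    (auto intro: Ck_on_const Ck_on_bilinear[OF assms(1) bounded_bilinear_mult])

lemma Ck_on_partials:
  assumes "set bs \<subseteq> Basis"
  shows "Ck_on (n + length bs) S g \<Longrightarrow> Ck_on n S (partials bs g)"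
  using assms
proof (induction bs arbitrary: n)
  case (Cons b bs)
  have "Ck_on (Suc n) S (partials bs g)"
    using Cons.prems by (intro Cons.IH) auto
  then show ?case using Cons.prems by (simp add: partials_def)
qed (simp add: partials_def)

text \<open>Differentiation does not enlarge supports: \<open>S\<close> will be the complement of a
  compact support.\<close>

lemma partials_zero_open:
  assumes S: "open S" and 0: "\<And>x. x \<in> S \<Longrightarrow> g x = 0"
  shows "x \<in> S \<Longrightarrow> partials bs g x = 0"
proof (induction bs arbitrary: x)
  case (Cons b bs)
  have "partial b (partials bs g) x = partial b (\<lambda>x. 0) x"
    using Cons by (intro partial_cong[OF S]) auto
  also have "\<dots> = 0" using partial_eq[OF has_derivative_const] by auto
  finally show ?case by (simp add: partials_def)
qed (simp add: partials_def 0)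

text \<open>In coordinates the adjoint is a finite sum of expressions bilinear in \<open>A\<close>
  and \<open>w\<close>, so that smoothness in \<open>x\<close> follows from the closure properties
  of \<open>Ck_on\<close>.\<close>

lemma adjoint_blinfun_apply:
  fixes A :: "'b::euclidean_space \<Rightarrow>\<^sub>L 'c::euclidean_space"
  shows "adjoint (blinfun_apply A) w = (\<Sum>i\<in>Basis. (blinfun_apply A i \<bullet> w) *\<^sub>R i)"
proof -
  have "adjoint (blinfun_apply A) w \<bullet> i = blinfun_apply A i \<bullet> w" for i
    using adjoint_works[of "blinfun_apply A" i w] by (simp add: inner_commute blinfun.bounded_linear_right bounded_linear.linear)
  then show ?thesis
    using euclidean_representation[of "adjoint (blinfun_apply A) w"] by simp
qed

lemma test_functionsD:
  assumes "\<phi> \<in> test_functions \<Omega>"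
  shows "\<exists>K. compact K \<and> K \<subseteq> \<Omega> \<and> (\<forall>x. x \<notin> K \<longrightarrow> \<phi> x = 0) \<and> (\<forall>k. Ck_on k UNIV \<phi>)"
proof (intro exI[of _ "closure {x. \<phi> x \<noteq> 0}"] conjI allI impI)
  show "\<phi> x = 0" if "x \<notin> closure {x. \<phi> x \<noteq> 0}" for x
    using closure_subset[of "{x. \<phi> x \<noteq> 0}"] that by auto
qed (use assms in \<open>auto simp: test_functions_def\<close>)

lemma compact_support_bounded:
  fixes g :: "'a::euclidean_space \<Rightarrow> 'b::euclidean_space"
  assumes K: "compact K" "K \<subseteq> S" and g: "continuous_on S g" and 0: "\<And>x. x \<in> S \<Longrightarrow> x \<notin> K \<Longrightarrow> g x = 0"
  shows "\<exists>B. \<forall>x\<in>S. norm (g x) \<le> B"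
proof -
  have "bounded (g ` K)"
    using compact_continuous_image[OF continuous_on_subset[OF g K(2)] K(1)] by (rule compact_imp_bounded)
  then obtain B where B: "\<And>x. x \<in> K \<Longrightarrow> norm (g x) \<le> B" by (auto simp: bounded_iff)
  have "norm (g x) \<le> max 0 B" if "x \<in> S" for x
    using B[of x] 0[of x] that by (cases "x \<in> K") (auto simp: le_max_iff_disj)
  then show ?thesis by blast
qed

text \<open>Finiteness of \<open>leb \<Omega>\<close> is a locale assumption here; for the final
  theorem it is derived from (H2).\<close>

locale diff_operator =
  fixes \<Omega> :: "'a::euclidean_space set" and k :: nat
    and a :: "'a list \<Rightarrow> 'a \<Rightarrow> ('b::euclidean_space \<Rightarrow>\<^sub>L 'c::euclidean_space)"
  assumes O: "open \<Omega>" and adm: "admissible_coeffs \<Omega> k a" and fin: "finite_measure (leb \<Omega>)"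
begin

sublocale L: finite_measure "leb \<Omega>" by (rule fin)

lemma coeff_Ck: "bs \<in> deriv_lists k \<Longrightarrow> Ck_on (length bs) \<Omega> (a bs)"
  using adm by (simp add: admissible_coeffs_def)

lemma deriv_lists_Basis: "bs \<in> deriv_lists k \<Longrightarrow> set bs \<subseteq> Basis"
  by (simp add: deriv_lists_def)

definition adj_term :: "'a list \<Rightarrow> ('a \<Rightarrow> 'c) \<Rightarrow> 'a \<Rightarrow> 'b"
  where "adj_term bs \<phi> = (\<lambda>y. adjoint (blinfun_apply (a bs y)) (\<phi> y))"

text \<open>The coefficients are differentiable on \<open>\<Omega>\<close> only. The term is of the
  required class there and vanishes on the open complement of the support of \<open>\<phi>\<close>;
  the two open sets cover the space.\<close>

lemma adj_term_Ck:
  assumes \<phi>: "\<phi> \<in> test_functions \<Omega>" and bs: "bs \<in> deriv_lists k"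
  shows "Ck_on (length bs) UNIV (adj_term bs \<phi>)"
proof -
  obtain K where K: "compact K" "K \<subseteq> \<Omega>" "\<And>x. x \<notin> K \<Longrightarrow> \<phi> x = 0" "\<And>k. Ck_on k UNIV \<phi>"
    using test_functionsD[OF \<phi>] by blast
  have 1: "Ck_on (length bs) \<Omega> (adj_term bs \<phi>)"
    unfolding adj_term_def adjoint_blinfun_apply
    by (intro Ck_on_sum O Ck_on_bounded_linear[OF O bounded_linear_scaleR_left]
        Ck_on_bilinear[OF O bounded_bilinear_inner]
        Ck_on_bounded_linear[OF O blinfun.bounded_linear_left] coeff_Ck bs Ck_on_subset[OF K(4)]) auto
  have c: "open (- K)" using K(1) by (simp add: compact_imp_closed open_Compl)
  have 2: "Ck_on (length bs) (- K) (adj_term bs \<phi>)"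
  proof (rule Ck_on_cong[OF c, THEN iffD1])
    show "0 = adj_term bs \<phi> x" if "x \<in> - K" for x
      using K(3)[of x] that by (simp add: adj_term_def adjoint_blinfun_apply)
  qed (rule Ck_on_const)
  have "\<Omega> \<union> - K = UNIV" using K(2) by auto
  then show ?thesis using Ck_on_Un[OF O c 1 2] by simp
qed

lemma formal_adjoint_eq:
  "formal_adjoint k a \<phi> x = (\<Sum>bs\<in>deriv_lists k. (-1) ^ length bs *\<^sub>R partials bs (adj_term bs \<phi>) x)"
  by (simp add: formal_adjoint_def adj_term_def)

lemma adj_term_zero:
  assumes "\<And>x. x \<notin> K \<Longrightarrow> \<phi> x = 0" "x \<notin> K"
  shows "adj_term bs \<phi> x = 0"
  using assms by (simp add: adj_term_def adjoint_blinfun_apply)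

lemma partials_adj_term:
  assumes \<phi>: "\<phi> \<in> test_functions \<Omega>" and bs: "bs \<in> deriv_lists k"
  shows "continuous_on UNIV (partials bs (adj_term bs \<phi>))"
    "\<exists>B. \<forall>x. norm (partials bs (adj_term bs \<phi>) x) \<le> B"
proof -
  obtain K where K: "compact K" "K \<subseteq> \<Omega>" "\<And>x. x \<notin> K \<Longrightarrow> \<phi> x = 0" "\<And>k. Ck_on k UNIV \<phi>"
    using test_functionsD[OF \<phi>] by blast
  show c: "continuous_on UNIV (partials bs (adj_term bs \<phi>))"
    using Ck_on_partials[OF deriv_lists_Basis[OF bs], of 0 UNIV] adj_term_Ck[OF \<phi> bs] by simp
  have o: "open (- K)" using K(1) by (simp add: compact_imp_closed open_Compl)
  have "partials bs (adj_term bs \<phi>) x = 0" if "x \<notin> K" for x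
    using that adj_term_zero[OF K(3)] by (intro partials_zero_open[OF o]) auto
  then show "\<exists>B. \<forall>x. norm (partials bs (adj_term bs \<phi>) x) \<le> B"
    using compact_support_bounded[OF K(1) _ c] by auto
qed

text \<open>Being bounded and continuous, \<open>formal_adjoint\<close> can be integrated against
  every integrable function, so that the distributional definition of the operator becomes an
  ordinary integral.\<close>

lemma formal_adjoint_bounded:
  assumes \<phi>: "\<phi> \<in> test_functions \<Omega>"
  shows "continuous_on UNIV (formal_adjoint k a \<phi>)" "\<exists>B. \<forall>x. norm (formal_adjoint k a \<phi> x) \<le> B"
proof -
  show "continuous_on UNIV (formal_adjoint k a \<phi>)"
    unfolding formal_adjoint_eq[abs_def]
    by (intro continuous_on_sum continuous_on_scaleR continuous_on_const partials_adj_term[OF \<phi>])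
  obtain B where B: "\<And>bs x. bs \<in> deriv_lists k \<Longrightarrow> norm (partials bs (adj_term bs \<phi>) x) \<le> B bs"
    using partials_adj_term(2)[OF \<phi>] by metis
  have "norm (formal_adjoint k a \<phi> x) \<le> (\<Sum>bs\<in>deriv_lists k. B bs)" for x
    unfolding formal_adjoint_eq by (intro sum_norm_le) (simp add: B power_abs)
  then show "\<exists>B. \<forall>x. norm (formal_adjoint k a \<phi> x) \<le> B" by blast
qed

lemma borel_measurable_leb:
  fixes \<phi> :: "'a \<Rightarrow> 'e::topological_space"
  assumes "continuous_on UNIV \<phi>"
  shows "\<phi> \<in> borel_measurable (leb \<Omega>)"
  by (rule measurable_continuous_on_borel_on[OF continuous_on_subset[OF assms] sets_leb]) simp

lemma op_distr_fun_measure: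
  assumes \<phi>: "\<phi> \<in> test_functions \<Omega>" and u: "integrable (leb \<Omega>) u"
  shows "op_distr \<Omega> k a (fun_measure \<Omega> u) \<phi> = (LINT x|leb \<Omega>. formal_adjoint k a \<phi> x \<bullet> u x)"
  unfolding op_distr_def fun_measure_eq_dmeas
  by (rule vint_dmeas[OF fin sets_leb u borel_measurable_leb[OF formal_adjoint_bounded(1)[OF \<phi>]]])

lemma integrable_adjoint_inner:
  assumes \<phi>: "\<phi> \<in> test_functions \<Omega>" and u: "integrable (leb \<Omega>) u"
  shows "integrable (leb \<Omega>) (\<lambda>x. formal_adjoint k a \<phi> x \<bullet> u x)"
proof -
  obtain B where "\<And>x. norm (formal_adjoint k a \<phi> x) \<le> B" using formal_adjoint_bounded(2)[OF \<phi>] by blast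
  then show ?thesis
    by (intro integrable_bounded_inner[where B=B] u borel_measurable_leb[OF formal_adjoint_bounded(1)[OF \<phi>]])
qed

lemma test_function_bounded:
  assumes \<phi>: "\<phi> \<in> test_functions \<Omega>"
  shows "continuous_on UNIV \<phi>" "\<exists>B. \<forall>x. norm (\<phi> x) \<le> B"
proof -
  obtain K where K: "compact K" "K \<subseteq> \<Omega>" "\<And>x. x \<notin> K \<Longrightarrow> \<phi> x = 0" "\<And>k. Ck_on k UNIV \<phi>"
    using test_functionsD[OF \<phi>] by blast
  show c: "continuous_on UNIV \<phi>" using K(4)[of 0] by simp
  show "\<exists>B. \<forall>x. norm (\<phi> x) \<le> B" using compact_support_bounded[OF K(1) _ c] K(3) by auto
qed

lemma integrable_test_inner:
  assumes \<phi>: "\<phi> \<in> test_functions \<Omega>" and u: "integrable (leb \<Omega>) u"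
  shows "integrable (leb \<Omega>) (\<lambda>x. \<phi> x \<bullet> u x)"
proof -
  obtain B where "\<And>x. norm (\<phi> x) \<le> B" using test_function_bounded(2)[OF \<phi>] by blast
  then show ?thesis
    by (intro integrable_bounded_inner[where B=B] u borel_measurable_leb[OF test_function_bounded(1)[OF \<phi>]])
qed

lemma op_rel_iff:
  "op_rel \<Omega> k a u v \<longleftrightarrow> integrable (leb \<Omega>) u \<and> integrable (leb \<Omega>) v \<and>
    (\<forall>\<phi>\<in>test_functions \<Omega>. (LINT x|leb \<Omega>. formal_adjoint k a \<phi> x \<bullet> u x) = (LINT x|leb \<Omega>. \<phi> x \<bullet> v x))"
  by (auto simp: op_rel_def L1_def op_distr_fun_measure inner_commute)

lemma op_rel_add:
  assumes "op_rel \<Omega> k a u v" "op_rel \<Omega> k a u' v'"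
  shows "op_rel \<Omega> k a (u + u') (v + v')"
  using assms unfolding op_rel_iff
  by (auto simp: plus_fun_def inner_add_right integrable_adjoint_inner integrable_test_inner)

lemma op_rel_scale:
  assumes "op_rel \<Omega> k a u v"
  shows "op_rel \<Omega> k a (c *\<^sub>R u) (c *\<^sub>R v)"
  using assms unfolding op_rel_iff by (auto simp: scaleR_fun_def)

lemma op_rel_zero: "op_rel \<Omega> k a 0 0"
  unfolding op_rel_iff by (auto simp: zero_fun_def)

lemma ker_fun_iff: "u \<in> ker_fun \<Omega> k a \<longleftrightarrow> op_rel \<Omega> k a u 0"
  unfolding op_rel_iff by (auto simp: ker_fun_def L1_def op_distr_fun_measure zero_fun_def)

lemma inner_tendsto:
  fixes u :: "nat \<Rightarrow> 'a \<Rightarrow> 'e::euclidean_space"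
  assumes u: "\<And>n. integrable (leb \<Omega>) (u n)" "integrable (leb \<Omega>) w"
    and lim: "(\<lambda>n. LINT x|leb \<Omega>. norm (u n x - w x)) \<longlonglongrightarrow> 0"
    and \<psi>: "\<psi> \<in> borel_measurable (leb \<Omega>)" "\<And>x. norm (\<psi> x) \<le> B"
  shows "(\<lambda>n. LINT x|leb \<Omega>. \<psi> x \<bullet> u n x) \<longlonglongrightarrow> (LINT x|leb \<Omega>. \<psi> x \<bullet> w x)"
proof -
  have i: "integrable (leb \<Omega>) (\<lambda>x. \<psi> x \<bullet> z x)" if "integrable (leb \<Omega>) z" for z
    using \<psi> that by (intro integrable_bounded_inner[where B=B]) auto
  have "(\<lambda>n. (LINT x|leb \<Omega>. \<psi> x \<bullet> u n x) - (LINT x|leb \<Omega>. \<psi> x \<bullet> w x)) \<longlonglongrightarrow> 0"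
  proof (rule Lim_null_comparison)
    show "(\<lambda>n. B * (LINT x|leb \<Omega>. norm (u n x - w x))) \<longlonglongrightarrow> 0"
      using tendsto_mult[OF tendsto_const[of B] lim] by simp
    show "\<forall>\<^sub>F n in sequentially. norm ((LINT x|leb \<Omega>. \<psi> x \<bullet> u n x) - (LINT x|leb \<Omega>. \<psi> x \<bullet> w x))
        \<le> B * (LINT x|leb \<Omega>. norm (u n x - w x))"
    proof (rule always_eventually, rule allI)
      fix n
      have "(LINT x|leb \<Omega>. \<psi> x \<bullet> u n x) - (LINT x|leb \<Omega>. \<psi> x \<bullet> w x) = (LINT x|leb \<Omega>. \<psi> x \<bullet> (u n x - w x))"
        using i u by (simp add: inner_diff_right)
      also have "norm \<dots> \<le> (LINT x|leb \<Omega>. B * norm (u n x - w x))"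
      proof (rule order_trans[OF integral_norm_bound integral_mono])
        fix x
        have "norm (\<psi> x \<bullet> (u n x - w x)) \<le> norm (\<psi> x) * norm (u n x - w x)"
          using Cauchy_Schwarz_ineq2 by simp
        also have "\<dots> \<le> B * norm (u n x - w x)" using \<psi>(2) by (intro mult_right_mono) auto
        finally show "norm (\<psi> x \<bullet> (u n x - w x)) \<le> B * norm (u n x - w x)" .
      qed (use u i in auto)
      finally show "norm ((LINT x|leb \<Omega>. \<psi> x \<bullet> u n x) - (LINT x|leb \<Omega>. \<psi> x \<bullet> w x)) \<le> B * (LINT x|leb \<Omega>. norm (u n x - w x))"
        by simp
    qed
  qed
  then show ?thesis by (simp add: LIM_zero_iff)
qed

text \<open>Both sides of the weak formulation are integrals against bounded functions and hence
  continuous in \<open>L\<^sup>1\<close>: the operator has a closed graph.\<close>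

lemma op_rel_closed:
  assumes rel: "\<And>n. op_rel \<Omega> k a (u n) (v n)" and uw: "integrable (leb \<Omega>) u'" "integrable (leb \<Omega>) v'"
    and lim: "(\<lambda>n. LINT x|leb \<Omega>. norm (u n x - u' x)) \<longlonglongrightarrow> 0" "(\<lambda>n. LINT x|leb \<Omega>. norm (v n x - v' x)) \<longlonglongrightarrow> 0"
  shows "op_rel \<Omega> k a u' v'"
  unfolding op_rel_iff
proof (intro conjI ballI uw)
  fix \<phi> :: "'a \<Rightarrow> 'c" assume \<phi>: "\<phi> \<in> test_functions \<Omega>"
  have i: "integrable (leb \<Omega>) (u n)" "integrable (leb \<Omega>) (v n)"
    and eq: "(LINT x|leb \<Omega>. formal_adjoint k a \<phi> x \<bullet> u n x) = (LINT x|leb \<Omega>. \<phi> x \<bullet> v n x)" for n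
    using rel[of n] \<phi> by (auto simp: op_rel_iff)
  obtain B where B: "\<And>x. norm (formal_adjoint k a \<phi> x) \<le> B" using formal_adjoint_bounded(2)[OF \<phi>] by blast
  obtain B' where B': "\<And>x. norm (\<phi> x) \<le> B'" using test_function_bounded(2)[OF \<phi>] by blast
  have "(\<lambda>n. LINT x|leb \<Omega>. formal_adjoint k a \<phi> x \<bullet> u n x) \<longlonglongrightarrow> (LINT x|leb \<Omega>. formal_adjoint k a \<phi> x \<bullet> u' x)"
    by (rule inner_tendsto[OF i(1) uw(1) lim(1) borel_measurable_leb[OF formal_adjoint_bounded(1)[OF \<phi>]] B])
  moreover have "(\<lambda>n. LINT x|leb \<Omega>. \<phi> x \<bullet> v n x) \<longlonglongrightarrow> (LINT x|leb \<Omega>. \<phi> x \<bullet> v' x)"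
    by (rule inner_tendsto[OF i(2) uw(2) lim(2) borel_measurable_leb[OF test_function_bounded(1)[OF \<phi>]] B'])
  ultimately show "(LINT x|leb \<Omega>. formal_adjoint k a \<phi> x \<bullet> u' x) = (LINT x|leb \<Omega>. \<phi> x \<bullet> v' x)"
    unfolding eq by (rule LIMSEQ_unique)
qed

end

section \<open>Test functions\<close>

text \<open>The functions \<open>x\<^sup>-\<^sup>n exp (-1/x)\<close>, extended by \<open>0\<close> to \<open>x \<le> 0\<close>, have derivatives in their own
  linear span, which makes all of them smooth.\<close>

definition flat :: "nat \<Rightarrow> real \<Rightarrow> real"
  where "flat n x = (if 0 < x then inverse x ^ n * exp (- inverse x) else 0)"

lemma flat_tendsto_0: "(flat n \<longlongrightarrow> 0) (at 0)"
proof (rule filterlim_split_at)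
  show "(flat n \<longlongrightarrow> 0) (at_left 0)"
  proof (rule Lim_transform_eventually[OF tendsto_const])
    have "\<forall>\<^sub>F x in at_left (0::real). x < 0" by (simp add: eventually_at_filter)
    then show "\<forall>\<^sub>F x in at_left 0. 0 = flat n x" by eventually_elim (simp add: flat_def)
  qed
  show "(flat n \<longlongrightarrow> 0) (at_right 0)"
    unfolding at_right_to_top filterlim_filtermap
  proof (rule Lim_transform_eventually[OF tendsto_power_div_exp_0[of n]])
    show "\<forall>\<^sub>F x in at_top. x ^ n / exp x = flat n (inverse x)"
      using eventually_gt_at_top[of 0]
      by eventually_elim (simp add: flat_def exp_minus divide_inverse)
  qed
qed

lemma flat_deriv: "(flat n has_real_derivative flat (n + 2) x - n * flat (n + 1) x) (at x)"
proof -
  consider "0 < x" | "x < 0" | "x = 0" by linarith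
  then show ?thesis
  proof cases
    case 1
    have "((\<lambda>x. inverse x ^ n) has_real_derivative - n * inverse x ^ (n + 1)) (at x)"
    proof (induction n)
      case (Suc n)
      from DERIV_mult[OF DERIV_inverse Suc.IH] 1 show ?case
        by (simp add: power2_eq_square algebra_simps)
    qed simp
    moreover have "((\<lambda>x. exp (- inverse x)) has_real_derivative exp (- inverse x) * inverse x ^ 2) (at x)"
      using 1 by (auto intro!: derivative_eq_intros simp: power2_eq_square)
    ultimately have "((\<lambda>x. inverse x ^ n * exp (- inverse x)) has_real_derivative
        - n * inverse x ^ (n + 1) * exp (- inverse x) + exp (- inverse x) * inverse x ^ 2 * inverse x ^ n) (at x)"
      by (rule DERIV_mult)
    then have "((\<lambda>x. inverse x ^ n * exp (- inverse x)) has_real_derivative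
        inverse x ^ n * (exp (- inverse x) * inverse x ^ 2) - n * inverse x ^ (n + 1) * exp (- inverse x)) (at x)"
      by (simp add: algebra_simps)
    moreover have "inverse x ^ n * (exp (- inverse x) * inverse x ^ 2) - n * inverse x ^ (n + 1) * exp (- inverse x)
        = flat (n + 2) x - n * flat (n + 1) x"
      using 1 by (simp add: flat_def power_add power2_eq_square)
    ultimately have "((\<lambda>x. inverse x ^ n * exp (- inverse x)) has_real_derivative flat (n + 2) x - n * flat (n + 1) x) (at x)"
      by simp
    then show ?thesis
      by (rule has_field_derivative_transform_within_open[where S="{0<..}"]) (use 1 in \<open>auto simp: flat_def\<close>)
  next
    case 2
    have "((\<lambda>x. 0) has_real_derivative flat (n + 2) x - n * flat (n + 1) x) (at x)"
      using 2 by (simp add: flat_def)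
    then show ?thesis
      by (rule has_field_derivative_transform_within_open[where S="{..<0}"]) (use 2 in \<open>auto simp: flat_def\<close>)
  next
    case 3
    \<comment> \<open>The difference quotient of \<open>flat n\<close> at 0 is
      \<open>flat (Suc n)\<close>.\<close>
    have "((\<lambda>h. (flat n (0 + h) - flat n 0) / h) \<longlongrightarrow> 0) (at 0)"
    proof (rule Lim_transform_eventually[OF flat_tendsto_0[of "Suc n"]])
      show "\<forall>\<^sub>F h in at 0. flat (Suc n) h = (flat n (0 + h) - flat n 0) / h"
        by (rule always_eventually) (auto simp: flat_def divide_inverse)
    qed
    then show ?thesis using 3 by (simp add: DERIV_def flat_def)
  qed
qed

lemma Ck_on_flat: "Ck_on k UNIV (\<lambda>x::'a::euclidean_space. flat n (c * (x \<bullet> b) + d))"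
proof (induction k arbitrary: n)
  case 0
  have "continuous_on UNIV (flat n)"
    by (intro continuous_at_imp_continuous_on ballI) (rule DERIV_isCont[OF flat_deriv])
  then show ?case
    by (auto intro!: continuous_on_compose2[of UNIV "flat n"] continuous_intros)
next
  case (Suc k)
  let ?l = "\<lambda>x::'a. c * (x \<bullet> b) + d"
  have d: "((\<lambda>x. flat n (?l x)) has_derivative (\<lambda>h. (flat (n + 2) (?l x) - n * flat (n + 1) (?l x)) * (c * (h \<bullet> b)))) (at x)" for x
  proof -
    have "(?l has_derivative (\<lambda>h. c * (h \<bullet> b))) (at x)" by (auto intro!: derivative_eq_intros)
    from has_derivative_compose[OF this has_field_derivative_imp_has_derivative[OF flat_deriv]]
    show ?thesis by (simp add: mult.commute)
  qed
  have "Ck_on k UNIV (partial b' (\<lambda>x. flat n (?l x)))" for b'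
  proof -
    have "Ck_on k UNIV (\<lambda>x. c * (b' \<bullet> b) * flat (n + 2) (?l x) + (- n * (c * (b' \<bullet> b))) * flat (n + 1) (?l x))"
      by (intro Ck_on_add Ck_on_bounded_linear[OF open_UNIV bounded_linear_mult_right] Suc.IH) auto
    also have "(\<lambda>x. c * (b' \<bullet> b) * flat (n + 2) (?l x) + (- n * (c * (b' \<bullet> b))) * flat (n + 1) (?l x)) = partial b' (\<lambda>x. flat n (?l x))"
      unfolding partial_eq[OF d, abs_def] by (simp add: algebra_simps)
    finally show ?thesis .
  qed
  then show ?case using d by (auto simp: differentiable_def)
qed

text \<open>The offset \<open>- 1\<close> keeps the support at distance \<open>1 / N\<close> from
  the faces of the box, hence compact in the open box. Since \<open>flat 0\<close> tends to 1 at
  infinity, growing \<open>N\<close> gives the indicator of the box.\<close>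

definition bump :: "nat \<Rightarrow> 'a::euclidean_space \<Rightarrow> 'a \<Rightarrow> 'a \<Rightarrow> real"
  where "bump N p q x = (\<Prod>b\<in>Basis. flat 0 (N * (x \<bullet> b) + (- N * (p \<bullet> b) - 1)) * flat 0 (- N * (x \<bullet> b) + (N * (q \<bullet> b) - 1)))"

lemma flat_0_bounds: "0 \<le> flat 0 x" "flat 0 x \<le> 1"
  by (auto simp: flat_def)

lemma bump_bounds: "0 \<le> bump N p q x" "bump N p q x \<le> 1"
  unfolding bump_def by (auto intro!: prod_nonneg prod_le_1 mult_nonneg_nonneg mult_le_one flat_0_bounds)

lemma Ck_on_bump: "Ck_on k UNIV (bump N p q)"
  unfolding bump_def[abs_def]
  by (intro Ck_on_prod Ck_on_bilinear[OF open_UNIV bounded_bilinear_mult] Ck_on_flat open_UNIV)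

lemma bump_support:
  assumes "0 < N" "bump N p q x \<noteq> 0"
  shows "x \<in> cbox (p + (1/N) *\<^sub>R One) (q - (1/N) *\<^sub>R One)"
  unfolding mem_box
proof
  fix b :: 'a assume b: "b \<in> Basis"
  have "flat 0 (N * (x \<bullet> b) + (- N * (p \<bullet> b) - 1)) \<noteq> 0" "flat 0 (- N * (x \<bullet> b) + (N * (q \<bullet> b) - 1)) \<noteq> 0"
    using assms(2) b by (auto simp: bump_def)
  then have "1 < N * (x \<bullet> b) - N * (p \<bullet> b)" "1 < N * (q \<bullet> b) - N * (x \<bullet> b)"
    by (auto simp: flat_def split: if_splits)
  then show "(p + (1/N) *\<^sub>R One) \<bullet> b \<le> x \<bullet> b \<and> x \<bullet> b \<le> (q - (1/N) *\<^sub>R One) \<bullet> b"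
    using assms(1) b by (simp add: inner_add_left inner_diff_left field_simps)
qed

lemma shrunk_cbox_subset:
  assumes "0 < e"
  shows "cbox (p + e *\<^sub>R One) (q - e *\<^sub>R One) \<subseteq> box p (q::'a::euclidean_space)"
proof
  fix x assume x: "x \<in> cbox (p + e *\<^sub>R One) (q - e *\<^sub>R One)"
  have "p \<bullet> b < x \<bullet> b \<and> x \<bullet> b < q \<bullet> b" if b: "b \<in> Basis" for b
  proof -
    have "(p + e *\<^sub>R One) \<bullet> b \<le> x \<bullet> b \<and> x \<bullet> b \<le> (q - e *\<^sub>R One) \<bullet> b"
      using x b unfolding mem_box by blast
    then have "p \<bullet> b + e \<le> x \<bullet> b" "x \<bullet> b \<le> q \<bullet> b - e"
      using b by (simp_all add: inner_add_left inner_diff_left)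
    then show ?thesis using assms by simp
  qed
  then show "x \<in> box p q" by (simp add: mem_box)
qed

lemma bump_tendsto: "(\<lambda>N. bump (Suc N) p q x) \<longlonglongrightarrow> indicator (box p q) x"
proof (cases "x \<in> box p q")
  case True
  have lim: "(\<lambda>N. flat 0 (Suc N * y - 1)) \<longlonglongrightarrow> 1" if y: "0 < y" for y :: real
  proof -
    have f: "filterlim (\<lambda>N. real (Suc N) * y - 1) at_top sequentially"
    proof -
      have "filterlim (\<lambda>N. real (Suc N) * y) at_top sequentially"
        by (intro filterlim_at_top_mult_tendsto_pos[OF tendsto_const y]
            filterlim_compose[OF filterlim_real_sequentially filterlim_Suc])
      from filterlim_tendsto_add_at_top[OF tendsto_const[of "-1"] this] show ?thesis by simp
    qed
    have "((\<lambda>z. exp (- inverse z)) \<longlongrightarrow> exp (- 0)) (at_top::real filter)"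
      by (intro tendsto_intros tendsto_inverse_0_at_top filterlim_ident)
    then have "((\<lambda>z. exp (- inverse z)) \<longlongrightarrow> 1) (at_top::real filter)" by simp
    then have "((\<lambda>z. flat 0 z) \<longlongrightarrow> 1) at_top"
    proof (rule Lim_transform_eventually)
      show "\<forall>\<^sub>F z in at_top. exp (- inverse z) = flat 0 z"
        using eventually_gt_at_top[of 0] by eventually_elim (simp add: flat_def)
    qed
    from filterlim_compose[OF this f] show ?thesis .
  qed
  have "(\<lambda>N. \<Prod>b\<in>Basis. flat 0 (Suc N * (x \<bullet> b - p \<bullet> b) - 1) * flat 0 (Suc N * (q \<bullet> b - x \<bullet> b) - 1)) \<longlonglongrightarrow> (\<Prod>b\<in>(Basis::'a set). 1 * 1)"
    using True by (intro tendsto_prod tendsto_mult lim) (auto simp: mem_box)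
  moreover have "(\<Prod>b\<in>Basis. flat 0 (Suc N * (x \<bullet> b - p \<bullet> b) - 1) * flat 0 (Suc N * (q \<bullet> b - x \<bullet> b) - 1)) = bump (Suc N) p q x" for N
    unfolding bump_def by (intro prod.cong refl arg_cong2[where f="(*)"] arg_cong[where f="flat 0"]) (auto simp: algebra_simps)
  ultimately show ?thesis using True by simp
next
  case False
  have "bump (Suc N) p q x = 0" for N
  proof (rule ccontr)
    assume "bump (Suc N) p q x \<noteq> 0"
    from bump_support[OF _ this] have "x \<in> cbox (p + (1/real (Suc N)) *\<^sub>R One) (q - (1/real (Suc N)) *\<^sub>R One)" by simp
    then have "x \<in> box p q" using shrunk_cbox_subset[of "1/real (Suc N)" p q] by auto
    then show False using False by contradiction
  qed
  then show ?thesis using False by simp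
qed

lemma bump_test_function:
  fixes v :: "'e::euclidean_space"
  assumes sub: "box p q \<subseteq> \<Omega>"
  shows "(\<lambda>x. bump (Suc N) p q x *\<^sub>R v) \<in> test_functions \<Omega>"
proof -
  let ?C = "cbox (p + (1/real (Suc N)) *\<^sub>R One) (q - (1/real (Suc N)) *\<^sub>R One)"
  have "{x. bump (Suc N) p q x *\<^sub>R v \<noteq> 0} \<subseteq> ?C" using bump_support[of "Suc N" p q] by auto
  then have cl: "closure {x. bump (Suc N) p q x *\<^sub>R v \<noteq> 0} \<subseteq> ?C" by (intro closure_minimal closed_cbox)
  have "?C \<subseteq> box p q" by (rule shrunk_cbox_subset) simp
  moreover have "compact (closure {x. bump (Suc N) p q x *\<^sub>R v \<noteq> 0})"
    using cl bounded_subset[OF bounded_cbox cl] by (simp add: compact_eq_bounded_closed)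
  moreover have "Ck_on k UNIV (\<lambda>x. bump (Suc N) p q x *\<^sub>R v)" for k
    by (intro Ck_on_bounded_linear[OF open_UNIV bounded_linear_scaleR_left] Ck_on_bump)
  ultimately show ?thesis using cl sub by (auto simp: test_functions_def)
qed

lemma box_in_borel_on: "open \<Omega> \<Longrightarrow> box p q \<inter> \<Omega> \<in> borel_on \<Omega>"
  unfolding borel_on_def sets_restrict_space by (subst Int_commute) (intro imageI, simp)

text \<open>Bumps give vanishing integrals over all boxes inside \<open>\<Omega>\<close>. Boxes form
  an intersection-stable generator of the Borel sets, so within one such box the integral over every
  Borel set vanishes; countably many boxes cover \<open>\<Omega>\<close>.\<close>

theorem fundamental_lemma:
  fixes h :: "'a::euclidean_space \<Rightarrow> 'e::euclidean_space"
  assumes O: "open \<Omega>" and h: "integrable (leb \<Omega>) h"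
    and 0: "\<And>\<phi>. \<phi> \<in> test_functions \<Omega> \<Longrightarrow> (LINT x|leb \<Omega>. \<phi> x \<bullet> h x) = 0"
  shows "AE x in leb \<Omega>. h x = 0"
proof -
  have hm: "h \<in> borel_measurable (leb \<Omega>)" using h by simp
  have bx: "(LINT x:box p q|leb \<Omega>. h x) = 0" if sub: "box p q \<subseteq> \<Omega>" for p q
  proof -
    have bm: "box p q \<in> sets (leb \<Omega>)"
      using box_in_borel_on[OF O, of p q] sub by (simp add: Int_absorb2 sets_leb)
    have ii: "integrable (leb \<Omega>) (\<lambda>x. indicator (box p q) x *\<^sub>R h x)"
      by (rule integrable_mult_indicator[OF bm h])
    have "(LINT x:box p q|leb \<Omega>. h x) \<bullet> v = 0" if "v \<in> Basis" for v
    proof -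
      have cm: "(\<lambda>x. bump (Suc N) p q x *\<^sub>R v) \<in> borel_measurable (leb \<Omega>)" for N
        using Ck_on_continuous_on[OF Ck_on_subset[OF Ck_on_bump]]
        by (intro measurable_continuous_on_borel_on[OF _ sets_leb] continuous_intros) blast
      have "(\<lambda>N. LINT x|leb \<Omega>. (bump (Suc N) p q x *\<^sub>R v) \<bullet> h x) \<longlonglongrightarrow> (LINT x|leb \<Omega>. indicator (box p q) x * (v \<bullet> h x))"
      proof (rule integral_dominated_convergence[where w="\<lambda>x. norm (h x)"])
        show "AE x in leb \<Omega>. (\<lambda>N. (bump (Suc N) p q x *\<^sub>R v) \<bullet> h x) \<longlonglongrightarrow> indicator (box p q) x * (v \<bullet> h x)"
          by (intro AE_I2) (auto intro!: tendsto_mult bump_tendsto)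
        show "AE x in leb \<Omega>. norm ((bump (Suc N) p q x *\<^sub>R v) \<bullet> h x) \<le> norm (h x)" for N
        proof (rule AE_I2)
          fix x
          have "\<bar>v \<bullet> h x\<bar> \<le> norm (h x)" using Basis_le_norm[OF that, of "h x"] by (simp add: inner_commute)
          then have "bump (Suc N) p q x * \<bar>v \<bullet> h x\<bar> \<le> 1 * norm (h x)"
            using bump_bounds[of "Suc N" p q x] by (intro mult_mono) auto
          then show "norm ((bump (Suc N) p q x *\<^sub>R v) \<bullet> h x) \<le> norm (h x)"
            using bump_bounds[of "Suc N" p q x] by (simp add: abs_mult)
        qed
        show "(\<lambda>x. indicator (box p q) x * (v \<bullet> h x)) \<in> borel_measurable (leb \<Omega>)" using bm hm by measurable
        show "(\<lambda>x. (bump (Suc N) p q x *\<^sub>R v) \<bullet> h x) \<in> borel_measurable (leb \<Omega>)" for N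
          using cm hm by (rule borel_measurable_inner)
      qed (use h in auto)
      then have "(LINT x|leb \<Omega>. indicator (box p q) x * (v \<bullet> h x)) = 0"
        using 0[OF bump_test_function[OF sub]] by (simp add: LIMSEQ_const_iff)
      moreover have "(LINT x:box p q|leb \<Omega>. h x) \<bullet> v = (LINT x|leb \<Omega>. (indicator (box p q) x *\<^sub>R h x) \<bullet> v)"
        unfolding set_lebesgue_integral_def by (rule integral_inner_left[symmetric]) (rule ii)
      ultimately show ?thesis by (simp add: inner_commute)
    qed
    then have "\<forall>v\<in>Basis. (LINT x:box p q|leb \<Omega>. h x) \<bullet> v = 0" by blast
    then show ?thesis unfolding euclidean_all_zero_iff .
  qed
  have AB: "AE x in leb \<Omega>. x \<in> box p q \<longrightarrow> h x = 0" if sub: "box p q \<subseteq> \<Omega>" for p q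
  proof -
    let ?B = "box p q"
    have bm: "?B \<in> sets (leb \<Omega>)"
      using box_in_borel_on[OF O, of p q] sub by (simp add: Int_absorb2 sets_leb)
    let ?k = "\<lambda>x. indicator ?B x *\<^sub>R h x"
    have k: "integrable (leb \<Omega>) ?k" by (rule integrable_mult_indicator[OF bm h])
    \<comment> \<open>The indicator of \<open>?B\<close> reduces an arbitrary box to one inside
      \<open>\<Omega>\<close>, where \<open>bx\<close> applies.\<close>
    have Z: "(LINT x:A \<inter> \<Omega>|leb \<Omega>. ?k x) = 0" if A: "A \<in> sets borel" for A
    proof -
      have AO: "A \<inter> \<Omega> \<in> sets (leb \<Omega>)" if "A \<in> sets borel" for A
        using that unfolding sets_leb borel_on_def by (auto simp: sets_restrict_space)
      have "Int_stable (range (\<lambda>(a, b). box a b :: 'a set))" by (auto simp: Int_stable_def box_Int_box)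
      moreover have "range (\<lambda>(a, b). box a b :: 'a set) \<subseteq> Pow UNIV" by auto
      moreover have "A \<in> sigma_sets UNIV (range (\<lambda>(a, b). box a b))" using A unfolding borel_eq_box by simp
      ultimately show ?thesis
      proof (induction rule: sigma_sets_induct_disjoint)
        case (basic A)
        then obtain a b where A: "A = box a b" by auto
        obtain r s where rs: "box a b \<inter> ?B = box r s" unfolding box_Int_box by blast
        have "(LINT x:A \<inter> \<Omega>|leb \<Omega>. ?k x) = (LINT x:box r s|leb \<Omega>. h x)"
          unfolding set_lebesgue_integral_def
          by (intro Bochner_Integration.integral_cong) (use rs sub in \<open>auto simp: A split: split_indicator\<close>)
        also have "\<dots> = 0" using rs sub by (intro bx) auto
        finally show ?case .
      next
        case empty then show ?case by (simp add: set_lebesgue_integral_def)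
      next
        case (compl A)
        then have Ab: "A \<in> sets borel" unfolding borel_eq_box by simp
        have "(LINT x:\<Omega>|leb \<Omega>. ?k x) = (LINT x:box p q|leb \<Omega>. h x)"
          unfolding set_lebesgue_integral_def by (intro Bochner_Integration.integral_cong) (auto split: split_indicator)
        then have "(LINT x:\<Omega>|leb \<Omega>. ?k x) = 0" using bx[OF sub] by simp
        moreover have "(LINT x:(A \<inter> \<Omega>) \<union> ((UNIV - A) \<inter> \<Omega>)|leb \<Omega>. ?k x) = (LINT x:A \<inter> \<Omega>|leb \<Omega>. ?k x) + (LINT x:(UNIV - A) \<inter> \<Omega>|leb \<Omega>. ?k x)"
          using Ab AO by (intro set_integral_Un integrable_set_integrable k) auto
        moreover have "(A \<inter> \<Omega>) \<union> ((UNIV - A) \<inter> \<Omega>) = \<Omega>" by auto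
        ultimately show ?case using compl by simp
      next
        case (union A)
        then have Ab: "A i \<in> sets borel" for i unfolding borel_eq_box by auto
        have "(\<lambda>i. LINT x:A i \<inter> \<Omega>|leb \<Omega>. ?k x) sums (LINT x:(\<Union>i. A i \<inter> \<Omega>)|leb \<Omega>. ?k x)"
        proof (rule sums_set_integral[OF k])
          show "range (\<lambda>i. A i \<inter> \<Omega>) \<subseteq> sets (leb \<Omega>)" using Ab AO by blast
          show "disjoint_family (\<lambda>i. A i \<inter> \<Omega>)" using union(1) by (rule disjoint_family_on_bisimulation) auto
        qed
        then have "(\<lambda>i. 0) sums (LINT x:(\<Union>i. A i \<inter> \<Omega>)|leb \<Omega>. ?k x)" using union by simp
        then have "(LINT x:(\<Union>i. A i \<inter> \<Omega>)|leb \<Omega>. ?k x) = 0" using sums_unique2[OF sums_zero] by metis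
        moreover have "(\<Union>i. A i \<inter> \<Omega>) = (\<Union>i. A i) \<inter> \<Omega>" by blast
        ultimately show ?case by (simp only:)
      qed
    qed
    have "(LINT x:A|leb \<Omega>. ?k x) = (LINT x:A|leb \<Omega>. 0)" if "A \<in> sets (leb \<Omega>)" for A
    proof -
      have "A \<in> sets borel" "A \<inter> \<Omega> = A"
        using that O unfolding sets_leb borel_on_def by (auto simp: sets_restrict_space_iff)
      then show ?thesis using Z[of A] by simp
    qed
    then have "AE x in leb \<Omega>. ?k x = 0"
    proof (intro sigma_finite_measure.density_unique_banach[OF _ k])
      have "sigma_finite_measure (restrict_space lborel \<Omega>)"
        using O by (intro sigma_finite_measure_restrict_space sigma_finite_lborel) auto
      then show "sigma_finite_measure (leb \<Omega>)" by (simp add: leb_def)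
    qed auto
    then show ?thesis by eventually_elim (auto split: split_indicator_asm)
  qed
  obtain \<D> where D: "countable \<D>" "\<D> \<subseteq> Pow \<Omega>" "\<And>X. X \<in> \<D> \<Longrightarrow> \<exists>a b. X = box a b" "\<Union>\<D> = \<Omega>"
    by (rule open_countable_Union_open_box[OF O], rule that)
  have "\<forall>X\<in>\<D>. AE x in leb \<Omega>. x \<in> X \<longrightarrow> h x = 0"
    using D AB by (metis Pow_iff subsetD)
  then have "AE x in leb \<Omega>. \<forall>X\<in>\<D>. x \<in> X \<longrightarrow> h x = 0" by (subst AE_ball_countable[OF D(1)])
  then show ?thesis using AE_space
  proof eventually_elim
    case (elim x)
    then show ?case using D(4) by auto
  qed
qed

section \<open>Integration by parts against compactly supported functions\<close>

lemma integrable_lborel_compact_support: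
  fixes F :: "'a::euclidean_space \<Rightarrow> 'e::euclidean_space"
  assumes F: "continuous_on UNIV F" and K: "compact K" and 0: "\<And>x. x \<notin> K \<Longrightarrow> F x = 0"
  shows "integrable lborel F"
proof -
  obtain B where B: "\<And>x. norm (F x) \<le> B" using compact_support_bounded[OF K _ F] 0 by auto
  show ?thesis
  proof (rule Bochner_Integration.integrable_bound[where f="\<lambda>x. B * indicator K x"])
    show "integrable lborel (\<lambda>x. B * indicator K x)"
      using emeasure_bounded_finite[OF compact_imp_bounded[OF K]] borel_compact[OF K]
      by (intro integrable_mult_right integrable_real_indicator) auto
    show "F \<in> borel_measurable lborel" using F by (simp add: borel_measurable_continuous_onI)
    show "AE x in lborel. norm (F x) \<le> norm (B * indicator K x)"
      using B 0 order_trans[OF norm_ge_zero B[of 0]] by (intro AE_I2) (auto split: split_indicator)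
  qed
qed

text \<open>The difference quotients in direction \<open>b\<close> have integral 0 by translation
  invariance, and they converge to the partial derivative under a common integrable bound.\<close>

lemma lborel_integral_partial:
  fixes F :: "'a::euclidean_space \<Rightarrow> real"
  assumes F: "Ck_on 1 UNIV F" and K: "compact K" "\<And>x. x \<notin> K \<Longrightarrow> F x = 0" and b: "b \<in> Basis"
  shows "(LINT x|lborel. partial b F x) = 0"
proof -
  let ?D = "partial b F"
  have dF: "F differentiable at x" for x using F by simp
  have Dc: "continuous_on UNIV ?D" using F b by simp
  have Fc: "continuous_on UNIV F" using Ck_on_continuous_on[OF F] .
  have o: "open (- K)" using K(1) by (simp add: compact_imp_closed open_Compl)
  have D0: "?D x = 0" if "x \<notin> K" for x
    using partials_zero_open[OF o, of F x "[b]"] K(2) that by (simp add: partials_def)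
  obtain B where B: "\<And>x. norm (?D x) \<le> B" using compact_support_bounded[OF K(1) _ Dc] D0 by auto
  have line: "((\<lambda>s. F (x + s *\<^sub>R b)) has_real_derivative ?D (x + s *\<^sub>R b)) (at s)" for x s
  proof -
    have "((\<lambda>s. x + s *\<^sub>R b) has_derivative (\<lambda>h. h *\<^sub>R b)) (at s)" by (auto intro!: derivative_eq_intros)
    from has_derivative_compose[OF this dF[unfolded frechet_derivative_works]]
    have "((\<lambda>s. F (x + s *\<^sub>R b)) has_derivative (\<lambda>h. frechet_derivative F (at (x + s *\<^sub>R b)) (h *\<^sub>R b))) (at s)" .
    moreover have "frechet_derivative F (at (x + s *\<^sub>R b)) (h *\<^sub>R b) = ?D (x + s *\<^sub>R b) * h" for h
      using linear_frechet_derivative[OF dF] by (simp add: linear_scale partial_def)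
    ultimately show ?thesis by (simp add: has_field_derivative_def)
  qed
  obtain R where R: "0 < R" "\<And>x. x \<in> K \<Longrightarrow> norm x \<le> R"
    using compact_imp_bounded[OF K(1)] by (auto simp: bounded_pos)
  have intF: "integrable lborel F" by (rule integrable_lborel_compact_support[OF Fc K])
  define q where "q n x = (F (x + (1 / real (Suc n)) *\<^sub>R b) - F x) * real (Suc n)" for n x
  have "(\<lambda>n. LINT x|lborel. q n x) \<longlonglongrightarrow> (LINT x|lborel. ?D x)"
  \<comment> \<open>Increments are at most 1, so all quotients vanish outside the ball of radius
    \<open>R + 1\<close>; inside it the mean value theorem bounds them by \<open>B\<close>.\<close>
  proof (rule integral_dominated_convergence[where w="\<lambda>x. B * indicator (cball 0 (R + 1)) x"])
    show "integrable lborel (\<lambda>x. B * indicator (cball (0::'a) (R + 1)) x)"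
      using emeasure_bounded_finite[OF bounded_cball, of "0::'a" "R+1"]
      by (intro integrable_mult_right integrable_real_indicator) auto
    show "AE x in lborel. (\<lambda>n. q n x) \<longlonglongrightarrow> ?D x"
    proof (rule AE_I2)
      fix x
      have "((\<lambda>h. (F (x + (0 + h) *\<^sub>R b) - F (x + 0 *\<^sub>R b)) / h) \<longlongrightarrow> ?D (x + 0 *\<^sub>R b)) (at 0)"
        using line[of x 0] unfolding DERIV_def .
      moreover have "filterlim (\<lambda>n. 1 / real (Suc n)) (at 0) sequentially"
        unfolding filterlim_at using LIMSEQ_Suc[OF lim_1_over_n] by auto
      ultimately have "(\<lambda>n. (F (x + (0 + 1 / real (Suc n)) *\<^sub>R b) - F (x + 0 *\<^sub>R b)) / (1 / real (Suc n))) \<longlonglongrightarrow> ?D (x + 0 *\<^sub>R b)"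
        by (rule filterlim_compose)
      then show "(\<lambda>n. q n x) \<longlonglongrightarrow> ?D x" by (simp add: q_def)
    qed
    show "AE x in lborel. norm (q n x) \<le> B * indicator (cball 0 (R + 1)) x" for n
    proof (rule AE_I2)
      fix x
      let ?h = "1 / real (Suc n)"
      have h: "0 < ?h" "?h \<le> 1" by auto
      show "norm (q n x) \<le> B * indicator (cball 0 (R + 1)) x"
      proof (cases "norm x \<le> R + 1")
        case True
        obtain z where "F (x + ?h *\<^sub>R b) - F (x + 0 *\<^sub>R b) = (?h - 0) * ?D (x + z *\<^sub>R b)"
          using MVT2[OF h(1), of "\<lambda>s. F (x + s *\<^sub>R b)" "\<lambda>s. ?D (x + s *\<^sub>R b)"] line by blast
        then have "q n x = ?D (x + z *\<^sub>R b)" by (simp add: q_def)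
        then show ?thesis using B True by simp
      next
        case False
        have "norm x \<le> norm (x + ?h *\<^sub>R b) + norm (?h *\<^sub>R b)"
          using norm_triangle_ineq4[of "x + ?h *\<^sub>R b" "?h *\<^sub>R b"] by simp
        moreover have "norm (?h *\<^sub>R b) \<le> 1" using b h by simp
        ultimately have "R < norm (x + ?h *\<^sub>R b)" "R < norm x" using False by linarith+
        then have "x + ?h *\<^sub>R b \<notin> K" "x \<notin> K" using R(2) by (auto simp: not_le[symmetric])
        then have "q n x = 0" using K(2) by (simp add: q_def)
        then show ?thesis using False by simp
      qed
    qed
    show "?D \<in> borel_measurable lborel" using Dc by (simp add: borel_measurable_continuous_onI)
    have "continuous_on UNIV (q n)" for n
      unfolding q_def[abs_def] by (intro continuous_intros continuous_on_compose2[OF Fc]) auto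
    then show "q n \<in> borel_measurable lborel" for n by (simp add: borel_measurable_continuous_onI)
  qed
  moreover have "(LINT x|lborel. q n x) = 0" for n
  proof -
    let ?c = "(1 / real (Suc n)) *\<^sub>R b"
    have Fm: "F \<in> borel_measurable borel" using Fc by (rule borel_measurable_continuous_onI)
    have tr: "(LINT x|lborel. F (?c + x)) = (LINT x|lborel. F x)"
      using integral_distr[of "(+) ?c" lborel borel F] Fm by (simp add: lborel_distr_plus)
    have ti: "integrable lborel (\<lambda>x. F (?c + x))"
      using integrable_distr[of "(+) ?c" lborel borel F] intF by (simp add: lborel_distr_plus)
    have sw: "F (x + ?c) = F (?c + x)" for x by (simp add: add.commute)
    show ?thesis
      unfolding q_def sw using tr ti intF by simp
  qed
  ultimately show ?thesis by (simp add: LIMSEQ_const_iff)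
qed

lemma integration_by_parts:
  fixes g \<phi> :: "'a::euclidean_space \<Rightarrow> 'e::euclidean_space"
  assumes g: "Ck_on 1 UNIV g" and \<phi>: "Ck_on 1 UNIV \<phi>" and K: "compact K" "\<And>x. x \<notin> K \<Longrightarrow> \<phi> x = 0"
    and b: "b \<in> Basis"
  shows "(LINT x|lborel. partial b g x \<bullet> \<phi> x) = - (LINT x|lborel. g x \<bullet> partial b \<phi> x)"
proof -
  have F: "Ck_on 1 UNIV (\<lambda>x. g x \<bullet> \<phi> x)"
    by (rule Ck_on_bilinear[OF open_UNIV bounded_bilinear_inner g \<phi>])
  have c: "continuous_on UNIV g" "continuous_on UNIV \<phi>" "continuous_on UNIV (partial b g)" "continuous_on UNIV (partial b \<phi>)"
    using g \<phi> b Ck_on_continuous_on[OF g] Ck_on_continuous_on[OF \<phi>] by auto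
  have o: "open (- K)" using K(1) by (simp add: compact_imp_closed open_Compl)
  have p0: "partial b \<phi> x = 0" if "x \<notin> K" for x
    using partials_zero_open[OF o, of \<phi> x "[b]"] K(2) that by (simp add: partials_def)
  have d: "((\<lambda>x. g x \<bullet> \<phi> x) has_derivative
      (\<lambda>h. g x \<bullet> frechet_derivative \<phi> (at x) h + frechet_derivative g (at x) h \<bullet> \<phi> x)) (at x)" for x
    using g \<phi> by (intro has_derivative_inner) (auto simp: frechet_derivative_works)
  have eq: "partial b (\<lambda>x. g x \<bullet> \<phi> x) x = g x \<bullet> partial b \<phi> x + partial b g x \<bullet> \<phi> x" for x
    using partial_eq[OF d] by (simp add: partial_def)
  have i1: "integrable lborel (\<lambda>x. g x \<bullet> partial b \<phi> x)"
    by (rule integrable_lborel_compact_support[OF _ K(1)]) (use c p0 in \<open>auto intro!: continuous_intros\<close>)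
  have i2: "integrable lborel (\<lambda>x. partial b g x \<bullet> \<phi> x)"
    by (rule integrable_lborel_compact_support[OF _ K(1)]) (use c K(2) in \<open>auto intro!: continuous_intros\<close>)
  have "(LINT x|lborel. partial b (\<lambda>x. g x \<bullet> \<phi> x) x) = 0"
    by (rule lborel_integral_partial[OF F K(1) _ b]) (simp add: K(2))
  then show ?thesis unfolding eq using i1 i2 by simp
qed

text \<open>Derivatives are moved across one at a time, outermost first, and so arrive in reverse
  order.\<close>

lemma integration_by_parts_partials:
  fixes g \<phi> :: "'a::euclidean_space \<Rightarrow> 'e::euclidean_space"
  assumes "Ck_on (length bs) UNIV g" "\<And>k. Ck_on k UNIV \<phi>" "compact K" "\<And>x. x \<notin> K \<Longrightarrow> \<phi> x = 0" "set bs \<subseteq> Basis"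
  shows "(LINT x|lborel. partials bs g x \<bullet> \<phi> x) = (-1) ^ length bs * (LINT x|lborel. g x \<bullet> partials (rev bs) \<phi> x)"
  using assms
proof (induction bs arbitrary: \<phi>)
  case Nil
  then show ?case by (simp add: partials_def)
next
  case (Cons b bs)
  have o: "open (- K)" using Cons.prems by (simp add: compact_imp_closed open_Compl)
  have p0: "partial b \<phi> x = 0" if "x \<notin> K" for x
    using partials_zero_open[OF o, of \<phi> x "[b]"] Cons.prems(4) that by (simp add: partials_def)
  have pk: "Ck_on k UNIV (partial b \<phi>)" for k using Cons.prems(2)[of "Suc k"] Cons.prems(5) by simp
  have "Ck_on 1 UNIV (partials bs g)" using Cons.prems by (intro Ck_on_partials) auto
  then have "(LINT x|lborel. partials (b # bs) g x \<bullet> \<phi> x) = - (LINT x|lborel. partials bs g x \<bullet> partial b \<phi> x)"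
    using integration_by_parts[of "partials bs g" \<phi> K b] Cons.prems by (simp add: partials_def)
  also have "(LINT x|lborel. partials bs g x \<bullet> partial b \<phi> x) = (-1) ^ length bs * (LINT x|lborel. g x \<bullet> partials (rev bs) (partial b \<phi>) x)"
    using Cons.prems Ck_on_Suc_imp[of "length bs" UNIV g] pk p0 by (intro Cons.IH) auto
  finally show ?case by (simp add: partials_def)
qed

context diff_operator begin

lemma leb_integral_lborel:
  fixes F :: "'a \<Rightarrow> 'e::{banach,second_countable_topology}"
  assumes "\<And>x. x \<notin> \<Omega> \<Longrightarrow> F x = 0"
  shows "(LINT x|leb \<Omega>. F x) = (LINT x|lborel. F x)"
proof -
  have "(LINT x|leb \<Omega>. F x) = (LINT x|lborel. indicator \<Omega> x *\<^sub>R F x)"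
    unfolding leb_def using O by (intro integral_restrict_space) auto
  also have "\<dots> = (LINT x|lborel. F x)"
    using assms by (intro Bochner_Integration.integral_cong) (auto split: split_indicator)
  finally show ?thesis .
qed

text \<open>Integration by parts computes the operator on test functions classically. They are thus
  among the functions against which \<open>adj_op\<close> is specified, and this makes it
  unique.\<close>

lemma test_function_in_W:
  assumes \<phi>: "\<phi> \<in> test_functions \<Omega>"
  shows "\<phi> \<in> W \<Omega> k a"
proof -
  obtain K where K: "compact K" "K \<subseteq> \<Omega>" "\<And>x. x \<notin> K \<Longrightarrow> \<phi> x = 0" "\<And>k. Ck_on k UNIV \<phi>"
    using test_functionsD[OF \<phi>] by blast
  have o: "open (- K)" using K(1) by (simp add: compact_imp_closed open_Compl)
  define P where "P bs = partials (rev bs) \<phi>" for bs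
  have Pc: "continuous_on UNIV (P bs)" if "bs \<in> deriv_lists k" for bs
    unfolding P_def using Ck_on_partials[of "rev bs" 0 UNIV \<phi>] deriv_lists_Basis[OF that] K(4) by simp
  have P0: "P bs x = 0" if "x \<notin> K" for bs x
    unfolding P_def using K(3) that by (intro partials_zero_open[OF o]) auto
  define V where "V bs x = blinfun_apply (a bs x) (P bs x)" for bs x
  have Vc: "continuous_on \<Omega> (V bs)" if "bs \<in> deriv_lists k" for bs
    unfolding V_def[abs_def]
    by (intro bounded_bilinear.continuous_on[OF bounded_bilinear_blinfun_apply]
        Ck_on_continuous_on[OF coeff_Ck[OF that]] continuous_on_subset[OF Pc[OF that]]) auto
  have V0: "V bs x = 0" if "x \<notin> K" for bs x using P0[OF that] by (simp add: V_def)
  have Vi: "integrable (leb \<Omega>) (V bs)" if bs: "bs \<in> deriv_lists k" for bs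
  proof -
    obtain B where B: "\<And>x. x \<in> \<Omega> \<Longrightarrow> norm (V bs x) \<le> B"
      using compact_support_bounded[OF K(1,2) Vc[OF bs]] V0 by blast
    show ?thesis
      using B measurable_continuous_on_borel_on[OF Vc[OF bs] sets_leb]
      by (intro L.integrable_const_bound[where B=B]) auto
  qed
  define v where "v x = (\<Sum>bs\<in>deriv_lists k. V bs x)" for x
  have vi: "integrable (leb \<Omega>) v" unfolding v_def using Vi by auto
  have \<phi>i: "integrable (leb \<Omega>) \<phi>"
  proof -
    obtain B where B: "\<And>x. norm (\<phi> x) \<le> B" using compact_support_bounded[OF K(1) _ Ck_on_continuous_on[OF K(4)[of 0]]] K(3) by auto
    show ?thesis
      using B borel_measurable_leb[OF Ck_on_continuous_on[OF K(4)[of 0]]]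
      by (intro L.integrable_const_bound[where B=B]) auto
  qed
  have "(LINT x|leb \<Omega>. formal_adjoint k a \<psi> x \<bullet> \<phi> x) = (LINT x|leb \<Omega>. \<psi> x \<bullet> v x)" if \<psi>: "\<psi> \<in> test_functions \<Omega>" for \<psi>
  proof -
    have ip: "integrable (leb \<Omega>) (\<lambda>x. partials bs (adj_term bs \<psi>) x \<bullet> \<phi> x)" if bs: "bs \<in> deriv_lists k" for bs
    proof -
      obtain B where B: "\<And>x. norm (partials bs (adj_term bs \<psi>) x) \<le> B" using partials_adj_term(2)[OF \<psi> bs] by blast
      then show ?thesis
        by (intro integrable_bounded_inner[where B=B] \<phi>i borel_measurable_leb[OF partials_adj_term(1)[OF \<psi> bs]])
    qed
    have "(LINT x|leb \<Omega>. formal_adjoint k a \<psi> x \<bullet> \<phi> x) = (LINT x|leb \<Omega>. (\<Sum>bs\<in>deriv_lists k. (-1) ^ length bs * (partials bs (adj_term bs \<psi>) x \<bullet> \<phi> x)))"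
      by (simp add: formal_adjoint_eq inner_sum_left)
    also have "\<dots> = (\<Sum>bs\<in>deriv_lists k. (-1) ^ length bs * (LINT x|leb \<Omega>. partials bs (adj_term bs \<psi>) x \<bullet> \<phi> x))"
      using ip by (subst Bochner_Integration.integral_sum) auto
    also have "\<dots> = (\<Sum>bs\<in>deriv_lists k. LINT x|leb \<Omega>. \<psi> x \<bullet> V bs x)"
    proof (rule sum.cong[OF refl])
      fix bs :: "'a list" assume bs: "bs \<in> deriv_lists k"
      have z: "\<phi> x = 0" "P bs x = 0" if "x \<notin> \<Omega>" for x using K(2,3) P0 that by auto
      have "(LINT x|leb \<Omega>. partials bs (adj_term bs \<psi>) x \<bullet> \<phi> x) = (LINT x|lborel. partials bs (adj_term bs \<psi>) x \<bullet> \<phi> x)"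
        using z by (intro leb_integral_lborel) auto
      also have "\<dots> = (-1) ^ length bs * (LINT x|lborel. adj_term bs \<psi> x \<bullet> P bs x)"
        unfolding P_def by (rule integration_by_parts_partials[OF adj_term_Ck[OF \<psi> bs] K(4,1,3) deriv_lists_Basis[OF bs]])
      also have "(LINT x|lborel. adj_term bs \<psi> x \<bullet> P bs x) = (LINT x|leb \<Omega>. adj_term bs \<psi> x \<bullet> P bs x)"
        using z by (intro leb_integral_lborel[symmetric]) auto
      also have "(LINT x|leb \<Omega>. adj_term bs \<psi> x \<bullet> P bs x) = (LINT x|leb \<Omega>. \<psi> x \<bullet> V bs x)"
      proof (rule Bochner_Integration.integral_cong[OF refl])
        fix x
        have "linear (blinfun_apply (a bs x))" by (simp add: blinfun.bounded_linear_right bounded_linear.linear)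
        then show "adj_term bs \<psi> x \<bullet> P bs x = \<psi> x \<bullet> V bs x"
          unfolding adj_term_def V_def using adjoint_works[of "blinfun_apply (a bs x)" "P bs x" "\<psi> x"]
          by (simp add: inner_commute)
      qed
      finally show "(-1) ^ length bs * (LINT x|leb \<Omega>. partials bs (adj_term bs \<psi>) x \<bullet> \<phi> x) = (LINT x|leb \<Omega>. \<psi> x \<bullet> V bs x)"
        by (simp add: power_mult_distrib[symmetric] mult.assoc[symmetric])
    qed
    also have "\<dots> = (LINT x|leb \<Omega>. \<psi> x \<bullet> v x)"
      unfolding v_def inner_sum_right
      using Vi integrable_test_inner[OF \<psi>] by (intro Bochner_Integration.integral_sum[symmetric]) auto
    finally show ?thesis .
  qed
  then have "op_rel \<Omega> k a \<phi> v" unfolding op_rel_iff using \<phi>i vi by blast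
  then show ?thesis by (auto simp: W_def)
qed

end

section \<open>Closed range\<close>

lemma norm1_triangle:
  fixes f g h :: "'x \<Rightarrow> 'e::{banach,second_countable_topology}"
  assumes "integrable M f" "integrable M g" "integrable M h"
  shows "(LINT x|M. norm (f x - h x)) \<le> (LINT x|M. norm (f x - g x)) + (LINT x|M. norm (g x - h x))"
proof -
  have "(LINT x|M. norm (f x - h x)) \<le> (LINT x|M. norm (f x - g x) + norm (g x - h x))"
  proof (rule integral_mono)
    show "norm (f x - h x) \<le> norm (f x - g x) + norm (g x - h x)" for x
      using norm_triangle_ineq[of "f x - g x" "g x - h x"] by simp
  qed (use assms in auto)
  also have "\<dots> = (LINT x|M. norm (f x - g x)) + (LINT x|M. norm (g x - h x))"
    using assms by (intro Bochner_Integration.integral_add) auto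
  finally show ?thesis .
qed

lemma norm1_triangle_add:
  fixes f g :: "'x \<Rightarrow> 'e::{banach,second_countable_topology}"
  assumes "integrable M f" "integrable M g"
  shows "(LINT x|M. norm (f x + g x)) \<le> (LINT x|M. norm (f x)) + (LINT x|M. norm (g x))"
  using norm1_triangle[of M f "\<lambda>x. 0" "\<lambda>x. - g x"] assms by simp

text \<open>A subsequence converges almost everywhere, and Fatou's lemma carries every uniform bound
  on the distances to later members over to the limit. In this form the limit comes with
  rates.\<close>

lemma L1_complete:
  fixes s :: "nat \<Rightarrow> 'x \<Rightarrow> 'e::{banach,second_countable_topology}"
  assumes s: "\<And>n. integrable M (s n)"
    and cauchy: "\<And>e. 0 < e \<Longrightarrow> \<exists>N. \<forall>i\<ge>N. \<forall>j\<ge>N. (LINT x|M. norm (s i x - s j x)) < e"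
  shows "\<exists>S. integrable M S \<and> (\<forall>n e. (\<forall>j\<ge>n. (LINT x|M. norm (s n x - s j x)) \<le> e) \<longrightarrow> (LINT x|M. norm (s n x - S x)) \<le> e)"
proof -
  obtain r where r: "strict_mono r" "AE x in M. Cauchy (\<lambda>i. s (r i) x)"
    by (rule cauchy_L1_AE_cauchy_subseq[OF s cauchy]) (assumption | rule that)+
  define S where "S x = lim (\<lambda>i. s (r i) x)" for x
  have sm: "s n \<in> borel_measurable M" for n using s by auto
  have Sm: "S \<in> borel_measurable M" unfolding S_def using sm by (rule borel_measurable_lim_metric)
  have lim: "AE x in M. (\<lambda>i. s (r i) x) \<longlonglongrightarrow> S x"
    using r(2) by eventually_elim (simp add: S_def Cauchy_convergent_iff convergent_LIMSEQ_iff)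
  have fatou: "(\<integral>\<^sup>+x. ennreal (norm (s n x - S x)) \<partial>M) \<le> ennreal e"
    if e: "\<forall>j\<ge>n. (LINT x|M. norm (s n x - s j x)) \<le> e" for n e
  proof -
    have "(\<integral>\<^sup>+x. ennreal (norm (s n x - S x)) \<partial>M) = (\<integral>\<^sup>+x. liminf (\<lambda>i. ennreal (norm (s n x - s (r i) x))) \<partial>M)"
    proof (rule nn_integral_cong_AE)
      show "AE x in M. ennreal (norm (s n x - S x)) = liminf (\<lambda>i. ennreal (norm (s n x - s (r i) x)))"
        using lim
      proof eventually_elim
        case (elim x)
        have "(\<lambda>i. ennreal (norm (s n x - s (r i) x))) \<longlonglongrightarrow> ennreal (norm (s n x - S x))"
          by (intro tendsto_ennrealI tendsto_intros elim)
        from lim_imp_Liminf[OF trivial_limit_sequentially this] show ?case by (rule sym)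
      qed
    qed
    also have "\<dots> \<le> liminf (\<lambda>i. \<integral>\<^sup>+x. ennreal (norm (s n x - s (r i) x)) \<partial>M)"
      using sm by (intro nn_integral_liminf) auto
    also have "\<dots> \<le> ennreal e"
    proof (rule Liminf_le)
      show "\<forall>\<^sub>F i in sequentially. (\<integral>\<^sup>+x. ennreal (norm (s n x - s (r i) x)) \<partial>M) \<le> ennreal e"
        using eventually_ge_at_top[of n]
      proof eventually_elim
        case (elim i)
        then have "n \<le> r i" using seq_suble[OF r(1), of i] by linarith
        then have "(LINT x|M. norm (s n x - s (r i) x)) \<le> e" using e by blast
        moreover have "(\<integral>\<^sup>+x. ennreal (norm (s n x - s (r i) x)) \<partial>M) = ennreal (LINT x|M. norm (s n x - s (r i) x))"
          using s by (intro nn_integral_eq_integral) auto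
        ultimately show ?case by (simp add: ennreal_leI)
      qed
    qed simp
    finally show ?thesis .
  qed
  obtain N where N: "\<forall>i\<ge>N. \<forall>j\<ge>N. (LINT x|M. norm (s i x - s j x)) < 1" using cauchy[of 1] by auto
  have "(\<integral>\<^sup>+x. ennreal (norm (s N x - S x)) \<partial>M) \<le> ennreal 1"
    using N by (intro fatou) (auto intro: less_imp_le)
  then have "integrable M (\<lambda>x. s N x - S x)"
    using sm Sm by (intro integrableI_bounded) (auto intro: le_less_trans)
  from Bochner_Integration.integrable_diff[OF s[of N] this] have Si: "integrable M S" by simp
  have "(LINT x|M. norm (s n x - S x)) \<le> e" if e: "\<forall>j\<ge>n. (LINT x|M. norm (s n x - s j x)) \<le> e" for n e
  proof -
    have "ennreal (LINT x|M. norm (s n x - S x)) \<le> ennreal e"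
      using fatou[OF e] s Si nn_integral_eq_integral[of M "\<lambda>x. norm (s n x - S x)"] by auto
    moreover have "0 \<le> e" using e[rule_format, of n] by simp
    ultimately show ?thesis by (simp add: ennreal_le_iff)
  qed
  then show ?thesis using Si by blast
qed

lemma L1_geometric:
  fixes s :: "nat \<Rightarrow> 'x \<Rightarrow> 'e::{banach,second_countable_topology}"
  assumes s: "\<And>n. integrable M (s n)" and r: "\<And>n. 0 \<le> r n" "\<And>n. 2 * r (Suc n) \<le> (r n :: real)"
    and step: "\<And>n. (LINT x|M. norm (s n x - s (Suc n) x)) \<le> r n"
  shows "r \<longlonglongrightarrow> 0" "\<exists>S. integrable M S \<and> (\<forall>n. (LINT x|M. norm (s n x - S x)) \<le> 2 * r n)"
proof -
  \<comment> \<open>The subtracted \<open>2 * r (n + k)\<close> makes the induction close: a new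
    step costs at most \<open>r (n + k)\<close>, and \<open>2 * r (Suc i) \<le> r i\<close> pays for
    it.\<close>
  have le: "(LINT x|M. norm (s n x - s (n + k) x)) \<le> 2 * r n - 2 * r (n + k)" for n k
  proof (induction k)
    case (Suc k)
    have "(LINT x|M. norm (s n x - s (n + Suc k) x)) \<le> (LINT x|M. norm (s n x - s (n + k) x)) + (LINT x|M. norm (s (n + k) x - s (n + Suc k) x))"
      by (intro norm1_triangle s)
    then show ?case using Suc step[of "n + k"] r(2)[of "n + k"] by simp
  qed simp
  have le2: "(LINT x|M. norm (s n x - s j x)) \<le> 2 * r n" if "n \<le> j" for n j
    using le[of n "j - n"] r(1)[of j] that by simp
  have "r n \<le> r 0 * (1/2) ^ n" for n
  proof (induction n)
    case (Suc n) then show ?case using r(2)[of n] by simp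
  qed simp
  moreover have "(\<lambda>n. r 0 * (1/2) ^ n) \<longlonglongrightarrow> r 0 * 0" by (intro tendsto_intros) auto
  ultimately show rl: "r \<longlonglongrightarrow> 0"
    using tendsto_sandwich[of "\<lambda>n. 0" r sequentially "\<lambda>n. r 0 * (1/2) ^ n" 0] r(1) by simp
  have cauchy: "\<exists>N. \<forall>i\<ge>N. \<forall>j\<ge>N. (LINT x|M. norm (s i x - s j x)) < e" if e: "0 < e" for e
  proof -
    have "\<forall>\<^sub>F n in sequentially. r n < e/4" using e by (intro order_tendstoD[OF rl]) auto
    then obtain N where N: "r N < e/4" by (auto simp: eventually_sequentially)
    have "(LINT x|M. norm (s i x - s j x)) < e" if "N \<le> i" "N \<le> j" for i j
    proof -
      have "(LINT x|M. norm (s i x - s j x)) \<le> (LINT x|M. norm (s i x - s N x)) + (LINT x|M. norm (s N x - s j x))"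
        by (intro norm1_triangle s)
      also have "(LINT x|M. norm (s i x - s N x)) = (LINT x|M. norm (s N x - s i x))"
        by (subst norm_minus_commute) (rule refl)
      finally show ?thesis using le2[OF that(1)] le2[OF that(2)] N by linarith
    qed
    then show ?thesis by blast
  qed
  have "\<exists>S. integrable M S \<and> (\<forall>n e. (\<forall>j\<ge>n. (LINT x|M. norm (s n x - s j x)) \<le> e) \<longrightarrow> (LINT x|M. norm (s n x - S x)) \<le> e)"
    by (rule L1_complete[OF s cauchy])
  then obtain S where S: "integrable M S"
      "\<forall>n e. (\<forall>j\<ge>n. (LINT x|M. norm (s n x - s j x)) \<le> e) \<longrightarrow> (LINT x|M. norm (s n x - S x)) \<le> e"
    by (elim exE conjE)
  have "(LINT x|M. norm (s n x - S x)) \<le> 2 * r n" for n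
    by (rule S(2)[rule_format]) (rule le2)
  with S(1) show "\<exists>S. integrable M S \<and> (\<forall>n. (LINT x|M. norm (s n x - S x)) \<le> 2 * r n)"
    by (intro exI[of _ S] conjI allI)
qed

text \<open>The essential bound is enlarged to a positive one because later estimates divide by
  it.\<close>

lemma Linf_inner:
  fixes g :: "'a::euclidean_space \<Rightarrow> 'e::euclidean_space"
  assumes g: "g \<in> Linf \<Omega>"
  shows "\<exists>C>0. \<forall>u. integrable (leb \<Omega>) u \<longrightarrow> integrable (leb \<Omega>) (\<lambda>x. g x \<bullet> u x) \<and>
    (LINT x|leb \<Omega>. \<bar>g x \<bullet> u x\<bar>) \<le> C * (LINT x|leb \<Omega>. norm (u x)) \<and> (AE x in leb \<Omega>. norm (g x) \<le> C)"
proof -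
  obtain C0 where C0: "AE x in leb \<Omega>. norm (g x) \<le> C0" and gm: "g \<in> borel_measurable (leb \<Omega>)"
    using g by (auto simp: Linf_def)
  define C where "C = max 1 C0"
  have C: "AE x in leb \<Omega>. norm (g x) \<le> C" "0 < C" using C0 by (auto simp: C_def le_max_iff_disj)
  have "integrable (leb \<Omega>) (\<lambda>x. g x \<bullet> u x) \<and> (LINT x|leb \<Omega>. \<bar>g x \<bullet> u x\<bar>) \<le> C * (LINT x|leb \<Omega>. norm (u x))"
    if u: "integrable (leb \<Omega>) u" for u
  proof -
    have b: "AE x in leb \<Omega>. \<bar>g x \<bullet> u x\<bar> \<le> C * norm (u x)"
      using C(1)
    proof eventually_elim
      case (elim x)
      have "\<bar>g x \<bullet> u x\<bar> \<le> norm (g x) * norm (u x)" by (rule Cauchy_Schwarz_ineq2)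
      also have "\<dots> \<le> C * norm (u x)" using elim by (intro mult_right_mono) auto
      finally show ?case .
    qed
    have i: "integrable (leb \<Omega>) (\<lambda>x. g x \<bullet> u x)"
    proof (rule Bochner_Integration.integrable_bound[where f="\<lambda>x. C * norm (u x)"])
      show "AE x in leb \<Omega>. norm (g x \<bullet> u x) \<le> norm (C * norm (u x))"
        using b by eventually_elim simp
    qed (use u gm in auto)
    have "(LINT x|leb \<Omega>. \<bar>g x \<bullet> u x\<bar>) \<le> (LINT x|leb \<Omega>. C * norm (u x))"
      using i u b by (intro integral_mono_AE) auto
    then show ?thesis using i by simp
  qed
  then show ?thesis using C by blast
qed

section \<open>The operator on \<open>W\<close>, its adjoint, and preimages under closed
  range\<close>

context diff_operator begin

abbreviation N1 :: "('a \<Rightarrow> 'e::euclidean_space) \<Rightarrow> real"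
  where "N1 u \<equiv> LINT x|leb \<Omega>. norm (u x)"

lemma op_rel_integrable: "op_rel \<Omega> k a u v \<Longrightarrow> integrable (leb \<Omega>) u \<and> integrable (leb \<Omega>) v"
  by (simp add: op_rel_iff)

lemma op_rel_diff: "op_rel \<Omega> k a u v \<Longrightarrow> op_rel \<Omega> k a u' v' \<Longrightarrow> op_rel \<Omega> k a (u - u') (v - v')"
  using op_rel_add[of u v "(-1) *\<^sub>R u'" "(-1) *\<^sub>R v'"] op_rel_scale[of u' v' "-1"] by simp

text \<open>The fundamental lemma makes the choice in \<open>op\<close> immaterial up to null
  sets.\<close>

lemma op_rel_unique:
  assumes "op_rel \<Omega> k a u v" "op_rel \<Omega> k a u v'"
  shows "AE x in leb \<Omega>. v x = v' x"
proof -
  have "op_rel \<Omega> k a (u - u) (v - v')" by (rule op_rel_diff[OF assms])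
  then have r: "op_rel \<Omega> k a 0 (v - v')" by simp
  have "AE x in leb \<Omega>. (v - v') x = 0"
  proof (rule fundamental_lemma[OF O])
    show "integrable (leb \<Omega>) (v - v')" using op_rel_integrable[OF r] by simp
    show "(LINT x|leb \<Omega>. \<phi> x \<bullet> (v - v') x) = 0" if "\<phi> \<in> test_functions \<Omega>" for \<phi>
      using r that unfolding op_rel_iff by (auto simp: zero_fun_def)
  qed
  then show ?thesis by simp
qed

lemma op_rel_op: "u \<in> W \<Omega> k a \<Longrightarrow> op_rel \<Omega> k a u (op \<Omega> k a u)"
  unfolding W_def op_def mem_Collect_eq by (erule exE, rule someI[where P="op_rel \<Omega> k a u"], assumption)

lemma op_eq: "op_rel \<Omega> k a u v \<Longrightarrow> AE x in leb \<Omega>. op \<Omega> k a u x = v x"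
  by (rule op_rel_unique[OF op_rel_op]) (auto simp: W_def)

lemma integral_op_eq:
  assumes w: "w \<in> Linf \<Omega>" and r: "op_rel \<Omega> k a u v"
  shows "(LINT x|leb \<Omega>. w x \<bullet> op \<Omega> k a u x) = (LINT x|leb \<Omega>. w x \<bullet> v x)"
proof (rule integral_cong_AE)
  have wm: "w \<in> borel_measurable (leb \<Omega>)" using w by (simp add: Linf_def)
  have "op_rel \<Omega> k a u (op \<Omega> k a u)" using r by (intro op_rel_op) (auto simp: W_def)
  from op_rel_integrable[OF this] op_rel_integrable[OF r]
  have "op \<Omega> k a u \<in> borel_measurable (leb \<Omega>)" "v \<in> borel_measurable (leb \<Omega>)"
    by (simp_all add: borel_measurable_integrable)
  then show "(\<lambda>x. w x \<bullet> op \<Omega> k a u x) \<in> borel_measurable (leb \<Omega>)" "(\<lambda>x. w x \<bullet> v x) \<in> borel_measurable (leb \<Omega>)"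
    using wm by auto
  show "AE x in leb \<Omega>. w x \<bullet> op \<Omega> k a u x = w x \<bullet> v x"
    using op_eq[OF r] by eventually_elim simp
qed

lemma subspace_W: "subspace (W \<Omega> k a)"
proof (rule subspaceI)
  show "0 \<in> W \<Omega> k a" unfolding W_def mem_Collect_eq by (rule exI) (rule op_rel_zero)
  show "u + u' \<in> W \<Omega> k a" if u: "u \<in> W \<Omega> k a" "u' \<in> W \<Omega> k a" for u u'
  proof -
    obtain v v' where "op_rel \<Omega> k a u v" "op_rel \<Omega> k a u' v'" using u unfolding W_def mem_Collect_eq by blast
    from op_rel_add[OF this] show ?thesis unfolding W_def mem_Collect_eq by blast
  qed
  show "c *\<^sub>R u \<in> W \<Omega> k a" if u: "u \<in> W \<Omega> k a" for c u
  proof -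
    obtain v where "op_rel \<Omega> k a u v" using u unfolding W_def mem_Collect_eq by blast
    from op_rel_scale[OF this] show ?thesis unfolding W_def mem_Collect_eq by blast
  qed
qed

lemma op_image_iff: "v \<in> op_image \<Omega> k a \<longleftrightarrow> (\<exists>u. op_rel \<Omega> k a u v)"
  by (auto simp: op_image_def W_def)

lemma subspace_op_image: "subspace (op_image \<Omega> k a)"
proof (rule subspaceI)
  show "0 \<in> op_image \<Omega> k a" using op_rel_zero by (auto simp only: op_image_iff)
  show "v + v' \<in> op_image \<Omega> k a" if v: "v \<in> op_image \<Omega> k a" "v' \<in> op_image \<Omega> k a" for v v'
  proof -
    obtain u u' where "op_rel \<Omega> k a u v" "op_rel \<Omega> k a u' v'" using v unfolding op_image_iff by blast
    from op_rel_add[OF this] show ?thesis unfolding op_image_iff by blast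
  qed
  show "c *\<^sub>R v \<in> op_image \<Omega> k a" if v: "v \<in> op_image \<Omega> k a" for c v
  proof -
    obtain u where "op_rel \<Omega> k a u v" using v unfolding op_image_iff by blast
    from op_rel_scale[OF this] show ?thesis unfolding op_image_iff by blast
  qed
qed

text \<open>Membership in \<open>adj_domain\<close> says that pairing \<open>w\<close> with the
  image is bounded on \<open>W\<close> for the seminorm; the extension to all integrable functions
  is represented by a bounded function, which is an admissible choice for
  \<open>adj_op\<close>.\<close>

lemma adj_op_spec:
  assumes w: "w \<in> adj_domain \<Omega> k a"
  shows "adj_op \<Omega> k a w \<in> Linf \<Omega>"
    "\<And>u. u \<in> W \<Omega> k a \<Longrightarrow> (LINT x|leb \<Omega>. adj_op \<Omega> k a w x \<bullet> u x) = (LINT x|leb \<Omega>. w x \<bullet> op \<Omega> k a u x)"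
proof -
  have wL: "w \<in> Linf \<Omega>" using w by (simp add: adj_domain_def)
  obtain c where c: "0 < c" "\<And>u. u \<in> W \<Omega> k a \<Longrightarrow> \<bar>LINT x|leb \<Omega>. w x \<bullet> op \<Omega> k a u x\<bar> \<le> c * N1 u"
    using w by (auto simp: adj_domain_def)
  have i: "integrable (leb \<Omega>) (\<lambda>x. w x \<bullet> v x)" if "integrable (leb \<Omega>) v" for v
    using Linf_inner[OF wL] that by blast
  have "\<exists>g\<in>Linf \<Omega>. \<forall>u\<in>W \<Omega> k a. (LINT x|leb \<Omega>. w x \<bullet> op \<Omega> k a u x) = (LINT x|leb \<Omega>. g x \<bullet> u x)"
  proof (rule L1_extension[OF fin subspace_W, where C=c])
    show "W \<Omega> k a \<subseteq> L1 \<Omega>" using op_rel_integrable by (auto simp: W_def L1_def)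
    fix u u' assume u: "u \<in> W \<Omega> k a" "u' \<in> W \<Omega> k a"
    note r = op_rel_op[OF u(1)] op_rel_op[OF u(2)]
    show "(LINT x|leb \<Omega>. w x \<bullet> op \<Omega> k a (u + u') x) = (LINT x|leb \<Omega>. w x \<bullet> op \<Omega> k a u x) + (LINT x|leb \<Omega>. w x \<bullet> op \<Omega> k a u' x)"
      using integral_op_eq[OF wL op_rel_add[OF r]] i op_rel_integrable[OF r(1)] op_rel_integrable[OF r(2)]
      by (simp add: inner_add_right)
  next
    fix u s assume u: "u \<in> W \<Omega> k a"
    show "(LINT x|leb \<Omega>. w x \<bullet> op \<Omega> k a (s *\<^sub>R u) x) = s * (LINT x|leb \<Omega>. w x \<bullet> op \<Omega> k a u x)"
      using integral_op_eq[OF wL op_rel_scale[OF op_rel_op[OF u], of s]] by simp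
  next
    fix u assume "u \<in> W \<Omega> k a"
    then show "(LINT x|leb \<Omega>. w x \<bullet> op \<Omega> k a u x) \<le> c * N1 u" using c(2) by (auto simp: abs_le_iff)
  qed (use c in auto)
  then obtain g where "g \<in> Linf \<Omega>" "\<forall>u\<in>W \<Omega> k a. (LINT x|leb \<Omega>. w x \<bullet> op \<Omega> k a u x) = (LINT x|leb \<Omega>. g x \<bullet> u x)" by blast
  then have "\<exists>g. g \<in> Linf \<Omega> \<and> (\<forall>u\<in>W \<Omega> k a. (LINT x|leb \<Omega>. g x \<bullet> u x) = (LINT x|leb \<Omega>. w x \<bullet> op \<Omega> k a u x))"
    by (intro exI[of _ g]) simp
  from someI_ex[OF this] show "adj_op \<Omega> k a w \<in> Linf \<Omega>"
    "\<And>u. u \<in> W \<Omega> k a \<Longrightarrow> (LINT x|leb \<Omega>. adj_op \<Omega> k a w x \<bullet> u x) = (LINT x|leb \<Omega>. w x \<bullet> op \<Omega> k a u x)"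
    unfolding adj_op_def by blast+
qed

text \<open>Test functions belong to \<open>W\<close>, and they determine an integrable function
  almost everywhere.\<close>

lemma adj_op_unique:
  assumes w: "w \<in> adj_domain \<Omega> k a" and g: "g \<in> Linf \<Omega>"
    and eq: "\<And>u. u \<in> W \<Omega> k a \<Longrightarrow> (LINT x|leb \<Omega>. g x \<bullet> u x) = (LINT x|leb \<Omega>. w x \<bullet> op \<Omega> k a u x)"
  shows "AE x in leb \<Omega>. adj_op \<Omega> k a w x = g x"
proof -
  note s = adj_op_spec[OF w]
  have int: "integrable (leb \<Omega>) h" if h: "h \<in> Linf \<Omega>" for h :: "'a \<Rightarrow> 'b"
    using h by (auto simp: Linf_def intro: L.integrable_const_bound)
  have "AE x in leb \<Omega>. adj_op \<Omega> k a w x - g x = 0"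
  proof (rule fundamental_lemma[OF O])
    show "integrable (leb \<Omega>) (\<lambda>x. adj_op \<Omega> k a w x - g x)" using int[OF s(1)] int[OF g] by simp
    fix \<phi> :: "'a \<Rightarrow> 'b" assume \<phi>: "\<phi> \<in> test_functions \<Omega>"
    have "(LINT x|leb \<Omega>. adj_op \<Omega> k a w x \<bullet> \<phi> x) = (LINT x|leb \<Omega>. g x \<bullet> \<phi> x)"
      using s(2) eq test_function_in_W[OF \<phi>] by simp
    then show "(LINT x|leb \<Omega>. \<phi> x \<bullet> (adj_op \<Omega> k a w x - g x)) = 0"
      using integrable_test_inner[OF \<phi> int[OF s(1)]] integrable_test_inner[OF \<phi> int[OF g]]
      by (simp add: inner_diff_right inner_commute)
  qed
  then show ?thesis by simp
qed

lemma affine_funD: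
  assumes u0: "u0 \<in> W \<Omega> k a" and u: "u \<in> affine_fun \<Omega> k a u0"
  shows "op_rel \<Omega> k a u (op \<Omega> k a u0)" "u \<in> W \<Omega> k a" "integrable (leb \<Omega>) u"
proof -
  obtain v where v: "v \<in> ker_fun \<Omega> k a" and uv: "u = (\<lambda>x. u0 x + v x)" using u by (auto simp: affine_fun_def)
  have "op_rel \<Omega> k a (u0 + v) (op \<Omega> k a u0 + 0)"
    using v by (intro op_rel_add op_rel_op u0) (simp add: ker_fun_iff)
  moreover have "u0 + v = u" using uv by (simp add: plus_fun_def)
  ultimately show r: "op_rel \<Omega> k a u (op \<Omega> k a u0)" by simp
  then show "u \<in> W \<Omega> k a" "integrable (leb \<Omega>) u" using op_rel_integrable by (auto simp: W_def)
qed

text \<open>All members of the affine class have the same image under the operator. The integral is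
  therefore constant along admissible sequences, and this constant is the linear term of the dual
  functional.\<close>

lemma pairing_affine:
  assumes u0: "u0 \<in> W \<Omega> k a" and u: "u \<in> affine_fun \<Omega> k a u0" and w: "w \<in> adj_domain \<Omega> k a"
  shows "(LINT x|leb \<Omega>. adj_op \<Omega> k a w x \<bullet> u x) = (LINT x|leb \<Omega>. w x \<bullet> op \<Omega> k a u0 x)"
proof -
  have "w \<in> Linf \<Omega>" using w by (simp add: adj_domain_def)
  then show ?thesis
    using adj_op_spec(2)[OF w affine_funD(2)[OF u0 u]] integral_op_eq[OF _ affine_funD(1)[OF u0 u]] by simp
qed

text \<open>Open mapping theorem for the closed operator on its closed range: by Baire's argument some
  set of images of a bounded set is dense in a ball, and successive approximation removes the closure.\<close>

lemma closed_range_preimage: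
  assumes H1: "strongly_closed_L1 \<Omega> (op_image \<Omega> k a)"
  shows "\<exists>K. \<forall>v\<in>op_image \<Omega> k a. \<forall>\<delta>>0. \<exists>u. op_rel \<Omega> k a u v \<and> N1 u \<le> K * (N1 v + \<delta>)"
proof -
  let ?V = "op_image \<Omega> k a"
  define B where "B n = {v. \<exists>u. op_rel \<Omega> k a u v \<and> N1 u \<le> real n}" for n
  have Vi: "integrable (leb \<Omega>) v" if "v \<in> ?V" for v using that op_rel_integrable by (auto simp: op_image_iff)
  have Bi: "integrable (leb \<Omega>) v" if "v \<in> B n" for v n using that op_rel_integrable by (auto simp: B_def)
  have "\<exists>n. \<exists>v0\<in>?V. \<exists>r>0. \<forall>v\<in>?V. N1 (\<lambda>x. v x - v0 x) < r \<longrightarrow> (\<forall>e>0. \<exists>v'\<in>B n. N1 (\<lambda>x. v x - v' x) < e)"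
  proof (rule ccontr)
    assume notdense: "\<not> ?thesis"
    have neg: "\<exists>v\<in>?V. N1 (\<lambda>x. v x - v0 x) < r \<and> (\<exists>e>0. \<forall>v'\<in>B n. \<not> N1 (\<lambda>x. v x - v' x) < e)"
      if "v0 \<in> ?V" "0 < r" for n v0 r
      using that notdense by blast
    \<comment> \<open>Pairs of centre and radius. Each new centre stays within the old radius, the
      radii at least halve, and the new centre keeps distance \<open>4 * snd (p (Suc n))\<close>
      from \<open>B n\<close>. The limit is within \<open>2 * snd (p (Suc n))\<close> of that
      centre, hence outside every \<open>B n\<close>.\<close>
    have "\<exists>p. \<forall>n. (fst (p n) \<in> ?V \<and> 0 < snd (p n)) \<and> (N1 (\<lambda>x. fst (p n) x - fst (p (Suc n)) x) \<le> snd (p n) \<and>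
        2 * snd (p (Suc n)) \<le> snd (p n) \<and> (\<forall>v'\<in>B n. 4 * snd (p (Suc n)) \<le> N1 (\<lambda>x. fst (p (Suc n)) x - v' x)))"
    proof (rule dependent_nat_choice[where P="\<lambda>n p. fst p \<in> ?V \<and> 0 < snd p"
          and Q="\<lambda>n p q. N1 (\<lambda>x. fst p x - fst q x) \<le> snd p \<and> 2 * snd q \<le> snd p \<and> (\<forall>v'\<in>B n. 4 * snd q \<le> N1 (\<lambda>x. fst q x - v' x))"])
      show "\<exists>p :: ('a \<Rightarrow> 'c) \<times> real. fst p \<in> ?V \<and> 0 < snd p"
        using subspace_0[OF subspace_op_image] by (intro exI[of _ "(0, 1)"]) auto
      fix p :: "('a \<Rightarrow> 'c) \<times> real" and n assume p: "fst p \<in> ?V \<and> 0 < snd p"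
      then obtain v e where v: "v \<in> ?V" "N1 (\<lambda>x. v x - fst p x) < snd p" "0 < e" "\<forall>v'\<in>B n. \<not> N1 (\<lambda>x. v x - v' x) < e"
        using neg by blast
      show "\<exists>q. (fst q \<in> ?V \<and> 0 < snd q) \<and> (N1 (\<lambda>x. fst p x - fst q x) \<le> snd p \<and> 2 * snd q \<le> snd p \<and> (\<forall>v'\<in>B n. 4 * snd q \<le> N1 (\<lambda>x. fst q x - v' x)))"
        using v p by (intro exI[of _ "(v, min (snd p / 2) (e / 4))"]) (auto simp: norm_minus_commute not_less min_def)
    qed
    then obtain p where p: "\<And>n. fst (p n) \<in> ?V" "\<And>n. 0 < snd (p n)" "\<And>n. N1 (\<lambda>x. fst (p n) x - fst (p (Suc n)) x) \<le> snd (p n)"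
       "\<And>n. 2 * snd (p (Suc n)) \<le> snd (p n)" "\<And>n v'. v' \<in> B n \<Longrightarrow> 4 * snd (p (Suc n)) \<le> N1 (\<lambda>x. fst (p (Suc n)) x - v' x)" by blast
    note g = L1_geometric[of "leb \<Omega>" "\<lambda>n. fst (p n)" "\<lambda>n. snd (p n)", OF Vi[OF p(1)] less_imp_le[OF p(2)] p(4) p(3)]
    obtain S where S: "integrable (leb \<Omega>) S" "\<And>n. N1 (\<lambda>x. fst (p n) x - S x) \<le> 2 * snd (p n)" using g(2) by blast
    have "(\<lambda>n. N1 (\<lambda>x. fst (p n) x - S x)) \<longlonglongrightarrow> 0"
    proof (rule tendsto_sandwich[OF _ _ tendsto_const])
      show "(\<lambda>n. 2 * snd (p n)) \<longlonglongrightarrow> 0" using tendsto_mult[OF tendsto_const[of 2] g(1)] by simp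
    qed (use S(2) in auto)
    \<comment> \<open>Closedness of the range enters here: the limit has a preimage and so lies in
      some \<open>B n\<close>.\<close>
    with H1 have "S \<in> ?V"
      unfolding strongly_closed_L1_def
      by (elim allE[of _ "\<lambda>n. fst (p n)"] allE[of _ S] mp) (use p(1) S(1) in \<open>auto simp: L1_def\<close>)
    then obtain u where u: "op_rel \<Omega> k a u S" by (auto simp: op_image_iff)
    obtain n where "N1 u \<le> real n" using real_arch_simple by blast
    then have "S \<in> B n" using u by (auto simp: B_def)
    from p(5)[OF this] S(2)[of "Suc n"] p(2)[of "Suc n"] show False by linarith
  qed
  then obtain n v0 r where v0: "v0 \<in> ?V" "0 < r"
    and ball: "\<And>v e. v \<in> ?V \<Longrightarrow> N1 (\<lambda>x. v x - v0 x) < r \<Longrightarrow> 0 < e \<Longrightarrow> \<exists>v'\<in>B n. N1 (\<lambda>x. v x - v' x) < e" by blast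
  \<comment> \<open>Subtracting an approximation of the centre \<open>v0\<close> moves the ball to
    the origin, at the price of the doubled bound \<open>2 * real n\<close>.\<close>
  have small: "\<exists>u v'. op_rel \<Omega> k a u v' \<and> N1 u \<le> 2 * real n \<and> N1 (\<lambda>x. v x - v' x) < e"
    if v: "v \<in> ?V" "N1 v < r" and e: "0 < e" for v e
  proof -
    have "v0 + v \<in> ?V" using v v0 subspace_op_image by (simp add: subspace_add)
    then obtain p where p: "p \<in> B n" "N1 (\<lambda>x. (v0 + v) x - p x) < e/2"
      using ball[of "v0 + v" "e/2"] v e by auto
    obtain q where q: "q \<in> B n" "N1 (\<lambda>x. v0 x - q x) < e/2"
      using ball[of v0 "e/2"] v0 e by auto
    obtain a' b' where ab: "op_rel \<Omega> k a a' p" "N1 a' \<le> real n" "op_rel \<Omega> k a b' q" "N1 b' \<le> real n"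
      using p(1) q(1) by (auto simp: B_def)
    have 1: "N1 (\<lambda>x. a' x + - b' x) \<le> N1 a' + N1 (\<lambda>x. - b' x)"
      using ab op_rel_integrable by (intro norm1_triangle_add) auto
    have 2: "N1 (\<lambda>x. ((v0 + v) x - p x) + - (v0 x - q x)) \<le> N1 (\<lambda>x. (v0 + v) x - p x) + N1 (\<lambda>x. - (v0 x - q x))"
      using Vi[OF v(1)] Vi[OF v0(1)] Bi[OF p(1)] Bi[OF q(1)] by (intro norm1_triangle_add) auto
    have eqs: "((v0 + v) x - p x) + - (v0 x - q x) = v x - (p - q) x" for x by simp
    have "N1 (a' - b') \<le> 2 * real n" using 1 ab by simp
    moreover have "N1 (\<lambda>x. v x - (p - q) x) < e"
      using 2 p(2) q(2) unfolding eqs by (simp add: norm_minus_commute)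
    ultimately show ?thesis using op_rel_diff[OF ab(1,3)] by blast
  qed
  \<comment> \<open>Scaling by \<open>r / (2 * N1 v)\<close> brings \<open>v\<close> into the ball;
    undoing it turns the bound \<open>2 * real n\<close> into \<open>K * N1 v\<close>.\<close>
  define K where "K = 4 * real n / r"
  have K: "0 \<le> K" using v0 by (simp add: K_def)
  have approx: "\<exists>u v'. op_rel \<Omega> k a u v' \<and> N1 u \<le> K * N1 v \<and> N1 (\<lambda>x. v x - v' x) < e"
    if v: "v \<in> ?V" and e: "0 < e" for v e
  proof (cases "N1 v = 0")
    case True
    then show ?thesis using op_rel_zero e by (intro exI[of _ 0]) auto
  next
    case False
    moreover have "0 \<le> N1 v" by simp
    ultimately have pos: "0 < N1 v" by linarith
    define t where "t = r / (2 * N1 v)"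
    have t: "0 < t" using pos v0 by (simp add: t_def)
    have "t *\<^sub>R v \<in> ?V" using v subspace_op_image by (simp add: subspace_scale)
    moreover have "N1 (t *\<^sub>R v) < r"
    proof -
      have "N1 (t *\<^sub>R v) = t * N1 v" using t by simp
      then show ?thesis using pos v0 by (simp add: t_def)
    qed
    moreover have "0 < t * e" using t e by simp
    ultimately obtain u v' where uv: "op_rel \<Omega> k a u v'" "N1 u \<le> 2 * real n" "N1 (\<lambda>x. (t *\<^sub>R v) x - v' x) < t * e"
      using small by blast
    have "op_rel \<Omega> k a (inverse t *\<^sub>R u) (inverse t *\<^sub>R v')" by (rule op_rel_scale[OF uv(1)])
    moreover have "N1 (inverse t *\<^sub>R u) \<le> K * N1 v"
    proof -
      have "N1 (inverse t *\<^sub>R u) = inverse t * N1 u" using t by simp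
      also have "\<dots> \<le> inverse t * (2 * real n)" using t uv(2) by (intro mult_left_mono) auto
      also have "\<dots> = K * N1 v" using pos v0 by (simp add: t_def K_def field_simps)
      finally show ?thesis .
    qed
    moreover have "N1 (\<lambda>x. v x - (inverse t *\<^sub>R v') x) < e"
    proof -
      have "norm (v x - (inverse t *\<^sub>R v') x) = inverse t * norm ((t *\<^sub>R v) x - v' x)" for x
      proof -
        have "v x - (inverse t *\<^sub>R v') x = inverse t *\<^sub>R ((t *\<^sub>R v) x - v' x)"
          using t by (simp add: scaleR_diff_right)
        then show ?thesis using t by simp
      qed
      then have "N1 (\<lambda>x. v x - (inverse t *\<^sub>R v') x) = inverse t * N1 (\<lambda>x. (t *\<^sub>R v) x - v' x)" by simp
      also have "\<dots> < inverse t * (t * e)" using t uv(3) by (intro mult_strict_left_mono) auto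
      also have "inverse t * (t * e) = e" using t by (simp add: mult.assoc[symmetric])
      finally show ?thesis .
    qed
    ultimately show ?thesis by blast
  qed
  have "\<exists>u. op_rel \<Omega> k a u v \<and> N1 u \<le> (2 * K) * (N1 v + \<delta>)" if v: "v \<in> ?V" and d: "0 < \<delta>" for v \<delta>
  proof -
    \<comment> \<open>\<open>\<delta>\<close> keeps the tolerances positive when the seminorm of
      \<open>v\<close> is 0.\<close>
    define e where "e m = (N1 v + \<delta>) * (1/2) ^ m" for m
    have Nv: "0 \<le> N1 v" by simp
    then have e0: "0 < e m" for m using d by (simp add: e_def add_nonneg_pos)
    \<comment> \<open>Partial sums of the series of corrections, paired with their images. The
      clause for \<open>m = 0\<close> records the start at 0, from which the norm of the limit is
      estimated.\<close>
    have "\<exists>p. \<forall>m. ((op_rel \<Omega> k a (fst (p m)) (snd (p m)) \<and> N1 (\<lambda>x. v x - snd (p m) x) \<le> e m) \<and> (m = 0 \<longrightarrow> fst (p m) = 0)) \<and>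
        N1 (\<lambda>x. fst (p m) x - fst (p (Suc m)) x) \<le> K * e m"
    proof (rule dependent_nat_choice[where P="\<lambda>m p. (op_rel \<Omega> k a (fst p) (snd p) \<and> N1 (\<lambda>x. v x - snd p x) \<le> e m) \<and> (m = 0 \<longrightarrow> fst p = 0)"
         and Q="\<lambda>m p q. N1 (\<lambda>x. fst p x - fst q x) \<le> K * e m"])
      show "\<exists>p. (op_rel \<Omega> k a (fst p) (snd p) \<and> N1 (\<lambda>x. v x - snd p x) \<le> e 0) \<and> (0 = (0::nat) \<longrightarrow> fst p = 0)"
        using op_rel_zero d by (intro exI[of _ "(0, 0)"]) (auto simp: e_def)
      fix p :: "('a \<Rightarrow> 'b) \<times> ('a \<Rightarrow> 'c)" and m
      assume p: "(op_rel \<Omega> k a (fst p) (snd p) \<and> N1 (\<lambda>x. v x - snd p x) \<le> e m) \<and> (m = 0 \<longrightarrow> fst p = 0)"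
      have "snd p \<in> ?V" using p by (auto simp: op_image_iff)
      then have "v - snd p \<in> ?V" using v subspace_op_image by (simp add: subspace_diff)
      then obtain u v' where uv: "op_rel \<Omega> k a u v'" "N1 u \<le> K * N1 (v - snd p)" "N1 (\<lambda>x. (v - snd p) x - v' x) < e (Suc m)"
        using approx e0 by blast
      have 1: "op_rel \<Omega> k a (fst p + u) (snd p + v')" using p uv by (intro op_rel_add) auto
      have eq: "v x - (snd p + v') x = (v - snd p) x - v' x" for x by simp
      have 2: "N1 (\<lambda>x. v x - (snd p + v') x) \<le> e (Suc m)" unfolding eq using uv(3) by simp
      have "K * N1 (v - snd p) \<le> K * e m" using p K by (intro mult_left_mono) auto
      then have 3: "N1 (\<lambda>x. fst p x - (fst p + u) x) \<le> K * e m" using uv(2) by simp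
      show "\<exists>q. ((op_rel \<Omega> k a (fst q) (snd q) \<and> N1 (\<lambda>x. v x - snd q x) \<le> e (Suc m)) \<and> (Suc m = 0 \<longrightarrow> fst q = 0)) \<and> N1 (\<lambda>x. fst p x - fst q x) \<le> K * e m"
        by (rule exI[of _ "(fst p + u, snd p + v')"], unfold fst_conv snd_conv) (use 1 2 3 in blast)
    qed
    then obtain p where p: "\<And>m. op_rel \<Omega> k a (fst (p m)) (snd (p m))" "\<And>m. N1 (\<lambda>x. v x - snd (p m) x) \<le> e m" "fst (p 0) = 0"
      "\<And>m. N1 (\<lambda>x. fst (p m) x - fst (p (Suc m)) x) \<le> K * e m" by blast
    have r: "0 \<le> K * e m" "2 * (K * e (Suc m)) \<le> K * e m" for m using K e0[of m] by (auto simp: e_def)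
    have pi: "integrable (leb \<Omega>) (fst (p m))" for m using p(1) op_rel_integrable by blast
    note g = L1_geometric[of "leb \<Omega>" "\<lambda>m. fst (p m)" "\<lambda>m. K * e m", OF pi r p(4)]
    obtain U where U: "integrable (leb \<Omega>) U" "\<And>m. N1 (\<lambda>x. fst (p m) x - U x) \<le> 2 * (K * e m)" using g(2) by blast
    have "op_rel \<Omega> k a U v"
    proof (rule op_rel_closed[OF p(1) U(1) Vi[OF v]])
      show "(\<lambda>m. N1 (\<lambda>x. fst (p m) x - U x)) \<longlonglongrightarrow> 0"
      proof (rule tendsto_sandwich[OF _ _ tendsto_const])
        show "(\<lambda>m. 2 * (K * e m)) \<longlonglongrightarrow> 0" using tendsto_mult[OF tendsto_const[of 2] g(1)] by simp
      qed (use U(2) in auto)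
      show "(\<lambda>m. N1 (\<lambda>x. snd (p m) x - v x)) \<longlonglongrightarrow> 0"
      proof (rule tendsto_sandwich[OF _ _ tendsto_const])
        have "(\<lambda>m. (N1 v + \<delta>) * (1/2) ^ m) \<longlonglongrightarrow> (N1 v + \<delta>) * 0" by (intro tendsto_intros) auto
        then show "e \<longlonglongrightarrow> 0" by (simp add: e_def[abs_def])
      qed (use p(2) in \<open>auto simp: norm_minus_commute\<close>)
    qed
    moreover have "N1 U \<le> 2 * K * (N1 v + \<delta>)" using U(2)[of 0] p(3) by (simp add: e_def)
    ultimately show ?thesis by blast
  qed
  then show ?thesis by blast
qed

text \<open>As \<open>g\<close> annihilates the kernel, \<open>T v\<close> does not depend on the
  preimage of \<open>v\<close>. The preimage estimate makes \<open>T\<close> bounded on the range,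
  and the function representing its extension is the required \<open>w\<close>.\<close>

theorem adjoint_range:
  assumes H1: "strongly_closed_L1 \<Omega> (op_image \<Omega> k a)" and g: "g \<in> Linf \<Omega>"
    and perp: "\<And>v. v \<in> ker_fun \<Omega> k a \<Longrightarrow> (LINT x|leb \<Omega>. g x \<bullet> v x) = 0"
  shows "\<exists>w\<in>adj_domain \<Omega> k a. AE x in leb \<Omega>. adj_op \<Omega> k a w x = g x"
proof -
  obtain C where C: "0 < C" "\<And>u. integrable (leb \<Omega>) u \<Longrightarrow> integrable (leb \<Omega>) (\<lambda>x. g x \<bullet> u x)"
      "\<And>u. integrable (leb \<Omega>) u \<Longrightarrow> (LINT x|leb \<Omega>. \<bar>g x \<bullet> u x\<bar>) \<le> C * N1 u"
    using Linf_inner[OF g] by blast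
  have gle: "\<bar>LINT x|leb \<Omega>. g x \<bullet> u x\<bar> \<le> C * N1 u" if "integrable (leb \<Omega>) u" for u
    using C(3)[OF that] integral_abs_bound[of "leb \<Omega>" "\<lambda>x. g x \<bullet> u x"] by linarith
  define T where "T v = (LINT x|leb \<Omega>. g x \<bullet> (SOME u. op_rel \<Omega> k a u v) x)" for v
  have T: "T v = (LINT x|leb \<Omega>. g x \<bullet> u x)" if r: "op_rel \<Omega> k a u v" for u v
  proof -
    let ?s = "SOME u. op_rel \<Omega> k a u v"
    have s: "op_rel \<Omega> k a ?s v" using r by (rule someI[where P="\<lambda>u. op_rel \<Omega> k a u v"])
    have "op_rel \<Omega> k a (?s - u) (v - v)" by (rule op_rel_diff[OF s r])
    then have "?s - u \<in> ker_fun \<Omega> k a" by (simp add: ker_fun_iff)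
    from perp[OF this] show ?thesis
      using C(2) op_rel_integrable[OF s] op_rel_integrable[OF r] by (simp add: T_def inner_diff_right)
  qed
  obtain K where K: "\<And>v \<delta>. v \<in> op_image \<Omega> k a \<Longrightarrow> 0 < \<delta> \<Longrightarrow> \<exists>u. op_rel \<Omega> k a u v \<and> N1 u \<le> K * (N1 v + \<delta>)"
    using closed_range_preimage[OF H1] by blast
  define K' where "K' = max 1 K"
  have Tb: "T v \<le> (C * K') * N1 v" if v: "v \<in> op_image \<Omega> k a" for v
  proof -
    have le: "T v \<le> (C * K') * (N1 v + \<delta>)" if d: "0 < \<delta>" for \<delta>
    proof -
      obtain u where u: "op_rel \<Omega> k a u v" "N1 u \<le> K * (N1 v + \<delta>)" using K[OF v d] by blast
      have "T v \<le> C * N1 u" using gle[of u] T[OF u(1)] op_rel_integrable[OF u(1)] by (simp add: abs_le_iff)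
      also have "\<dots> \<le> C * (K' * (N1 v + \<delta>))"
        using u(2) C(1) d by (intro mult_left_mono order_trans[OF u(2)] mult_right_mono) (auto simp: K'_def add_nonneg_nonneg)
      finally show ?thesis by (simp add: mult.assoc)
    qed
    show ?thesis
    proof (rule field_le_epsilon)
      fix e :: real assume "0 < e"
      moreover have pos: "0 < C * K'" using C(1) by (simp add: K'_def)
      ultimately have "T v \<le> (C * K') * (N1 v + e / (C * K'))" by (intro le) simp
      also have "\<dots> = (C * K') * N1 v + (C * K') * (e / (C * K'))" by (rule distrib_left)
      also have "(C * K') * (e / (C * K')) = e" using pos by (metis less_irrefl nonzero_mult_div_cancel_left times_divide_eq_right)
      finally show "T v \<le> (C * K') * N1 v + e" .
    qed
  qed
  have "\<exists>w\<in>Linf \<Omega>. \<forall>v\<in>op_image \<Omega> k a. T v = (LINT x|leb \<Omega>. w x \<bullet> v x)"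
  proof (rule L1_extension[OF fin subspace_op_image _ _ _ Tb])
    show "op_image \<Omega> k a \<subseteq> L1 \<Omega>" using op_rel_integrable by (auto simp: op_image_iff L1_def)
    show "T (v + v') = T v + T v'" if v: "v \<in> op_image \<Omega> k a" "v' \<in> op_image \<Omega> k a" for v v'
    proof -
      obtain u u' where u: "op_rel \<Omega> k a u v" "op_rel \<Omega> k a u' v'" using v by (auto simp: op_image_iff)
      show ?thesis using T[OF op_rel_add[OF u]] T[OF u(1)] T[OF u(2)] C(2) op_rel_integrable[OF u(1)] op_rel_integrable[OF u(2)]
        by (simp add: inner_add_right)
    qed
    show "T (s *\<^sub>R v) = s * T v" if v: "v \<in> op_image \<Omega> k a" for v s
    proof -
      obtain u where u: "op_rel \<Omega> k a u v" using v by (auto simp: op_image_iff)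
      show ?thesis using T[OF op_rel_scale[OF u, of s]] T[OF u] by simp
    qed
    show "0 \<le> C * K'" using C(1) by (simp add: K'_def)
  qed
  then obtain w where w: "w \<in> Linf \<Omega>" "\<And>v. v \<in> op_image \<Omega> k a \<Longrightarrow> T v = (LINT x|leb \<Omega>. w x \<bullet> v x)" by blast
  have eq: "(LINT x|leb \<Omega>. g x \<bullet> u x) = (LINT x|leb \<Omega>. w x \<bullet> op \<Omega> k a u x)" if u: "u \<in> W \<Omega> k a" for u
    using w(2)[of "op \<Omega> k a u"] T[OF op_rel_op[OF u]] op_rel_op[OF u] by (auto simp: op_image_iff)
  have wd: "w \<in> adj_domain \<Omega> k a"
    unfolding adj_domain_def using w(1) C(1) gle op_rel_integrable op_rel_op
    by (auto simp: eq[symmetric] intro!: exI[of _ C])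
  then show ?thesis using adj_op_unique[OF wd g eq] by blast
qed

end

section \<open>Conjugate integrands and Lagrange multipliers\<close>

text \<open>Positive and negative part both have finite integrals here, so the difference in
  \<open>ereal_integral\<close> is one of real numbers.\<close>

lemma ereal_integral_eq:
  assumes q: "integrable N q" and eq: "AE x in N. c x = ereal (q x)"
  shows "ereal_integral N c = ereal (LINT x|N. q x)"
proof -
  have 1: "(\<integral>\<^sup>+x. e2ennreal (c x) \<partial>N) = (\<integral>\<^sup>+x. ennreal (q x) \<partial>N)"
    by (rule nn_integral_cong_AE) (use eq in eventually_elim, simp add: e2ennreal_ereal)
  have 2: "(\<integral>\<^sup>+x. e2ennreal (- c x) \<partial>N) = (\<integral>\<^sup>+x. ennreal (- q x) \<partial>N)"
    by (rule nn_integral_cong_AE) (use eq in eventually_elim, simp add: e2ennreal_ereal)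
  have "integrable N (\<lambda>x. - q x)" using q by simp
  then have fin: "(\<integral>\<^sup>+x. ennreal (q x) \<partial>N) \<noteq> top" "(\<integral>\<^sup>+x. ennreal (- q x) \<partial>N) \<noteq> top"
    using q by (auto simp: real_integrable_def)
  obtain a b where ab: "(\<integral>\<^sup>+x. ennreal (q x) \<partial>N) = ennreal a" "0 \<le> a" "(\<integral>\<^sup>+x. ennreal (- q x) \<partial>N) = ennreal b" "0 \<le> b"
    using fin by (metis ennreal_cases)
  show ?thesis
    unfolding ereal_integral_def 1 2 real_lebesgue_integral_def[OF q] using ab by (simp add: enn2ereal_ennreal)
qed

lemma SUP_ereal_le_iff_real: "(SUP n. ereal (a n)) \<le> ereal b \<longleftrightarrow> (\<forall>n. a n \<le> b)"
  by (simp add: SUP_le_iff)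

context integrand begin

lemma finite_leb_integrable:
  assumes fin: "finite_measure (leb \<Omega>)" and u: "integrable (leb \<Omega>) u"
  shows "integrable (leb \<Omega>) (\<lambda>x. f x (u x))"
  using relaxation.persp_integrable[OF relaxation_leb[OF fin] u] by simp

lemma fenchel_young: "ereal (zs \<bullet> z - f x z) \<le> conj_fun f x zs"
  unfolding conj_fun_def by (rule SUP_upper) simp

lemma conj_fun_lower:
  assumes "x \<in> \<Omega>" shows "ereal (- M) \<le> conj_fun f x zs"
proof -
  have "ereal (- M) \<le> ereal (zs \<bullet> 0 - f x 0)" using growth[OF assms, of 0] by simp
  also have "\<dots> \<le> conj_fun f x zs" by (rule fenchel_young)
  finally show ?thesis .
qed

text \<open>By continuity of \<open>f x\<close> a countable dense set suffices, chosen independently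
  of \<open>x\<close>; this yields measurability. The first entry 0 supplies the lower bound
  \<open>- M\<close> from which the later selections start.\<close>

lemma conj_fun_countable:
  "\<exists>Z::nat \<Rightarrow> 'b. Z 0 = 0 \<and> (\<forall>x\<in>\<Omega>. \<forall>zs. conj_fun f x zs = (SUP n. ereal (zs \<bullet> Z n - f x (Z n))))"
proof -
  obtain D :: "'b set" where D: "countable D" "\<And>X. open X \<Longrightarrow> X \<noteq> {} \<Longrightarrow> \<exists>d\<in>D. d \<in> X"
    by (rule countable_dense_setE) blast
  have ne: "D \<noteq> {}" using D(2)[of UNIV] by auto
  define Z where "Z n = (case n of 0 \<Rightarrow> 0 | Suc n \<Rightarrow> from_nat_into D n)" for n
  have "conj_fun f x zs = (SUP n. ereal (zs \<bullet> Z n - f x (Z n)))" if x: "x \<in> \<Omega>" for x zs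
  proof (rule antisym)
    show "(SUP n. ereal (zs \<bullet> Z n - f x (Z n))) \<le> conj_fun f x zs"
      by (intro SUP_least fenchel_young)
    show "conj_fun f x zs \<le> (SUP n. ereal (zs \<bullet> Z n - f x (Z n)))"
      unfolding conj_fun_def
    proof (rule SUP_least, rule ccontr)
      fix z assume "\<not> ereal (zs \<bullet> z - f x z) \<le> (SUP n. ereal (zs \<bullet> Z n - f x (Z n)))"
      then have lt: "(SUP n. ereal (zs \<bullet> Z n - f x (Z n))) < ereal (zs \<bullet> z - f x z)" by simp
      let ?S = "{y. (SUP n. ereal (zs \<bullet> Z n - f x (Z n))) < ereal (zs \<bullet> y - f x y)}"
      have "continuous_on UNIV (f x)"
      proof -
        have "continuous_on UNIV (\<lambda>z::'b. (x, z))" by (intro continuous_intros)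
        then have "continuous_on UNIV (\<lambda>z. case (x, z) of (x, z) \<Rightarrow> f x z)"
          by (rule continuous_on_compose2[OF cont]) (use x in auto)
        then show ?thesis by simp
      qed
      then have "continuous_on UNIV (\<lambda>y. ereal (zs \<bullet> y - f x y))" by (intro continuous_intros)
      then have "open ?S" by (intro open_Collect_less continuous_on_const)
      moreover have "?S \<noteq> {}" using lt by auto
      ultimately obtain d where d: "d \<in> D" "d \<in> ?S" using D(2) by blast
      obtain n where "from_nat_into D n = d" using from_nat_into_surj[OF D(1) d(1)] by blast
      then have "Z (Suc n) = d" by (simp add: Z_def)
      then have "ereal (zs \<bullet> d - f x d) \<le> (SUP n. ereal (zs \<bullet> Z n - f x (Z n)))"
        by (intro SUP_upper2[of "Suc n"]) auto
      then show False using d(2) by simp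
    qed
  qed
  moreover have "Z 0 = 0" by (simp add: Z_def)
  ultimately show ?thesis by blast
qed

lemma conj_fun_measurable:
  assumes g: "g \<in> borel_measurable (leb \<Omega>)"
  shows "(\<lambda>x. conj_fun f x (g x)) \<in> borel_measurable (leb \<Omega>)"
proof -
  obtain Z :: "nat \<Rightarrow> 'b" where Z': "\<forall>x\<in>\<Omega>. \<forall>zs. conj_fun f x zs = (SUP n. ereal (zs \<bullet> Z n - f x (Z n)))"
    using conj_fun_countable by (elim exE conjE)
  note Z = Z'[rule_format]
  have fz: "(\<lambda>x. f x (Z n)) \<in> borel_measurable (leb \<Omega>)" for n
    by (rule measurable_Caratheodory[OF cont sets_leb]) simp
  have "(\<lambda>x. SUP n. ereal (g x \<bullet> Z n - f x (Z n))) \<in> borel_measurable (leb \<Omega>)"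
    using g fz by (intro borel_measurable_SUP) auto
  then show ?thesis using Z by (subst measurable_cong[where g="\<lambda>x. SUP n. ereal (g x \<bullet> Z n - f x (Z n))"]) auto
qed

text \<open>The conjugate is at least \<open>- M\<close> and the domain has finite measure, so only
  the positive part can fail to be integrable.\<close>

lemma conj_fun_finite:
  assumes fin: "finite_measure (leb \<Omega>)" and g: "g \<in> borel_measurable (leb \<Omega>)"
    and A: "(\<integral>\<^sup>+x. e2ennreal (conj_fun f x (g x)) \<partial>leb \<Omega>) \<noteq> top"
  shows "\<exists>q. integrable (leb \<Omega>) q \<and> (AE x in leb \<Omega>. conj_fun f x (g x) = ereal (q x))"
proof -
  interpret finite_measure "leb \<Omega>" by fact
  let ?c = "\<lambda>x. conj_fun f x (g x)"
  have cm: "?c \<in> borel_measurable (leb \<Omega>)" by (rule conj_fun_measurable[OF g])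
  have em: "(\<lambda>x. e2ennreal (?c x)) \<in> borel_measurable (leb \<Omega>)" using cm by measurable
  have "AE x in leb \<Omega>. e2ennreal (?c x) \<noteq> top"
    using nn_integral_noteq_infinite[OF em] A by simp
  then have fin': "AE x in leb \<Omega>. ?c x = ereal (real_of_ereal (?c x))"
    using AE_space
  proof eventually_elim
    case (elim x)
    then have "ereal (- M) \<le> ?c x" using conj_fun_lower by simp
    moreover have "?c x \<noteq> \<infinity>" using elim(1) by (auto simp: e2ennreal_infty)
    ultimately show ?case by (cases "?c x") auto
  qed
  have qm: "(\<lambda>x. real_of_ereal (?c x)) \<in> borel_measurable (leb \<Omega>)" using cm by measurable
  have "integrable (leb \<Omega>) (\<lambda>x. real_of_ereal (?c x))"
  proof (rule integrableI_bounded[OF qm])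
    have "(\<integral>\<^sup>+x. ennreal (norm (real_of_ereal (?c x))) \<partial>leb \<Omega>) \<le> (\<integral>\<^sup>+x. e2ennreal (?c x) + ennreal M \<partial>leb \<Omega>)"
    proof (rule nn_integral_mono_AE)
      show "AE x in leb \<Omega>. ennreal (norm (real_of_ereal (?c x))) \<le> e2ennreal (?c x) + ennreal M"
        using fin' AE_space
      proof eventually_elim
        case (elim x)
        define r where "r = real_of_ereal (?c x)"
        have cr: "?c x = ereal r" using elim by (simp add: r_def)
        have rM: "- M \<le> r" using conj_fun_lower[of x "g x"] elim cr by simp
        show ?case
        proof (cases "0 \<le> r")
          case True then show ?thesis using M unfolding r_def[symmetric] cr by (simp add: e2ennreal_ereal)
        next
          case False
          then have "ennreal (norm r) \<le> ennreal M" using rM by (intro ennreal_leI) auto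
          then show ?thesis unfolding r_def[symmetric] by (simp add: add_increasing)
        qed
      qed
    qed
    also have "\<dots> = (\<integral>\<^sup>+x. e2ennreal (?c x) \<partial>leb \<Omega>) + (\<integral>\<^sup>+x. ennreal M \<partial>leb \<Omega>)"
      using em by (intro nn_integral_add) auto
    also have "\<dots> < \<infinity>"
    proof -
      have "emeasure (leb \<Omega>) \<Omega> < top"
        using emeasure_finite[of \<Omega>] unfolding infinity_ennreal_def less_top .
      then show ?thesis using A by (simp add: less_top ennreal_mult_less_top)
    qed
    finally show "(\<integral>\<^sup>+x. ennreal (norm (real_of_ereal (?c x))) \<partial>leb \<Omega>) < \<infinity>" .
  qed
  then show ?thesis using fin' by blast
qed

text \<open>The negative part is bounded by \<open>M\<close> on a domain of finite measure, so the
  difference in \<open>ereal_integral\<close> is infinity minus a finite number.\<close>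

lemma conj_fun_infinite:
  assumes fin: "finite_measure (leb \<Omega>)"
    and A: "(\<integral>\<^sup>+x. e2ennreal (conj_fun f x (g x)) \<partial>leb \<Omega>) = top"
  shows "ereal_integral (leb \<Omega>) (\<lambda>x. conj_fun f x (g x)) = \<infinity>"
proof -
  interpret finite_measure "leb \<Omega>" by fact
  have "(\<integral>\<^sup>+x. e2ennreal (- conj_fun f x (g x)) \<partial>leb \<Omega>) \<le> (\<integral>\<^sup>+x. ennreal M \<partial>leb \<Omega>)"
  proof (rule nn_integral_mono)
    fix x assume "x \<in> space (leb \<Omega>)"
    then have "- conj_fun f x (g x) \<le> ereal M" using conj_fun_lower[of x "g x"] by (simp add: ereal_uminus_le_reorder)
    then have "e2ennreal (- conj_fun f x (g x)) \<le> e2ennreal (ereal M)" by (rule e2ennreal_mono)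
    then show "e2ennreal (- conj_fun f x (g x)) \<le> ennreal M" by (simp add: e2ennreal_ereal)
  qed
  also have "\<dots> < top"
  proof -
    have "emeasure (leb \<Omega>) \<Omega> < top"
        using emeasure_finite[of \<Omega>] unfolding infinity_ennreal_def less_top .
    then show ?thesis by (simp add: ennreal_mult_less_top)
  qed
  finally obtain b where "(\<integral>\<^sup>+x. e2ennreal (- conj_fun f x (g x)) \<partial>leb \<Omega>) = ennreal b" "0 \<le> b"
    by (metis ennreal_cases less_irrefl)
  then show ?thesis unfolding ereal_integral_def A by (simp add: enn2ereal_ennreal)
qed

text \<open>The supremum defining the conjugate is attained in the limit by bounded measurable
  selections, so that integral and supremum may be exchanged.\<close>

lemma conj_fun_integral_le:
  assumes fin: "finite_measure (leb \<Omega>)" and g: "g \<in> Linf \<Omega>"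
    and le: "\<And>u. integrable (leb \<Omega>) u \<Longrightarrow> (LINT x|leb \<Omega>. g x \<bullet> u x - f x (u x)) \<le> c"
  shows "\<exists>q. integrable (leb \<Omega>) q \<and> (AE x in leb \<Omega>. conj_fun f x (g x) = ereal (q x)) \<and> (LINT x|leb \<Omega>. q x) \<le> c"
proof -
  interpret finite_measure "leb \<Omega>" by fact
  have gm: "g \<in> borel_measurable (leb \<Omega>)" using g by (simp add: Linf_def)
  obtain Z :: "nat \<Rightarrow> 'b" where Z0: "Z 0 = 0" and Z': "\<forall>x\<in>\<Omega>. \<forall>zs. conj_fun f x zs = (SUP n. ereal (zs \<bullet> Z n - f x (Z n)))"
    using conj_fun_countable by (elim exE conjE)
  note Z = Z'[rule_format]
  \<comment> \<open>Greedy choice: \<open>sel n x\<close> maximises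
    \<open>g x \<bullet> z - f x z\<close> over the first \<open>n + 1\<close> candidates. It takes
    finitely many values and is therefore bounded.\<close>
  define sel where "sel n x = rec_nat (Z 0) (\<lambda>n u. if g x \<bullet> u - f x u < g x \<bullet> Z (Suc n) - f x (Z (Suc n)) then Z (Suc n) else u) n" for n x
  have sel0: "sel 0 x = 0" for x by (simp add: sel_def Z0)
  have selS: "sel (Suc n) x = (if g x \<bullet> sel n x - f x (sel n x) < g x \<bullet> Z (Suc n) - f x (Z (Suc n)) then Z (Suc n) else sel n x)" for n x
    by (simp add: sel_def)
  define val where "val n x = g x \<bullet> sel n x - f x (sel n x)" for n x
  have sm: "sel n \<in> borel_measurable (leb \<Omega>)" for n
  proof (induction n)
    case 0 then show ?case by (simp add: sel0[abs_def])
  next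
    case (Suc n)
    have "(\<lambda>x. f x (sel n x)) \<in> borel_measurable (leb \<Omega>)" "(\<lambda>x. f x (Z (Suc n))) \<in> borel_measurable (leb \<Omega>)"
      by (rule measurable_Caratheodory[OF cont sets_leb]; use Suc in simp)+
    then have "(\<lambda>x. g x \<bullet> sel n x - f x (sel n x)) \<in> borel_measurable (leb \<Omega>)"
      "(\<lambda>x. g x \<bullet> Z (Suc n) - f x (Z (Suc n))) \<in> borel_measurable (leb \<Omega>)" using gm Suc by auto
    then have "{x \<in> space (leb \<Omega>). g x \<bullet> sel n x - f x (sel n x) < g x \<bullet> Z (Suc n) - f x (Z (Suc n))} \<in> sets (leb \<Omega>)"
      by (rule borel_measurable_less)
    then show ?case unfolding selS[abs_def] using Suc by (intro measurable_If) auto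
  qed
  have sb: "\<exists>B. \<forall>x. norm (sel n x) \<le> B" for n
  proof (induction n)
    case (Suc n)
    then obtain B where "\<And>x. norm (sel n x) \<le> B" by blast
    then have "norm (sel (Suc n) x) \<le> max B (norm (Z (Suc n)))" for x
      by (auto simp: selS le_max_iff_disj)
    then show ?case by blast
  qed (auto simp: sel0)
  have si: "integrable (leb \<Omega>) (sel n)" for n
  proof -
    obtain B where "\<And>x. norm (sel n x) \<le> B" using sb by blast
    then show ?thesis using sm by (intro integrable_const_bound[where B=B]) auto
  qed
  have gi: "integrable (leb \<Omega>) (\<lambda>x. g x \<bullet> sel n x)" for n using Linf_inner[OF g] si by blast
  have vi: "integrable (leb \<Omega>) (val n)" for n
    unfolding val_def[abs_def] using gi finite_leb_integrable[OF fin si] by simp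
  have vmono: "val n x \<le> val (Suc n) x" for n x by (simp add: val_def selS)
  have vinc: "incseq (\<lambda>n. val n x)" for x using vmono by (rule incseq_SucI)
  have vge: "g x \<bullet> Z n - f x (Z n) \<le> val n x" for n x
    by (cases n) (auto simp: val_def selS sel0 Z0)
  have v0: "- M \<le> val n x" if "x \<in> \<Omega>" for n x
  proof -
    have "- M \<le> val 0 x" using growth[OF that, of 0] by (simp add: val_def sel0)
    also have "\<dots> \<le> val n x" using vinc[of x] by (auto simp: incseq_def)
    finally show ?thesis .
  qed
  \<comment> \<open>Adding \<open>M\<close> makes the increasing values nonnegative on
    \<open>\<Omega>\<close>, so that monotone convergence in \<open>ennreal\<close> loses nothing by
    truncation.\<close>
  define H where "H x = (SUP n. ennreal (val n x + M))" for x
  have Hle: "(\<integral>\<^sup>+x. H x \<partial>leb \<Omega>) \<le> ennreal (c + M * measure (leb \<Omega>) \<Omega>)"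
  proof -
    have "(\<integral>\<^sup>+x. H x \<partial>leb \<Omega>) = (SUP n. \<integral>\<^sup>+x. ennreal (val n x + M) \<partial>leb \<Omega>)"
      unfolding H_def
    proof (rule nn_integral_monotone_convergence_SUP)
      show "incseq (\<lambda>n x. ennreal (val n x + M))"
        using vinc by (auto simp: incseq_def le_fun_def intro!: ennreal_leI)
      show "(\<lambda>x. ennreal (val n x + M)) \<in> borel_measurable (leb \<Omega>)" for n using vi[of n] by auto
    qed
    also have "\<dots> \<le> ennreal (c + M * measure (leb \<Omega>) \<Omega>)"
    proof (rule SUP_least)
      fix n
      have "(\<integral>\<^sup>+x. ennreal (val n x + M) \<partial>leb \<Omega>) = ennreal (LINT x|leb \<Omega>. val n x + M)"
        using vi[of n] v0[of _ n] by (intro nn_integral_eq_integral AE_I2) (auto simp: algebra_simps dest: v0[of _ n])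
      also have "(LINT x|leb \<Omega>. val n x + M) = (LINT x|leb \<Omega>. val n x) + M * measure (leb \<Omega>) \<Omega>"
        using vi[of n] by (simp add: mult.commute)
      also have "ennreal \<dots> \<le> ennreal (c + M * measure (leb \<Omega>) \<Omega>)"
        using le[OF si[of n]] by (intro ennreal_leI) (simp add: val_def)
      finally show "(\<integral>\<^sup>+x. ennreal (val n x + M) \<partial>leb \<Omega>) \<le> ennreal (c + M * measure (leb \<Omega>) \<Omega>)" .
    qed
    finally show ?thesis .
  qed
  have Hc: "conj_fun f x (g x) \<le> ereal (enn2real (H x) - M)" if x: "x \<in> \<Omega>" "H x \<noteq> top" for x
    unfolding Z[OF x(1)] SUP_ereal_le_iff_real
  proof
    fix n
    have "ennreal (val n x + M) \<le> H x" unfolding H_def by (rule SUP_upper) simp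
    also have "H x = ennreal (enn2real (H x))" using x(2) by (simp add: less_top)
    finally have "val n x + M \<le> enn2real (H x)" by (simp add: ennreal_le_iff)
    then show "g x \<bullet> Z n - f x (Z n) \<le> enn2real (H x) - M" using vge[of x n] by simp
  qed
  have Ale: "(\<integral>\<^sup>+x. e2ennreal (conj_fun f x (g x)) \<partial>leb \<Omega>) \<le> (\<integral>\<^sup>+x. H x \<partial>leb \<Omega>)"
  proof (rule nn_integral_mono)
    fix x assume "x \<in> space (leb \<Omega>)"
    then have x: "x \<in> \<Omega>" by simp
    show "e2ennreal (conj_fun f x (g x)) \<le> H x"
    proof (cases "H x = top")
      case False
      have "e2ennreal (conj_fun f x (g x)) \<le> e2ennreal (ereal (enn2real (H x) - M))" by (rule e2ennreal_mono[OF Hc[OF x False]])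
      also have "\<dots> = ennreal (enn2real (H x) - M)" by (simp add: e2ennreal_ereal)
      also have "\<dots> \<le> ennreal (enn2real (H x))" using M by (intro ennreal_leI) simp
      also have "\<dots> = H x" using False by (simp add: less_top)
      finally show ?thesis .
    qed simp
  qed
  have Ht: "(\<integral>\<^sup>+x. H x \<partial>leb \<Omega>) \<noteq> top" using Hle by (auto simp: top_unique)
  then have "(\<integral>\<^sup>+x. e2ennreal (conj_fun f x (g x)) \<partial>leb \<Omega>) \<noteq> top" using Ale by (auto simp: top_unique)
  then obtain q where q: "integrable (leb \<Omega>) q" "AE x in leb \<Omega>. conj_fun f x (g x) = ereal (q x)"
    using conj_fun_finite[OF fin gm] by blast
  have q0: "AE x in leb \<Omega>. 0 \<le> q x + M"
    using q(2) AE_space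
  proof eventually_elim
    case (elim x)
    then show ?case using conj_fun_lower[of x "g x"] by simp
  qed
  have "ennreal (LINT x|leb \<Omega>. q x + M) = (\<integral>\<^sup>+x. ennreal (q x + M) \<partial>leb \<Omega>)"
    using q(1) q0 by (intro nn_integral_eq_integral[symmetric]) auto
  also have "\<dots> \<le> (\<integral>\<^sup>+x. H x \<partial>leb \<Omega>)"
  proof (rule nn_integral_mono_AE)
    show "AE x in leb \<Omega>. ennreal (q x + M) \<le> H x"
      using q(2) AE_space
    proof eventually_elim
      case (elim x)
      show ?case
      proof (cases "H x = top")
        case False
        have "q x + M \<le> enn2real (H x)" using Hc[OF _ False] elim by auto
        then have "ennreal (q x + M) \<le> ennreal (enn2real (H x))" by (rule ennreal_leI)
        also have "\<dots> = H x" using False by (simp add: less_top)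
        finally show ?thesis .
      qed simp
    qed
  qed
  also note Hle
  finally have e: "ennreal (LINT x|leb \<Omega>. q x + M) \<le> ennreal (c + M * measure (leb \<Omega>) \<Omega>)" .
  \<comment> \<open>Without this sign, \<open>ennreal\<close> would identify a negative bound with 0
    and \<open>e\<close> could not be read as an inequality of real numbers.\<close>
  have "0 \<le> c + M * measure (leb \<Omega>) \<Omega>"
  proof -
    have "0 \<le> (LINT x|leb \<Omega>. val 0 x + M)"
      using v0[of _ 0] by (intro Bochner_Integration.integral_nonneg) (auto dest: v0[of _ 0])
    also have "\<dots> = (LINT x|leb \<Omega>. val 0 x) + M * measure (leb \<Omega>) \<Omega>" using vi[of 0] by (simp add: mult.commute)
    also have "\<dots> \<le> c + M * measure (leb \<Omega>) \<Omega>" using le[OF si[of 0]] by (simp add: val_def)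
    finally show ?thesis .
  qed
  with e have "(LINT x|leb \<Omega>. q x + M) \<le> c + M * measure (leb \<Omega>) \<Omega>" by (simp add: ennreal_le_iff)
  moreover have "(LINT x|leb \<Omega>. q x + M) = (LINT x|leb \<Omega>. q x) + M * measure (leb \<Omega>) \<Omega>"
    using q(1) by (simp add: mult.commute)
  ultimately show ?thesis using q by auto
qed

text \<open>The functional \<open>p h = inf {(\<Phi> (u0 + v + t h) - m) / t | t > 0, v \<in> Ker}\<close> is the directional
  derivative at \<open>0\<close> of the value function of the perturbed problem; a linear minorant is a
  Lagrange multiplier.\<close>

lemma lagrange_multiplier:
  fixes Ker :: "('a \<Rightarrow> 'b) set"
  assumes fin: "finite_measure (leb \<Omega>)" and Ker: "subspace Ker" "Ker \<subseteq> L1 \<Omega>" and u0: "u0 \<in> L1 \<Omega>"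
  defines "\<Phi> \<equiv> \<lambda>u. LINT x|leb \<Omega>. f x (u x)"
  defines "m \<equiv> INF v\<in>Ker. \<Phi> (u0 + v)"
  shows "\<exists>g\<in>Linf \<Omega>. (\<forall>v\<in>Ker. (LINT x|leb \<Omega>. g x \<bullet> v x) = 0) \<and> (\<forall>h\<in>L1 \<Omega>. m + (LINT x|leb \<Omega>. g x \<bullet> h x) \<le> \<Phi> (u0 + h))"
proof -
  let ?N = "\<lambda>u::'a \<Rightarrow> 'b. LINT x|leb \<Omega>. norm (u x)"
  note L1s = subspace_add[OF subspace_L1] subspace_scale[OF subspace_L1] subspace_diff[OF subspace_L1]
  have fi: "integrable (leb \<Omega>) (\<lambda>x. f x (u x))" if "u \<in> L1 \<Omega>" for u
    using finite_leb_integrable[OF fin] that by (simp add: L1_def)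
  have KL: "v \<in> L1 \<Omega>" if "v \<in> Ker" for v using Ker that by auto
  have lip: "\<Phi> u - \<Phi> v \<le> M * ?N (u - v)" if u: "u \<in> L1 \<Omega>" "v \<in> L1 \<Omega>" for u v
  proof -
    have "\<Phi> u - \<Phi> v = (LINT x|leb \<Omega>. f x (u x) - f x (v x))" using fi u by (simp add: \<Phi>_def)
    also have "\<dots> \<le> (LINT x|leb \<Omega>. M * norm ((u - v) x))"
      using fi u lipschitz_aux by (intro integral_mono) (auto simp: L1_def)
    finally show ?thesis by simp
  qed
  have cvx\<Phi>: "\<Phi> (s *\<^sub>R u + r *\<^sub>R v) \<le> s * \<Phi> u + r * \<Phi> v" if u: "u \<in> L1 \<Omega>" "v \<in> L1 \<Omega>" and s: "0 \<le> s" "0 \<le> r" "s + r = 1" for u v s r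
  proof -
    have "\<Phi> (s *\<^sub>R u + r *\<^sub>R v) \<le> (LINT x|leb \<Omega>. s * f x (u x) + r * f x (v x))"
      unfolding \<Phi>_def
    proof (rule integral_mono)
      show "integrable (leb \<Omega>) (\<lambda>x. f x ((s *\<^sub>R u + r *\<^sub>R v) x))" using u by (intro fi L1s)
      show "integrable (leb \<Omega>) (\<lambda>x. s * f x (u x) + r * f x (v x))" using fi u by auto
      fix x assume "x \<in> space (leb \<Omega>)"
      then have "convex_on UNIV (f x)" using cvx by simp
      then show "f x ((s *\<^sub>R u + r *\<^sub>R v) x) \<le> s * f x (u x) + r * f x (v x)"
        using s unfolding convex_on_def by simp
    qed
    then show ?thesis using fi u by (simp add: \<Phi>_def)
  qed
  have \<Phi>0: "0 \<le> \<Phi> u" for u unfolding \<Phi>_def using nn by (intro Bochner_Integration.integral_nonneg) auto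
  have K0: "0 \<in> Ker" using Ker by (simp add: subspace_0)
  have mle: "m \<le> \<Phi> (u0 + v)" if "v \<in> Ker" for v
    unfolding m_def using that \<Phi>0 by (intro cINF_lower bdd_belowI2[where m=0])
  have mex: "\<exists>v\<in>Ker. \<Phi> (u0 + v) < m + e" if "0 < e" for e
  proof -
    have "(INF v\<in>Ker. \<Phi> (u0 + v)) < m + e" using that by (simp add: m_def)
    then show ?thesis using K0 \<Phi>0 by (subst (asm) cINF_less_iff) (auto intro!: bdd_belowI2[where m=0])
  qed
  define Q where "Q h tv = (\<Phi> (u0 + snd tv + fst tv *\<^sub>R h) - m) / fst tv" for h and tv :: "real \<times> ('a \<Rightarrow> 'b)"
  define p where "p h = (INF tv\<in>{0<..} \<times> Ker. Q h tv)" for h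
  have "(1, 0) \<in> {0::real<..} \<times> Ker" using K0 by auto
  then have ne: "{0::real<..} \<times> Ker \<noteq> {}" by blast
  \<comment> \<open>\<open>\<Phi> (u0 + v)\<close> is at least \<open>m\<close>, and adding
    \<open>t *\<^sub>R h\<close> lowers it by at most \<open>M * t\<close> times the norm of
    \<open>h\<close>; after division by \<open>t\<close> the bound depends on neither
    \<open>t\<close> nor \<open>v\<close>.\<close>
  have low: "- M * ?N h \<le> Q h tv" if h: "h \<in> L1 \<Omega>" and tv: "tv \<in> {0<..} \<times> Ker" for h tv
  proof -
    obtain t v where tv': "tv = (t, v)" "0 < t" "v \<in> Ker" using tv by auto
    have L: "u0 + v \<in> L1 \<Omega>" "u0 + v + t *\<^sub>R h \<in> L1 \<Omega>" using u0 KL[OF tv'(3)] h by (auto intro!: L1s simp only:)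
    have "\<Phi> (u0 + v) - \<Phi> (u0 + v + t *\<^sub>R h) \<le> M * ?N ((u0 + v) - (u0 + v + t *\<^sub>R h))" by (rule lip[OF L])
    also have "?N ((u0 + v) - (u0 + v + t *\<^sub>R h)) = t * ?N h" using tv' by simp
    finally have lip1: "\<Phi> (u0 + v) - \<Phi> (u0 + v + t *\<^sub>R h) \<le> M * (t * ?N h)" .
    have "- (M * ?N h) * t \<le> \<Phi> (u0 + v + t *\<^sub>R h) - m" 
    proof -
      have "- (M * ?N h) * t = - (M * (t * ?N h))" by simp
      then show ?thesis using mle[OF tv'(3)] lip1 by linarith
    qed
    then show ?thesis using tv' by (simp add: Q_def pos_le_divide_eq del: minus_mult_left)
  qed
  have ple: "p h \<le> Q h tv" if "h \<in> L1 \<Omega>" "tv \<in> {0<..} \<times> Ker" for h tv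
    unfolding p_def using that low by (intro cINF_lower bdd_belowI2[where m="- M * ?N h"])
  have "sublinear_on (L1 \<Omega>) p"
    unfolding sublinear_on_def
  proof (intro conjI ballI allI impI)
    fix h1 h2 :: "'a \<Rightarrow> 'b" assume h: "h1 \<in> L1 \<Omega>" "h2 \<in> L1 \<Omega>"
    show "p (h1 + h2) \<le> p h1 + p h2"
      unfolding p_def[of h1] p_def[of h2]
    proof (rule le_cINF_add[OF ne ne])
      fix a b :: "real \<times> ('a \<Rightarrow> 'b)" assume ab: "a \<in> {0<..} \<times> Ker" "b \<in> {0<..} \<times> Ker"
      obtain t1 v1 where a: "a = (t1, v1)" "0 < t1" "v1 \<in> Ker" using ab by auto
      obtain t2 v2 where b: "b = (t2, v2)" "0 < t2" "v2 \<in> Ker" using ab by auto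
      \<comment> \<open>Convex weights with \<open>s * t1 = r * t2\<close>, so that both directions
        receive the same step in the combination.\<close>
      define s where "s = t2 / (t1 + t2)"
      define r where "r = t1 / (t1 + t2)"
      have sr: "0 \<le> s" "0 \<le> r" "s + r = 1" "s * t1 = r * t2"
        using a b by (auto simp: s_def r_def add_divide_distrib[symmetric])
      have st: "0 < s * t1" using a b by (simp add: s_def)
      let ?v = "s *\<^sub>R v1 + r *\<^sub>R v2"
      let ?x1 = "u0 + v1 + t1 *\<^sub>R h1" and ?x2 = "u0 + v2 + t2 *\<^sub>R h2"
      have x: "?x1 \<in> L1 \<Omega>" "?x2 \<in> L1 \<Omega>" using a b h u0 KL[OF a(3)] KL[OF b(3)] by (auto intro!: L1s simp only:)
      have "?v \<in> Ker" using a b Ker by (intro subspace_add subspace_scale)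
      then have "p (h1 + h2) \<le> Q (h1 + h2) (s * t1, ?v)" using h st by (intro ple L1s) auto
      also have "\<dots> = (\<Phi> (u0 + ?v + (s * t1) *\<^sub>R (h1 + h2)) - m) / (s * t1)" by (simp only: Q_def fst_conv snd_conv)
      also have "u0 + ?v + (s * t1) *\<^sub>R (h1 + h2) = s *\<^sub>R ?x1 + r *\<^sub>R ?x2"
      proof -
        have e0: "s *\<^sub>R u0 + r *\<^sub>R u0 = u0" by (simp only: scaleR_add_left[symmetric] sr(3) scaleR_one)
        have "s *\<^sub>R ?x1 + r *\<^sub>R ?x2 = (s *\<^sub>R u0 + r *\<^sub>R u0) + ?v + ((s * t1) *\<^sub>R h1 + (r * t2) *\<^sub>R h2)"
          by (simp only: scaleR_add_right scaleR_scaleR add.assoc add.commute add.left_commute)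
        then show ?thesis by (simp only: e0 sr(4)[symmetric] scaleR_add_right)
      qed
      also have "(\<Phi> (s *\<^sub>R ?x1 + r *\<^sub>R ?x2) - m) / (s * t1) \<le> (s * \<Phi> ?x1 + r * \<Phi> ?x2 - m) / (s * t1)"
        using st cvx\<Phi>[OF x sr(1-3)] by (intro divide_right_mono) auto
      also have "\<dots> = (s * (\<Phi> ?x1 - m) + r * (\<Phi> ?x2 - m)) / (s * t1)"
      proof -
        have "m = s * m + r * m" using sr(3) by (simp only: distrib_right[symmetric] mult_1)
        then have "s * \<Phi> ?x1 + r * \<Phi> ?x2 - m = s * (\<Phi> ?x1 - m) + r * (\<Phi> ?x2 - m)" by (simp only: right_diff_distrib)
        then show ?thesis by (rule arg_cong)
      qed
      also have "\<dots> = (s * (\<Phi> ?x1 - m)) / (s * t1) + (r * (\<Phi> ?x2 - m)) / (r * t2)"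
        unfolding add_divide_distrib sr(4) ..
      also have "\<dots> = (\<Phi> ?x1 - m) / t1 + (\<Phi> ?x2 - m) / t2"
        using st sr(4) a b by (auto simp: s_def r_def)
      finally show "p (h1 + h2) \<le> Q h1 a + Q h2 b" by (simp only: Q_def a(1) b(1) fst_conv snd_conv)
    qed
  next
    fix h :: "'a \<Rightarrow> 'b" and c :: real assume h: "h \<in> L1 \<Omega>" and c: "0 < c"
    have "p (c *\<^sub>R h) / c \<le> p h"
      unfolding p_def[of h]
    proof (rule cINF_greatest[OF ne])
      fix tv :: "real \<times> ('a \<Rightarrow> 'b)" assume tv: "tv \<in> {0<..} \<times> Ker"
      obtain t v where tv': "tv = (t, v)" "0 < t" "v \<in> Ker" using tv by auto
      have "p (c *\<^sub>R h) \<le> Q (c *\<^sub>R h) (t / c, v)" using h c tv' by (intro ple L1s) auto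
      also have "\<dots> = (\<Phi> (u0 + v + t *\<^sub>R h) - m) / (t / c)" using c by (simp only: Q_def fst_conv snd_conv scaleR_scaleR) simp
      also have "\<dots> = c * Q h tv" using c tv' by (simp only: Q_def fst_conv snd_conv) simp
      finally show "p (c *\<^sub>R h) / c \<le> Q h tv" using c by (simp add: pos_divide_le_eq mult.commute)
    qed
    then show "p (c *\<^sub>R h) \<le> c * p h" using c by (simp add: pos_divide_le_eq mult.commute)
  qed
  \<comment> \<open>Step 1 from a nearly minimising kernel element, with the Lipschitz bound for
    \<open>\<Phi>\<close>.\<close>
  moreover have pN: "p h \<le> M * ?N h" if h: "h \<in> L1 \<Omega>" for h
  proof (rule field_le_epsilon)
    fix e :: real assume "0 < e"
    then obtain v where v: "v \<in> Ker" "\<Phi> (u0 + v) < m + e" using mex by blast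
    have L: "u0 + v + 1 *\<^sub>R h \<in> L1 \<Omega>" "u0 + v \<in> L1 \<Omega>" using u0 KL[OF v(1)] h by (auto intro!: L1s simp only:)
    have "p h \<le> Q h (1, v)" using h v by (intro ple) auto
    also have "\<dots> = \<Phi> (u0 + v + 1 *\<^sub>R h) - m" by (simp only: Q_def fst_conv snd_conv div_by_1)
    also have "\<dots> \<le> \<Phi> (u0 + v) + M * ?N ((u0 + v + 1 *\<^sub>R h) - (u0 + v)) - m" using lip[OF L] by linarith
    also have "?N ((u0 + v + 1 *\<^sub>R h) - (u0 + v)) = ?N h" by simp
    finally show "p h \<le> M * ?N h + e" using v(2) by linarith
  qed
  ultimately obtain g where g: "g \<in> Linf \<Omega>" "\<And>h. h \<in> L1 \<Omega> \<Longrightarrow> (LINT x|leb \<Omega>. g x \<bullet> h x) \<le> p h"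
    using L1_hahn_banach[OF fin, where C=M] by blast
  \<comment> \<open>Step 1 from the kernel element \<open>z - v\<close> cancels \<open>v\<close> and
    leaves \<open>\<Phi> (u0 + z)\<close>, which is close to \<open>m\<close>. The same for
    \<open>- v\<close> makes the minorant vanish on the kernel.\<close>
  have pK: "p v \<le> 0" if v: "v \<in> Ker" for v
  proof (rule field_le_epsilon)
    fix e :: real assume "0 < e"
    then obtain z where z: "z \<in> Ker" "\<Phi> (u0 + z) < m + e" using mex by blast
    have "z - v \<in> Ker" using z v Ker by (intro subspace_diff)
    then have "p v \<le> Q v (1, z - v)" using KL[OF v] by (intro ple) auto
    also have "\<dots> = \<Phi> (u0 + (z - v) + 1 *\<^sub>R v) - m" by (simp only: Q_def fst_conv snd_conv div_by_1)
    also have "u0 + (z - v) + 1 *\<^sub>R v = u0 + z" by (simp only: scaleR_one add.assoc diff_add_cancel)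
    finally show "p v \<le> 0 + e" using z(2) by linarith
  qed
  have "(LINT x|leb \<Omega>. g x \<bullet> v x) = 0" if v: "v \<in> Ker" for v
  proof -
    have nv: "- v \<in> Ker" using v Ker by (simp add: subspace_neg)
    have "(LINT x|leb \<Omega>. g x \<bullet> v x) \<le> 0" using g(2)[OF KL[OF v]] pK[OF v] by linarith
    moreover have "(LINT x|leb \<Omega>. g x \<bullet> (- v) x) \<le> 0" using g(2)[OF KL[OF nv]] pK[OF nv] by linarith
    ultimately show ?thesis by simp
  qed
  moreover have "m + (LINT x|leb \<Omega>. g x \<bullet> h x) \<le> \<Phi> (u0 + h)" if h: "h \<in> L1 \<Omega>" for h
  proof -
    have "p h \<le> Q h (1, 0)" using h K0 by (intro ple) auto
    also have "\<dots> = \<Phi> (u0 + h) - m" by (simp only: Q_def fst_conv snd_conv div_by_1 scaleR_one add_0_right)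
    finally show ?thesis using g(2)[OF h] by linarith
  qed
  ultimately show ?thesis using g(1) by blast
qed

end

section \<open>Duality and extremality relations\<close>

lemma dmeas_add:
  assumes "integrable \<rho> s" "integrable \<rho> s'"
  shows "dmeas \<rho> (\<lambda>x. s x + s' x) = (\<lambda>E. dmeas \<rho> s E + dmeas \<rho> s' E)"
  using assms by (auto simp: dmeas_def fun_eq_iff integrable_set_integrable)

lemma dmeas_cong_AE:
  assumes "integrable \<rho> s" "integrable \<rho> s'" "AE x in \<rho>. s x = s' x"
  shows "dmeas \<rho> s = dmeas \<rho> s'"
proof
  fix E show "dmeas \<rho> s E = dmeas \<rho> s' E"
    unfolding dmeas_def
    using assms by (auto intro!: set_lebesgue_integral_cong_AE)
qed

context lebesgue_density begin

lemma fun_measure_dmeas: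
  fixes u :: "'a \<Rightarrow> 'b::euclidean_space"
  assumes u: "integrable (leb \<Omega>) u"
  shows "fun_measure \<Omega> u = dmeas \<rho> (\<lambda>x. t x *\<^sub>R u x)"
proof
  fix E
  have um: "u \<in> borel_measurable \<rho>" using borel_measurable_integrable[OF u] unfolding leb_meas .
  show "fun_measure \<Omega> u E = dmeas \<rho> (\<lambda>x. t x *\<^sub>R u x) E"
  proof (cases "E \<in> sets \<rho>")
    case True
    have "(LINT x:E|leb \<Omega>. u x) = (LINT x|\<rho>. t x *\<^sub>R (indicator E x *\<^sub>R u x))"
      unfolding set_lebesgue_integral_def using um True by (intro integral_leb) auto
    then show ?thesis using True by (simp add: fun_measure_def dmeas_def sets_rho set_lebesgue_integral_def scaleR_left_commute mult.commute)
  qed (simp add: fun_measure_def dmeas_def sets_rho)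
qed

end

locale variational_problem =
  D: diff_operator \<Omega> k a + I: integrand \<Omega> f M \<omega>
  for \<Omega> :: "'a::euclidean_space set" and k :: nat
    and a :: "'a list \<Rightarrow> 'a \<Rightarrow> ('b::euclidean_space \<Rightarrow>\<^sub>L 'c::euclidean_space)"
    and f :: "'a \<Rightarrow> 'b \<Rightarrow> real" and M \<omega> +
  fixes u0 :: "'a \<Rightarrow> 'b"
  assumes H1: "strongly_closed_L1 \<Omega> (op_image \<Omega> k a)"
    and H2: "\<forall>m\<in>ker_meas \<Omega> k a. \<exists>u. (\<forall>j. u j \<in> ker_fun \<Omega> k a) \<and> area_strict_conv \<Omega> (\<lambda>j. fun_measure \<Omega> (u j)) m"
    and u0: "u0 \<in> W \<Omega> k a"
begin

abbreviation Phi where "Phi u \<equiv> LINT x|leb \<Omega>. f x (u x)"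
abbreviation pair where "pair w \<equiv> LINT x|leb \<Omega>. w x \<bullet> op \<Omega> k a u0 x"

lemma u0_integrable: "integrable (leb \<Omega>) u0"
  using D.op_rel_integrable[OF D.op_rel_op[OF u0]] by simp

lemma affine_radon: "m \<in> affine_meas \<Omega> k a u0 \<Longrightarrow> m \<in> radon_measures \<Omega>"
  unfolding affine_meas_def ker_meas_def fun_measure_eq_dmeas
  by (auto intro!: radon_measures_add dmeas_radon sets_leb u0_integrable)

lemma ex_lebesgue_density:
  assumes "m \<in> radon_measures \<Omega>"
  shows "\<exists>\<rho> s t. lebesgue_density \<Omega> \<rho> t \<and> integrable \<rho> s \<and> m = dmeas \<rho> s"
proof -
  obtain \<rho> s t where "finite_measure \<rho>" "sets \<rho> = borel_on \<Omega>" "integrable \<rho> s" "integrable \<rho> t"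
      "\<And>x. 0 \<le> t x" "m = dmeas \<rho> s" "leb \<Omega> = density \<rho> (\<lambda>x. ennreal (t x))"
    by (rule radon_rep[OF assms D.fin], rule that)
  then show ?thesis unfolding lebesgue_density_def by blast
qed

text \<open>(H2) provides sequences in the kernel; \<open>area_strict_shift\<close> adds
  \<open>u0\<close> to them and to their limit.\<close>

lemma recovery_sequence:
  assumes m: "m \<in> affine_meas \<Omega> k a u0"
  shows "\<exists>u. (\<forall>j. u j \<in> affine_fun \<Omega> k a u0) \<and> area_strict_conv \<Omega> (\<lambda>j. fun_measure \<Omega> (u j)) m"
proof -
  obtain n where n: "n \<in> ker_meas \<Omega> k a" and mn: "m = (\<lambda>E. fun_measure \<Omega> u0 E + n E)"
    using m by (auto simp: affine_meas_def)
  obtain v where v: "\<And>j. v j \<in> ker_fun \<Omega> k a" "area_strict_conv \<Omega> (\<lambda>j. fun_measure \<Omega> (v j)) n"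
    using H2 n by blast
  have "n \<in> radon_measures \<Omega>" using n by (simp add: ker_meas_def)
  then obtain \<rho> s t where L: "lebesgue_density \<Omega> \<rho> t" and s: "integrable \<rho> s" and ns: "n = dmeas \<rho> s"
    using ex_lebesgue_density by blast
  interpret L: lebesgue_density \<Omega> \<rho> t by (rule L)
  have vi: "integrable (leb \<Omega>) (v j)" for j using v(1)[of j] by (simp add: ker_fun_def L1_def)
  have "area_strict_conv \<Omega> (\<lambda>j. fun_measure \<Omega> (\<lambda>x. u0 x + v j x)) (dmeas \<rho> (\<lambda>x. t x *\<^sub>R u0 x + s x))"
    using v(2) unfolding ns by (intro L.area_strict_shift D.O vi s u0_integrable)
  moreover have "dmeas \<rho> (\<lambda>x. t x *\<^sub>R u0 x + s x) = m"
    unfolding dmeas_add[OF L.integrable_scaleR_t[OF u0_integrable] s] mn ns L.fun_measure_dmeas[OF u0_integrable] ..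
  moreover have "(\<lambda>x. u0 x + v j x) \<in> affine_fun \<Omega> k a u0" for j using v(1) by (auto simp: affine_fun_def)
  ultimately show ?thesis by (intro exI[of _ "\<lambda>j x. u0 x + v j x"]) auto
qed

lemma affine_fun_measure:
  assumes u: "u \<in> affine_fun \<Omega> k a u0"
  shows "fun_measure \<Omega> u \<in> affine_meas \<Omega> k a u0"
proof -
  obtain v where v: "v \<in> ker_fun \<Omega> k a" and uv: "u = (\<lambda>x. u0 x + v x)" using u by (auto simp: affine_fun_def)
  have vi: "integrable (leb \<Omega>) v" using v by (simp add: ker_fun_def L1_def)
  have "fun_measure \<Omega> v \<in> ker_meas \<Omega> k a"
    using v vi dmeas_radon[OF sets_leb vi] by (simp add: ker_meas_def ker_fun_def fun_measure_eq_dmeas)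
  moreover have "fun_measure \<Omega> u = (\<lambda>E. fun_measure \<Omega> u0 E + fun_measure \<Omega> v E)"
    unfolding uv fun_measure_eq_dmeas by (rule dmeas_add[OF u0_integrable vi])
  ultimately show ?thesis by (auto simp: affine_meas_def)
qed

lemma relaxed_fun_measure:
  assumes u: "integrable (leb \<Omega>) u"
  shows "relaxed \<Omega> f (fun_measure \<Omega> u) = ennreal (Phi u)"
  using relaxation.relaxed_dmeas[OF I.relaxation_leb[OF D.fin] u] by (simp add: fun_measure_eq_dmeas)

text \<open>Reshetnyak continuity with the constant cutoff 1; the relaxed functional is in
  particular a finite number.\<close>

lemma relaxed_limit:
  assumes m: "m \<in> radon_measures \<Omega>" and u: "\<And>j. integrable (leb \<Omega>) (u j)"
    and conv: "area_strict_conv \<Omega> (\<lambda>j. fun_measure \<Omega> (u j)) m"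
  shows "\<exists>e\<ge>0. relaxed \<Omega> f m = ennreal e \<and> (\<lambda>j. Phi (u j)) \<longlonglongrightarrow> e"
proof -
  obtain \<rho> s t where L: "lebesgue_density \<Omega> \<rho> t" and s: "integrable \<rho> s" and ms: "m = dmeas \<rho> s"
    using ex_lebesgue_density[OF m] by blast
  interpret R: relaxation \<Omega> \<rho> t f M \<omega> by (intro relaxation.intro L I.integrand_axioms)
  have "(\<lambda>j. LINT x|leb \<Omega>. 1 * f x (u j x)) \<longlonglongrightarrow> (LINT x|\<rho>. 1 * persp f x (s x, t x))"
    using conv unfolding ms by (intro R.energy_tendsto[where \<phi>="\<lambda>x. 1"] u s) (auto simp: bounded_iff intro: exI[of _ 1])
  moreover have "0 \<le> (LINT x|\<rho>. persp f x (s x, t x))"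
    using I.persp_bounds(1) by (intro Bochner_Integration.integral_nonneg) auto
  ultimately show ?thesis using R.relaxed_dmeas[OF s] ms by auto
qed

lemma fenchel_integral:
  assumes u: "integrable (leb \<Omega>) u" and g: "g \<in> Linf \<Omega>"
    and q: "integrable (leb \<Omega>) q" "AE x in leb \<Omega>. conj_fun f x (g x) = ereal (q x)"
  shows "AE x in leb \<Omega>. 0 \<le> f x (u x) + q x - g x \<bullet> u x"
    "integrable (leb \<Omega>) (\<lambda>x. f x (u x) + q x - g x \<bullet> u x)"
    "(LINT x|leb \<Omega>. f x (u x) + q x - g x \<bullet> u x) = Phi u + (LINT x|leb \<Omega>. q x) - (LINT x|leb \<Omega>. g x \<bullet> u x)"
proof -
  show "AE x in leb \<Omega>. 0 \<le> f x (u x) + q x - g x \<bullet> u x"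
    using q(2)
  proof eventually_elim
    case (elim x)
    then show ?case using I.fenchel_young[of "g x" "u x" x] by simp
  qed
  have gu: "integrable (leb \<Omega>) (\<lambda>x. g x \<bullet> u x)" using Linf_inner[OF g] u by blast
  note fu = I.finite_leb_integrable[OF D.fin u]
  show "integrable (leb \<Omega>) (\<lambda>x. f x (u x) + q x - g x \<bullet> u x)" using fu gu q by simp
  show "(LINT x|leb \<Omega>. f x (u x) + q x - g x \<bullet> u x) = Phi u + (LINT x|leb \<Omega>. q x) - (LINT x|leb \<Omega>. g x \<bullet> u x)"
    using fu gu q by simp
qed

lemma dual_functional_eq:
  assumes q: "integrable (leb \<Omega>) q" "AE x in leb \<Omega>. conj_fun f x (adj_op \<Omega> k a w x) = ereal (q x)"
  shows "dual_functional \<Omega> k a u0 f w = ereal (pair w - (LINT x|leb \<Omega>. q x))"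
  unfolding dual_functional_def ereal_integral_eq[OF q] by simp

text \<open>The negative part of the conjugate always has a finite integral, so a dual value other
  than \<open>-\<infinity>\<close> comes with a real integrable representative
  \<open>q\<close>.\<close>

lemma dual_functional_cases:
  assumes w: "w \<in> adj_domain \<Omega> k a"
  shows "dual_functional \<Omega> k a u0 f w = -\<infinity> \<or>
    (\<exists>q. integrable (leb \<Omega>) q \<and> (AE x in leb \<Omega>. conj_fun f x (adj_op \<Omega> k a w x) = ereal (q x)))"
proof (cases "(\<integral>\<^sup>+x. e2ennreal (conj_fun f x (adj_op \<Omega> k a w x)) \<partial>leb \<Omega>) = top")
  case True
  then show ?thesis unfolding dual_functional_def I.conj_fun_infinite[OF D.fin True] by simp
next
  case False
  have "adj_op \<Omega> k a w \<in> borel_measurable (leb \<Omega>)" using D.adj_op_spec(1)[OF w] by (simp add: Linf_def)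
  then show ?thesis using I.conj_fun_finite[OF D.fin _ False] by blast
qed

text \<open>Along a recovery sequence the integrated Fenchel inequality contains the products only
  through the constant \<open>pair w\<close>, so it passes to the limit although the products
  themselves are not under control.\<close>

lemma weak_duality:
  assumes m: "m \<in> affine_meas \<Omega> k a u0" and w: "w \<in> adj_domain \<Omega> k a"
  shows "dual_functional \<Omega> k a u0 f w \<le> enn2ereal (relaxed \<Omega> f m)"
  using dual_functional_cases[OF w]
proof (elim disjE exE conjE)
  fix q assume q: "integrable (leb \<Omega>) q" "AE x in leb \<Omega>. conj_fun f x (adj_op \<Omega> k a w x) = ereal (q x)"
  obtain u where u: "\<And>j. u j \<in> affine_fun \<Omega> k a u0" "area_strict_conv \<Omega> (\<lambda>j. fun_measure \<Omega> (u j)) m"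
    using recovery_sequence[OF m] by blast
  have ui: "integrable (leb \<Omega>) (u j)" for j by (rule D.affine_funD(3)[OF u0 u(1)])
  obtain e where e: "0 \<le> e" "relaxed \<Omega> f m = ennreal e" "(\<lambda>j. Phi (u j)) \<longlonglongrightarrow> e"
    using relaxed_limit[OF affine_radon[OF m] ui u(2)] by blast
  have "pair w - (LINT x|leb \<Omega>. q x) \<le> Phi (u j)" for j
  proof -
    note F = fenchel_integral[OF ui[of j] D.adj_op_spec(1)[OF w] q]
    have "0 \<le> (LINT x|leb \<Omega>. f x (u j x) + q x - adj_op \<Omega> k a w x \<bullet> u j x)"
      using F(1) by (rule integral_nonneg_AE)
    then show ?thesis unfolding F(3) D.pairing_affine[OF u0 u(1) w] by simp
  qed
  then have "pair w - (LINT x|leb \<Omega>. q x) \<le> e" by (intro LIMSEQ_le_const[OF e(3)]) auto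
  then show ?thesis unfolding dual_functional_eq[OF q] e(2) using e(1) by (simp add: enn2ereal_ennreal)
qed simp

text \<open>Exchanging integral and supremum turns the multiplier inequality into a bound on the
  integral of the conjugate, and \<open>adjoint_range\<close> supplies a dual field with this value.
  The generalized solution competes with every function of the affine class, so its energy is at
  most their infimum \<open>c\<close>.\<close>

lemma strong_duality:
  assumes m: "generalized_solution \<Omega> k a u0 f m"
  shows "\<exists>w\<in>adj_domain \<Omega> k a. enn2ereal (relaxed \<Omega> f m) \<le> dual_functional \<Omega> k a u0 f w"
proof -
  have Ker: "subspace (ker_fun \<Omega> k a)"
  proof (rule subspaceI)
    show "0 \<in> ker_fun \<Omega> k a" unfolding D.ker_fun_iff by (rule D.op_rel_zero)
    show "u + v \<in> ker_fun \<Omega> k a" if "u \<in> ker_fun \<Omega> k a" "v \<in> ker_fun \<Omega> k a" for u v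
      using D.op_rel_add[of u 0 v 0] that unfolding D.ker_fun_iff by simp
    show "c *\<^sub>R u \<in> ker_fun \<Omega> k a" if "u \<in> ker_fun \<Omega> k a" for c u
      using D.op_rel_scale[of u 0 c] that unfolding D.ker_fun_iff by (simp only: scaleR_zero_right)
  qed
  have KL: "ker_fun \<Omega> k a \<subseteq> L1 \<Omega>" by (auto simp: ker_fun_def)
  have u0L: "u0 \<in> L1 \<Omega>" using u0_integrable by (simp add: L1_def)
  define c where "c = (INF v\<in>ker_fun \<Omega> k a. Phi (u0 + v))"
  obtain g where g: "g \<in> Linf \<Omega>" "\<And>v. v \<in> ker_fun \<Omega> k a \<Longrightarrow> (LINT x|leb \<Omega>. g x \<bullet> v x) = 0"
      "\<And>h. h \<in> L1 \<Omega> \<Longrightarrow> c + (LINT x|leb \<Omega>. g x \<bullet> h x) \<le> Phi (u0 + h)"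
    using I.lagrange_multiplier[OF D.fin Ker KL u0L] unfolding c_def by blast
  have gi: "integrable (leb \<Omega>) (\<lambda>x. g x \<bullet> u x)" if "integrable (leb \<Omega>) u" for u
    using Linf_inner[OF g(1)] that by blast
  \<comment> \<open>The multiplier inequality in direction \<open>u - u0\<close>, rearranged so that
    the supremum over \<open>u\<close> bounds the integral of the conjugate.\<close>
  have "(LINT x|leb \<Omega>. g x \<bullet> u x - f x (u x)) \<le> (LINT x|leb \<Omega>. g x \<bullet> u0 x) - c" if u: "integrable (leb \<Omega>) u" for u
  proof -
    have "u - u0 \<in> L1 \<Omega>" using u u0L by (intro subspace_diff[OF subspace_L1]) (simp_all add: L1_def)
    from g(3)[OF this] have "c + (LINT x|leb \<Omega>. g x \<bullet> u x - g x \<bullet> u0 x) \<le> Phi u"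
      by (simp add: inner_diff_right)
    then show ?thesis using gi[OF u] gi[OF u0_integrable] I.finite_leb_integrable[OF D.fin u] by simp
  qed
  then obtain q where q: "integrable (leb \<Omega>) q" "AE x in leb \<Omega>. conj_fun f x (g x) = ereal (q x)"
     "(LINT x|leb \<Omega>. q x) \<le> (LINT x|leb \<Omega>. g x \<bullet> u0 x) - c"
    using I.conj_fun_integral_le[OF D.fin g(1)] by blast
  obtain w where w: "w \<in> adj_domain \<Omega> k a" "AE x in leb \<Omega>. adj_op \<Omega> k a w x = g x"
    using D.adjoint_range[OF H1 g(1,2)] by blast
  have q': "AE x in leb \<Omega>. conj_fun f x (adj_op \<Omega> k a w x) = ereal (q x)"
    using q(2) w(2) by eventually_elim simp
  have "pair w = (LINT x|leb \<Omega>. adj_op \<Omega> k a w x \<bullet> u0 x)" using D.adj_op_spec(2)[OF w(1) u0] by simp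
  also have "\<dots> = (LINT x|leb \<Omega>. g x \<bullet> u0 x)"
  proof (rule integral_cong_AE)
    show "(\<lambda>x. adj_op \<Omega> k a w x \<bullet> u0 x) \<in> borel_measurable (leb \<Omega>)" "(\<lambda>x. g x \<bullet> u0 x) \<in> borel_measurable (leb \<Omega>)"
      using D.adj_op_spec(1)[OF w(1)] g(1) borel_measurable_integrable[OF u0_integrable] by (auto simp: Linf_def)
    show "AE x in leb \<Omega>. adj_op \<Omega> k a w x \<bullet> u0 x = g x \<bullet> u0 x" using w(2) by eventually_elim simp
  qed
  finally have cw: "ereal c \<le> dual_functional \<Omega> k a u0 f w"
    unfolding dual_functional_eq[OF q(1) q'] using q(3) by simp
  have ma: "m \<in> affine_meas \<Omega> k a u0" using m by (simp add: generalized_solution_def)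
  obtain u where u: "\<And>j. u j \<in> affine_fun \<Omega> k a u0" "area_strict_conv \<Omega> (\<lambda>j. fun_measure \<Omega> (u j)) m"
    using recovery_sequence[OF ma] by blast
  have ui: "integrable (leb \<Omega>) (u j)" for j by (rule D.affine_funD(3)[OF u0 u(1)])
  obtain e where e: "0 \<le> e" "relaxed \<Omega> f m = ennreal e"
    using relaxed_limit[OF affine_radon[OF ma] ui u(2)] by blast
  have "e \<le> c"
    unfolding c_def
  proof (rule cINF_greatest)
    show "ker_fun \<Omega> k a \<noteq> {}" using subspace_0[OF Ker] by auto
    fix v assume v: "v \<in> ker_fun \<Omega> k a"
    have a: "u0 + v \<in> affine_fun \<Omega> k a u0" using v by (auto simp: affine_fun_def plus_fun_def)
    have "ennreal e \<le> relaxed \<Omega> f (fun_measure \<Omega> (u0 + v))"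
      using m affine_fun_measure[OF a] e(2) by (auto simp: generalized_solution_def)
    also have "\<dots> = ennreal (Phi (u0 + v))" by (rule relaxed_fun_measure[OF D.affine_funD(3)[OF u0 a]])
    finally show "e \<le> Phi (u0 + v)"
      using I.nn by (subst (asm) ennreal_le_iff) (auto intro!: Bochner_Integration.integral_nonneg)
  qed
  then have "ereal e \<le> dual_functional \<Omega> k a u0 f w" using cw by (meson ereal_less_eq(3) order_trans)
  then show ?thesis using w(1) e by (auto simp: enn2ereal_ennreal)
qed

end

section \<open>Extremality relations for a fixed measure and dual field\<close>

locale extremality = variational_problem \<Omega> k a f M \<omega> u0 + R: relaxation \<Omega> \<rho> t f M \<omega>
  for \<Omega> :: "'a::euclidean_space set" and k :: nat
    and a :: "'a list \<Rightarrow> 'a \<Rightarrow> ('b::euclidean_space \<Rightarrow>\<^sub>L 'c::euclidean_space)"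
    and f :: "'a \<Rightarrow> 'b \<Rightarrow> real" and M \<omega> u0 \<rho> t +
  fixes s :: "'a \<Rightarrow> 'b" and w :: "'a \<Rightarrow> 'c"
  assumes s: "integrable \<rho> s" and mu: "dmeas \<rho> s \<in> affine_meas \<Omega> k a u0" and w: "w \<in> adj_domain \<Omega> k a"
begin

abbreviation "mu \<equiv> dmeas \<rho> s"
abbreviation "g \<equiv> adj_op \<Omega> k a w"
abbreviation "v \<equiv> dens (leb \<Omega>) mu"

text \<open>The densities with respect to \<open>\<rho>\<close> of the total variation of the singular part of \<open>mu\<close>,
  of the singular part of the relaxed functional, and of the extremal measure.\<close>

definition kap :: "'a \<Rightarrow> real" where "kap x = (if t x = 0 then norm (s x) else 0)"
definition rs :: "'a \<Rightarrow> real" where "rs x = (if t x = 0 then recession f x (s x) else 0)"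
definition d1 :: "'a \<Rightarrow> real" where "d1 x = t x * (v x \<bullet> g x) + rs x"

lemma g_Linf: "g \<in> Linf \<Omega>" by (rule D.adj_op_spec(1)[OF w])

lemma v_integrable: "integrable (leb \<Omega>) v" by (rule R.dens_leb(1)[OF s])

lemma v_eq: "AE x in \<rho>. 0 < t x \<longrightarrow> v x = s x /\<^sub>R t x" by (rule R.dens_leb(2)[OF s])

lemma measurable_rho:
  "v \<in> borel_measurable \<rho>" "g \<in> borel_measurable \<rho>" "s \<in> borel_measurable \<rho>"
  using borel_measurable_integrable[OF v_integrable] g_Linf borel_measurable_integrable[OF s]
  unfolding Linf_def by (simp_all add: R.leb_meas)

lemma vg_integrable: "integrable (leb \<Omega>) (\<lambda>x. v x \<bullet> g x)"
  using Linf_inner[OF g_Linf] v_integrable by (auto simp: inner_commute)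

lemma kap_nonneg: "0 \<le> kap x" by (simp add: kap_def)

lemma kap_integrable: "integrable \<rho> kap"
  using integrable_norm[OF R.integrable_sing[OF s]] by (simp add: kap_def[abs_def] if_distrib cong: if_cong)

lemma rs_bounds: "x \<in> \<Omega> \<Longrightarrow> 0 \<le> rs x" "x \<in> \<Omega> \<Longrightarrow> rs x \<le> M * kap x"
  using I.recession_bounds[of x "s x"] by (auto simp: rs_def kap_def)

lemma rs_integrable: "integrable \<rho> rs"
proof (rule Bochner_Integration.integrable_bound[where f="\<lambda>x. M * kap x"])
  have "(\<lambda>x. recession f x (s x)) \<in> borel_measurable \<rho>"
    by (rule measurable_Caratheodory[OF I.recession_continuous R.sets_rho measurable_rho(3)])
  then show "rs \<in> borel_measurable \<rho>" unfolding rs_def[abs_def] by measurable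
  show "AE x in \<rho>. norm (rs x) \<le> norm (M * kap x)"
    using rs_bounds by (intro AE_I2) fastforce
qed (use kap_integrable in auto)

lemma tvg_integrable: "integrable \<rho> (\<lambda>x. t x * (v x \<bullet> g x))"
  using R.integrable_scaleR_t[OF vg_integrable] by simp

lemma d1_integrable: "integrable \<rho> d1"
  unfolding d1_def[abs_def] using tvg_integrable rs_integrable by simp

lemma fv_integrable: "integrable (leb \<Omega>) (\<lambda>x. f x (v x))"
  by (rule I.finite_leb_integrable[OF D.fin v_integrable])

lemma persp_eq: "AE x in \<rho>. persp f x (s x, t x) = t x * f x (v x) + rs x"
  using v_eq
proof eventually_elim
  case (elim x)
  then show ?case using R.t(2)[of x] by (cases "t x = 0") (auto simp: persp_def rs_def less_le)
qed

lemma integral_persp: "(LINT x|\<rho>. persp f x (s x, t x)) = Phi v + (LINT x|\<rho>. rs x)"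
proof -
  have i: "integrable \<rho> (\<lambda>x. t x * f x (v x))" using R.integrable_scaleR_t[OF fv_integrable] by simp
  have "(LINT x|\<rho>. persp f x (s x, t x)) = (LINT x|\<rho>. t x * f x (v x) + rs x)"
    using borel_measurable_integrable[OF R.persp_integrable[OF s]] i rs_integrable persp_eq
    by (intro integral_cong_AE) auto
  also have "\<dots> = (LINT x|\<rho>. t x * f x (v x)) + (LINT x|\<rho>. rs x)" using i rs_integrable by simp
  also have "(LINT x|\<rho>. t x * f x (v x)) = Phi v"
    using R.integral_leb[of "\<lambda>x. f x (v x)"] borel_measurable_integrable[OF fv_integrable] by (simp add: R.leb_meas)
  finally show ?thesis .
qed

lemma sing_variation_eq: "sing_variation \<Omega> mu = density \<rho> (\<lambda>x. ennreal (kap x))"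
  unfolding R.sing_variation_dmeas[OF s] kap_def ..

lemma dens_sing:
  fixes z :: "'a \<Rightarrow> 'e::euclidean_space"
  assumes "integrable \<rho> z"
  shows "integrable (sing_variation \<Omega> mu) (dens (sing_variation \<Omega> mu) (dmeas \<rho> z))"
    "AE x in \<rho>. 0 < kap x \<longrightarrow> dens (sing_variation \<Omega> mu) (dmeas \<rho> z) x = z x /\<^sub>R kap x"
  unfolding sing_variation_eq
  using dens_dmeas[OF R.fin R.sets_rho assms kap_integrable kap_nonneg] by auto

lemma AE_sing: "(AE x in sing_variation \<Omega> mu. P x) \<longleftrightarrow> (AE x in \<rho>. 0 < kap x \<longrightarrow> P x)"
  unfolding sing_variation_eq using borel_measurable_integrable[OF kap_integrable] by (rule AE_density_real)

text \<open>\<open>kap\<close> is the density of the singular variation, and homogeneity of the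
  recession function absorbs it.\<close>

lemma recession_dens: "AE x in \<rho>. kap x * recession f x (dens (sing_variation \<Omega> mu) mu x) = rs x"
  using dens_sing(2)[OF s] AE_space
proof eventually_elim
  case (elim x)
  then have x: "x \<in> \<Omega>" by simp
  show ?case
  proof (cases "kap x = 0")
    case True
    then show ?thesis using I.recession_bounds[OF x, of "s x"] by (auto simp: kap_def rs_def split: if_splits)
  next
    case False
    then have t0: "t x = 0" "kap x = norm (s x)" "0 < kap x" by (auto simp: kap_def split: if_splits)
    then have "recession f x (dens (sing_variation \<Omega> mu) mu x) = inverse (norm (s x)) * recession f x (s x)"
      using elim I.recession_scale[OF x, of "inverse (norm (s x))" "s x"] by simp
    then show ?thesis using t0 by (simp add: rs_def)
  qed
qed

text \<open>The definition takes the density of the whole measure with respect to its singular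
  variation. Where \<open>kap\<close> is positive, \<open>t\<close> vanishes and this density is
  \<open>s / kap\<close>, the same as for the singular part alone.\<close>

lemma extremal_measure_eq: "extremal_measure \<Omega> k a f mu w = dmeas \<rho> d1"
proof
  fix E
  show "extremal_measure \<Omega> k a f mu w E = dmeas \<rho> d1 E"
  proof (cases "E \<in> sets \<rho>")
    case True
    let ?D = "dens (sing_variation \<Omega> mu) mu"
    have vgm: "(\<lambda>x. v x \<bullet> g x) \<in> borel_measurable \<rho>" using measurable_rho by auto
    have "(LINT x:E|leb \<Omega>. v x \<bullet> g x) = (LINT x|\<rho>. t x *\<^sub>R (indicator E x *\<^sub>R (v x \<bullet> g x)))"
      unfolding set_lebesgue_integral_def using vgm True by (intro R.integral_leb) auto
    also have "\<dots> = (LINT x:E|\<rho>. t x * (v x \<bullet> g x))"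
      unfolding set_lebesgue_integral_def by (simp add: mult.left_commute)
    finally have 1: "(LINT x:E|leb \<Omega>. v x \<bullet> g x) = (LINT x:E|\<rho>. t x * (v x \<bullet> g x))" .
    have Dm: "?D \<in> borel_measurable \<rho>"
      using borel_measurable_integrable[OF dens_sing(1)[OF s]] unfolding sing_variation_eq by simp
    have rm: "(\<lambda>x. recession f x (?D x)) \<in> borel_measurable \<rho>"
      by (rule measurable_Caratheodory[OF I.recession_continuous R.sets_rho Dm])
    have km: "kap \<in> borel_measurable \<rho>" using kap_integrable by simp
    have "(LINT x:E|sing_variation \<Omega> mu. recession f x (?D x)) = (LINT x|\<rho>. kap x *\<^sub>R (indicator E x *\<^sub>R recession f x (?D x)))"
      unfolding set_lebesgue_integral_def unfolding sing_variation_eq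
      using rm km True kap_nonneg unfolding sing_variation_eq by (intro integral_density) auto
    also have "\<dots> = (LINT x:E|\<rho>. rs x)"
      unfolding set_lebesgue_integral_def
    proof (rule integral_cong_AE)
      show "AE x in \<rho>. kap x *\<^sub>R indicat_real E x *\<^sub>R recession f x (?D x) = indicat_real E x *\<^sub>R rs x"
        using recession_dens by eventually_elim (auto split: split_indicator)
    qed (use rm km True borel_measurable_integrable[OF rs_integrable] in auto)
    finally have 2: "(LINT x:E|sing_variation \<Omega> mu. recession f x (?D x)) = (LINT x:E|\<rho>. rs x)" .
    have "(LINT x:E|\<rho>. d1 x) = (LINT x:E|\<rho>. t x * (v x \<bullet> g x)) + (LINT x:E|\<rho>. rs x)"
      unfolding d1_def by (intro set_integral_add integrable_set_integrable tvg_integrable rs_integrable True)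
    then show ?thesis using True unfolding extremal_measure_def 1 2 by (simp add: dmeas_def R.sets_rho)
  qed (simp add: extremal_measure_def dmeas_def R.sets_rho)
qed

lemma relaxed_mu: "relaxed \<Omega> f mu = ennreal (Phi v + (LINT x|\<rho>. rs x))" "0 \<le> Phi v + (LINT x|\<rho>. rs x)"
proof -
  show "relaxed \<Omega> f mu = ennreal (Phi v + (LINT x|\<rho>. rs x))"
    unfolding R.relaxed_dmeas[OF s] integral_persp ..
  show "0 \<le> Phi v + (LINT x|\<rho>. rs x)"
    unfolding integral_persp[symmetric] using I.persp_bounds(1) by (intro Bochner_Integration.integral_nonneg) auto
qed

lemma weak_star_uj:
  assumes u: "\<And>j. integrable (leb \<Omega>) (u j)" and d: "integrable \<rho> d"
  shows "weak_star_conv \<Omega> (\<lambda>j. fun_measure \<Omega> (\<lambda>x. u j x \<bullet> g x)) (dmeas \<rho> d) \<longleftrightarrow>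
    (\<forall>\<phi>. continuous_on \<Omega> \<phi> \<and> bounded (\<phi> ` \<Omega>) \<longrightarrow>
      (\<lambda>j. LINT x|leb \<Omega>. \<phi> x * (g x \<bullet> u j x)) \<longlonglongrightarrow> (LINT x|\<rho>. \<phi> x * d x))"
proof -
  have ug: "integrable (leb \<Omega>) (\<lambda>x. u j x \<bullet> g x)" for j
    using Linf_inner[OF g_Linf] u[of j] by (auto simp: inner_commute)
  show ?thesis
    unfolding R.weak_star_conv_fun_measure_iff[where u="\<lambda>j x. u j x \<bullet> g x", OF ug d]
    by (simp add: inner_commute)
qed

text \<open>The Fenchel equality \<open>fen\<close> makes the conjugate integrable and expresses its
  integral through \<open>v\<close>. The constant test function then evaluates
  \<open>pair w\<close>, since all pairings along the sequence equal it.\<close>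

lemma optimal_if_extremal:
  assumes pair: "extremal_measure \<Omega> k a f mu w \<in> pairing \<Omega> k a u0 mu w"
    and fen: "AE x in leb \<Omega>. ereal (v x \<bullet> g x) = ereal (f x (v x)) + conj_fun f x (g x)"
  shows "generalized_solution \<Omega> k a u0 f mu \<and> dual_solution \<Omega> k a u0 f w"
proof -
  obtain u where u: "\<And>j. u j \<in> affine_fun \<Omega> k a u0"
      "weak_star_conv \<Omega> (\<lambda>j. fun_measure \<Omega> (\<lambda>x. u j x \<bullet> g x)) (dmeas \<rho> d1)"
    using pair unfolding extremal_measure_eq pairing_def by blast
  have ui: "integrable (leb \<Omega>) (u j)" for j by (rule D.affine_funD(3)[OF u0 u(1)])
  have "continuous_on \<Omega> (\<lambda>x. 1::real) \<and> bounded ((\<lambda>x. 1::real) ` \<Omega>)" by (auto simp: bounded_iff intro: exI[of _ 1])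
  then have "(\<lambda>j. LINT x|leb \<Omega>. 1 * (g x \<bullet> u j x)) \<longlonglongrightarrow> (LINT x|\<rho>. 1 * d1 x)"
    using u(2) weak_star_uj[where u=u, OF ui d1_integrable] by blast
  then have pd: "pair w = (LINT x|\<rho>. d1 x)"
    using D.pairing_affine[OF u0 u(1) w] by (simp add: LIMSEQ_const_iff)
  define q where "q x = v x \<bullet> g x - f x (v x)" for x
  have q: "integrable (leb \<Omega>) q" unfolding q_def[abs_def] using vg_integrable fv_integrable by simp
  have qc: "AE x in leb \<Omega>. conj_fun f x (g x) = ereal (q x)"
    using fen
  proof eventually_elim
    case (elim x) then show ?case by (cases "conj_fun f x (g x)") (auto simp: q_def)
  qed
  have "(LINT x|\<rho>. d1 x) = (LINT x|leb \<Omega>. v x \<bullet> g x) + (LINT x|\<rho>. rs x)"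
    using tvg_integrable rs_integrable R.integral_leb[of "\<lambda>x. v x \<bullet> g x"] measurable_rho
    by (simp add: d1_def)
  moreover have "(LINT x|leb \<Omega>. q x) = (LINT x|leb \<Omega>. v x \<bullet> g x) - Phi v"
    unfolding q_def using vg_integrable fv_integrable by simp
  ultimately have eq: "dual_functional \<Omega> k a u0 f w = enn2ereal (relaxed \<Omega> f mu)"
    unfolding dual_functional_eq[OF q qc] relaxed_mu(1) pd using relaxed_mu(2) by (simp add: enn2ereal_ennreal)
  have "relaxed \<Omega> f mu \<le> relaxed \<Omega> f m'" if "m' \<in> affine_meas \<Omega> k a u0" for m'
    using weak_duality[OF that w] unfolding eq by (simp add: less_eq_ennreal.rep_eq)
  moreover have "dual_functional \<Omega> k a u0 f w' \<le> dual_functional \<Omega> k a u0 f w" if "w' \<in> adj_domain \<Omega> k a" for w'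
    using weak_duality[OF mu that] unfolding eq .
  ultimately show ?thesis using mu w by (simp add: generalized_solution_def dual_solution_def)
qed

text \<open>The energy of \<open>mu\<close> bounds the value of \<open>w\<close> from above by weak
  duality, and from below because \<open>w\<close> does at least as well as the dual field of strong
  duality. Finiteness of the energy excludes the value \<open>-\<infinity>\<close>.\<close>

lemma duality_equality:
  assumes gs: "generalized_solution \<Omega> k a u0 f mu" and ds: "dual_solution \<Omega> k a u0 f w"
  shows "\<exists>q. integrable (leb \<Omega>) q \<and> (AE x in leb \<Omega>. conj_fun f x (g x) = ereal (q x)) \<and>
    pair w = (LINT x|\<rho>. persp f x (s x, t x)) + (LINT x|leb \<Omega>. q x)"
proof -
  obtain w' where w': "w' \<in> adj_domain \<Omega> k a" "enn2ereal (relaxed \<Omega> f mu) \<le> dual_functional \<Omega> k a u0 f w'"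
    using strong_duality[OF gs] by blast
  have "dual_functional \<Omega> k a u0 f w' \<le> dual_functional \<Omega> k a u0 f w" using ds w'(1) by (simp add: dual_solution_def)
  with w'(2) weak_duality[OF mu w] have eq: "dual_functional \<Omega> k a u0 f w = enn2ereal (relaxed \<Omega> f mu)" by simp
  then have "dual_functional \<Omega> k a u0 f w \<noteq> -\<infinity>" unfolding relaxed_mu(1) using relaxed_mu(2) by (simp add: enn2ereal_ennreal)
  then obtain q where q: "integrable (leb \<Omega>) q" "AE x in leb \<Omega>. conj_fun f x (g x) = ereal (q x)"
    using dual_functional_cases[OF w] by blast
  have "pair w - (LINT x|leb \<Omega>. q x) = (LINT x|\<rho>. persp f x (s x, t x))"
    using eq unfolding dual_functional_eq[OF q] relaxed_mu(1) integral_persp using relaxed_mu(2) by (simp add: enn2ereal_ennreal)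
  then show ?thesis using q by (intro exI[of _ q]) simp
qed

text \<open>By Fenchel's inequality the integrands \<open>f x (u j x) + f\<^sup>* x (g x) - g x \<bullet> u j x\<close> are nonnegative;
  optimality makes their integrals tend to \<open>0\<close>, which identifies the limit of the pairings.\<close>

lemma pairing_limit:
  assumes q: "integrable (leb \<Omega>) q" "AE x in leb \<Omega>. conj_fun f x (g x) = ereal (q x)"
    and eq: "pair w = (LINT x|\<rho>. persp f x (s x, t x)) + (LINT x|leb \<Omega>. q x)"
    and u: "\<And>j. u j \<in> affine_fun \<Omega> k a u0" "area_strict_conv \<Omega> (\<lambda>j. fun_measure \<Omega> (u j)) mu"
    and \<phi>: "continuous_on \<Omega> \<phi>" "bounded (\<phi> ` \<Omega>)"
  shows "(\<lambda>j. LINT x|leb \<Omega>. \<phi> x * (g x \<bullet> u j x)) \<longlonglongrightarrow> (LINT x|\<rho>. \<phi> x * (persp f x (s x, t x) + t x * q x))"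
proof -
  obtain B where B: "0 \<le> B" "\<And>x. x \<in> \<Omega> \<Longrightarrow> \<bar>\<phi> x\<bar> \<le> B" using boundedD_real[OF \<phi>(2)] by auto
  note \<phi>m = R.borel_measurable_continuous[OF \<phi>(1)]
  have \<phi>i: "integrable N (\<lambda>x. \<phi> x * z x)" if "integrable N z" "\<phi> \<in> borel_measurable N" "space N = \<Omega>" for N z
    using B that by (intro integrable_bounded_mult[where B=B]) auto
  have ui: "integrable (leb \<Omega>) (u j)" for j by (rule D.affine_funD(3)[OF u0 u(1)])
  define r where "r j x = f x (u j x) + q x - g x \<bullet> u j x" for j x
  note F = fenchel_integral[OF ui g_Linf q, folded r_def]
  have gui: "integrable (leb \<Omega>) (\<lambda>x. g x \<bullet> u j x)" for j using Linf_inner[OF g_Linf] ui by blast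
  have fui: "integrable (leb \<Omega>) (\<lambda>x. f x (u j x))" for j by (rule I.finite_leb_integrable[OF D.fin ui])
  have "(\<lambda>j. LINT x|leb \<Omega>. 1 * f x (u j x)) \<longlonglongrightarrow> (LINT x|\<rho>. 1 * persp f x (s x, t x))"
    by (rule R.energy_tendsto[where \<phi>="\<lambda>x. 1", OF ui s u(2)]) (auto simp: bounded_iff intro: exI[of _ 1])
  then have "(\<lambda>j. Phi (u j) + (LINT x|leb \<Omega>. q x) - pair w) \<longlonglongrightarrow> (LINT x|\<rho>. persp f x (s x, t x)) + (LINT x|leb \<Omega>. q x) - pair w"
    by (intro tendsto_intros) simp
  \<comment> \<open>The gap integrates to energy plus conjugate minus the constant
    \<open>pair w\<close>, and by \<open>eq\<close> these balance in the limit.\<close>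
  then have r0: "(\<lambda>j. LINT x|leb \<Omega>. r j x) \<longlonglongrightarrow> 0"
    unfolding F(3) D.pairing_affine[OF u0 u(1) w] by (simp add: eq)
  have "(\<lambda>j. LINT x|leb \<Omega>. \<phi> x * r j x) \<longlonglongrightarrow> 0"
  proof (rule Lim_null_comparison)
    show "(\<lambda>j. B * (LINT x|leb \<Omega>. r j x)) \<longlonglongrightarrow> 0" using tendsto_mult[OF tendsto_const[of B] r0] by simp
    show "\<forall>\<^sub>F j in sequentially. norm (LINT x|leb \<Omega>. \<phi> x * r j x) \<le> B * (LINT x|leb \<Omega>. r j x)"
    proof (rule always_eventually, rule allI)
      fix j
      have "norm (LINT x|leb \<Omega>. \<phi> x * r j x) \<le> (LINT x|leb \<Omega>. norm (\<phi> x * r j x))" by (rule integral_norm_bound)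
      also have "\<dots> \<le> (LINT x|leb \<Omega>. B * r j x)"
      proof (rule integral_mono_AE)
        show "AE x in leb \<Omega>. norm (\<phi> x * r j x) \<le> B * r j x"
          using F(1)[of j] AE_space
        proof eventually_elim
          case (elim x)
          then show ?case using B(2)[of x] by (simp add: abs_mult mult_right_mono)
        qed
      qed (use \<phi>i[OF F(2) \<phi>m(2)] F(2) in auto)
      finally show "norm (LINT x|leb \<Omega>. \<phi> x * r j x) \<le> B * (LINT x|leb \<Omega>. r j x)" by simp
    qed
  qed
  then have "(\<lambda>j. (LINT x|leb \<Omega>. \<phi> x * f x (u j x)) + (LINT x|leb \<Omega>. \<phi> x * q x) - (LINT x|leb \<Omega>. \<phi> x * r j x)) \<longlonglongrightarrow>
      (LINT x|\<rho>. \<phi> x * persp f x (s x, t x)) + (LINT x|leb \<Omega>. \<phi> x * q x) - 0"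
    by (intro tendsto_intros R.energy_tendsto[OF ui s u(2) \<phi>])
  moreover have "(LINT x|leb \<Omega>. \<phi> x * f x (u j x)) + (LINT x|leb \<Omega>. \<phi> x * q x) - (LINT x|leb \<Omega>. \<phi> x * r j x) = (LINT x|leb \<Omega>. \<phi> x * (g x \<bullet> u j x))" for j
  proof -
    note i = \<phi>i[OF fui[of j] \<phi>m(2)] \<phi>i[OF q(1) \<phi>m(2)] \<phi>i[OF F(2)[of j] \<phi>m(2)]
    have "(LINT x|leb \<Omega>. \<phi> x * f x (u j x)) + (LINT x|leb \<Omega>. \<phi> x * q x) - (LINT x|leb \<Omega>. \<phi> x * r j x)
      = (LINT x|leb \<Omega>. \<phi> x * f x (u j x) + \<phi> x * q x - \<phi> x * r j x)" using i by simp
    then show ?thesis by (simp add: r_def algebra_simps)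
  qed
  moreover have "(LINT x|\<rho>. \<phi> x * persp f x (s x, t x)) + (LINT x|leb \<Omega>. \<phi> x * q x) - 0 = (LINT x|\<rho>. \<phi> x * (persp f x (s x, t x) + t x * q x))"
  proof -
    have qm: "q \<in> borel_measurable \<rho>" using borel_measurable_integrable[OF q(1)] unfolding R.leb_meas .
    have tq: "integrable \<rho> (\<lambda>x. t x * q x)" using R.integrable_scaleR_t[OF q(1)] by simp
    have "(LINT x|leb \<Omega>. \<phi> x * q x) = (LINT x|\<rho>. \<phi> x * (t x * q x))"
      using R.integral_leb[of "\<lambda>x. \<phi> x * q x"] qm \<phi>m by (simp add: mult.left_commute)
    then show ?thesis
      using \<phi>i[OF R.persp_integrable[OF s] \<phi>m(1)] \<phi>i[OF tq \<phi>m(1)] by (simp add: distrib_left)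
  qed
  ultimately show ?thesis by simp
qed

text \<open>\<open>key\<close> evaluates the limit of the localised pairings twice: exactly, by
  \<open>pairing_limit\<close>, and through strong convergence to \<open>v\<close>, up to
  \<open>C\<close> times the singular mass under \<open>\<phi>\<close>. A cutoff near 1 on
  \<open>{t > 0}\<close> and near 0 on the singular set leaves the whole Fenchel gap on one side and
  nothing on the other.\<close>

lemma extremality_pointwise:
  assumes q: "integrable (leb \<Omega>) q" "AE x in leb \<Omega>. conj_fun f x (g x) = ereal (q x)"
    and eq: "pair w = (LINT x|\<rho>. persp f x (s x, t x)) + (LINT x|leb \<Omega>. q x)"
  shows "AE x in \<rho>. t x * (f x (v x) + q x - g x \<bullet> v x) = 0"
proof -
  obtain u where u: "\<And>j. u j \<in> affine_fun \<Omega> k a u0" "area_strict_conv \<Omega> (\<lambda>j. fun_measure \<Omega> (u j)) mu"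
    using recovery_sequence[OF mu] by blast
  have ui: "integrable (leb \<Omega>) (u j)" for j by (rule D.affine_funD(3)[OF u0 u(1)])
  obtain C where C: "0 < C" "AE x in leb \<Omega>. norm (g x) \<le> C" "\<And>u. integrable (leb \<Omega>) u \<Longrightarrow> integrable (leb \<Omega>) (\<lambda>x. g x \<bullet> u x)"
    using Linf_inner[OF g_Linf] v_integrable by blast
  define T where "T x = f x (v x) + q x - g x \<bullet> v x" for x
  note F = fenchel_integral[OF v_integrable g_Linf q, folded T_def]
  have tT: "integrable \<rho> (\<lambda>x. t x * T x)" using R.integrable_scaleR_t[OF F(2)] by simp
  have T0: "AE x in \<rho>. 0 \<le> t x * T x"
    using F(1)[unfolded R.AE_leb]
  proof eventually_elim
    case (elim x) then show ?case using R.t(2)[of x] by (cases "t x = 0") auto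
  qed
  let ?P = "\<lambda>x. persp f x (s x, t x)"
  have tq: "integrable \<rho> (\<lambda>x. t x * q x)" using R.integrable_scaleR_t[OF q(1)] by simp
  have key: "(LINT x|\<rho>. \<phi> x * (t x * T x)) \<le> C * (LINT x|\<rho>. \<phi> x * kap x)"
    if \<phi>: "continuous_on \<Omega> \<phi>" "\<And>x. x \<in> \<Omega> \<Longrightarrow> 0 \<le> \<phi> x" "\<And>x. x \<in> \<Omega> \<Longrightarrow> \<phi> x \<le> 1" for \<phi>
  proof -
    have \<phi>b: "bounded (\<phi> ` \<Omega>)" using \<phi>(2,3) by (auto simp: bounded_iff intro!: exI[of _ 1])
    note \<phi>m = R.borel_measurable_continuous[OF \<phi>(1)]
    have \<phi>i: "integrable N (\<lambda>x. \<phi> x * z x)" if "integrable N z" "\<phi> \<in> borel_measurable N" "space N = \<Omega>" for N z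
      using \<phi> that by (intro integrable_bounded_mult[where B=1]) auto
    have le: "(LINT x|\<rho>. \<phi> x * (?P x + t x * q x)) \<le> (LINT x|leb \<Omega>. \<phi> x * (g x \<bullet> v x)) + C * ((LINT x|\<rho>. \<phi> x * kap x) + e)"
      if e: "0 < e" for e
    proof -
      have ae: "AE x in \<rho>. 0 < t x \<longrightarrow> s x = t x *\<^sub>R v x"
        using v_eq by eventually_elim simp
      have "\<forall>\<^sub>F j in sequentially. (LINT x|leb \<Omega>. \<phi> x * norm (u j x - v x)) < (LINT x|\<rho>. \<phi> x * norm (if t x = 0 then s x else 0)) + e"
        by (rule R.area_strict_L1_bound[OF D.O ui s u(2) v_integrable ae \<phi> e])
      moreover have "(LINT x|\<rho>. \<phi> x * norm (if t x = 0 then s x else 0)) = (LINT x|\<rho>. \<phi> x * kap x)"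
        by (intro Bochner_Integration.integral_cong) (auto simp: kap_def)
      ultimately have ev: "\<forall>\<^sub>F j in sequentially. (LINT x|leb \<Omega>. \<phi> x * (g x \<bullet> u j x)) \<le> (LINT x|leb \<Omega>. \<phi> x * (g x \<bullet> v x)) + C * ((LINT x|\<rho>. \<phi> x * kap x) + e)"
      proof (elim eventually_mono)
        fix j assume "(LINT x|leb \<Omega>. \<phi> x * norm (u j x - v x)) < (LINT x|\<rho>. \<phi> x * norm (if t x = 0 then s x else 0)) + e"
        then have j: "(LINT x|leb \<Omega>. \<phi> x * norm (u j x - v x)) \<le> (LINT x|\<rho>. \<phi> x * kap x) + e"
          using \<open>(LINT x|\<rho>. \<phi> x * norm (if t x = 0 then s x else 0)) = (LINT x|\<rho>. \<phi> x * kap x)\<close> by simp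
        have iN: "integrable (leb \<Omega>) (\<lambda>x. \<phi> x * norm (u j x - v x))"
          by (rule \<phi>i[OF _ \<phi>m(2)]) (use ui[of j] v_integrable in auto)
        note i1 = \<phi>i[OF C(3)[OF ui[of j]] \<phi>m(2)] and i2 = \<phi>i[OF C(3)[OF v_integrable] \<phi>m(2)]
        have "(LINT x|leb \<Omega>. \<phi> x * (g x \<bullet> u j x)) \<le> (LINT x|leb \<Omega>. \<phi> x * (g x \<bullet> v x) + C * (\<phi> x * norm (u j x - v x)))"
        proof (rule integral_mono_AE)
          show "AE x in leb \<Omega>. \<phi> x * (g x \<bullet> u j x) \<le> \<phi> x * (g x \<bullet> v x) + C * (\<phi> x * norm (u j x - v x))"
            using C(2) AE_space
          proof eventually_elim
            case (elim x)
            have "g x \<bullet> u j x - g x \<bullet> v x = g x \<bullet> (u j x - v x)" by (simp add: inner_diff_right)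
            also have "\<dots> \<le> norm (g x) * norm (u j x - v x)" by (rule norm_cauchy_schwarz)
            also have "\<dots> \<le> C * norm (u j x - v x)" using elim by (intro mult_right_mono) auto
            finally have "\<phi> x * (g x \<bullet> u j x) \<le> \<phi> x * (g x \<bullet> v x + C * norm (u j x - v x))"
              using \<phi>(2)[of x] elim by (intro mult_left_mono) auto
            then show ?case by (simp add: algebra_simps)
          qed
        qed (use i1 i2 iN in auto)
        also have "\<dots> = (LINT x|leb \<Omega>. \<phi> x * (g x \<bullet> v x)) + C * (LINT x|leb \<Omega>. \<phi> x * norm (u j x - v x))"
          using i2 iN by simp
        also have "\<dots> \<le> (LINT x|leb \<Omega>. \<phi> x * (g x \<bullet> v x)) + C * ((LINT x|\<rho>. \<phi> x * kap x) + e)"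
          using j C(1) by (intro add_left_mono mult_left_mono) auto
        finally show "(LINT x|leb \<Omega>. \<phi> x * (g x \<bullet> u j x)) \<le> (LINT x|leb \<Omega>. \<phi> x * (g x \<bullet> v x)) + C * ((LINT x|\<rho>. \<phi> x * kap x) + e)" .
      qed
      show ?thesis
        by (rule tendsto_upperbound[OF pairing_limit[OF q eq u \<phi>(1) \<phi>b] ev]) simp
    qed
    have gvm: "(\<lambda>x. \<phi> x * (g x \<bullet> v x)) \<in> borel_measurable \<rho>" using \<phi>m measurable_rho by auto
    have tgv: "integrable \<rho> (\<lambda>x. t x * (g x \<bullet> v x))" using tvg_integrable by (simp add: inner_commute)
    have gv: "(LINT x|leb \<Omega>. \<phi> x * (g x \<bullet> v x)) = (LINT x|\<rho>. \<phi> x * (t x * (g x \<bullet> v x)))"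
      using R.integral_leb[OF gvm] by (simp add: mult.left_commute)
    have "(LINT x|\<rho>. \<phi> x * (?P x + t x * q x)) \<le> (LINT x|leb \<Omega>. \<phi> x * (g x \<bullet> v x)) + C * (LINT x|\<rho>. \<phi> x * kap x)"
    proof (rule field_le_epsilon)
      fix e :: real assume "0 < e"
      then have "0 < e / C" using C(1) by simp
      from le[OF this] show "(LINT x|\<rho>. \<phi> x * (?P x + t x * q x)) \<le> (LINT x|leb \<Omega>. \<phi> x * (g x \<bullet> v x)) + C * (LINT x|\<rho>. \<phi> x * kap x) + e"
        using C(1) by (simp add: distrib_left)
    qed
    \<comment> \<open>The singular energy \<open>\<phi> x * rs x\<close> is nonnegative and is
      dropped.\<close>
    moreover have "(LINT x|\<rho>. \<phi> x * (t x * T x)) \<le> (LINT x|\<rho>. \<phi> x * (?P x + t x * q x)) - (LINT x|\<rho>. \<phi> x * (t x * (g x \<bullet> v x)))"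
    proof -
      note j1 = \<phi>i[OF tT \<phi>m(1)] and j2 = \<phi>i[OF Bochner_Integration.integrable_add[OF R.persp_integrable[OF s] tq] \<phi>m(1)]
        and j3 = \<phi>i[OF tgv \<phi>m(1)]
      have "(LINT x|\<rho>. \<phi> x * (t x * T x)) \<le> (LINT x|\<rho>. \<phi> x * (?P x + t x * q x) - \<phi> x * (t x * (g x \<bullet> v x)))"
      proof (rule integral_mono_AE)
        show "AE x in \<rho>. \<phi> x * (t x * T x) \<le> \<phi> x * (?P x + t x * q x) - \<phi> x * (t x * (g x \<bullet> v x))"
          using persp_eq AE_space
        proof eventually_elim
          case (elim x)
          then have x: "x \<in> \<Omega>" by simp
          have "\<phi> x * (?P x + t x * q x) - \<phi> x * (t x * (g x \<bullet> v x)) = \<phi> x * (t x * T x) + \<phi> x * rs x"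
            unfolding elim(1) T_def by (simp add: algebra_simps)
          then show ?case using \<phi>(2)[OF x] rs_bounds(1)[OF x] by simp
        qed
      qed (use j1 j2 j3 in auto)
      then show ?thesis using j2 j3 by simp
    qed
    ultimately show ?thesis unfolding gv by simp
  qed
  have "(LINT x|\<rho>. t x * T x) \<le> e" if e: "0 < e" for e
  proof -
    \<comment> \<open>The indicator of \<open>{t > 0}\<close>, to be approximated by a continuous
      function in the norm with weight \<open>K\<close>, which controls the gap and the singular
      mass at once.\<close>
    define S where "S x = (if t x = 0 then 0 else 1::real)" for x
    define K where "K x = \<bar>t x * T x\<bar> + kap x" for x
    have Ki: "integrable \<rho> K" unfolding K_def[abs_def] using tT kap_integrable by auto
    have K0: "0 \<le> K x" for x using kap_nonneg by (simp add: K_def)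
    have Sm: "S \<in> borel_measurable \<rho>" unfolding S_def[abs_def] by measurable
    have S1: "norm (S x) \<le> 1" for x by (simp add: S_def)
    \<comment> \<open>\<open>1 + C\<close>, because the approximation error enters once through the
      gap and \<open>C\<close> times through the singular mass.\<close>
    have pos: "0 < e / (1 + C)" using e C(1) by simp
    obtain h where h: "continuous_on UNIV h" "\<And>x. norm (h x) \<le> 1" "(LINT x|\<rho>. K x * norm (h x - S x)) < e / (1 + C)"
      by (rule continuous_dense_weighted[OF R.fin R.sets_rho D.O Sm S1 Ki K0 pos], rule that)
    \<comment> \<open>As \<open>S\<close> is nonnegative, the positive part of \<open>h\<close> is
      at least as close to it as \<open>h\<close>.\<close>
    define \<phi> where "\<phi> x = max 0 (h x)" for x
    have \<phi>c: "continuous_on \<Omega> \<phi>" unfolding \<phi>_def[abs_def]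
      using continuous_on_subset[OF h(1)] by (intro continuous_intros) auto
    have hb: "h x \<le> 1" for x using h(2)[of x] by simp
    have \<phi>01: "0 \<le> \<phi> x" "\<phi> x \<le> 1" for x using hb[of x] by (auto simp: \<phi>_def)
    have \<phi>S: "\<bar>\<phi> x - S x\<bar> \<le> norm (h x - S x)" for x by (auto simp: \<phi>_def S_def)
    note \<phi>m = R.borel_measurable_continuous[OF \<phi>c]
    have hm: "h \<in> borel_measurable \<rho>" using continuous_on_subset[OF h(1)] by (intro R.borel_measurable_continuous) auto
    have \<phi>i: "integrable \<rho> (\<lambda>x. \<phi> x * z x)" if "integrable \<rho> z" for z
      using \<phi>01 that \<phi>m by (intro integrable_bounded_mult[where B=1]) auto
    have iKh: "integrable \<rho> (\<lambda>x. norm (h x - S x) * K x)"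
    proof (rule integrable_bounded_mult[OF Ki, where B=2])
      show "\<bar>norm (h x - S x)\<bar> \<le> 2" for x using h(2)[of x] by (auto simp: S_def abs_le_iff)
    qed (use hm Sm in auto)
    have b1: "(LINT x|\<rho>. t x * T x) \<le> (LINT x|\<rho>. \<phi> x * (t x * T x)) + (LINT x|\<rho>. norm (h x - S x) * K x)"
    proof -
      have "(LINT x|\<rho>. t x * T x) \<le> (LINT x|\<rho>. \<phi> x * (t x * T x) + norm (h x - S x) * K x)"
      proof (rule integral_mono)
        fix x
        have "t x * T x = S x * (t x * T x)" by (simp add: S_def)
        also have "\<dots> = \<phi> x * (t x * T x) + (S x - \<phi> x) * (t x * T x)" by (simp add: algebra_simps)
        also have "(S x - \<phi> x) * (t x * T x) \<le> \<bar>S x - \<phi> x\<bar> * \<bar>t x * T x\<bar>" unfolding abs_mult[symmetric] by (rule abs_ge_self)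
        also have "\<dots> \<le> norm (h x - S x) * K x"
          using \<phi>S[of x] kap_nonneg[of x] by (intro mult_mono) (auto simp: K_def abs_minus_commute)
        finally show "t x * T x \<le> \<phi> x * (t x * T x) + norm (h x - S x) * K x" by simp
      qed (use tT \<phi>i[OF tT] iKh in auto)
      then show ?thesis using \<phi>i[OF tT] iKh by simp
    qed
    have b2: "(LINT x|\<rho>. \<phi> x * kap x) \<le> (LINT x|\<rho>. norm (h x - S x) * K x)"
    proof (rule integral_mono)
      fix x
      have "\<phi> x * kap x = (\<phi> x - S x) * kap x" by (simp add: S_def kap_def)
      also have "\<dots> \<le> \<bar>\<phi> x - S x\<bar> * kap x" using kap_nonneg by (intro mult_right_mono) auto
      also have "\<dots> \<le> norm (h x - S x) * K x"
        using \<phi>S[of x] kap_nonneg[of x] by (intro mult_mono) (auto simp: K_def)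
      finally show "\<phi> x * kap x \<le> norm (h x - S x) * K x" .
    qed (use \<phi>i[OF kap_integrable] iKh in auto)
    have "(LINT x|\<rho>. t x * T x) \<le> C * (LINT x|\<rho>. \<phi> x * kap x) + (LINT x|\<rho>. norm (h x - S x) * K x)"
      using b1 key[OF \<phi>c \<phi>01] by linarith
    also have "\<dots> \<le> C * (LINT x|\<rho>. norm (h x - S x) * K x) + (LINT x|\<rho>. norm (h x - S x) * K x)"
      using b2 C(1) by (intro add_right_mono mult_left_mono) auto
    also have "\<dots> = (1 + C) * (LINT x|\<rho>. K x * norm (h x - S x))" by (simp add: algebra_simps)
    also have "\<dots> \<le> (1 + C) * (e / (1 + C))" using h(3) C(1) by (intro mult_left_mono) auto
    also have "\<dots> = e" using C(1) by simp
    finally show ?thesis .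
  qed
  then have "(LINT x|\<rho>. t x * T x) \<le> 0" by (rule field_le_epsilon) simp
  moreover have "0 \<le> (LINT x|\<rho>. t x * T x)" using T0 by (rule integral_nonneg_AE)
  ultimately have "(LINT x|\<rho>. t x * T x) = 0" by linarith
  then show ?thesis using integral_nonneg_eq_0_iff_AE[OF tT T0] by (simp add: T_def)
qed

lemma extremal_if_optimal:
  assumes gs: "generalized_solution \<Omega> k a u0 f mu" and ds: "dual_solution \<Omega> k a u0 f w"
  shows "pairing \<Omega> k a u0 mu w = {dmeas \<rho> d1}"
    "AE x in leb \<Omega>. ereal (v x \<bullet> g x) = ereal (f x (v x)) + conj_fun f x (g x)"
proof -
  obtain q where q: "integrable (leb \<Omega>) q" "AE x in leb \<Omega>. conj_fun f x (g x) = ereal (q x)"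
    and eq: "pair w = (LINT x|\<rho>. persp f x (s x, t x)) + (LINT x|leb \<Omega>. q x)"
    using duality_equality[OF gs ds] by blast
  note T = extremality_pointwise[OF q eq]
  have Tl: "AE x in leb \<Omega>. f x (v x) + q x - g x \<bullet> v x = 0"
    unfolding R.AE_leb using T by eventually_elim auto
  show "AE x in leb \<Omega>. ereal (v x \<bullet> g x) = ereal (f x (v x)) + conj_fun f x (g x)"
    using Tl q(2) by eventually_elim (simp add: inner_commute)
  \<comment> \<open>The density delivered by \<open>pairing_limit\<close>; the vanishing gap turns
    it into that of the extremal measure.\<close>
  define d0 where "d0 x = persp f x (s x, t x) + t x * q x" for x
  have d0i: "integrable \<rho> d0" unfolding d0_def[abs_def]
    using R.persp_integrable[OF s] R.integrable_scaleR_t[OF q(1)] by simp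
  have "AE x in \<rho>. d0 x = d1 x"
    using T persp_eq
  proof eventually_elim
    case (elim x)
    have "d0 x - d1 x = t x * (f x (v x) + q x - g x \<bullet> v x)"
      unfolding d0_def d1_def elim(2) by (simp add: algebra_simps inner_commute)
    then show ?case using elim(1) by simp
  qed
  then have d01: "dmeas \<rho> d0 = dmeas \<rho> d1" by (rule dmeas_cong_AE[OF d0i d1_integrable])
  have lim: "weak_star_conv \<Omega> (\<lambda>j. fun_measure \<Omega> (\<lambda>x. u j x \<bullet> g x)) (dmeas \<rho> d1)"
    if u: "\<And>j. u j \<in> affine_fun \<Omega> k a u0" "area_strict_conv \<Omega> (\<lambda>j. fun_measure \<Omega> (u j)) mu" for u
  proof -
    have ui: "integrable (leb \<Omega>) (u j)" for j by (rule D.affine_funD(3)[OF u0 u(1)])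
    show ?thesis
      unfolding d01[symmetric] weak_star_uj[where u=u, OF ui d0i] d0_def
      using pairing_limit[OF q eq u] by blast
  qed
  have rad: "dmeas \<rho> d1 \<in> radon_measures \<Omega>" by (rule dmeas_radon[OF R.sets_rho d1_integrable])
  show "pairing \<Omega> k a u0 mu w = {dmeas \<rho> d1}"
  proof
    show "{dmeas \<rho> d1} \<subseteq> pairing \<Omega> k a u0 mu w"
      using recovery_sequence[OF mu] lim rad unfolding pairing_def by blast
    show "pairing \<Omega> k a u0 mu w \<subseteq> {dmeas \<rho> d1}"
    proof
      fix l assume "l \<in> pairing \<Omega> k a u0 mu w"
      then obtain u where l: "l \<in> radon_measures \<Omega>" and u: "\<And>j. u j \<in> affine_fun \<Omega> k a u0"
          "area_strict_conv \<Omega> (\<lambda>j. fun_measure \<Omega> (u j)) mu" "weak_star_conv \<Omega> (\<lambda>j. fun_measure \<Omega> (\<lambda>x. u j x \<bullet> g x)) l"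
        by (auto simp: pairing_def)
      \<comment> \<open>All admissible sequences have the same limit of pairings, and weak limits
        are unique.\<close>
      have "l = dmeas \<rho> d1"
      proof (rule vint_eq_imp_eq[OF D.fin D.O l rad])
        fix \<phi> :: "'a \<Rightarrow> real" assume "continuous_on \<Omega> \<phi>" "bounded (\<phi> ` \<Omega>)"
        then show "vint \<Omega> \<phi> l = vint \<Omega> \<phi> (dmeas \<rho> d1)"
          using u(3) lim[OF u(1,2)] unfolding weak_star_conv_def by (blast intro: LIMSEQ_unique)
      qed
      then show "l \<in> {dmeas \<rho> d1}" by simp
    qed
  qed
qed

text \<open>Where \<open>t\<close> is positive the term \<open>rs\<close> of \<open>d1\<close>
  vanishes, and where \<open>kap\<close> is positive the other term does, so each density sees one
  summand only.\<close>

lemma densities: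
  shows "AE x in leb \<Omega>. dens (leb \<Omega>) (dmeas \<rho> d1) x = v x \<bullet> g x"
    "AE x in sing_variation \<Omega> mu. dens (sing_variation \<Omega> mu) (dmeas \<rho> d1) x = recession f x (dens (sing_variation \<Omega> mu) mu x)"
proof -
  show "AE x in leb \<Omega>. dens (leb \<Omega>) (dmeas \<rho> d1) x = v x \<bullet> g x"
    unfolding R.AE_leb using R.dens_leb(2)[OF d1_integrable]
  proof eventually_elim
    case (elim x) then show ?case by (auto simp: d1_def rs_def)
  qed
  show "AE x in sing_variation \<Omega> mu. dens (sing_variation \<Omega> mu) (dmeas \<rho> d1) x = recession f x (dens (sing_variation \<Omega> mu) mu x)"
    unfolding AE_sing using dens_sing(2)[OF d1_integrable] recession_dens
  proof eventually_elim
    case (elim x)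
    show ?case
    proof
      assume k: "0 < kap x"
      then have "t x = 0" by (auto simp: kap_def split: if_splits)
      then have "d1 x = kap x * recession f x (dens (sing_variation \<Omega> mu) mu x)" using elim by (simp add: d1_def)
      then show "dens (sing_variation \<Omega> mu) (dmeas \<rho> d1) x = recession f x (dens (sing_variation \<Omega> mu) mu x)"
        using elim(1) k by (simp add: mult.assoc[symmetric])
    qed
  qed
qed

end

text \<open>The zero measure lies in the kernel and its area is at least the Lebesgue measure of
  \<open>\<Omega>\<close>; area-strict convergence to it includes finiteness of this area.\<close>

lemma finite_leb_if_recovery:
  assumes H2: "\<forall>m\<in>ker_meas \<Omega> k a. \<exists>u. (\<forall>j. u j \<in> ker_fun \<Omega> k a) \<and> area_strict_conv \<Omega> (\<lambda>j. fun_measure \<Omega> (u j)) m"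
  shows "finite_measure (leb \<Omega>)"
proof (rule finite_measureI)
  define z :: "'a \<Rightarrow> 'b" where "z = (\<lambda>x. 0)"
  have zi: "integrable (leb \<Omega>) z" by (simp add: z_def)
  have z0: "dmeas (leb \<Omega>) z = (\<lambda>E. 0)" by (simp add: z_def dmeas_def fun_eq_iff)
  have "total_variation \<Omega> (dmeas (leb \<Omega>) z) = density (leb \<Omega>) (\<lambda>x. ennreal (norm (z x)))"
    by (rule total_variation_dmeas[OF sets_leb zi])
  also have "\<dots> = null_measure (leb \<Omega>)" by (simp add: z_def null_measure_eq_density)
  finally have tv: "total_variation \<Omega> (\<lambda>E::'a set. 0::'b) = null_measure (leb \<Omega>)" unfolding z0 .
  have vint0: "vint \<Omega> \<phi> (\<lambda>E. 0::'b) = 0" for \<phi> unfolding vint_def tv by (simp add: integral_null_measure)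
  have "(\<lambda>E. 0::'b) \<in> ker_meas \<Omega> k a"
    by (auto simp: ker_meas_def op_distr_def vint0 radon_measures_def)
  then obtain u where "area_strict_conv \<Omega> (\<lambda>j. fun_measure \<Omega> (u j)) (\<lambda>E. 0::'b)" using H2 by blast
  then have fin: "area \<Omega> (\<lambda>E. 0::'b) \<Omega> < \<infinity>" by (simp add: area_strict_conv_def)
  have "emeasure (leb \<Omega>) \<Omega> = (\<integral>\<^sup>+x\<in>\<Omega>. 1 \<partial>leb \<Omega>)" using sets.top[of "leb \<Omega>"] by simp
  also have "\<dots> \<le> (\<integral>\<^sup>+x\<in>\<Omega>. ennreal (sqrt (1 + (norm (dens (leb \<Omega>) (\<lambda>E. 0::'b) x))\<^sup>2)) \<partial>leb \<Omega>)"
    by (intro nn_integral_mono mult_right_mono) (auto simp: one_ennreal_def[symmetric] ennreal_leI[of 1, simplified])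
  also have "\<dots> \<le> area \<Omega> (\<lambda>E. 0::'b) \<Omega>" by (simp add: area_def)
  finally show "emeasure (leb \<Omega>) (space (leb \<Omega>)) \<noteq> \<infinity>" using fin by (auto simp: top_unique)
qed

theorem theorem1p3:
  fixes \<Omega> :: "'a::euclidean_space set"
    and k :: nat
    and a :: "'a list \<Rightarrow> 'a \<Rightarrow> ('b::euclidean_space \<Rightarrow>\<^sub>L 'c::euclidean_space)"
    and u0 :: "'a \<Rightarrow> 'b"
    and f :: "'a \<Rightarrow> 'b \<Rightarrow> real"
    and \<mu> :: "'a set \<Rightarrow> 'b"
    and w :: "'a \<Rightarrow> 'c"
  assumes "open \<Omega>"
    and "frontier \<Omega> \<in> null_sets lborel"
    and "admissible_coeffs \<Omega> k a"
    and H1: "strongly_closed_L1 \<Omega> (op_image \<Omega> k a)"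
    and H2: "\<forall>m\<in>ker_meas \<Omega> k a. \<exists>u. (\<forall>j. u j \<in> ker_fun \<Omega> k a) \<and>
               area_strict_conv \<Omega> (\<lambda>j. fun_measure \<Omega> (u j)) m"
    and "u0 \<in> W \<Omega> k a"
    and "continuous_on (\<Omega> \<times> UNIV) (\<lambda>(x, z). f x z)"
    and "\<forall>x\<in>\<Omega>. \<forall>z. 0 \<le> f x z"
    and "\<forall>x\<in>\<Omega>. convex_on UNIV (f x)"
    and "\<exists>M>0. \<forall>x\<in>\<Omega>. \<forall>z. 1 / M * (norm z - 1) \<le> \<bar>f x z\<bar> \<and> \<bar>f x z\<bar> \<le> M * (1 + norm z)"
    and "\<exists>\<omega>. modulus_of_continuity \<omega> \<and>
           (\<forall>x\<in>\<Omega>. \<forall>y\<in>\<Omega>. \<forall>z. \<bar>f x z - f y z\<bar> \<le> \<omega> (norm (x - y)) * (1 + norm z))"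
    and "\<mu> \<in> affine_meas \<Omega> k a u0"
    and "w \<in> adj_domain \<Omega> k a"
  shows "generalized_solution \<Omega> k a u0 f \<mu> \<and> dual_solution \<Omega> k a u0 f w \<longleftrightarrow>
    pairing \<Omega> k a u0 \<mu> w = {extremal_measure \<Omega> k a f \<mu> w} \<and>
    (\<forall>l\<in>pairing \<Omega> k a u0 \<mu> w.
       (AE x in leb \<Omega>.
          dens (leb \<Omega>) l x = dens (leb \<Omega>) \<mu> x \<bullet> adj_op \<Omega> k a w x \<and>
          ereal (dens (leb \<Omega>) \<mu> x \<bullet> adj_op \<Omega> k a w x) =
            ereal (f x (dens (leb \<Omega>) \<mu> x)) + conj_fun f x (adj_op \<Omega> k a w x)) \<and>
       (AE x in sing_variation \<Omega> \<mu>.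
          dens (sing_variation \<Omega> \<mu>) l x = recession f x (dens (sing_variation \<Omega> \<mu>) \<mu> x)))"
proof -
  have fin: "finite_measure (leb \<Omega>)" by (rule finite_leb_if_recovery[OF H2])
  obtain M where M: "0 < M" "\<And>x z. x \<in> \<Omega> \<Longrightarrow> \<bar>f x z\<bar> \<le> M * (1 + norm z)"
    using assms(10) by blast
  obtain \<omega> where \<omega>: "modulus_of_continuity \<omega>"
      "\<And>x y z. x \<in> \<Omega> \<Longrightarrow> y \<in> \<Omega> \<Longrightarrow> \<bar>f x z - f y z\<bar> \<le> \<omega> (norm (x - y)) * (1 + norm z)"
    using assms(11) by blast
  have D: "diff_operator \<Omega> k a" using assms(1,3) fin by (simp add: diff_operator_def)
  have I: "integrand \<Omega> f M \<omega>"
  proof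
    show "f x z \<le> M * (1 + norm z)" if "x \<in> \<Omega>" for x z using M(2)[OF that, of z] by simp
  qed (use assms(1,7,8,9) M(1) \<omega> in auto)
  interpret V: variational_problem \<Omega> k a f M \<omega> u0
    by (intro variational_problem.intro variational_problem_axioms.intro D I H1 H2 assms(6))
  \<comment> \<open>Both sides of the equivalence are free of \<open>\<rho>\<close>, so any
    representation of \<open>\<mu>\<close> may be fixed from here on.\<close>
  obtain \<rho> s t where L: "lebesgue_density \<Omega> \<rho> t" and s: "integrable \<rho> s" and mu: "\<mu> = dmeas \<rho> s"
    using V.ex_lebesgue_density[OF V.affine_radon[OF assms(12)]] by blast
  interpret E: extremality \<Omega> k a f M \<omega> u0 \<rho> t s w
    using assms(12,13) s unfolding mu
    by (intro extremality.intro extremality_axioms.intro V.variational_problem_axioms relaxation.intro L I)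
  show ?thesis (is "?i \<longleftrightarrow> ?ii")
  proof
    assume ?i
    then have gs: "generalized_solution \<Omega> k a u0 f E.mu" and ds: "dual_solution \<Omega> k a u0 f w" by (simp_all add: mu)
    note X = E.extremal_if_optimal[OF gs ds]
    show ?ii
      unfolding mu X(1) E.extremal_measure_eq using E.densities X(2) by auto
  next
    assume ii: ?ii
    have p: "extremal_measure \<Omega> k a f E.mu w \<in> pairing \<Omega> k a u0 E.mu w"
      using ii unfolding mu by auto
    \<comment> \<open>The pointwise relations are instantiated at the extremal measure, a member of
      the pairing by the singleton condition; they supply the Fenchel equality.\<close>
    moreover have "AE x in leb \<Omega>. ereal (E.v x \<bullet> E.g x) = ereal (f x (E.v x)) + conj_fun f x (E.g x)"
      using conjunct2[OF ii, unfolded mu, rule_format, OF p] by (auto elim: eventually_mono)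
    ultimately show ?i unfolding mu by (rule E.optimal_if_extremal)
  qed
qed

end
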